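(* Let $d\ge5$ and $Q\ge2$, let $L(s,F)$ be an $L$-function of degree $d$ satisfying the framework described in the context, let $0\le\beta<1$, and for each integer $q$ with $Q\le q\le 2Q$ let $\mathcal{F}_q$ be a subset (possibly the complete set, possibly depending on $F$) of the set of all primitive Dirichlet characters modulo $q$. Assume: (A1) $|\lambda_F(n)|\le \tau_d(n)$ for all integers $n\ge 1$. (A2) For some fixed (but arbitrary) $\varepsilon>0$, $\sum_{X\le n\le X+Y}|\lambda_F(n)|^2\ll_F Y$ holds for all large $X\geq 2$ and all $X^{1-\varepsilon}\le Y\le X$. (A3) For any $2\le P_1\le P_2\le X$, $\displaystyle\sum_{n\le X,\ (n,\prod_{P_1\le p\le P_2}p)=1}|\lambda_F(n)|^2\ll_F X\frac{\log P_1}{\log P_2}$. (A4) There is a small constant $c_F>0$ depending only on $F$ such that for all $Q\le q\le 2Q$ and any $T$ with $\log^{100}q\ll T\ll q^{o(1)}$, $$\prod_{\chi\in\mathcal{F}_q}L(\sigma+it,F\times\chi)\ne 0\quad\text{for } \sigma>1-\frac{c_F}{\log^{\beta}(qT)},\ |t|\le T.$$ Then, for any $\eta<1-\beta$, $$\sum_{Q\le q\le 2Q}\ \sum_{\chi\in\mathcal{F}_q}\Big|L\big(\tfrac12,F\times\chi\big)\Big|^2\ll_F\frac{Q^{d/2}}{\log^{\eta}Q}.$$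
   Context: Framework. $L(s,F)=\sum_{n\ge1}\lambda_F(n)n^{-s}=\prod_p\prod_{j=1}^d(1-\alpha_{j,F}(p)p^{-s})^{-1}$ is a Dirichlet series with Euler product of degree $d$, both absolutely convergent for $\Re(s)>1$; $\lambda_F$ is multiplicative with $\lambda_F(p^r)=\sum_{r_1,\dots,r_d\ge0,\ r_1+\cdots+r_d=r}\prod_{j=1}^d\alpha_{j,F}(p)^{r_j}$. For $q\ge2$ and a primitive Dirichlet character $\chi$ modulo $q$, $$L(s,F\times\chi)=\sum_{n\ge1}\frac{\lambda_F(n)\chi(n)}{n^s}=\prod_p\prod_{j=1}^d\Big(1-\frac{\alpha_{j,F}(p)\chi(p)}{p^s}\Big)^{-1},$$ both absolutely convergent for $\Re(s)>1$. Put $L_\infty(s,F\times\chi)=N^{s/2}\prod_{j=1}^d\Gamma_{\mathbb R}(s+\mu_j)$ with $\Gamma_{\mathbb R}(s)=\pi^{-s/2}\Gamma(s/2)$, where the conductor $N$ (a positive integer) depends only on $F$ and $q$, and the $\mu_j\in\mathbb C$ depend only on $F$ and $\chi(-1)$ and satisfy $\Re(\mu_j)\ge-1+\theta_F$ for some fixed $\theta_F$ with $\frac1{2d}<\theta_F<\frac12$. Let $\Lambda(s,F\times\chi)=L(s,F\times\chi)L_\infty(s,F\times\chi)$. It is assumed that: (1) $\Lambda(s,F\times\chi)$ extends to an entire function of order 1; (2) $\Lambda(s,F\times\chi)=\kappa\,\Lambda(1-s,\tilde F\times\overline\chi)$ for some $\kappa=\kappa_{F,\chi}$ with $|\kappa|=1$,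 where $\tilde F$ is the dual form with $\lambda_{\tilde F}(n)=\overline{\lambda_F(n)}$ (its completed $L$-function is formed in the same way, with the same $N$ and with parameters $\overline{\mu_j}$); (3) with the analytic conductor $C(s,F\times\chi)=N\prod_{j=1}^d(|s+\mu_j+3|)$ and $C(F\times\chi)=C(\frac12,F\times\chi)$, one has $C(F\times\chi)\ll_F N\ll_F q^d$ for large $q$. Notation. $\tau_d$ is the $d$-fold divisor function, $p$ denotes a prime, $\log^a x=(\log x)^a$. The condition $\log^{100}q\ll T\ll q^{o(1)}$ refers to functions $T=T(q)$ with $T\gg\log^{100}q$ and $\log T\leq o(\log q)$ as $q\to\infty$. $F$ (and $d,\beta,\eta$) are fixed, all constants in the hypotheses are uniform in $q$, $Q$ and $\chi$, and the implied constant in the conclusion depends on $F$ and the fixed parameters but not on $Q$. *)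

theory Defs
  imports "HOL-Complex_Analysis.Complex_Analysis" "HOL-Library.Landau_Symbols"
begin

definition dirichlet_char :: "nat \<Rightarrow> (int \<Rightarrow> complex) \<Rightarrow> bool" where
  "dirichlet_char q chi \<longleftrightarrow>
     (\<forall>n. chi (n + int q) = chi n) \<and>
     (\<forall>m n. chi (m * n) = chi m * chi n) \<and>
     (\<forall>n. chi n \<noteq> 0 \<longleftrightarrow> coprime n (int q))"

definition primitive_char :: "nat \<Rightarrow> (int \<Rightarrow> complex) \<Rightarrow> bool" where
  "primitive_char q chi \<longleftrightarrow> dirichlet_char q chi \<and>
     \<not> (\<exists>m \<psi>. m dvd q \<and> m < q \<and> dirichlet_char m \<psi> \<and>
             (\<forall>n. coprime n (int q) \<longrightarrow> chi n = \<psi> n))"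

definition divisor_fold :: "nat \<Rightarrow> nat \<Rightarrow> nat" where
  "divisor_fold d n = card {xs :: nat list. length xs = d \<and> prod_list xs = n}"

text \<open>The data attached to a form. The conductor \<open>lf_cond F q\<close> is that of the twists by
  primitive characters modulo \<open>q\<close>; the gamma shifts \<open>lf_mu F e j\<close> depend on the character
  \<open>chi\<close> only through \<open>e = chi (-1)\<close>. Indices \<open>j\<close> run over \<open>{..<lf_degree F}\<close>, and
  \<open>lf_alpha F j p\<close> is meaningful for prime \<open>p\<close> only.\<close>

record lform =
  lf_degree :: nat
  lf_coeff :: "nat \<Rightarrow> complex"
  lf_alpha :: "nat \<Rightarrow> nat \<Rightarrow> complex"
  lf_cond :: "nat \<Rightarrow> nat"
  lf_mu :: "complex \<Rightarrow> nat \<Rightarrow> complex"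

definition dual_form :: "lform \<Rightarrow> lform" where
  "dual_form F = F\<lparr>
     lf_coeff := (\<lambda>n. cnj (lf_coeff F n)),
     lf_alpha := (\<lambda>j p. cnj (lf_alpha F j p)),
     lf_mu := (\<lambda>e j. cnj (lf_mu F e j))\<rparr>"

definition conj_char :: "(int \<Rightarrow> complex) \<Rightarrow> int \<Rightarrow> complex" where
  "conj_char chi = (\<lambda>n. cnj (chi n))"

definition L_term :: "lform \<Rightarrow> (int \<Rightarrow> complex) \<Rightarrow> complex \<Rightarrow> nat \<Rightarrow> complex" where
  "L_term F chi s n = lf_coeff F n * chi (int n) / of_nat n powr s"

definition L_series :: "lform \<Rightarrow> (int \<Rightarrow> complex) \<Rightarrow> complex \<Rightarrow> complex" where
  "L_series F chi s = (\<Sum>\<^sub>\<infinity>n\<in>{1..}. L_term F chi s n)"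

definition euler_factor :: "lform \<Rightarrow> (int \<Rightarrow> complex) \<Rightarrow> complex \<Rightarrow> nat \<Rightarrow> complex" where
  "euler_factor F chi s p =
     (if prime p
      then \<Prod>j<lf_degree F. inverse (1 - lf_alpha F j p * chi (int p) / of_nat p powr s)
      else 1)"

definition euler_product_converges :: "lform \<Rightarrow> (int \<Rightarrow> complex) \<Rightarrow> bool" where
  "euler_product_converges F chi \<longleftrightarrow>
     (\<forall>s. Re s > 1 \<longrightarrow>
        (\<lambda>n. norm (L_term F chi s n)) summable_on {1..} \<and>
        abs_convergent_prod (euler_factor F chi s) \<and>
        L_series F chi s = prodinf (euler_factor F chi s))"

text \<open>The (unique, if it exists) entire function that agrees with \<open>f\<close> on the half plane
  \<open>Re s > 1\<close>; its existence has to be assumed or proved where it is used.\<close>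

definition is_entire_extension :: "(complex \<Rightarrow> complex) \<Rightarrow> (complex \<Rightarrow> complex) \<Rightarrow> bool" where
  "is_entire_extension f g \<longleftrightarrow> g holomorphic_on UNIV \<and> (\<forall>s. Re s > 1 \<longrightarrow> g s = f s)"

definition entire_extension :: "(complex \<Rightarrow> complex) \<Rightarrow> complex \<Rightarrow> complex" where
  "entire_extension f = (SOME g. is_entire_extension f g)"

definition L_twist :: "lform \<Rightarrow> (int \<Rightarrow> complex) \<Rightarrow> complex \<Rightarrow> complex" where
  "L_twist F chi = entire_extension (L_series F chi)"

definition Gamma_R :: "complex \<Rightarrow> complex" where
  "Gamma_R s = of_real pi powr (- s / 2) * Gamma (s / 2)"

definition L_infinity :: "lform \<Rightarrow> nat \<Rightarrow> (int \<Rightarrow> complex) \<Rightarrow> complex \<Rightarrow> complex" where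
  "L_infinity F q chi s =
     of_nat (lf_cond F q) powr (s / 2) * (\<Prod>j<lf_degree F. Gamma_R (s + lf_mu F (chi (-1)) j))"

text \<open>The completed function is continued from \<open>Re s > 1\<close> as a whole rather than formed pointwise
  as a product, because \<open>Gamma\<close> is \<open>0\<close> by convention at its poles.\<close>

definition completed_product :: "lform \<Rightarrow> nat \<Rightarrow> (int \<Rightarrow> complex) \<Rightarrow> complex \<Rightarrow> complex" where
  "completed_product F q chi s = L_series F chi s * L_infinity F q chi s"

definition Lambda_twist :: "lform \<Rightarrow> nat \<Rightarrow> (int \<Rightarrow> complex) \<Rightarrow> complex \<Rightarrow> complex" where
  "Lambda_twist F q chi = entire_extension (completed_product F q chi)"

definition entire_order :: "(complex \<Rightarrow> complex) \<Rightarrow> ereal" where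
  "entire_order f =
     Inf {ereal \<rho> | \<rho>. \<rho> \<ge> 0 \<and> (\<lambda>s. norm (f s)) \<in> O[at_infinity](\<lambda>s. exp (norm s powr \<rho>))}"

definition analytic_conductor ::
  "lform \<Rightarrow> nat \<Rightarrow> (int \<Rightarrow> complex) \<Rightarrow> complex \<Rightarrow> real" where
  "analytic_conductor F q chi s =
     real (lf_cond F q) * (\<Prod>j<lf_degree F. norm (s + lf_mu F (chi (-1)) j + 3))"

definition multiplicative_coeffs :: "lform \<Rightarrow> bool" where
  "multiplicative_coeffs F \<longleftrightarrow>
     lf_coeff F 1 = 1 \<and>
     (\<forall>m n. m \<ge> 1 \<longrightarrow> n \<ge> 1 \<longrightarrow> coprime m n \<longrightarrow>
        lf_coeff F (m * n) = lf_coeff F m * lf_coeff F n) \<and>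
     (\<forall>p r. prime p \<longrightarrow>
        lf_coeff F (p ^ r) =
          (\<Sum>rs | length rs = lf_degree F \<and> sum_list rs = r.
             \<Prod>j<lf_degree F. lf_alpha F j p ^ (rs ! j)))"

definition L_framework :: "lform \<Rightarrow> bool" where
  "L_framework F \<longleftrightarrow>
     multiplicative_coeffs F \<and>
     euler_product_converges F (\<lambda>_. 1) \<and>
     (\<forall>q\<ge>2. lf_cond F q \<ge> 1) \<and>
     (\<exists>\<theta>. 1 / (2 * real (lf_degree F)) < \<theta> \<and> \<theta> < 1 / 2 \<and>
        (\<forall>q\<ge>2. \<forall>chi. primitive_char q chi \<longrightarrow>
           (\<forall>j<lf_degree F. Re (lf_mu F (chi (-1)) j) \<ge> - 1 + \<theta>))) \<and>
     (\<forall>q\<ge>2. \<forall>chi. primitive_char q chi \<longrightarrow>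
        euler_product_converges F chi \<and>
        (\<exists>g. is_entire_extension (completed_product F q chi) g) \<and>
        entire_order (Lambda_twist F q chi) = 1 \<and>
        (\<exists>\<kappa>. norm \<kappa> = 1 \<and>
           (\<forall>s. Lambda_twist F q chi s =
                \<kappa> * Lambda_twist (dual_form F) q (conj_char chi) (1 - s)))) \<and>
     (\<exists>C q\<^sub>1. \<forall>q\<ge>q\<^sub>1. \<forall>chi. q \<ge> 2 \<longrightarrow> primitive_char q chi \<longrightarrow>
        analytic_conductor F q chi (1 / 2) \<le> C * real (lf_cond F q) \<and>
        real (lf_cond F q) \<le> C * real q ^ lf_degree F)"

text \<open>The functions \<open>T\<close> with \<open>log^100 q << T << q^{o(1)}\<close> as \<open>q \<rightarrow> \<infinity>\<close>; the upper bound means \<open>log T = o(log q)\<close>.\<close>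

definition admissible_height :: "(nat \<Rightarrow> real) \<Rightarrow> bool" where
  "admissible_height T \<longleftrightarrow>
     (\<exists>a>0. \<forall>\<^sub>F q in sequentially. T q \<ge> a * ln (real q) ^ 100) \<and>
     (\<lambda>q. ln (T q)) \<in> o(\<lambda>q. ln (real q))"

text \<open>Nonvanishing of the product of \<open>L(\<sigma> + it, F \<times> chi)\<close> over \<open>chi \<in> \<F> q\<close>,
  for \<open>Q \<le> q \<le> 2Q\<close>. A condition on \<open>T\<close> that is asymptotic in \<open>q\<close> says nothing about a single
  value \<open>T q\<close>, so for each \<open>T\<close> nonvanishing is required for \<open>q \<ge> q\<^sub>0 T\<close> only. The
  threshold \<open>q\<^sub>0\<close>, like \<open>c\<close>, is a parameter, to be chosen before \<open>Q\<close> and \<open>\<F>\<close>.\<close>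

definition zero_free ::
  "lform \<Rightarrow> real \<Rightarrow> real \<Rightarrow> ((nat \<Rightarrow> real) \<Rightarrow> nat) \<Rightarrow> real \<Rightarrow> (nat \<Rightarrow> (int \<Rightarrow> complex) set) \<Rightarrow> bool"
  where
  "zero_free F \<beta> c q\<^sub>0 Q \<F> \<longleftrightarrow>
     (\<forall>T. admissible_height T \<longrightarrow>
       (\<forall>q. Q \<le> real q \<longrightarrow> real q \<le> 2 * Q \<longrightarrow> q\<^sub>0 T \<le> q \<longrightarrow>
         (\<forall>\<sigma> t. \<sigma> > 1 - c / ln (real q * T q) powr \<beta> \<longrightarrow> \<bar>t\<bar> \<le> T q \<longrightarrow>
           (\<Prod>chi\<in>\<F> q. L_twist F chi (Complex \<sigma> t)) \<noteq> 0)))"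

end

(* By the functional equation, L(1/2, F x chi) is, up to a negligible error, the sum of two integrals of
   w(1+it) L(3/2+it, F x chi) with a weight w(s) of size Q^(d Re s / 2) exp(-t^2/2). Here L is a Dirichlet
   series, whose coefficients are split by Ramare's identity over the primes P1 <= p <= P2, where
   P1 = exp(log^b Q) with beta < b < 1 and P2 = Q^(1/10): into products lam(p) lam(m) / (1 + omega(m)) with
   m >= Q^2, and a remainder, which lives on the n without prime factors in [P1, P2] up to negligible sets.

   The remainder is cut into dyadic blocks; on the block n ~ M the line of integration is moved to Re s = 1 if
   M > Q^(d/2) and close to Re s = 0 otherwise. The large sieve (additive characters, Gauss sums, Bessel's
   inequality) loses nothing for M >= Q^2, and the blocks with M <= Q^(9/4) are negligible as d >= 5;
   by (A3) the remainder contributes Q^(d/2) log P1 / log P2, which is Q^(d/2) log^(b-1) Q.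

   In the products, the sum over p is evaluated on Re s = 1. The nonvanishing hypothesis and the
   Borel-Caratheodory theorem bound log L in the zero-free region, so Perron's formula with the kernel
   x^s/s^2 gives sum lam(p) chi(p) p^(-1-it) << log^(-2) Q for |t| <= log Q, while the large sieve bounds
   the sum over m. *)

theory Submission
  imports Defs "HOL-Number_Theory.Cong" "HOL-Real_Asymp.Real_Asymp"
begin

section \<open>Dirichlet characters and Gauss sums\<close>

text \<open>The parameters come from three balances. (1) A zero-free region of width log^(-beta) Q
  saves, in a sum over primes p >= P1, a factor P1^(-c log^(-beta) Q) = exp(-c log^(b - beta) Q),
  which beats every power of log Q as soon as b > beta; the price is log P1 / log P2, so the
  exponent 1 - b comes as close to 1 - beta as desired. (2) Ramare's weight 1 / (1 + omega(m))
  depends on m alone, and that separates the variables p and m. It requires n / p >= Q^2 for all p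
  up to P2, which fails only for n below Q^2 P2 = Q^(21/10), and the mass of these n is negligible
  in every block beyond Q^(9/4). (3) The large sieve charges Q^2 for a block shorter than Q^2, while
  the target is Q^(d/2). For d = 4 these coincide; d >= 5 leaves room for the blocks up to Q^(9/4),
  for the small power of Q lost because the line stays slightly to the right of Re s = 0, and for
  all powers of log Q, so that a crude mean square of the remainder suffices there.\<close>

lemma dirichlet_char_mult: "dirichlet_char q ch \<Longrightarrow> ch (m * n) = ch m * ch n"
  by (simp add: dirichlet_char_def)

lemma dirichlet_char_eq_0_iff: "dirichlet_char q ch \<Longrightarrow> ch n = 0 \<longleftrightarrow> \<not> coprime n (int q)"
  by (auto simp: dirichlet_char_def)

lemma dirichlet_char_add_mult:
  assumes "dirichlet_char q ch"
  shows "ch (n + k * int q) = ch n"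
proof -
  have step: "ch (m + int q) = ch m" for m
    using assms by (simp add: dirichlet_char_def)
  have nat: "ch (m + int j * int q) = ch m" for m and j :: nat
  proof (induction j)
    case (Suc j)
    have "ch (m + int (Suc j) * int q) = ch ((m + int j * int q) + int q)"
      by (simp add: algebra_simps)
    then show ?case using step Suc by simp
  qed simp
  show ?thesis
  proof (cases "k \<ge> 0")
    case True
    then show ?thesis using nat[of n "nat k"] by simp
  next
    case False
    then show ?thesis using nat[of "n + k * int q" "nat (-k)"] by simp
  qed
qed

lemma dirichlet_char_mod:
  assumes "dirichlet_char q ch"
  shows "ch (n mod int q) = ch n"
  using dirichlet_char_add_mult[OF assms, of "n mod int q" "n div int q"] by (simp add: algebra_simps)

lemma dirichlet_char_cong:
  assumes "dirichlet_char q ch" "m mod int q = n mod int q"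
  shows "ch m = ch n"
  using dirichlet_char_mod[OF assms(1)] assms(2) by metis

lemma dirichlet_char_1:
  assumes "dirichlet_char q ch"
  shows "ch 1 = 1"
proof -
  have "ch 1 * ch 1 = ch 1" using dirichlet_char_mult[OF assms, of 1 1] by simp
  moreover have "ch 1 \<noteq> 0" using dirichlet_char_eq_0_iff[OF assms, of 1] by simp
  ultimately show ?thesis by (simp only: mult_cancel_left1 mult_cancel_right2) simp
qed

lemma dirichlet_char_power:
  assumes "dirichlet_char q ch"
  shows "ch (n ^ k) = ch n ^ k"
  by (induction k) (simp_all add: dirichlet_char_1[OF assms] dirichlet_char_mult[OF assms])

text \<open>Pigeonhole: among the q + 1 powers n^0, ..., n^q two agree modulo q, so some power of
  \<open>ch n\<close> with positive exponent at most q is 1. The exponent \<open>fact q\<close> is a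
  multiple of all of these, hence the same for every n; this yields norm 1 and a finite set of
  values.\<close>

lemma dirichlet_char_root_of_unity:
  assumes "dirichlet_char q ch" "q > 0" "coprime n (int q)"
  shows "ch n ^ fact q = 1"
proof -
  have nz: "ch n \<noteq> 0" using assms dirichlet_char_eq_0_iff by blast
  have "\<not> inj_on (\<lambda>i. n ^ i mod int q) {0..q}"
  proof
    assume "inj_on (\<lambda>i. n ^ i mod int q) {0..q}"
    then have "card {0..q} \<le> card {0..<int q}"
      by (rule card_inj_on_le) (use assms(2) in auto)
    then show False by simp
  qed
  then obtain a b where ab: "a \<le> q" "b \<le> q" "a < b" "n ^ a mod int q = n ^ b mod int q"
    unfolding inj_on_def by (metis atLeastAtMost_iff linorder_neqE_nat)
  then have "ch n ^ a = ch n ^ b"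
    using dirichlet_char_cong[OF assms(1)] dirichlet_char_power[OF assms(1)] by metis
  also have "ch n ^ b = ch n ^ a * ch n ^ (b - a)"
    using ab by (simp flip: power_add)
  finally have "ch n ^ (b - a) = 1" using nz by simp
  moreover have "(b - a) dvd fact q" using ab by (intro dvd_fact) auto
  ultimately show ?thesis by (auto elim!: dvdE simp: power_mult)
qed

lemma norm_dirichlet_char:
  assumes "dirichlet_char q ch" "q > 0" "coprime n (int q)"
  shows "norm (ch n) = 1"
proof -
  have "norm (ch n) ^ fact q = 1"
    using dirichlet_char_root_of_unity[OF assms] by (metis norm_one norm_power)
  then show ?thesis using power_eq_1_iff[of "norm (ch n)" "fact q"] by auto
qed

lemma norm_dirichlet_char_le:
  assumes "dirichlet_char q ch" "q > 0"
  shows "norm (ch n) \<le> 1"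
  using norm_dirichlet_char[OF assms, of n] dirichlet_char_eq_0_iff[OF assms(1), of n] by force

text \<open>A character is determined by its values on one period, and these lie in the finite set
  formed by 0 and the roots of unity of exponent \<open>fact q\<close>.\<close>

lemma finite_dirichlet_chars:
  assumes "q > 0"
  shows "finite {ch. dirichlet_char q ch}"
proof -
  define Z :: "complex set" where "Z = insert 0 {z. z ^ fact q = 1}"
  have "finite Z" unfolding Z_def by (simp add: finite_roots_unity)
  then have fin: "finite ({0..<int q} \<rightarrow>\<^sub>E Z)" by (intro finite_PiE) auto
  have "inj_on (\<lambda>ch. restrict ch {0..<int q}) {ch. dirichlet_char q ch}"
  proof (rule inj_onI, rule ext)
    fix ch \<psi> :: "int \<Rightarrow> complex" and n
    assume *: "ch \<in> {ch. dirichlet_char q ch}" "\<psi> \<in> {ch. dirichlet_char q ch}"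
      "restrict ch {0..<int q} = restrict \<psi> {0..<int q}"
    have "n mod int q \<in> {0..<int q}" using assms by simp
    then have "ch (n mod int q) = \<psi> (n mod int q)" using *(3) by (metis restrict_apply')
    then show "ch n = \<psi> n" using * by (simp add: dirichlet_char_mod)
  qed
  moreover have "(\<lambda>ch. restrict ch {0..<int q}) ` {ch. dirichlet_char q ch} \<subseteq> {0..<int q} \<rightarrow>\<^sub>E Z"
  proof safe
    fix ch n assume *: "dirichlet_char q ch" "n \<in> {0..<int q}"
    show "restrict ch {0..<int q} n \<in> Z"
      using dirichlet_char_root_of_unity[OF *(1) assms, of n] dirichlet_char_eq_0_iff[OF *(1), of n] *(2)
      by (cases "coprime n (int q)") (auto simp: Z_def)
  qed auto
  ultimately show ?thesis using fin by (metis finite_imageD finite_subset)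
qed

text \<open>With k the product of the primes that divide q but not n, every prime p dividing q
  divides exactly one of n and k * m: if p divides n, it divides neither k, whose prime factors
  avoid n, nor m, which is coprime to n; otherwise it is a factor of k.\<close>

lemma coprime_residue_lift:
  fixes n :: int and q :: nat
  assumes "q > 0" "coprime n (int m)"
  shows "\<exists>k. coprime (n + k * int m) (int q)"
proof -
  define P where "P = {p. prime p \<and> p dvd int q \<and> \<not> p dvd n}"
  have "P \<subseteq> prime_factors (int q)"
    using assms(1) by (auto simp: P_def in_prime_factors_iff)
  then have "finite P" by (rule finite_subset) simp
  define k where "k = \<Prod>P"
  have "coprime (n + k * int m) (int q)"
  proof (rule ccontr)
    assume "\<not> coprime (n + k * int m) (int q)"
    then obtain p where p: "prime p" "p dvd n + k * int m" "p dvd int q"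
    proof -
      define g where "g = gcd (n + k * int m) (int q)"
      have "g \<noteq> 0" "\<not> is_unit g"
        using assms(1) \<open>\<not> coprime _ _\<close> by (auto simp: g_def is_unit_gcd_iff)
      then obtain p where "prime p" "p dvd g" using prime_divisor_exists by blast
      then show ?thesis using that[of p] by (simp add: g_def)
    qed
    show False
    proof (cases "p dvd n")
      case True
      then have "p dvd k * int m" using p(2) by (metis dvd_add_right_iff)
      then have "p dvd k \<or> p dvd int m" by (rule prime_dvd_multD[OF p(1)])
      then show False
      proof (elim disjE)
        assume "p dvd k"
        then obtain r where "r \<in> P" "p dvd r"
          using prime_dvd_prod_iff[OF \<open>finite P\<close> p(1), of "\<lambda>x. x"] by (auto simp: k_def)
        then have "p = r" using p(1) by (auto simp: P_def intro: primes_dvd_imp_eq)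
        then show False using True \<open>r \<in> P\<close> by (auto simp: P_def)
      next
        assume "p dvd int m"
        then show False using True assms(2) p(1) by (meson coprime_common_divisor not_prime_unit)
      qed
    next
      case False
      then have "p \<in> P" using p by (auto simp: P_def)
      then have "p dvd k" using \<open>finite P\<close> by (auto simp: k_def intro: dvd_prodI)
      then show False using False p(2) by (metis dvd_add_left_iff dvd_mult2)
    qed
  qed
  then show ?thesis by blast
qed

text \<open>If \<open>ch\<close> were 1 on all units that are 1 modulo m, it would depend on n
  modulo m only and so come from a character modulo m, against primitivity. To define that character
  at every n coprime to m, n is first moved within its class modulo m to a number coprime to
  q.\<close>

lemma primitive_char_nontrivial_kernel:
  assumes "primitive_char q ch" "q > 0" "m dvd q" "m < q"
  shows "\<exists>u. coprime u (int q) \<and> u mod int m = 1 mod int m \<and> ch u \<noteq> 1"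
proof (rule ccontr)
  assume "\<not> ?thesis"
  then have triv: "ch u = 1" if "coprime u (int q)" "u mod int m = 1 mod int m" for u
    using that by blast
  have ch: "dirichlet_char q ch" using assms by (simp add: primitive_char_def)
  have wd: "ch a = ch b" if ab: "coprime a (int q)" "coprime b (int q)" "a mod int m = b mod int m" for a b
  proof -
    \<comment> \<open>Multiplication by an inverse w of a modulo q reduces a = b (mod m) to b * w =
      1 (mod m), where \<open>triv\<close> applies.\<close>
    obtain w where w: "[a * w = 1] (mod int q)" using ab(1) cong_solve_coprime_int by blast
    have cw: "coprime w (int q)"
      using cong_imp_coprime[OF cong_sym[OF w]] by simp
    have wm: "[a * w = 1] (mod int m)"
      by (rule cong_dvd_modulus[OF w]) (use assms(3) in simp)
    have "[b * w = a * w] (mod int m)" by (rule cong_mult) (use ab(3) in \<open>simp_all add: cong_def\<close>)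
    then have "[b * w = 1] (mod int m)" using wm by (rule cong_trans)
    then have "ch (b * w) = 1" using triv[of "b * w"] ab(2) cw by (simp add: cong_def)
    moreover have "ch (a * w) = 1"
      using dirichlet_char_cong[OF ch, of "a * w" 1] w dirichlet_char_1[OF ch] by (simp add: cong_def)
    ultimately have "ch b * ch w = ch a * ch w" by (simp add: dirichlet_char_mult[OF ch])
    then show ?thesis using dirichlet_char_eq_0_iff[OF ch, of w] cw by simp
  qed
  define l where "l n = (SOME n'. n' mod int m = n mod int m \<and> coprime n' (int q))" for n
  have l: "l n mod int m = n mod int m \<and> coprime (l n) (int q)" if n: "coprime n (int m)" for n
  proof -
    obtain k where "coprime (n + k * int m) (int q)"
      using coprime_residue_lift[OF assms(2) n] by blast
    moreover have "(n + k * int m) mod int m = n mod int m" by simp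
    ultimately have "\<exists>n'. n' mod int m = n mod int m \<and> coprime n' (int q)" by blast
    then show ?thesis unfolding l_def by (rule someI_ex)
  qed
  have down: "coprime n (int m)" if "coprime n (int q)" for n
    by (rule coprime_divisors[OF dvd_refl _ that]) (use assms(3) in simp)
  define \<psi> where "\<psi> n = (if coprime n (int m) then ch (l n) else 0)" for n
  have agree: "ch n = \<psi> n" if "coprime n (int q)" for n
    using that down[OF that] l[OF down[OF that]] wd[of n "l n"] by (simp add: \<psi>_def)
  have "dirichlet_char m \<psi>"
    unfolding dirichlet_char_def
  proof (intro conjI allI)
    fix n
    have cop: "coprime (n + int m) (int m) \<longleftrightarrow> coprime n (int m)"
      by (metis coprime_iff_gcd_eq_1 gcd_add1)
    have "ch (l (n + int m)) = ch (l n)" if "coprime n (int m)"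
      using l[OF that] l[of "n + int m"] that cop by (intro wd) auto
    then show "\<psi> (n + int m) = \<psi> n" using cop by (simp add: \<psi>_def)
  next
    fix a b
    show "\<psi> (a * b) = \<psi> a * \<psi> b"
    proof (cases "coprime a (int m) \<and> coprime b (int m)")
      case True
      have "l (a * b) mod int m = (l a * l b) mod int m"
      proof -
        have "[a * b = l a * l b] (mod int m)"
          by (rule cong_mult) (use l[of a] l[of b] True in \<open>simp_all add: cong_def\<close>)
        then show ?thesis using l[of "a * b"] True by (simp add: cong_def)
      qed
      then have "ch (l (a * b)) = ch (l a * l b)"
        using l[of a] l[of b] l[of "a * b"] True by (intro wd) auto
      then show ?thesis using True by (simp add: \<psi>_def dirichlet_char_mult[OF ch])
    qed (auto simp: \<psi>_def)
  next
    fix n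
    show "\<psi> n \<noteq> 0 \<longleftrightarrow> coprime n (int m)"
      using l[of n] dirichlet_char_eq_0_iff[OF ch, of "l n"] by (auto simp: \<psi>_def)
  qed
  then show False using assms agree unfolding primitive_char_def by blast
qed

definition e_unit :: "real \<Rightarrow> complex" where "e_unit x = cis (2 * pi * x)"

lemma e_unit_add: "e_unit (x + y) = e_unit x * e_unit y"
  by (simp add: e_unit_def cis_mult ring_distribs)

lemma e_unit_int [simp]: "e_unit (of_int k) = 1"
  by (simp add: e_unit_def cis_multiple_2pi)

lemma cnj_e_unit: "cnj (e_unit x) = e_unit (- x)" by (simp add: e_unit_def cis_cnj)

lemma e_unit_mod_int:
  assumes "q > 0"
  shows "e_unit (of_int (a mod int q) / real q) = e_unit (of_int a / real q)"
proof -
  have "of_int a / real q = of_int (a mod int q) / real q + of_int (a div int q)"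
  proof -
    have "real_of_int a = of_int (a div int q) * real q + of_int (a mod int q)"
      by (metis div_mult_mod_eq of_int_add of_int_mult of_int_of_nat_eq)
    then show ?thesis using assms by (simp add: add_divide_distrib)
  qed
  then show ?thesis by (simp add: e_unit_add)
qed

lemma e_unit_cong:
  assumes "q > 0" "a mod int q = b mod int q"
  shows "e_unit (of_int a / real q) = e_unit (of_int b / real q)"
  using e_unit_mod_int[OF assms(1)] assms(2) by metis

lemma bij_betw_mult_mod:
  fixes u :: int
  assumes "q > 0" "coprime u (int q)"
  shows "bij_betw (\<lambda>a. (a * u) mod int q) {0..<int q} {0..<int q}"
proof -
  have inj: "inj_on (\<lambda>a. (a * u) mod int q) {0..<int q}"
  proof (rule inj_onI)
    fix a b assume *: "a \<in> {0..<int q}" "b \<in> {0..<int q}" "(a * u) mod int q = (b * u) mod int q"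
    then have "[a = b] (mod int q)" using assms cong_mult_rcancel[of u "int q" a b]
      by (simp add: cong_def coprime_commute)
    then show "a = b" using *(1,2) by (auto simp: cong_def)
  qed
  moreover have "(\<lambda>a. (a * u) mod int q) ` {0..<int q} = {0..<int q}"
    by (rule endo_inj_surj) (use assms inj in auto)
  ultimately show ?thesis by (simp add: bij_betw_def)
qed

text \<open>The character is conjugated so that \<open>gauss_sum_separable\<close> produces
  \<open>ch n\<close> and not its conjugate.\<close>

definition gauss_sum :: "nat \<Rightarrow> (int \<Rightarrow> complex) \<Rightarrow> int \<Rightarrow> complex" where
  "gauss_sum q ch n = (\<Sum>a\<in>{0..<int q}. cnj (ch a) * e_unit (of_int (a * n) / real q))"

lemma gauss_sum_mult_coprime:
  assumes "dirichlet_char q ch" "q > 0" "coprime u (int q)"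
  shows "gauss_sum q ch (n * u) = ch u * gauss_sum q ch n"
proof -
  have u: "ch u * cnj (ch u) = 1"
    using norm_dirichlet_char[OF assms] by (simp add: complex_norm_square[symmetric])
  have "ch u * gauss_sum q ch n = ch u * (\<Sum>a\<in>{0..<int q}. cnj (ch ((a * u) mod int q)) * e_unit (of_int (((a * u) mod int q) * n) / real q))"
    unfolding gauss_sum_def
    by (subst sum.reindex_bij_betw[OF bij_betw_mult_mod[OF assms(2,3)], symmetric]) rule
  also have "\<dots> = ch u * (\<Sum>a\<in>{0..<int q}. cnj (ch (a * u)) * e_unit (of_int (a * (n * u)) / real q))"
  proof -
    have "e_unit (of_int (((a * u) mod int q) * n) / real q) = e_unit (of_int (a * (n * u)) / real q)" for a
      by (rule e_unit_cong[OF assms(2)]) (simp add: mod_simps mult_ac)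
    then show ?thesis by (simp only: dirichlet_char_mod[OF assms(1)])
  qed
  also have "\<dots> = (\<Sum>a\<in>{0..<int q}. (ch u * cnj (ch u)) * (cnj (ch a) * e_unit (of_int (a * (n * u)) / real q)))"
    by (simp add: sum_distrib_left dirichlet_char_mult[OF assms(1)] mult_ac)
  also have "\<dots> = gauss_sum q ch (n * u)" by (simp add: u gauss_sum_def)
  finally show ?thesis by simp
qed

lemma gauss_sum_cong:
  assumes "q > 0" "m mod int q = n mod int q"
  shows "gauss_sum q ch m = gauss_sum q ch n"
  unfolding gauss_sum_def
  by (intro sum.cong refl arg_cong2[of _ _ _ _ "(*)"] e_unit_cong[OF assms(1)] mod_mult_cong assms(2))

text \<open>For n coprime to q this is a change of variables. Otherwise put m = q / gcd(n, q):
  primitivity supplies a unit u = 1 (mod m) with \<open>ch u\<close> \<noteq> 1, and then n * u = n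
  (mod q), so that the sum equals \<open>ch u\<close> times itself and vanishes, as does
  \<open>ch n\<close>.\<close>

lemma gauss_sum_separable:
  assumes "primitive_char q ch" "q > 0"
  shows "gauss_sum q ch n = ch n * gauss_sum q ch 1"
proof (cases "coprime n (int q)")
  case True
  then show ?thesis
    using gauss_sum_mult_coprime[of q ch n 1] assms by (simp add: primitive_char_def)
next
  case False
  have ch: "dirichlet_char q ch" using assms by (simp add: primitive_char_def)
  define g where "g = nat (gcd n (int q))"
  have g: "int g = gcd n (int q)" by (simp add: g_def)
  have "g dvd q" using g by (metis gcd_dvd2 int_dvd_int_iff)
  then obtain m where m: "q = g * m" by blast
  have "g \<noteq> 1" using False g by (metis coprime_iff_gcd_eq_1 of_nat_1)
  have "g > 0" "m > 0" using m assms(2) by auto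
  then have "m < q" using m \<open>g \<noteq> 1\<close> by auto
  then obtain u where u: "coprime u (int q)" "u mod int m = 1 mod int m" "ch u \<noteq> 1"
    using primitive_char_nontrivial_kernel[OF assms, of m] m by auto
  have "int g dvd n" using g by simp
  then obtain n1 where n1: "n = int g * n1" by blast
  have "int m dvd u - 1" using u(2) by (simp add: mod_eq_dvd_iff)
  then obtain k where k: "u = 1 + int m * k" by (metis add.commute diff_add_cancel dvdE)
  have "n * u - n = int q * (n1 * k)" unfolding m n1 k by (simp add: algebra_simps)
  then have "int q dvd n * u - n" by simp
  then have "(n * u) mod int q = n mod int q" by (simp add: mod_eq_dvd_iff)
  then have "gauss_sum q ch n = ch u * gauss_sum q ch n"
    using gauss_sum_cong[OF assms(2), of "n * u" n ch] gauss_sum_mult_coprime[OF ch assms(2) u(1), of n] by simp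
  then have "gauss_sum q ch n = 0" using u(3) by simp
  then show ?thesis using False dirichlet_char_eq_0_iff[OF ch] by simp
qed

lemma sum_e_unit_residues:
  assumes "q > 0"
  shows "(\<Sum>n\<in>{0..<int q}. e_unit (of_int (a * n) / real q)) = (if int q dvd a then of_nat q else 0)"
proof (cases "int q dvd a")
  case True
  then obtain b where "a = int q * b" by blast
  then have "e_unit (of_int (a * n) / real q) = 1" for n
    using assms e_unit_int[of "b * n"] by (simp add: field_simps)
  then show ?thesis using True by simp
next
  case False
  define z where "z = e_unit (of_int a / real q)"
  have zp: "z ^ k = e_unit (of_int (a * int k) / real q)" for k
    by (simp add: z_def e_unit_def Complex.DeMoivre algebra_simps)
  have "z \<noteq> 1"
  proof
    assume "z = 1"
    then have "cos (2 * pi * (of_int a / real q)) = 1" by (simp add: z_def e_unit_def complex_eq_iff)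
    then obtain k :: int where "2 * pi * (of_int a / real q) = of_int k * 2 * pi"
      using cos_one_2pi_int by auto
    then have "of_int a = (of_int (k * int q) :: real)" using assms by (simp add: field_simps)
    then have "a = k * int q" by (simp only: of_int_eq_iff)
    then show False using False by simp
  qed
  have "(\<Sum>n\<in>{0..<int q}. e_unit (of_int (a * n) / real q)) = (\<Sum>k<q. z ^ k)"
    unfolding zp
    by (rule sum.reindex_bij_witness[of _ int nat]) auto
  also have "\<dots> = (z ^ q - 1) / (z - 1)" using \<open>z \<noteq> 1\<close> by (simp add: geometric_sum)
  also have "z ^ q = 1" unfolding zp using assms e_unit_int[of a] by (simp add: field_simps)
  finally show ?thesis using False by simp
qed

text \<open>The mean square of \<open>gauss_sum q ch n\<close> over a period is computed twice: by
  orthogonality of the additive characters it is q * \<phi>, by separability it is \<phi> times the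
  square in question.\<close>

lemma norm_gauss_sum_1:
  assumes "primitive_char q ch" "q > 0"
  shows "(norm (gauss_sum q ch 1))\<^sup>2 = real q"
proof -
  have ch: "dirichlet_char q ch" using assms by (simp add: primitive_char_def)
  define A where "A = {0..<int q}"
  have [simp]: "finite A" by (simp add: A_def)
  define \<phi> where "\<phi> = (\<Sum>a\<in>A. (norm (ch a))\<^sup>2)"
  have "\<phi> > 0"
  proof -
    have "1 mod int q \<in> A" using assms by (simp add: A_def)
    moreover have "(norm (ch (1 mod int q)))\<^sup>2 > 0" using ch by (simp add: dirichlet_char_mod dirichlet_char_1)
    ultimately show ?thesis unfolding \<phi>_def by (intro sum_pos2) auto
  qed
  have "complex_of_real (\<Sum>n\<in>A. (norm (gauss_sum q ch n))\<^sup>2) =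
      (\<Sum>n\<in>A. gauss_sum q ch n * cnj (gauss_sum q ch n))"
    by (simp only: of_real_sum complex_norm_square)
  also have "\<dots> = (\<Sum>n\<in>A. \<Sum>a\<in>A. \<Sum>b\<in>A. cnj (ch a) * ch b * e_unit (of_int ((a - b) * n) / real q))"
  proof -
    have "e_unit (of_int (a * n) / real q) * cnj (e_unit (of_int (b * n) / real q)) =
        e_unit (of_int ((a - b) * n) / real q)" for a b n
      by (simp add: cnj_e_unit flip: e_unit_add) (simp add: left_diff_distrib diff_divide_distrib)
    moreover have assoc4: "(w * x) * (y * z) = w * y * (x * z)" for w x y z :: complex
      by (simp add: mult_ac)
    ultimately have "(cnj (ch a) * e_unit (of_int (a * n) / real q)) * cnj (cnj (ch b) * e_unit (of_int (b * n) / real q)) =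
        cnj (ch a) * ch b * e_unit (of_int ((a - b) * n) / real q)" for a b n
      by (metis (no_types, lifting) assoc4 complex_cnj_cnj complex_cnj_mult)
    then show ?thesis
      unfolding gauss_sum_def A_def[symmetric] cnj_sum sum_product by (simp only:)
  qed
  also have "\<dots> = (\<Sum>a\<in>A. \<Sum>b\<in>A. cnj (ch a) * ch b * (\<Sum>n\<in>A. e_unit (of_int ((a - b) * n) / real q)))"
    by (subst sum.swap, rule sum.cong[OF refl], subst sum.swap) (simp add: sum_distrib_left)
  also have "\<dots> = (\<Sum>a\<in>A. \<Sum>b\<in>A. if b = a then cnj (ch a) * ch a * of_nat q else 0)"
  proof (intro sum.cong refl)
    fix a b assume ab: "a \<in> A" "b \<in> A"
    have "int q dvd a - b \<longleftrightarrow> b = a"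
      using ab by (auto simp: A_def simp flip: mod_eq_dvd_iff)
    then show "cnj (ch a) * ch b * (\<Sum>n\<in>A. e_unit (of_int ((a - b) * n) / real q)) =
       (if b = a then cnj (ch a) * ch a * of_nat q else 0)"
      unfolding A_def sum_e_unit_residues[OF assms(2)] by auto
  qed
  also have "\<dots> = complex_of_real (real q * \<phi>)"
    by (simp only: \<phi>_def of_real_mult of_real_sum complex_norm_square sum_distrib_left)
       (simp add: mult_ac)
  finally have "(\<Sum>n\<in>A. (norm (gauss_sum q ch n))\<^sup>2) = real q * \<phi>"
    by (simp only: of_real_eq_iff)
  moreover have "(\<Sum>n\<in>A. (norm (gauss_sum q ch n))\<^sup>2) = \<phi> * (norm (gauss_sum q ch 1))\<^sup>2"
    unfolding \<phi>_def sum_distrib_right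
    by (intro sum.cong refl, subst gauss_sum_separable[OF assms]) (simp add: norm_mult power_mult_distrib)
  ultimately show ?thesis using \<open>\<phi> > 0\<close> by simp
qed

lemma dirichlet_char_orthogonal:
  assumes "dirichlet_char q ch" "dirichlet_char q \<psi>" "ch \<noteq> \<psi>" "q > 0"
  shows "(\<Sum>a\<in>{0..<int q}. ch a * cnj (\<psi> a)) = 0" (is "?S = 0")
proof -
  obtain b where b: "ch b \<noteq> \<psi> b" using assms(3) by blast
  then have cop: "coprime b (int q)"
    using dirichlet_char_eq_0_iff[OF assms(1), of b] dirichlet_char_eq_0_iff[OF assms(2), of b] by auto
  have "?S = (\<Sum>a\<in>{0..<int q}. ch (a * b mod int q) * cnj (\<psi> (a * b mod int q)))"
    by (subst sum.reindex_bij_betw[OF bij_betw_mult_mod[OF assms(4) cop]]) rule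
  also have "\<dots> = (ch b * cnj (\<psi> b)) * ?S"
    by (simp add: dirichlet_char_mod[OF assms(1)] dirichlet_char_mod[OF assms(2)] sum_distrib_left
        dirichlet_char_mult[OF assms(1)] dirichlet_char_mult[OF assms(2)] mult_ac)
  finally have "(ch b * cnj (\<psi> b) - 1) * ?S = 0" by (simp add: algebra_simps)
  moreover have "ch b * cnj (\<psi> b) \<noteq> 1"
  proof
    assume *: "ch b * cnj (\<psi> b) = 1"
    have "\<psi> b * cnj (\<psi> b) = 1"
      using norm_dirichlet_char[OF assms(2,4) cop] by (simp add: complex_norm_square[symmetric])
    then have "ch b = \<psi> b" using * by (metis mult.commute mult.left_commute mult.right_neutral)
    then show False using b by simp
  qed
  ultimately show ?thesis by simp
qed

text \<open>The characters are orthogonal on the units modulo q, each with squared norm the number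
  of units, and Bessel's inequality produces this number as a factor. It is enlarged to q, the form
  that cancels against the square of a Gauss sum.\<close>

lemma bessel_dirichlet_chars:
  fixes f :: "int \<Rightarrow> complex"
  assumes X: "finite X" "\<And>ch. ch \<in> X \<Longrightarrow> dirichlet_char q ch" and "q > 0"
  shows "(\<Sum>ch\<in>X. (norm (\<Sum>a\<in>{0..<int q}. cnj (ch a) * f a))\<^sup>2)
     \<le> real q * (\<Sum>a | a \<in> {0..<int q} \<and> coprime a (int q). (norm (f a))\<^sup>2)"
proof -
  define A where "A = {a \<in> {0..<int q}. coprime a (int q)}"
  have [simp]: "finite A" by (rule finite_subset[of _ "{0..<int q}"]) (auto simp: A_def)
  define c where "c ch = (\<Sum>a\<in>A. cnj (ch a) * f a)" for ch
  have restr: "(\<Sum>a\<in>{0..<int q}. g a) = (\<Sum>a\<in>A. g a)"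
    if "\<And>a. a \<in> {0..<int q} \<Longrightarrow> \<not> coprime a (int q) \<Longrightarrow> g a = 0" for g :: "int \<Rightarrow> complex"
    by (rule sum.mono_neutral_right) (use that in \<open>auto simp: A_def\<close>)
  have c: "(\<Sum>a\<in>{0..<int q}. cnj (ch a) * f a) = c ch" if "ch \<in> X" for ch
    unfolding c_def using dirichlet_char_eq_0_iff[OF X(2)[OF that]] by (intro restr) auto
  define \<phi> where "\<phi> = real (card A)"
  have orth: "(\<Sum>a\<in>A. ch a * cnj (\<psi> a)) = (if \<psi> = ch then of_real \<phi> else 0)" if "ch \<in> X" "\<psi> \<in> X" for ch \<psi>
  proof (cases "ch = \<psi>")
    case True
    have "(\<Sum>a\<in>A. ch a * cnj (ch a)) = (\<Sum>a\<in>A. 1)"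
      using norm_dirichlet_char[OF X(2)[OF that(1)] assms(3)]
      by (intro sum.cong refl) (simp add: A_def complex_norm_square[symmetric])
    then show ?thesis using True by (simp add: \<phi>_def)
  next
    case False
    have "(\<Sum>a\<in>{0..<int q}. ch a * cnj (\<psi> a)) = (\<Sum>a\<in>A. ch a * cnj (\<psi> a))"
      using dirichlet_char_eq_0_iff[OF X(2)[OF that(1)]] by (intro restr) auto
    then show ?thesis using False dirichlet_char_orthogonal[OF X(2)[OF that(1)] X(2)[OF that(2)] False assms(3)] by simp
  qed
  \<comment> \<open>h / \<phi> is the orthogonal projection of f to the span of X. That the mean
    square of \<phi> * f - h is nonnegative is Bessel's inequality.\<close>
  define h where "h a = (\<Sum>ch\<in>X. c ch * ch a)" for a
  define B where "B = (\<Sum>ch\<in>X. (norm (c ch))\<^sup>2)"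
  define N where "N = (\<Sum>a\<in>A. (norm (f a))\<^sup>2)"
  have B: "of_real B = (\<Sum>ch\<in>X. c ch * cnj (c ch))"
    unfolding B_def of_real_sum complex_norm_square ..
  have N: "of_real N = (\<Sum>a\<in>A. f a * cnj (f a))"
    unfolding N_def of_real_sum complex_norm_square ..
  have "\<phi> > 0"
  proof -
    have "1 mod int q \<in> A" using assms(3) by (auto simp: A_def)
    then show ?thesis by (auto simp: \<phi>_def card_gt_0_iff)
  qed
  have hh: "(\<Sum>a\<in>A. h a * cnj (h a)) = of_real (\<phi> * B)"
  proof -
    have "(\<Sum>a\<in>A. h a * cnj (h a)) = (\<Sum>a\<in>A. \<Sum>ch\<in>X. \<Sum>\<psi>\<in>X. c ch * cnj (c \<psi>) * (ch a * cnj (\<psi> a)))"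
      unfolding h_def cnj_sum sum_product by (intro sum.cong refl) (simp add: mult_ac)
    also have "\<dots> = (\<Sum>ch\<in>X. \<Sum>\<psi>\<in>X. c ch * cnj (c \<psi>) * (\<Sum>a\<in>A. ch a * cnj (\<psi> a)))"
      by (subst sum.swap, rule sum.cong[OF refl], subst sum.swap) (simp add: sum_distrib_left)
    also have "\<dots> = (\<Sum>ch\<in>X. \<Sum>\<psi>\<in>X. if \<psi> = ch then c ch * cnj (c ch) * of_real \<phi> else 0)"
      by (intro sum.cong refl) (auto simp: orth)
    also have "\<dots> = of_real (\<phi> * B)"
      using X(1) by (simp add: B sum_distrib_left mult_ac)
    finally show ?thesis .
  qed
  have fh: "(\<Sum>a\<in>A. f a * cnj (h a)) = of_real B"
  proof -
    have "(\<Sum>a\<in>A. f a * cnj (h a)) = (\<Sum>a\<in>A. \<Sum>ch\<in>X. cnj (c ch) * (cnj (ch a) * f a))"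
      unfolding h_def cnj_sum sum_distrib_left by (intro sum.cong refl) (simp add: mult_ac)
    also have "\<dots> = (\<Sum>ch\<in>X. cnj (c ch) * c ch)"
      by (subst sum.swap) (simp add: c_def sum_distrib_left)
    finally show ?thesis by (simp add: B mult_ac)
  qed
  have "complex_of_real (\<Sum>a\<in>A. (norm (\<phi> * f a - h a))\<^sup>2) =
      \<phi>\<^sup>2 * (\<Sum>a\<in>A. f a * cnj (f a)) - \<phi> * (\<Sum>a\<in>A. f a * cnj (h a))
       - \<phi> * cnj (\<Sum>a\<in>A. f a * cnj (h a)) + (\<Sum>a\<in>A. h a * cnj (h a))"
  proof -
    have "complex_of_real ((norm (\<phi> * f a - h a))\<^sup>2) = \<phi>\<^sup>2 * (f a * cnj (f a)) - \<phi> * (f a * cnj (h a))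
       - \<phi> * cnj (f a * cnj (h a)) + h a * cnj (h a)" for a
      unfolding complex_norm_square by (simp add: algebra_simps power2_eq_square)
    then show ?thesis
      unfolding of_real_sum by (simp only: sum.distrib sum_subtractf sum_distrib_left cnj_sum)
  qed
  also have "\<dots> = of_real (\<phi>\<^sup>2 * N - \<phi> * B)"
    unfolding hh fh by (simp add: N)
  finally have "(\<Sum>a\<in>A. (norm (\<phi> * f a - h a))\<^sup>2) = \<phi>\<^sup>2 * N - \<phi> * B"
    by (simp only: of_real_eq_iff)
  moreover have "0 \<le> (\<Sum>a\<in>A. (norm (\<phi> * f a - h a))\<^sup>2)" by (intro sum_nonneg) auto
  ultimately have "0 \<le> \<phi>\<^sup>2 * N - \<phi> * B" by simp
  then have "\<phi> * B \<le> \<phi> * (\<phi> * N)" by (simp add: power2_eq_square mult_ac)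
  then have "B \<le> \<phi> * N" using \<open>\<phi> > 0\<close> by simp
  also have "\<phi> \<le> real q"
  proof -
    have "card A \<le> card {0..<int q}" by (rule card_mono) (auto simp: A_def)
    then show ?thesis by (simp add: \<phi>_def)
  qed
  then have "\<phi> * N \<le> real q * N" by (intro mult_right_mono) (auto simp: N_def sum_nonneg)
  finally show ?thesis using c by (simp add: B_def N_def A_def)
qed

section \<open>The large sieve\<close>

text \<open>Gallagher's form of the Sobolev inequality: for each x in the interval, g \<alpha> is at
  most g x plus the integral of |g'|, and averaging over x gives the claim. The interval lies to the
  right of \<alpha>, and a continuous majorant h stands in for |g'|.\<close>

lemma sobolev_pointwise:
  fixes g h :: "real \<Rightarrow> real"
  assumes "\<delta> > 0"
    and g: "\<And>x. (g has_real_derivative g' x) (at x)"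
    and g': "\<And>x. \<bar>g' x\<bar> \<le> h x" and h: "continuous_on UNIV h"
  shows "\<delta> * g \<alpha> \<le> integral {\<alpha>..\<alpha>+\<delta>} (\<lambda>x. g x + \<delta> * h x)"
proof -
  have contg: "continuous_on S g" for S
    using g by (meson DERIV_isCont continuous_at_imp_continuous_on)
  have hint: "h integrable_on {a..b}" for a b
    using h by (intro integrable_continuous_real continuous_on_subset[OF h]) auto
  have gint: "g integrable_on {a..b}" for a b
    by (intro integrable_continuous_real contg)
  define I where "I = integral {\<alpha>..\<alpha>+\<delta>} h"
  have hpos: "h x \<ge> 0" for x using g'[of x] by linarith
  have le: "g \<alpha> \<le> g x + I" if "x \<in> {\<alpha>..\<alpha>+\<delta>}" for x
  proof -
    have "(g' has_integral (g x - g \<alpha>)) {\<alpha>..x}"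
      using that g by (intro fundamental_theorem_of_calculus)
        (auto simp: has_real_derivative_iff_has_vector_derivative intro: has_vector_derivative_at_within)
    then have "((\<lambda>x. - g' x) has_integral - (g x - g \<alpha>)) {\<alpha>..x}" by (rule has_integral_neg)
    then have "- (g x - g \<alpha>) \<le> integral {\<alpha>..x} h"
      by (rule has_integral_le[OF _ integrable_integral[OF hint]]) (use g' in \<open>force simp: abs_le_iff\<close>)
    also have "\<dots> \<le> I" unfolding I_def
      using that hpos by (intro integral_subset_le hint) auto
    finally show ?thesis by simp
  qed
  have "\<delta> * g \<alpha> = integral {\<alpha>..\<alpha>+\<delta>} (\<lambda>_. g \<alpha>)" using assms(1) by simp
  also have "\<dots> \<le> integral {\<alpha>..\<alpha>+\<delta>} (\<lambda>x. g x + I)"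
    by (intro integral_le integrable_add gint integrable_const_ivl le)
  also have "\<dots> = integral {\<alpha>..\<alpha>+\<delta>} g + \<delta> * I"
    using assms(1) by (subst integral_add) (auto intro: gint)
  also have "\<dots> = integral {\<alpha>..\<alpha>+\<delta>} (\<lambda>x. g x + \<delta> * h x)"
    unfolding I_def by (subst integral_add) (auto intro: gint hint integrable_on_mult_right)
  finally show ?thesis .
qed

lemma has_integral_e_unit:
  "((\<lambda>x. e_unit (of_int k * x)) has_integral (if k = 0 then 1 else 0)) {0..1}"
proof (cases "k = 0")
  case True
  then show ?thesis using has_integral_const_real[of "1::complex" 0 1] by (simp add: e_unit_def)
next
  case False
  define c where "c = 2 * of_real pi * \<i> * of_int k"
  have "c \<noteq> 0" using False by (simp add: c_def)
  have e: "e_unit (of_int k * x) = exp (c * of_real x)" for x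
    by (simp add: e_unit_def cis_conv_exp c_def mult_ac)
  have "((\<lambda>x. exp (c * of_real x)) has_integral exp (c * of_real 1) / c - exp (c * of_real 0) / c) {0..1}"
  proof (rule fundamental_theorem_of_calculus)
    fix x :: real
    have "((\<lambda>z. exp (c * z) / c) has_field_derivative exp (c * of_real x)) (at (of_real x))"
      using \<open>c \<noteq> 0\<close> by (auto intro!: derivative_eq_intros)
    then show "((\<lambda>x. exp (c * complex_of_real x) / c) has_vector_derivative exp (c * of_real x)) (at x within {0..1})"
      by (rule has_vector_derivative_real_field)
  qed simp
  moreover have "exp (c * of_real 1) = 1"
    using e[of 1] by simp
  ultimately show ?thesis using False by (simp add: e)
qed

lemma has_integral_trig_poly_square:
  fixes a :: "nat \<Rightarrow> complex"
  shows "((\<lambda>x. (norm (\<Sum>n=1..N. a n * e_unit (real n * x)))\<^sup>2) has_integral (\<Sum>n=1..N. (norm (a n))\<^sup>2)) {0..1}"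
proof -
  have eq: "(\<Sum>n=1..N. a n * e_unit (real n * x)) * cnj (\<Sum>n=1..N. a n * e_unit (real n * x))
    = (\<Sum>m=1..N. \<Sum>n=1..N. a m * cnj (a n) * e_unit (of_int (int m - int n) * x))" for x
  proof -
    have "e_unit (real m * x) * cnj (e_unit (real n * x)) = e_unit (of_int (int m - int n) * x)" for m n
      by (simp add: cnj_e_unit left_diff_distrib flip: e_unit_add)
    moreover have "(w * u) * (y * v) = w * y * (u * v)" for w u y v :: complex
      by (simp add: mult_ac)
    ultimately show ?thesis unfolding cnj_sum sum_product by (simp only: complex_cnj_mult)
  qed
  have "((\<lambda>x. \<Sum>m=1..N. \<Sum>n=1..N. a m * cnj (a n) * e_unit (of_int (int m - int n) * x))
    has_integral (\<Sum>m=1..N. \<Sum>n=1..N. a m * cnj (a n) * (if int m - int n = 0 then 1 else 0))) {0..1}"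
    by (intro has_integral_sum has_integral_mult_right has_integral_e_unit) auto
  also have "(\<Sum>m=1..N. \<Sum>n=1..N. a m * cnj (a n) * (if int m - int n = 0 then 1 else 0)) =
    (\<Sum>m=1..N. \<Sum>n=1..N. if n = m then a m * cnj (a m) else 0)"
    by (intro sum.cong refl) auto
  also have "\<dots> = complex_of_real (\<Sum>n=1..N. (norm (a n))\<^sup>2)"
    unfolding of_real_sum complex_norm_square by simp
  finally have "((\<lambda>x. complex_of_real ((norm (\<Sum>n=1..N. a n * e_unit (real n * x)))\<^sup>2)) has_integral
     complex_of_real (\<Sum>n=1..N. (norm (a n))\<^sup>2)) {0..1}"
    unfolding complex_norm_square eq .
  from has_integral_Re[OF this] show ?thesis by simp
qed

text \<open>The values of |S|^2 at the points of R are replaced by integrals over intervals of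
  length \<delta> that overlap in end points at most, and Parseval's identity evaluates the integral
  over a full period. The constant 65 is 1 + 64, with 64 N^2 a bound for (2 \<pi> n)^2. Since the
  intervals extend to the right, R stays below 1 - \<delta>, so that they remain in one
  period.\<close>

lemma additive_large_sieve:
  fixes a :: "nat \<Rightarrow> complex"
  assumes R: "finite R" "R \<subseteq> {0..1-\<delta>}" and "\<delta> > 0"
    and sep: "\<And>r s. r \<in> R \<Longrightarrow> s \<in> R \<Longrightarrow> r \<noteq> s \<Longrightarrow> \<bar>r - s\<bar> \<ge> \<delta>"
  shows "(\<Sum>r\<in>R. (norm (\<Sum>n=1..N. a n * e_unit (real n * r)))\<^sup>2)
    \<le> (1 / \<delta> + 65 * real N) * (\<Sum>n=1..N. (norm (a n))\<^sup>2)"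
proof (cases "N = 0")
  case False
  then have N: "real N \<ge> 1" by simp
  define b where "b n = 2 * of_real pi * \<i> * of_nat n * a n" for n
  define S where "S x = (\<Sum>n=1..N. a n * e_unit (real n * x))" for x
  define D where "D x = (\<Sum>n=1..N. b n * e_unit (real n * x))" for x
  define A where "A = (\<Sum>n=1..N. (norm (a n))\<^sup>2)"
  define g where "g x = (norm (S x))\<^sup>2" for x
  \<comment> \<open>The derivative of |S|^2 is at most 2 |S| |D|. As D = S' has a mean square of up
    to (2 \<pi> N)^2 times that of S, the product is split with the weight N, which balances the two
    squares.\<close>
  define h where "h x = real N * (norm (S x))\<^sup>2 + (norm (D x))\<^sup>2 / real N" for x
  have e: "e_unit (real n * x) = exp (2 * of_real pi * \<i> * of_nat n * of_real x)" for n x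
    by (simp add: e_unit_def cis_conv_exp mult_ac)
  have Sd: "(S has_vector_derivative D x) (at x)" for x
  proof -
    have "((\<lambda>z. \<Sum>n=1..N. a n * exp (2 * of_real pi * \<i> * of_nat n * z)) has_field_derivative
       (\<Sum>n=1..N. b n * exp (2 * of_real pi * \<i> * of_nat n * of_real x))) (at (of_real x))"
      by (auto intro!: derivative_eq_intros sum.cong simp: b_def)
    then have "((\<lambda>x. \<Sum>n=1..N. a n * exp (2 * of_real pi * \<i> * of_nat n * of_real x)) has_vector_derivative
       (\<Sum>n=1..N. b n * exp (2 * of_real pi * \<i> * of_nat n * of_real x))) (at x)"
      by (rule has_vector_derivative_real_field)
    then show ?thesis unfolding S_def D_def e .
  qed
  have gd: "(g has_real_derivative 2 * (Re (S x) * Re (D x) + Im (S x) * Im (D x))) (at x)" for x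
  proof -
    have "((\<lambda>x. Re (S x)) has_real_derivative Re (D x)) (at x)"
      "((\<lambda>x. Im (S x)) has_real_derivative Im (D x)) (at x)"
      using Sd[of x] by (simp_all add: has_vector_derivative_complex_iff o_def)
    from DERIV_add[OF DERIV_power[OF this(1), of 2] DERIV_power[OF this(2), of 2]]
    show ?thesis unfolding g_def cmod_power2 by (simp add: algebra_simps)
  qed
  have gh: "\<bar>2 * (Re (S x) * Re (D x) + Im (S x) * Im (D x))\<bar> \<le> h x" for x
  proof -
    have "\<bar>Re (S x) * Re (D x) + Im (S x) * Im (D x)\<bar> = \<bar>Re (S x * cnj (D x))\<bar>" by simp
    also have "\<dots> \<le> norm (S x * cnj (D x))" by (rule abs_Re_le_cmod)
    also have "\<dots> = norm (S x) * norm (D x)" by (simp add: norm_mult)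
    finally have "\<bar>2 * (Re (S x) * Re (D x) + Im (S x) * Im (D x))\<bar> \<le> 2 * norm (S x) * norm (D x)"
      by (simp add: abs_mult)
    also have "\<dots> \<le> h x"
    proof -
      have "0 \<le> (real N * norm (S x) - norm (D x))\<^sup>2" by simp
      then have "real N * (2 * norm (S x) * norm (D x)) \<le> real N * h x"
        using N by (simp add: h_def power2_eq_square algebra_simps)
      then show ?thesis using N by simp
    qed
    finally show ?thesis .
  qed
  have Scont: "continuous_on UNIV S" "continuous_on UNIV D"
    unfolding S_def D_def e by (intro continuous_intros)+
  then have hc: "continuous_on UNIV h"
    unfolding h_def using N by (intro continuous_intros) auto
  define F where "F x = g x + \<delta> * h x" for x
  have Fc: "continuous_on UNIV F" unfolding F_def g_def using Scont hc by (intro continuous_intros)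
  have Fint: "F integrable_on {u..v}" for u v
    by (intro integrable_continuous_real continuous_on_subset[OF Fc]) auto
  have Fpos: "F x \<ge> 0" for x using gh[of x] assms(3) by (simp add: F_def g_def)
  have "\<delta> * (\<Sum>r\<in>R. g r) \<le> (\<Sum>r\<in>R. integral {r..r+\<delta>} F)"
    unfolding sum_distrib_left F_def
    by (intro sum_mono sobolev_pointwise[OF assms(3) gd gh hc])
  also have "\<dots> \<le> integral {0..1} F"
  proof -
    define T where "T = (\<lambda>r. {r..r+\<delta>}) ` R"
    have inj: "inj_on (\<lambda>r. {r..r+\<delta>}) R"
      using assms(3) by (auto simp: inj_on_def Icc_eq_Icc)
    have "(F has_integral (\<Sum>J\<in>T. integral J F)) (\<Union>T)"
    proof (rule has_integral_Union)
      show "finite T" using R by (simp add: T_def)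
      show "(F has_integral integral J F) J" if "J \<in> T" for J
        using that Fint by (auto simp: T_def intro: integrable_integral)
      show "pairwise (\<lambda>S S'. negligible (S \<inter> S')) T"
      proof (rule pairwiseI)
        fix J K assume "J \<in> T" "K \<in> T" "J \<noteq> K"
        then obtain r s where rs: "r \<in> R" "s \<in> R" "r \<noteq> s" "J = {r..r+\<delta>}" "K = {s..s+\<delta>}"
          by (auto simp: T_def)
        have "J \<inter> K \<subseteq> {r, s}" using sep[OF rs(1-3)] by (auto simp: rs(4,5))
        then show "negligible (J \<inter> K)" by (meson negligible_subset negligible_finite finite.intros)
      qed
    qed
    moreover have "(\<Sum>J\<in>T. integral J F) = (\<Sum>r\<in>R. integral {r..r+\<delta>} F)"
      unfolding T_def by (subst sum.reindex[OF inj]) simp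
    ultimately have *: "(F has_integral (\<Sum>r\<in>R. integral {r..r+\<delta>} F)) (\<Union>T)" by simp
    have sub: "\<Union>T \<subseteq> {0..1}" using R(2) by (fastforce simp: T_def)
    show ?thesis
      by (rule has_integral_subset_le[OF sub * integrable_integral[OF Fint]]) (use Fpos in auto)
  qed
  also have "\<dots> \<le> (1 + \<delta> * (65 * real N)) * A"
  proof -
    have "(F has_integral (A + \<delta> * (real N * A + (\<Sum>n=1..N. (norm (b n))\<^sup>2) / real N))) {0..1}"
      unfolding F_def g_def h_def S_def D_def A_def
      by (intro has_integral_add has_integral_mult_right has_integral_divide has_integral_trig_poly_square)
    then have "integral {0..1} F = A + \<delta> * (real N * A + (\<Sum>n=1..N. (norm (b n))\<^sup>2) / real N)"
      by (rule integral_unique)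
    moreover have "(\<Sum>n=1..N. (norm (b n))\<^sup>2) \<le> (\<Sum>n=1..N. 64 * (real N)\<^sup>2 * (norm (a n))\<^sup>2)"
    proof (rule sum_mono)
      fix n assume n: "n \<in> {1..N}"
      have "(2 * pi * real n)\<^sup>2 \<le> (8 * real N)\<^sup>2"
        using n pi_less_4 by (intro power_mono mult_mono) auto
      then have "(2 * pi * real n)\<^sup>2 * (norm (a n))\<^sup>2 \<le> 64 * (real N)\<^sup>2 * (norm (a n))\<^sup>2"
        by (intro mult_right_mono) (auto simp: power_mult_distrib)
      then show "(norm (b n))\<^sup>2 \<le> 64 * (real N)\<^sup>2 * (norm (a n))\<^sup>2"
        by (simp add: b_def norm_mult power_mult_distrib)
    qed
    then have "(\<Sum>n=1..N. (norm (b n))\<^sup>2) / real N \<le> 64 * real N * A"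
    proof -
      assume "(\<Sum>n=1..N. (norm (b n))\<^sup>2) \<le> (\<Sum>n=1..N. 64 * (real N)\<^sup>2 * (norm (a n))\<^sup>2)"
      then have "(\<Sum>n=1..N. (norm (b n))\<^sup>2) \<le> 64 * (real N)\<^sup>2 * A"
        by (simp only: A_def sum_distrib_left)
      then show ?thesis using N by (simp add: divide_le_eq power2_eq_square mult_ac)
    qed
    then have "A + \<delta> * (real N * A + (\<Sum>n=1..N. (norm (b n))\<^sup>2) / real N) \<le> A + \<delta> * (real N * A + 64 * real N * A)"
      using assms(3) by (intro add_left_mono mult_left_mono) auto
    ultimately have "integral {0..1} F \<le> A + \<delta> * (real N * A + 64 * real N * A)" by simp
    then show ?thesis by (simp add: algebra_simps)
  qed
  finally have "\<delta> * (\<Sum>r\<in>R. g r) \<le> \<delta> * ((1 / \<delta> + 65 * real N) * A)"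
    using assms(3) by (simp add: algebra_simps)
  then show ?thesis using assms(3) by (simp add: g_def S_def A_def)
qed simp

text \<open>Multiplication by \<open>gauss_sum q ch 1\<close> turns the character sum into a
  combination of exponential sums. The square of its norm is q, which cancels the factor q in
  Bessel's inequality.\<close>

lemma large_sieve_modulus:
  fixes a :: "nat \<Rightarrow> complex"
  assumes "q > 0" "finite X" "\<And>ch. ch \<in> X \<Longrightarrow> primitive_char q ch"
  shows "(\<Sum>ch\<in>X. (norm (\<Sum>n=1..N. a n * ch (int n)))\<^sup>2)
    \<le> (\<Sum>b | b \<in> {0..<int q} \<and> coprime b (int q). (norm (\<Sum>n=1..N. a n * e_unit (real n * (of_int b / real q))))\<^sup>2)"
proof -
  define S where "S x = (\<Sum>n=1..N. a n * e_unit (real n * x))" for x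
  have "real q * (norm (\<Sum>n=1..N. a n * ch (int n)))\<^sup>2 =
     (norm (\<Sum>b\<in>{0..<int q}. cnj (ch b) * S (of_int b / real q)))\<^sup>2" if "ch \<in> X" for ch
  proof -
    note ch = assms(3)[OF that]
    have "gauss_sum q ch 1 * (\<Sum>n=1..N. a n * ch (int n)) = (\<Sum>n=1..N. a n * (ch (int n) * gauss_sum q ch 1))"
      by (simp add: sum_distrib_left mult_ac)
    also have "\<dots> = (\<Sum>n=1..N. a n * gauss_sum q ch (int n))"
      by (simp only: gauss_sum_separable[OF ch assms(1), symmetric])
    also have "\<dots> = (\<Sum>b\<in>{0..<int q}. cnj (ch b) * S (of_int b / real q))"
      unfolding gauss_sum_def S_def sum_distrib_left
      by (subst sum.swap) (simp add: mult_ac)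
    finally show ?thesis
      using norm_gauss_sum_1[OF ch assms(1)] by (metis norm_mult power_mult_distrib)
  qed
  then have "real q * (\<Sum>ch\<in>X. (norm (\<Sum>n=1..N. a n * ch (int n)))\<^sup>2) =
     (\<Sum>ch\<in>X. (norm (\<Sum>b\<in>{0..<int q}. cnj (ch b) * S (of_int b / real q)))\<^sup>2)"
    by (simp add: sum_distrib_left)
  also have "\<dots> \<le> real q * (\<Sum>b | b \<in> {0..<int q} \<and> coprime b (int q). (norm (S (of_int b / real q)))\<^sup>2)"
    by (rule bessel_dirichlet_chars) (use assms in \<open>auto simp: primitive_char_def\<close>)
  finally show ?thesis using assms(1) by (simp add: S_def)
qed

text \<open>Distinct reduced fractions with denominators q, r up to 2 Q differ by at least 1 / (q
  r), hence by 1 / (4 Q^2); this is the spacing \<delta> of the additive large sieve.\<close>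

lemma large_sieve:
  fixes a :: "nat \<Rightarrow> complex"
  assumes "Q \<ge> 2"
    and X: "\<And>q. Q \<le> real q \<Longrightarrow> real q \<le> 2 * Q \<Longrightarrow> finite (X q)"
      "\<And>q ch. Q \<le> real q \<Longrightarrow> real q \<le> 2 * Q \<Longrightarrow> ch \<in> X q \<Longrightarrow> primitive_char q ch"
  shows "(\<Sum>q | Q \<le> real q \<and> real q \<le> 2 * Q. \<Sum>ch\<in>X q. (norm (\<Sum>n=1..N. a n * ch (int n)))\<^sup>2)
     \<le> (4 * Q\<^sup>2 + 65 * real N) * (\<Sum>n=1..N. (norm (a n))\<^sup>2)"
proof -
  define M where "M = {q. Q \<le> real q \<and> real q \<le> 2 * Q}"
  have "M \<subseteq> {..nat \<lfloor>2 * Q\<rfloor>}" by (auto simp: M_def le_nat_floor)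
  then have [simp]: "finite M" by (rule finite_subset) simp
  define B where "B q = {b \<in> {0..<int q}. coprime b (int q)}" for q
  have [simp]: "finite (B q)" for q by (rule finite_subset[of _ "{0..<int q}"]) (auto simp: B_def)
  define S where "S x = (\<Sum>n=1..N. a n * e_unit (real n * x))" for x
  define fr where "fr = (\<lambda>(q, b). of_int b / real (q::nat) :: real)"
  define P where "P = Sigma M B"
  have [simp]: "finite P" by (simp add: P_def)
  have sep: "\<bar>fr x - fr y\<bar> \<ge> 1 / (4 * Q\<^sup>2)" if "x \<in> P" "y \<in> P" "x \<noteq> y" for x y
  proof -
    obtain q b r c where xy: "x = (q, b)" "y = (r, c)" by fastforce
    have qr: "q \<in> M" "r \<in> M" "b \<in> B q" "c \<in> B r" using that by (auto simp: P_def xy)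
    then have pos: "real q > 0" "real r > 0" "real q \<le> 2 * Q" "real r \<le> 2 * Q"
      using assms(1) by (auto simp: M_def)
    have "b * int r \<noteq> c * int q"
    proof
      assume eq: "b * int r = c * int q"
      have "int q dvd int r"
        using eq qr(3) by (metis B_def coprime_commute coprime_dvd_mult_right_iff dvd_triv_right mem_Collect_eq)
      moreover have "int r dvd int q"
        using eq qr(4) by (metis B_def coprime_commute coprime_dvd_mult_right_iff dvd_triv_right mem_Collect_eq)
      ultimately have "q = r" by (simp add: dvd_antisym)
      then have "b = c" using eq pos by simp
      then show False using \<open>q = r\<close> that(3) xy by simp
    qed
    then have "1 \<le> \<bar>b * int r - c * int q\<bar>" by linarith
    then have "1 \<le> \<bar>real_of_int (b * int r - c * int q)\<bar>"
      by (metis of_int_1 of_int_abs of_int_le_iff)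
    moreover have "fr x - fr y = real_of_int (b * int r - c * int q) / (real q * real r)"
      using pos by (simp add: fr_def xy field_simps)
    ultimately have "1 / (real q * real r) \<le> \<bar>fr x - fr y\<bar>"
      using pos by (simp add: abs_divide divide_right_mono)
    moreover have "real q * real r \<le> (2 * Q) * (2 * Q)" using pos by (intro mult_mono) auto
    then have "1 / (4 * Q\<^sup>2) \<le> 1 / (real q * real r)"
      using pos by (intro divide_left_mono) (auto simp: power2_eq_square)
    ultimately show ?thesis by linarith
  qed
  have inj: "inj_on fr P"
  proof (rule inj_onI, rule ccontr)
    fix x y assume "x \<in> P" "y \<in> P" "fr x = fr y" "x \<noteq> y"
    then show False using sep[of x y] assms(1) by simp
  qed
  have "(\<Sum>q\<in>M. \<Sum>ch\<in>X q. (norm (\<Sum>n=1..N. a n * ch (int n)))\<^sup>2) \<le> (\<Sum>q\<in>M. \<Sum>b\<in>B q. (norm (S (of_int b / real q)))\<^sup>2)"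
    unfolding B_def S_def using assms
    by (intro sum_mono large_sieve_modulus) (auto simp: M_def)
  also have "\<dots> = (\<Sum>x\<in>P. (norm (S (fr x)))\<^sup>2)"
    unfolding P_def by (subst sum.Sigma) (auto simp: fr_def split_beta)
  also have "\<dots> = (\<Sum>r\<in>fr ` P. (norm (S r))\<^sup>2)" by (simp add: sum.reindex[OF inj])
  also have "\<dots> \<le> (1 / (1 / (4 * Q\<^sup>2)) + 65 * real N) * (\<Sum>n=1..N. (norm (a n))\<^sup>2)"
    unfolding S_def
  proof (rule additive_large_sieve)
    \<comment> \<open>A reduced fraction with denominator q is at most 1 - 1/q, and 1/q is at least
      the spacing because q <= 2 Q.\<close>
    show "fr ` P \<subseteq> {0..1 - 1 / (4 * Q\<^sup>2)}"
    proof
      fix r assume "r \<in> fr ` P"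
      then obtain q b where qb: "q \<in> M" "b \<in> B q" "r = of_int b / real q"
        by (auto simp: P_def fr_def)
      have q: "real q > 0" "real q \<le> 2 * Q" using qb assms(1) by (auto simp: M_def)
      have "b + 1 \<le> int q" "b \<ge> 0" using qb by (auto simp: B_def)
      then have b: "real_of_int b \<le> real q - 1" "real_of_int b \<ge> 0"
        by linarith+
      have "r \<le> 1 - 1 / real q" using b q by (simp add: qb(3) field_simps)
      moreover have "1 / (4 * Q\<^sup>2) \<le> 1 / real q"
      proof (intro divide_left_mono)
        have "1 * (2 * Q) \<le> (2 * Q) * (2 * Q)" using assms(1) by (intro mult_right_mono) auto
        moreover have "(2 * Q) * (2 * Q) = 4 * Q\<^sup>2" by (simp add: power2_eq_square)
        ultimately show "real q \<le> 4 * Q\<^sup>2" using q by linarith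
      qed (use q assms(1) in auto)
      ultimately show "r \<in> {0..1 - 1 / (4 * Q\<^sup>2)}" using b q by (simp add: qb(3))
    qed
    show "\<bar>r - s\<bar> \<ge> 1 / (4 * Q\<^sup>2)" if "r \<in> fr ` P" "s \<in> fr ` P" "r \<noteq> s" for r s
      using that sep by blast
  qed (use assms in auto)
  finally show ?thesis by (simp add: M_def)
qed

section \<open>Complex analysis\<close>

lemma rectpath_integral_estimate:
  assumes "a < b" "H > 0" "B \<ge> 0"
    and cont: "continuous_on (path_image (rectpath (Complex a (-H)) (Complex b H))) f"
    and hor: "\<And>x. a \<le> x \<Longrightarrow> x \<le> b \<Longrightarrow> norm (f (Complex x H)) \<le> B \<and> norm (f (Complex x (-H))) \<le> B"
    and int: "(f has_contour_integral I) (rectpath (Complex a (-H)) (Complex b H))"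
  shows "norm (\<i> * (integral {-H..H} (\<lambda>t. f (Complex b t)) - integral {-H..H} (\<lambda>t. f (Complex a t))) - I)
    \<le> 2 * B * (b - a)"
proof -
  define p1 p2 p3 p4 where p: "p1 = Complex a (-H)" "p2 = Complex b (-H)" "p3 = Complex b H" "p4 = Complex a H"
  have img: "path_image (rectpath p1 p3) =
     {z. Re z \<in> {a, b} \<and> Im z \<in> {-H..H}} \<union> {z. Im z \<in> {-H, H} \<and> Re z \<in> {a..b}}"
    using assms(1,2) by (subst path_image_rectpath) (auto simp: p)
  have seg: "closed_segment p1 p2 \<subseteq> path_image (rectpath p1 p3)" "closed_segment p2 p3 \<subseteq> path_image (rectpath p1 p3)"
     "closed_segment p3 p4 \<subseteq> path_image (rectpath p1 p3)" "closed_segment p4 p1 \<subseteq> path_image (rectpath p1 p3)"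
    unfolding img using assms(1,2)
    by (auto simp: p closed_segment_same_Re closed_segment_same_Im closed_segment_eq_real_ivl)
  have cont': "continuous_on (closed_segment p1 p2) f" "continuous_on (closed_segment p2 p3) f"
     "continuous_on (closed_segment p3 p4) f" "continuous_on (closed_segment p4 p1) f"
    using seg cont by (auto simp: p intro: continuous_on_subset)
  have ci: "f contour_integrable_on linepath p1 p2" "f contour_integrable_on linepath p2 p3"
     "f contour_integrable_on linepath p3 p4" "f contour_integrable_on linepath p4 p1"
    using cont' by (auto intro: contour_integrable_continuous_linepath)
  have "I = contour_integral (rectpath p1 p3) f" using int by (simp add: p contour_integral_unique)
  also have "\<dots> = contour_integral (linepath p1 p2) f + (contour_integral (linepath p2 p3) f
      + (contour_integral (linepath p3 p4) f + contour_integral (linepath p4 p1) f))"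
    using ci unfolding rectpath_def Let_def by (simp add: p contour_integrable_joinI)
  finally have I: "I = \<dots>" .
  have v1: "contour_integral (linepath p2 p3) f = \<i> * integral {-H..H} (\<lambda>t. f (Complex b t))"
    using assms by (intro contour_integral_linepath_same_Re) (auto simp: p)
  have "contour_integral (linepath p1 p4) f = \<i> * integral {-H..H} (\<lambda>t. f (Complex a t))"
    using assms by (intro contour_integral_linepath_same_Re) (auto simp: p)
  moreover have "contour_integral (linepath p4 p1) f = - contour_integral (linepath p1 p4) f"
    using contour_integral_reverse_linepath[OF cont'(4)] .
  ultimately have v2: "contour_integral (linepath p4 p1) f = - (\<i> * integral {-H..H} (\<lambda>t. f (Complex a t)))" by simp
  have h1: "norm (contour_integral (linepath p1 p2) f) \<le> B * norm (p2 - p1)"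
  proof (rule contour_integral_bound_linepath[OF ci(1) assms(3)])
    fix z assume "z \<in> closed_segment p1 p2"
    then have "Im z = -H" "a \<le> Re z" "Re z \<le> b"
      using assms(1) by (auto simp: p closed_segment_same_Im closed_segment_eq_real_ivl)
    then show "norm (f z) \<le> B" using hor[of "Re z"] by (metis complex_surj)
  qed
  have h2: "norm (contour_integral (linepath p3 p4) f) \<le> B * norm (p4 - p3)"
  proof (rule contour_integral_bound_linepath[OF ci(3) assms(3)])
    fix z assume "z \<in> closed_segment p3 p4"
    then have "Im z = H" "a \<le> Re z" "Re z \<le> b"
      using assms(1) by (auto simp: p closed_segment_same_Im closed_segment_eq_real_ivl)
    then show "norm (f z) \<le> B" using hor[of "Re z"] by (metis complex_surj)
  qed
  have n: "norm (p2 - p1) = b - a" "norm (p4 - p3) = b - a"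
    using assms(1) by (auto simp: p cmod_def)
  have "\<i> * (integral {-H..H} (\<lambda>t. f (Complex b t)) - integral {-H..H} (\<lambda>t. f (Complex a t))) - I =
     - (contour_integral (linepath p1 p2) f + contour_integral (linepath p3 p4) f)"
    unfolding I v1 v2 by (simp add: algebra_simps)
  also have "norm \<dots> \<le> B * (b - a) + B * (b - a)"
    unfolding norm_minus_cancel using norm_triangle_ineq h1 h2 unfolding n by (meson add_mono order_trans)
  finally show ?thesis by simp
qed

lemma vertical_integral_shift:
  assumes "a < b" "H > 0" "B \<ge> 0"
    and hol: "f holomorphic_on {z. a \<le> Re z \<and> Re z \<le> b \<and> - H \<le> Im z \<and> Im z \<le> H}"
    and hor: "\<And>x. a \<le> x \<Longrightarrow> x \<le> b \<Longrightarrow> norm (f (Complex x H)) \<le> B \<and> norm (f (Complex x (-H))) \<le> B"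
  shows "norm (integral {-H..H} (\<lambda>t. f (Complex b t)) - integral {-H..H} (\<lambda>t. f (Complex a t))) \<le> 2 * B * (b - a)"
proof -
  let ?R = "rectpath (Complex a (-H)) (Complex b H)"
  have conv: "convex {z. a \<le> Re z \<and> Re z \<le> b \<and> - H \<le> Im z \<and> Im z \<le> H}"
    unfolding Collect_conj_eq by (intro convex_Int convex_halfspace_Re_ge convex_halfspace_Re_le convex_halfspace_Im_ge convex_halfspace_Im_le)
  have img: "path_image ?R \<subseteq> {z. a \<le> Re z \<and> Re z \<le> b \<and> - H \<le> Im z \<and> Im z \<le> H}"
    using assms(1,2) by (subst path_image_rectpath) auto
  have "(f has_contour_integral 0) ?R"
    by (rule Cauchy_theorem_convex_simple[OF hol conv _ img]) auto
  moreover have "continuous_on (path_image ?R) f"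
    using holomorphic_on_imp_continuous_on[OF hol] img continuous_on_subset by blast
  ultimately have "norm (\<i> * (integral {-H..H} (\<lambda>t. f (Complex b t)) - integral {-H..H} (\<lambda>t. f (Complex a t))) - 0)
    \<le> 2 * B * (b - a)"
    using assms by (intro rectpath_integral_estimate) auto
  then show ?thesis by (simp add: norm_mult)
qed

text \<open>The residue of f s / s at 0 is f 0. The factor is 2 \<pi> without \<i> because the
  integrals run over the height t, and ds = \<i> dt.\<close>

lemma vertical_integral_shift_pole:
  fixes f :: "complex \<Rightarrow> complex"
  assumes "a < 0" "0 < b" "H > 0" "B \<ge> 0"
    and hol: "f holomorphic_on {z. a \<le> Re z \<and> Re z \<le> b}"
    and hor: "\<And>x. a \<le> x \<Longrightarrow> x \<le> b \<Longrightarrow> norm (f (Complex x H) / Complex x H) \<le> B \<and> norm (f (Complex x (-H)) / Complex x (-H)) \<le> B"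
  shows "norm (integral {-H..H} (\<lambda>t. f (Complex b t) / Complex b t) - integral {-H..H} (\<lambda>t. f (Complex a t) / Complex a t)
     - 2 * pi * f 0) \<le> 2 * B * (b - a)"
proof -
  let ?R = "rectpath (Complex a (-H)) (Complex b H)"
  have conv: "convex {z. a \<le> Re z \<and> Re z \<le> b}"
    using convex_Int[OF convex_halfspace_Re_ge convex_halfspace_Re_le] by (simp add: Collect_conj_eq)
  have img: "path_image ?R \<subseteq> {z. a \<le> Re z \<and> Re z \<le> b} - {0}"
    using assms(1-3) by (subst path_image_rectpath) auto
  have "0 \<in> box (Complex a (-H)) (Complex b H)" using assms by (simp add: in_box_complex_iff)
  then have wn: "winding_number ?R 0 = 1" by (rule winding_number_rectpath)
  have int: "0 \<in> interior {z. a \<le> Re z \<and> Re z \<le> b}"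
  proof (rule interiorI)
    show "open {z. a < Re z \<and> Re z < b}"
      using open_Int[OF open_halfspace_Re_gt open_halfspace_Re_lt] by (simp add: Collect_conj_eq)
  qed (use assms in auto)
  have "((\<lambda>w. f w / (w - 0)) has_contour_integral complex_of_real (2 * pi) * \<i> * winding_number ?R 0 * f 0) ?R"
    by (rule Cauchy_integral_formula_convex_simple[OF conv hol int _ img]) auto
  then have "((\<lambda>w. f w / w) has_contour_integral complex_of_real (2 * pi) * \<i> * f 0) ?R" by (simp add: wn)
  moreover have "continuous_on (path_image ?R) (\<lambda>w. f w / w)"
    by (intro continuous_on_divide continuous_on_id
         continuous_on_subset[OF holomorphic_on_imp_continuous_on[OF hol]]) (use img in auto)
  ultimately have "norm (\<i> * (integral {-H..H} (\<lambda>t. f (Complex b t) / Complex b t) - integral {-H..H} (\<lambda>t. f (Complex a t) / Complex a t)) - complex_of_real (2 * pi) * \<i> * f 0)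
    \<le> 2 * B * (b - a)"
    using assms by (intro rectpath_integral_estimate[where f = "\<lambda>w. f w / w"]) auto
  moreover have "\<i> * (integral {-H..H} (\<lambda>t. f (Complex b t) / Complex b t) - integral {-H..H} (\<lambda>t. f (Complex a t) / Complex a t)) - complex_of_real (2 * pi) * \<i> * f 0
    = \<i> * (integral {-H..H} (\<lambda>t. f (Complex b t) / Complex b t) - integral {-H..H} (\<lambda>t. f (Complex a t) / Complex a t) - 2 * pi * f 0)"
    by (simp add: algebra_simps)
  ultimately show ?thesis by (simp add: norm_mult)
qed

lemma norm_integral_le_const:
  fixes f :: "real \<Rightarrow> complex"
  assumes "\<And>t. t \<in> {-H..H} \<Longrightarrow> norm (f t) \<le> B" "H \<ge> 0" "continuous_on {-H..H} f"
  shows "norm (integral {-H..H} f) \<le> 2 * B * H"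
proof -
  have "norm (integral {-H..H} f) \<le> B * (H - (-H))"
    by (rule integral_bound) (use assms in auto)
  then show ?thesis by simp
qed

text \<open>For y <= 1 the line is moved to the right by T. On the new line and on the two
  horizontal sides |s| >= T, while y^(Re s) only decreases, so the integrand is at most y^c / T^2;
  the three sides have total length 4 T.\<close>

lemma perron_log_small:
  assumes "0 < y" "y \<le> 1" "c > 0" "T > 0"
  shows "norm (integral {-T..T} (\<lambda>t. exp (Complex c t * of_real (ln y)) / (Complex c t)\<^sup>2)) \<le> 4 * y powr c / T"
proof -
  define f where "f s = exp (s * of_real (ln y)) / s\<^sup>2" for s :: complex
  have yc: "norm (exp (s * of_real (ln y))) \<le> y powr c" if "Re s \<ge> c" for s
  proof -
    have "Re s * ln y \<le> c * ln y" using that assms by (intro mult_right_mono_neg) auto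
    then show ?thesis using assms by (simp add: powr_def)
  qed
  have bd: "norm (f s) \<le> y powr c / T\<^sup>2" if "Re s \<ge> c" "norm s \<ge> T" for s
    unfolding f_def norm_divide norm_power
    using yc[OF that(1)] that assms by (intro frac_le power_mono) auto
  have hol: "f holomorphic_on {z. c \<le> Re z \<and> Re z \<le> c + T}"
    unfolding f_def using assms by (intro holomorphic_intros) auto
  have "norm (integral {-T..T} (\<lambda>t. f (Complex (c + T) t)) - integral {-T..T} (\<lambda>t. f (Complex c t)))
      \<le> 2 * (y powr c / T\<^sup>2) * ((c + T) - c)"
  proof (rule vertical_integral_shift)
    show "norm (f (Complex x T)) \<le> y powr c / T\<^sup>2 \<and> norm (f (Complex x (- T))) \<le> y powr c / T\<^sup>2"
      if "c \<le> x" "x \<le> c + T" for x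
      using that assms abs_Im_le_cmod[of "Complex x T"] abs_Im_le_cmod[of "Complex x (-T)"]
      by (auto intro!: bd)
  qed (use assms in \<open>auto intro: holomorphic_on_subset[OF hol]\<close>)
  moreover have "norm (integral {-T..T} (\<lambda>t. f (Complex (c + T) t))) \<le> 2 * (y powr c / T\<^sup>2) * T"
  proof (rule norm_integral_le_const)
    show "continuous_on {- T..T} (\<lambda>t. f (Complex (c + T) t))"
      by (rule continuous_on_compose2[OF holomorphic_on_imp_continuous_on[OF hol]])
         (use assms in \<open>auto simp: Complex_eq intro!: continuous_intros\<close>)
    show "norm (f (Complex (c + T) t)) \<le> y powr c / T\<^sup>2" if "t \<in> {-T..T}" for t
      using assms abs_Re_le_cmod[of "Complex (c + T) t"] by (intro bd) auto
  qed (use assms in auto)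
  moreover define u where "u = y powr c / T\<^sup>2 * T"
  ultimately have "norm (integral {-T..T} (\<lambda>t. f (Complex c t))) \<le> 4 * u"
    using norm_triangle_sub[of "integral {-T..T} (\<lambda>t. f (Complex c t))" "integral {-T..T} (\<lambda>t. f (Complex (c + T) t))"]
    unfolding norm_minus_commute[of "integral {-T..T} (\<lambda>t. f (Complex c t))"]
    by simp
  then show ?thesis using assms by (simp add: f_def u_def power2_eq_square)
qed

text \<open>For y >= 1 the line is moved left to -T, across the double pole at 0. There exp(s L) /
  s^2 is written as e s / s + 1 / s^2 with the entire function e s = (exp(s L) - 1) / s: Cauchy's
  formula for e gives e 0 = L = ln y, and 1 / s^2 has a primitive. The other sides are at distance
  at least T from 0, as in the case of small y; T >= c bounds the horizontal ones by 2 T.\<close>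

lemma perron_log_large:
  assumes "y \<ge> 1" "c > 0" "T \<ge> c"
  shows "norm (integral {-T..T} (\<lambda>t. exp (Complex c t * of_real (ln y)) / (Complex c t)\<^sup>2) - 2 * pi * ln y) \<le> 6 * y powr c / T"
proof -
  define L where "L = ln y"
  define f where "f s = exp (s * of_real L) / s\<^sup>2" for s :: complex
  have T: "T > 0" using assms by simp
  let ?R = "rectpath (Complex (-T) (-T)) (Complex c T)"
  have img: "path_image ?R \<subseteq> UNIV - {0}"
    using assms T by (subst path_image_rectpath) auto
  have "0 \<in> box (Complex (-T) (-T)) (Complex c T)" using assms T by (simp add: in_box_complex_iff)
  then have wn: "winding_number ?R 0 = 1" by (rule winding_number_rectpath)
  define e where "e z = (if z = 0 then deriv (\<lambda>s. exp (s * of_real L)) 0 else (exp (z * of_real L) - exp (0 * of_real L)) / (z - 0))" for z :: complex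
  have "e holomorphic_on UNIV" unfolding e_def
    by (rule pole_lemma) (auto intro!: holomorphic_intros)
  then have "((\<lambda>w. e w / (w - 0)) has_contour_integral complex_of_real (2 * pi) * \<i> * winding_number ?R 0 * e 0) ?R"
    by (intro Cauchy_integral_formula_convex_simple[of UNIV]) (use img in auto)
  moreover have "deriv (\<lambda>s. exp (s * complex_of_real L)) 0 = of_real L"
    by (rule DERIV_imp_deriv) (auto intro!: derivative_eq_intros)
  ultimately have 1: "((\<lambda>w. e w / w) has_contour_integral complex_of_real (2 * pi) * \<i> * of_real L) ?R"
    by (simp add: wn e_def)
  have "((\<lambda>w. 1 / w\<^sup>2) has_contour_integral (- 1 / pathfinish ?R) - (- 1 / pathstart ?R)) ?R"
    by (rule contour_integral_primitive[of "UNIV - {0}"])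
       (use img in \<open>auto intro!: derivative_eq_intros simp: power2_eq_square\<close>)
  then have 2: "((\<lambda>w. 1 / w\<^sup>2) has_contour_integral 0) ?R" by simp
  have "(f has_contour_integral complex_of_real (2 * pi) * \<i> * of_real L + 0) ?R"
  proof (rule has_contour_integral_eq[OF has_contour_integral_add[OF 1 2]])
    fix z assume "z \<in> path_image ?R"
    then have "z \<noteq> 0" using img by auto
    then show "e z / z + 1 / z\<^sup>2 = f z" by (simp add: e_def f_def field_simps power2_eq_square)
  qed
  then have fint: "(f has_contour_integral complex_of_real (2 * pi) * \<i> * of_real L) ?R" by simp
  have bd: "norm (f s) \<le> y powr c / T\<^sup>2" if "Re s \<le> c" "norm s \<ge> T" for s
  proof -
    have "norm (exp (s * of_real L)) \<le> y powr c"
    proof -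
      have "Re s * ln y \<le> c * ln y" using that assms by (intro mult_right_mono) auto
      then show ?thesis using assms by (simp add: powr_def L_def)
    qed
    then show ?thesis unfolding f_def norm_divide norm_power
      using that assms T by (intro frac_le power_mono) auto
  qed
  have fc: "continuous_on (UNIV - {0}) f"
    unfolding f_def by (intro continuous_intros) auto
  have "norm (\<i> * (integral {-T..T} (\<lambda>t. f (Complex c t)) - integral {-T..T} (\<lambda>t. f (Complex (-T) t))) - complex_of_real (2 * pi) * \<i> * of_real L)
    \<le> 2 * (y powr c / T\<^sup>2) * (c - (-T))"
  proof (rule rectpath_integral_estimate[OF _ _ _ continuous_on_subset[OF fc img] _ fint])
    show "norm (f (Complex x T)) \<le> y powr c / T\<^sup>2 \<and> norm (f (Complex x (- T))) \<le> y powr c / T\<^sup>2"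
      if "-T \<le> x" "x \<le> c" for x
      using that assms T abs_Im_le_cmod[of "Complex x T"] abs_Im_le_cmod[of "Complex x (-T)"]
      by (auto intro!: bd)
  qed (use assms T in auto)
  also have "\<dots> \<le> 2 * (y powr c / T\<^sup>2) * (2 * T)"
    using assms T by (intro mult_left_mono) auto
  also have "\<i> * (integral {-T..T} (\<lambda>t. f (Complex c t)) - integral {-T..T} (\<lambda>t. f (Complex (-T) t))) - complex_of_real (2 * pi) * \<i> * of_real L
    = \<i> * ((integral {-T..T} (\<lambda>t. f (Complex c t)) - 2 * pi * L) - integral {-T..T} (\<lambda>t. f (Complex (-T) t)))"
    by (simp add: algebra_simps)
  finally have A: "norm ((integral {-T..T} (\<lambda>t. f (Complex c t)) - 2 * pi * L) - integral {-T..T} (\<lambda>t. f (Complex (-T) t))) \<le> 4 * (y powr c / T\<^sup>2) * T"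
    by (simp add: norm_mult)
  have "norm (integral {-T..T} (\<lambda>t. f (Complex (-T) t))) \<le> 2 * (y powr c / T\<^sup>2) * T"
  proof (rule norm_integral_le_const)
    show "continuous_on {- T..T} (\<lambda>t. f (Complex (-T) t))"
      by (rule continuous_on_compose2[OF fc])
         (use T in \<open>auto simp: Complex_eq complex_eq_iff intro!: continuous_intros\<close>)
    show "norm (f (Complex (-T) t)) \<le> y powr c / T\<^sup>2" if "t \<in> {-T..T}" for t
      using assms T abs_Re_le_cmod[of "Complex (-T) t"] by (intro bd) auto
  qed (use T in auto)
  moreover define u where "u = y powr c / T\<^sup>2 * T"
  ultimately have "norm (integral {-T..T} (\<lambda>t. f (Complex c t)) - 2 * pi * L) \<le> 6 * u"
    using A norm_triangle_ineq[of "(integral {-T..T} (\<lambda>t. f (Complex c t)) - 2 * pi * L) - integral {-T..T} (\<lambda>t. f (Complex (-T) t))" "integral {-T..T} (\<lambda>t. f (Complex (-T) t))"]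
    by simp
  then show ?thesis using T by (simp add: f_def L_def u_def power2_eq_square)
qed

text \<open>The kernel y^s / s^2 picks out ln y for y >= 1 and 0 for y <= 1. In contrast to y^s / s
  it converges absolutely, and the error does not blow up as y approaches 1.\<close>

lemma perron_log:
  assumes "y > 0" "c > 0" "T \<ge> c"
  shows "norm (integral {-T..T} (\<lambda>t. exp (Complex c t * of_real (ln y)) / (Complex c t)\<^sup>2) - 2 * pi * max 0 (ln y)) \<le> 6 * y powr c / T"
proof (cases "y \<le> 1")
  case True
  have "norm (integral {-T..T} (\<lambda>t. exp (Complex c t * of_real (ln y)) / (Complex c t)\<^sup>2)) \<le> 4 * y powr c / T"
    using perron_log_small[of y c T] True assms by simp
  also have "\<dots> \<le> 6 * y powr c / T" using assms by (intro divide_right_mono) auto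
  finally have "norm (integral {-T..T} (\<lambda>t. exp (Complex c t * of_real (ln y)) / (Complex c t)\<^sup>2)) \<le> 6 * y powr c / T" .
  moreover have "max 0 (ln y) = 0" using True assms by simp
  ultimately show ?thesis by simp
next
  case False
  then show ?thesis using perron_log_large[of y c T] assms by (simp add: max_def)
qed

text \<open>Multiplication by exp(\<epsilon> z^2) turns the growth condition into decay along the
  strip, so the maximum principle on a tall rectangle bounds the product; then \<epsilon> tends to
  0. The growth condition, for all \<epsilon>, is one that functions of order 1 and reciprocal Gamma
  factors satisfy.\<close>

lemma phragmen_lindelof_strip:
  assumes "a < b" and hol: "f holomorphic_on {z. a \<le> Re z \<and> Re z \<le> b}" and "B > 0"
    and side: "\<And>z. Re z = a \<or> Re z = b \<Longrightarrow> norm (f z) \<le> B"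
    and growth: "\<And>\<epsilon>. \<epsilon> > 0 \<Longrightarrow> \<exists>Y. \<forall>z. a \<le> Re z \<and> Re z \<le> b \<and> \<bar>Im z\<bar> \<ge> Y \<longrightarrow> norm (f z) \<le> exp (\<epsilon> * (Im z)\<^sup>2)"
    and z: "a \<le> Re z0" "Re z0 \<le> b"
  shows "norm (f z0) \<le> B"
proof -
  define M where "M = max \<bar>a\<bar> \<bar>b\<bar>"
  define K where "K = M\<^sup>2 + (Im z0)\<^sup>2"
  have ne: "norm (exp (of_real e * z\<^sup>2)) = exp (e * ((Re z)\<^sup>2 - (Im z)\<^sup>2))" for e z
    by (simp add: power2_eq_square)
  have reM: "(Re z)\<^sup>2 \<le> M\<^sup>2" if "a \<le> Re z" "Re z \<le> b" for z
    using that by (intro abs_le_square_iff[THEN iffD1]) (auto simp: M_def)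
  have main: "norm (f z0) \<le> B * exp (\<epsilon> * K)" if e: "\<epsilon> > 0" for \<epsilon>
  proof -
    define g where "g z = f z * exp (of_real \<epsilon> * z\<^sup>2)" for z
    obtain Y where Y: "\<And>z. a \<le> Re z \<Longrightarrow> Re z \<le> b \<Longrightarrow> \<bar>Im z\<bar> \<ge> Y \<Longrightarrow> norm (f z) \<le> exp (\<epsilon>/2 * (Im z)\<^sup>2)"
      using growth[of "\<epsilon>/2"] e by auto
    \<comment> \<open>The height of the rectangle: it contains z0, its horizontal sides lie where
      the growth bound holds, and there exp(-\<epsilon>/2 * Z^2) <= B.\<close>
    define Z where "Z = Max {Y, \<bar>Im z0\<bar> + 1, sqrt (2 / \<epsilon> * \<bar>ln B\<bar>)}"
    have Z: "Z \<ge> Y" "Z \<ge> \<bar>Im z0\<bar> + 1" "Z \<ge> sqrt (2 / \<epsilon> * \<bar>ln B\<bar>)" by (auto simp: Z_def)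
    have "2 / \<epsilon> * \<bar>ln B\<bar> \<le> Z\<^sup>2" using Z(3) Z(2) by (metis abs_ge_zero add_nonneg_nonneg order_trans real_sqrt_le_iff real_sqrt_unique zero_le_one real_sqrt_abs abs_of_nonneg)
    then have ZB: "exp (- (\<epsilon>/2 * Z\<^sup>2)) \<le> B"
    proof -
      assume "2 / \<epsilon> * \<bar>ln B\<bar> \<le> Z\<^sup>2"
      then have "\<bar>ln B\<bar> \<le> \<epsilon>/2 * Z\<^sup>2" using e by (simp add: field_simps)
      then have "- (\<epsilon>/2 * Z\<^sup>2) \<le> ln B" by linarith
      then show ?thesis using assms(3) by (metis exp_le_cancel_iff exp_ln)
    qed
    have "norm (g z0) \<le> B * exp (\<epsilon> * M\<^sup>2)"
    proof (rule maximum_modulus_frontier[of g "cbox (Complex a (-Z)) (Complex b Z)"])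
      show "g holomorphic_on interior (cbox (Complex a (-Z)) (Complex b Z))"
        unfolding g_def using interior_subset
        by (intro holomorphic_intros holomorphic_on_subset[OF hol]) (auto simp: interior_cbox in_box_complex_iff)
      show "continuous_on (closure (cbox (Complex a (-Z)) (Complex b Z))) g"
        unfolding g_def closure_closed[OF closed_cbox]
        by (intro continuous_intros continuous_on_subset[OF holomorphic_on_imp_continuous_on[OF hol]])
           (auto simp: in_cbox_complex_iff)
      show "bounded (cbox (Complex a (-Z)) (Complex b Z))" by (rule bounded_cbox)
      show "z0 \<in> cbox (Complex a (-Z)) (Complex b Z)"
        using z Z(2) by (auto simp: in_cbox_complex_iff)
      fix w assume "w \<in> frontier (cbox (Complex a (-Z)) (Complex b Z))"
      then have w1: "w \<in> cbox (Complex a (-Z)) (Complex b Z)" and w2: "w \<notin> box (Complex a (-Z)) (Complex b Z)"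
        by (auto simp: frontier_def interior_cbox)
      have wr: "a \<le> Re w" "Re w \<le> b" "\<bar>Im w\<bar> \<le> Z" using w1 by (auto simp: in_cbox_complex_iff)
      consider "Re w = a \<or> Re w = b" | "\<bar>Im w\<bar> = Z"
        using w2 wr by (auto simp: in_box_complex_iff)
      then show "norm (g w) \<le> B * exp (\<epsilon> * M\<^sup>2)"
      proof cases
        case 1
        have "(Re w)\<^sup>2 - (Im w)\<^sup>2 \<le> M\<^sup>2" using reM[OF wr(1,2)] by (smt (verit) zero_le_power2)
        then have "exp (\<epsilon> * ((Re w)\<^sup>2 - (Im w)\<^sup>2)) \<le> exp (\<epsilon> * M\<^sup>2)" using e by simp
        then show ?thesis unfolding g_def norm_mult ne
          using side[OF 1] assms(3) by (intro mult_mono) auto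
      next
        case 2
        then have im: "(Im w)\<^sup>2 = Z\<^sup>2" by (metis power2_abs)
        have "norm (g w) \<le> exp (\<epsilon>/2 * (Im w)\<^sup>2) * exp (\<epsilon> * ((Re w)\<^sup>2 - (Im w)\<^sup>2))"
          unfolding g_def norm_mult ne using Y[of w] wr 2 Z(1) by (intro mult_right_mono) auto
        also have "\<dots> = exp (- (\<epsilon>/2 * Z\<^sup>2)) * exp (\<epsilon> * (Re w)\<^sup>2)"
          unfolding im by (simp add: algebra_simps flip: exp_add)
        also have "\<dots> \<le> B * exp (\<epsilon> * M\<^sup>2)"
          using ZB reM[OF wr(1,2)] e assms(3) by (intro mult_mono) auto
        finally show ?thesis .
      qed
    qed
    then have "norm (f z0) * exp (\<epsilon> * ((Re z0)\<^sup>2 - (Im z0)\<^sup>2)) \<le> B * exp (\<epsilon> * M\<^sup>2)"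
      unfolding g_def norm_mult ne .
    then have "norm (f z0) * exp (\<epsilon> * ((Re z0)\<^sup>2 - (Im z0)\<^sup>2)) * exp (- (\<epsilon> * ((Re z0)\<^sup>2 - (Im z0)\<^sup>2)))
       \<le> B * exp (\<epsilon> * M\<^sup>2) * exp (- (\<epsilon> * ((Re z0)\<^sup>2 - (Im z0)\<^sup>2)))"
      by (rule mult_right_mono) simp
    then have "norm (f z0) \<le> B * (exp (\<epsilon> * M\<^sup>2) * exp (- (\<epsilon> * ((Re z0)\<^sup>2 - (Im z0)\<^sup>2))))"
      by (simp add: mult.assoc exp_minus_inverse)
    also have "exp (\<epsilon> * M\<^sup>2) * exp (- (\<epsilon> * ((Re z0)\<^sup>2 - (Im z0)\<^sup>2))) \<le> exp (\<epsilon> * K)"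
      using e by (simp add: K_def algebra_simps flip: exp_add)
    finally show ?thesis using assms(3) by simp
  qed
  have "((\<lambda>\<epsilon>. B * exp (\<epsilon> * K)) \<longlongrightarrow> B * exp (0 * K)) (at_right 0)"
    by (intro tendsto_intros)
  then have "norm (f z0) \<le> B * exp (0 * K)"
    by (rule tendsto_lowerbound)
       (use eventually_mono[OF eventually_at_right_less[of "0::real"] main] in auto)
  then show ?thesis by simp
qed

text \<open>The map g / (2 N - g) sends the half plane Re g < N into the unit disc and 0 to 0, so
  Schwarz's lemma applies to h; solving for g gives the bound. Here N = M + |f z0| bounds the real
  part of f - f z0.\<close>

lemma borel_caratheodory:
  assumes hol: "f holomorphic_on ball z0 R" and "0 < r" "r < R"
    and Re: "\<And>z. z \<in> ball z0 R \<Longrightarrow> Re (f z) < M" and "M > 0"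
    and z: "norm (z - z0) \<le> r"
  shows "norm (f z) \<le> norm (f z0) + 2 * r / (R - r) * (M + norm (f z0))"
proof -
  define N where "N = M + norm (f z0)"
  have N: "N > 0" using assms by (simp add: N_def add_pos_nonneg)
  define g where "g w = f (z0 + of_real R * w) - f z0" for w
  define h where "h w = g w / (2 * of_real N - g w)" for w
  have R: "R > 0" using assms by simp
  have inb: "z0 + of_real R * w \<in> ball z0 R" if "norm w < 1" for w
    using that R by (simp add: dist_norm norm_mult)
  have gN: "Re (g w) < N" if "norm w < 1" for w
    using Re[OF inb[OF that]] abs_Re_le_cmod[of "f z0"] by (simp add: g_def N_def)
  have holg: "g holomorphic_on ball 0 1"
  proof -
    have "(f \<circ> (\<lambda>w. z0 + of_real R * w)) holomorphic_on ball 0 1"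
      by (rule holomorphic_on_compose_gen[OF _ hol]) (use inb in \<open>auto intro!: holomorphic_intros\<close>)
    then show ?thesis unfolding g_def by (auto intro!: holomorphic_intros simp: o_def)
  qed
  have nz: "2 * of_real N - g w \<noteq> 0" if "norm w < 1" for w
  proof
    assume "2 * of_real N - g w = 0"
    then have "g w = of_real (2 * N)" by simp
    then have "Re (g w) = 2 * N" by simp
    then show False using gN[OF that] N by simp
  qed
  have holh: "h holomorphic_on ball 0 1"
    unfolding h_def using holg nz by (auto intro!: holomorphic_intros)
  have hlt: "norm (h w) < 1" if "norm w < 1" for w
  proof -
    have "(norm (g w))\<^sup>2 < (norm (2 * of_real N - g w))\<^sup>2"
      using mult_strict_left_mono[OF gN[OF that] N]
      unfolding cmod_power2 by (simp add: power2_eq_square algebra_simps)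
    then have "norm (g w) < norm (2 * of_real N - g w)" by (simp add: power2_less_imp_less)
    then show ?thesis using nz[OF that] by (simp add: h_def norm_divide)
  qed
  define w where "w = (z - z0) / of_real R"
  have w: "norm w \<le> r / R" using z R by (simp add: w_def norm_divide divide_right_mono)
  also have "\<dots> < 1" using assms by simp
  finally have w1: "norm w < 1" .
  have "norm (h w) \<le> norm w"
    by (rule Schwarz_Lemma(1)[OF holh _ _ w1]) (use hlt in \<open>auto simp: h_def g_def\<close>)
  then have hw: "norm (h w) \<le> r / R" using w by simp
  have gw: "g w = f z - f z0" using R by (simp add: g_def w_def)
  have "g w = h w * (2 * of_real N - g w)" using nz[OF w1] by (simp add: h_def)
  from arg_cong[OF this, of norm] have "norm (g w) = norm (h w) * norm (2 * of_real N - g w)"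
    by (simp only: norm_mult)
  also have "\<dots> \<le> norm (h w) * (2 * N + norm (g w))"
    using norm_triangle_ineq4[of "2 * of_real N" "g w"] N
    by (intro mult_left_mono) (auto simp: norm_mult)
  also have "norm (h w) * (2 * N + norm (g w)) \<le> r / R * (2 * N + norm (g w))" using hw N by (intro mult_right_mono) auto
  finally have "R * norm (g w) \<le> r * (2 * N + norm (g w))" using R by (simp add: field_simps)
  then have "norm (g w) * (R - r) \<le> 2 * r * N" by (simp add: algebra_simps)
  then have "norm (g w) \<le> 2 * r / (R - r) * N" using assms(3) by (simp add: pos_le_divide_eq)
  moreover have "norm (f z) \<le> norm (f z0) + norm (g w)" unfolding gw by (metis norm_triangle_sub)
  ultimately show ?thesis by (simp add: N_def)
qed

section \<open>Bounds for Gamma and its reciprocal in vertical strips\<close>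

lemma norm_Gamma_le:
  assumes "Re z > 0"
  shows "norm (Gamma z) \<le> Gamma (Re z)"
proof -
  have 1: "((\<lambda>t. complex_of_real t powr (z - 1) / complex_of_real (exp t)) has_integral Gamma z) {0..}"
    using Gamma_integral_complex[OF assms] .
  have 2: "((\<lambda>t. t powr (Re z - 1) / exp t) has_integral Gamma (Re z)) {0..}"
    using Gamma_integral_real[OF assms] .
  have "norm (integral {0..} (\<lambda>t. complex_of_real t powr (z - 1) / complex_of_real (exp t)))
     \<le> integral {0..} (\<lambda>t. t powr (Re z - 1) / exp t)"
  proof (rule integral_norm_bound_integral)
    fix t :: real assume "t \<in> {0..}"
    then show "norm (complex_of_real t powr (z - 1) / complex_of_real (exp t)) \<le> t powr (Re z - 1) / exp t"
      by (cases "t = 0") (auto simp: norm_divide norm_powr_real_powr)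
  qed (use 1 2 in auto)
  then show ?thesis using integral_unique[OF 1] integral_unique[OF 2] by simp
qed

lemma Gamma_bounded_strip:
  assumes "0 < a"
  shows "\<exists>C. \<forall>z. a \<le> Re z \<longrightarrow> Re z \<le> b \<longrightarrow> norm (Gamma z) \<le> C"
proof -
  have "continuous_on {a..b} (Gamma :: real \<Rightarrow> real)"
    by (rule continuous_on_Gamma) (use assms in \<open>auto elim!: nonpos_Ints_cases\<close>)
  then have "bounded (Gamma ` {a..b} :: real set)"
    by (intro compact_imp_bounded compact_continuous_image) auto
  then obtain C where "\<forall>y\<in>Gamma ` {a..b}. norm (y :: real) \<le> C"
    unfolding bounded_iff by blast
  then have C: "norm (Gamma x :: real) \<le> C" if "x \<in> {a..b}" for x using that by blast
  have "norm (Gamma z) \<le> C" if "a \<le> Re z" "Re z \<le> b" for z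
  proof -
    have "norm (Gamma z) \<le> Gamma (Re z)" using norm_Gamma_le[of z] that assms by simp
    also have "\<dots> \<le> norm (Gamma (Re z))" by simp
    also have "\<dots> \<le> C" using that by (intro C) auto
    finally show ?thesis .
  qed
  then show ?thesis by blast
qed

lemma norm_sin_le: "norm (sin (z :: complex)) \<le> exp \<bar>Im z\<bar>"
proof -
  have "norm (exp (\<i> * z) - exp (- (\<i> * z))) \<le> norm (exp (\<i> * z)) + norm (exp (- (\<i> * z)))"
    by (rule norm_triangle_ineq4)
  also have "\<dots> = exp (- Im z) + exp (Im z)" by simp
  also have "\<dots> \<le> 2 * exp \<bar>Im z\<bar>"
    by (cases "Im z \<ge> 0") auto
  finally show ?thesis by (simp add: sin_exp_eq' norm_divide norm_mult norm_minus_commute)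
qed

text \<open>For Re z <= 1/2 the reflection formula expresses rGamma z by a sine times Gamma (1 - z),
  which is bounded there. Beyond that, rGamma z = rGamma (z - 1) / (z - 1) with |z - 1| >= 1 carries
  the bound to the right one unit at a time. The part |Im z| < 1 lies in a compact
  rectangle.\<close>

lemma rGamma_growth:
  "\<exists>C>0. \<forall>z::complex. \<bar>Re z\<bar> \<le> K \<longrightarrow> norm (rGamma z) \<le> C * exp (pi * \<bar>Im z\<bar>)"
proof -
  define L where "L = max K 1"
  have L: "L \<ge> 1" "L \<ge> K" by (auto simp: L_def)
  have "compact (cbox (Complex (-L) (-1)) (Complex L 1))" by (rule compact_cbox)
  then have "bounded (rGamma ` cbox (Complex (-L) (-1)) (Complex L 1))"
    by (intro compact_imp_bounded compact_continuous_image continuous_on_rGamma)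
  then obtain C0 where C0: "\<And>z. z \<in> cbox (Complex (-L) (-1)) (Complex L 1) \<Longrightarrow> norm (rGamma z) \<le> C0"
    by (auto simp: bounded_iff)
  obtain C1 where C1: "\<And>z::complex. 1/2 \<le> Re z \<Longrightarrow> Re z \<le> 1 + L \<Longrightarrow> norm (Gamma z) \<le> C1"
    using Gamma_bounded_strip[of "1/2" "1 + L"] by auto
  define C where "C = Max {1, C0, C1}"
  have C: "C \<ge> 1" "C \<ge> C1" "C \<ge> C0" by (auto simp: C_def)
  have step: "norm (rGamma z) \<le> C * exp (pi * \<bar>Im z\<bar>)"
    if "-L \<le> Re z" "Re z \<le> 1/2 + real n" "\<bar>Im z\<bar> \<ge> 1" for n and z :: complex
    using that
  proof (induction n arbitrary: z)
    case 0
    have "1 - z \<notin> \<int>\<^sub>\<le>\<^sub>0"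
    proof
      assume "1 - z \<in> \<int>\<^sub>\<le>\<^sub>0"
      then obtain n where n: "1 - z = of_int n" "n \<le> 0" by (auto elim!: nonpos_Ints_cases)
      from arg_cong[OF n(1), of Re] n(2) have "Re (1 - z) \<le> 0" by simp
      then show False using 0 by simp
    qed
    then have "rGamma (1 - z) * Gamma (1 - z) = 1"
      by (simp add: rGamma_inverse_Gamma Gamma_eq_zero_iff)
    then have "rGamma z = (rGamma z * rGamma (1 - z)) * Gamma (1 - z)" by (simp only: mult.assoc mult.right_neutral)
    then have "rGamma z = sin (of_real pi * z) / of_real pi * Gamma (1 - z)"
      by (simp only: rGamma_reflection_complex)
    then have "norm (rGamma z) = norm (sin (of_real pi * z)) / pi * norm (Gamma (1 - z))"
      by (simp add: norm_mult norm_divide)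
    also have "\<dots> \<le> exp \<bar>Im (of_real pi * z)\<bar> / 1 * C"
      using 0 C C1[of "1 - z"] pi_gt3 by (intro mult_mono frac_le norm_sin_le) auto
    finally show ?case by (simp add: abs_mult mult_ac)
  next
    case (Suc n)
    show ?case
    proof (cases "Re z \<le> 1/2")
      case True
      then show ?thesis using Suc.IH[of z] Suc.prems by simp
    next
      case False
      have "(z - 1) * rGamma z = rGamma (z - 1)" using rGamma_plus1[of "z - 1"] by simp
      then have "norm (z - 1) * norm (rGamma z) = norm (rGamma (z - 1))" by (metis norm_mult)
      moreover have "norm (z - 1) \<ge> 1" using abs_Im_le_cmod[of "z - 1"] Suc.prems by simp
      ultimately have "norm (rGamma z) \<le> norm (rGamma (z - 1))"
        by (metis mult_right_mono norm_ge_zero mult_1)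
      also have "\<dots> \<le> C * exp (pi * \<bar>Im (z - 1)\<bar>)"
        using False Suc.prems L by (intro Suc.IH) auto
      finally show ?thesis by simp
    qed
  qed
  have "norm (rGamma z) \<le> C * exp (pi * \<bar>Im z\<bar>)" if z: "\<bar>Re z\<bar> \<le> K" for z :: complex
  proof (cases "\<bar>Im z\<bar> \<ge> 1")
    case True
    have "Re z \<le> 1/2 + real (nat \<lceil>L\<rceil>)" using z L by linarith
    then show ?thesis using step[of z "nat \<lceil>L\<rceil>"] True z L by simp
  next
    case False
    then have "norm (rGamma z) \<le> C0" using z L by (intro C0) (auto simp: in_cbox_complex_iff)
    also have "\<dots> \<le> C * 1" using C by simp
    also have "\<dots> \<le> C * exp (pi * \<bar>Im z\<bar>)" using C by (intro mult_left_mono) auto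
    finally show ?thesis .
  qed
  then show ?thesis using C(1) by (intro exI[of _ C]) auto
qed

section \<open>The twisted L-functions\<close>

text \<open>The reciprocal of \<open>Gamma_R\<close> as an entire function; it is 0 at the poles,
  where \<open>Gamma_R\<close> itself has the default value 0.\<close>

definition rGamma_R :: "complex \<Rightarrow> complex" where
  "rGamma_R s = of_real pi powr (s / 2) * rGamma (s / 2)"

lemma Gamma_R_mult_rGamma_R:
  assumes "Re s > 0"
  shows "Gamma_R s * rGamma_R s = 1"
proof -
  have "s / 2 \<notin> \<int>\<^sub>\<le>\<^sub>0"
  proof
    assume "s / 2 \<in> \<int>\<^sub>\<le>\<^sub>0"
    then obtain n where n: "s / 2 = of_int n" "n \<le> 0" by (auto elim!: nonpos_Ints_cases)
    from arg_cong[OF n(1), of Re] n(2) assms show False by simp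
  qed
  then have "Gamma (s / 2) * rGamma (s / 2) = 1"
    by (simp add: rGamma_inverse_Gamma Gamma_eq_zero_iff)
  moreover have "of_real pi powr (- s / 2) * of_real pi powr (s / 2) = (1 :: complex)"
    by (simp flip: powr_add)
  moreover have "(a * b) * (c * d) = (a * c) * (b * d)" for a b c d :: complex by simp
  ultimately show ?thesis unfolding Gamma_R_def rGamma_R_def by (metis mult_1)
qed

lemma holomorphic_rGamma_R [holomorphic_intros]:
  "f holomorphic_on A \<Longrightarrow> (\<lambda>z. rGamma_R (f z)) holomorphic_on A"
  unfolding rGamma_R_def by (auto intro!: holomorphic_intros)

lemma cnj_Gamma_R: "cnj (Gamma_R s) = Gamma_R (cnj s)"
  unfolding Gamma_R_def by (simp add: cnj_powr cnj_Gamma)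

text \<open>The identity theorem on the half plane Re s > 1 makes the chosen extension the only
  one.\<close>

lemma entire_extension_eq:
  assumes "is_entire_extension f g"
  shows "entire_extension f = g"
proof -
  have "is_entire_extension f (entire_extension f)"
    unfolding entire_extension_def by (rule someI[of _ g]) (rule assms)
  then have e: "entire_extension f holomorphic_on UNIV" "\<And>s. Re s > 1 \<Longrightarrow> entire_extension f s = f s"
    by (auto simp: is_entire_extension_def)
  have g: "g holomorphic_on UNIV" "\<And>s. Re s > 1 \<Longrightarrow> g s = f s"
    using assms by (auto simp: is_entire_extension_def)
  have ne: "{s. Re s > 1} \<noteq> {}" by (auto intro: exI[of _ 2])
  have "entire_extension f z = g z" for z
    by (rule analytic_continuation_open[OF open_halfspace_Re_gt[of 1] open_UNIV ne connected_UNIV _ e(1) g(1)])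
       (use e(2) g(2) in auto)
  then show ?thesis by blast
qed

text \<open>The growth allowed by \<open>phragmen_lindelof_strip\<close>. It is stable under finite
  products, since \<epsilon> can be split, and it includes every bound of the form C exp(c |Im
  z|).\<close>

definition strip_subgaussian :: "real \<Rightarrow> real \<Rightarrow> (complex \<Rightarrow> complex) \<Rightarrow> bool" where
  "strip_subgaussian a b f \<longleftrightarrow> (\<forall>\<epsilon>>0. \<exists>Y. \<forall>z. a \<le> Re z \<and> Re z \<le> b \<and> \<bar>Im z\<bar> \<ge> Y \<longrightarrow> norm (f z) \<le> exp (\<epsilon> * (Im z)\<^sup>2))"

lemma strip_subgaussian_mult:
  assumes "strip_subgaussian a b f" "strip_subgaussian a b g"
  shows "strip_subgaussian a b (\<lambda>z. f z * g z)"
  unfolding strip_subgaussian_def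
proof (intro allI impI)
  fix \<epsilon> :: real assume e: "\<epsilon> > 0"
  then have e2: "\<epsilon> / 2 > 0" by simp
  obtain Y where Y: "\<And>z. a \<le> Re z \<and> Re z \<le> b \<and> \<bar>Im z\<bar> \<ge> Y \<Longrightarrow> norm (f z) \<le> exp (\<epsilon>/2 * (Im z)\<^sup>2)"
    using assms(1) e2 unfolding strip_subgaussian_def by blast
  obtain Z where Z: "\<And>z. a \<le> Re z \<and> Re z \<le> b \<and> \<bar>Im z\<bar> \<ge> Z \<Longrightarrow> norm (g z) \<le> exp (\<epsilon>/2 * (Im z)\<^sup>2)"
    using assms(2) e2 unfolding strip_subgaussian_def by blast
  have "norm (f z * g z) \<le> exp (\<epsilon> * (Im z)\<^sup>2)" if "a \<le> Re z \<and> Re z \<le> b \<and> \<bar>Im z\<bar> \<ge> max Y Z" for z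
  proof -
    have "norm (f z) * norm (g z) \<le> exp (\<epsilon>/2 * (Im z)\<^sup>2) * exp (\<epsilon>/2 * (Im z)\<^sup>2)"
      using that by (intro mult_mono Y Z) auto
    also have "\<dots> = exp (\<epsilon> * (Im z)\<^sup>2)" by (simp flip: exp_add)
    finally show ?thesis by (simp add: norm_mult)
  qed
  then show "\<exists>Y. \<forall>z. a \<le> Re z \<and> Re z \<le> b \<and> \<bar>Im z\<bar> \<ge> Y \<longrightarrow> norm (f z * g z) \<le> exp (\<epsilon> * (Im z)\<^sup>2)" by blast
qed

lemma strip_subgaussian_exp_bound:
  assumes "\<And>z. a \<le> Re z \<Longrightarrow> Re z \<le> b \<Longrightarrow> norm (f z) \<le> C * exp (c * \<bar>Im z\<bar>)"
  shows "strip_subgaussian a b f"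
  unfolding strip_subgaussian_def
proof (intro allI impI)
  fix \<epsilon> :: real assume e: "\<epsilon> > 0"
  define C' where "C' = max 1 C"
  have "eventually (\<lambda>y::real. ln C' + c * y \<le> \<epsilon> * y\<^sup>2) at_top" using e by real_asymp
  then obtain Y where Y: "\<And>y. y \<ge> Y \<Longrightarrow> ln C' + c * y \<le> \<epsilon> * y\<^sup>2"
    by (auto simp: eventually_at_top_linorder)
  have "norm (f z) \<le> exp (\<epsilon> * (Im z)\<^sup>2)" if z: "a \<le> Re z \<and> Re z \<le> b \<and> \<bar>Im z\<bar> \<ge> Y" for z
  proof -
    have "norm (f z) \<le> C * exp (c * \<bar>Im z\<bar>)" using assms z by auto
    also have "\<dots> \<le> C' * exp (c * \<bar>Im z\<bar>)" by (intro mult_right_mono) (auto simp: C'_def)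
    also have "\<dots> = exp (ln C' + c * \<bar>Im z\<bar>)" by (simp add: exp_add C'_def)
    also have "\<dots> \<le> exp (\<epsilon> * (Im z)\<^sup>2)" using Y[of "\<bar>Im z\<bar>"] z by simp
    finally show ?thesis .
  qed
  then show "\<exists>Y. \<forall>z. a \<le> Re z \<and> Re z \<le> b \<and> \<bar>Im z\<bar> \<ge> Y \<longrightarrow> norm (f z) \<le> exp (\<epsilon> * (Im z)\<^sup>2)" by blast
qed

lemma strip_subgaussian_prod:
  assumes "finite A" "\<And>j. j \<in> A \<Longrightarrow> strip_subgaussian a b (f j)"
  shows "strip_subgaussian a b (\<lambda>z. \<Prod>j\<in>A. f j z)"
  using assms
proof (induction A rule: finite_induct)
  case empty
  show ?case by (rule strip_subgaussian_exp_bound[of _ _ _ 1 0]) auto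
next
  case (insert x A)
  then show ?case using strip_subgaussian_mult[of a b "f x" "\<lambda>z. \<Prod>j\<in>A. f j z"] by simp
qed

text \<open>Order 1 yields a growth exponent \<rho> < 3/2, and |Im z|^(3/2) is negligible against
  \<epsilon> (Im z)^2 in a strip.\<close>

lemma strip_subgaussian_order_1:
  assumes "entire_order f = 1"
  shows "strip_subgaussian a b f"
  unfolding strip_subgaussian_def
proof (intro allI impI)
  fix \<epsilon> :: real assume e: "\<epsilon> > 0"
  have "Inf {ereal \<rho> | \<rho>. \<rho> \<ge> 0 \<and> (\<lambda>s. norm (f s)) \<in> O[at_infinity](\<lambda>s. exp (norm s powr \<rho>))} < ereal (3/2)"
    using assms unfolding entire_order_def by simp
  then obtain \<rho> where \<rho>: "0 \<le> \<rho>" "\<rho> < 3/2" "(\<lambda>s. norm (f s)) \<in> O[at_infinity](\<lambda>s. exp (norm s powr \<rho>))"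
    unfolding Inf_less_iff by auto
  obtain c where c: "c > 0" "eventually (\<lambda>s. norm (norm (f s)) \<le> c * norm (exp (norm s powr \<rho>))) at_infinity"
    using landau_o.bigE[OF \<rho>(3)] by blast
  then obtain R where R: "\<And>s. norm s \<ge> R \<Longrightarrow> norm (f s) \<le> c * exp (norm s powr \<rho>)"
    by (auto simp: eventually_at_infinity)
  define K where "K = max \<bar>a\<bar> \<bar>b\<bar>"
  have "eventually (\<lambda>y::real. ln c + (y + K) powr (3/2) \<le> \<epsilon> * y\<^sup>2) at_top" using e by real_asymp
  then obtain Y where Y: "\<And>y. y \<ge> Y \<Longrightarrow> ln c + (y + K) powr (3/2) \<le> \<epsilon> * y\<^sup>2"
    by (auto simp: eventually_at_top_linorder)
  have "norm (f z) \<le> exp (\<epsilon> * (Im z)\<^sup>2)" if z: "a \<le> Re z \<and> Re z \<le> b \<and> \<bar>Im z\<bar> \<ge> Max {Y, R, 1}" for z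
  proof -
    have y: "\<bar>Im z\<bar> \<ge> Y" "\<bar>Im z\<bar> \<ge> R" "\<bar>Im z\<bar> \<ge> 1" using z by auto
    have n: "norm z \<ge> \<bar>Im z\<bar>" by (rule abs_Im_le_cmod)
    have "norm z \<le> \<bar>Re z\<bar> + \<bar>Im z\<bar>" by (rule cmod_le)
    also have "\<bar>Re z\<bar> \<le> K" using z by (auto simp: K_def)
    finally have n': "norm z \<le> \<bar>Im z\<bar> + K" by simp
    have "norm (f z) \<le> c * exp (norm z powr \<rho>)" using n y by (intro R) simp
    also have "norm z powr \<rho> \<le> norm z powr (3/2)" using n y \<rho> by (intro powr_mono) auto
    also have "norm z powr (3/2) \<le> (\<bar>Im z\<bar> + K) powr (3/2)" using n' by (intro powr_mono2) auto
    finally have "norm (f z) \<le> c * exp ((\<bar>Im z\<bar> + K) powr (3/2))" using c(1) by simp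
    also have "\<dots> = exp (ln c + (\<bar>Im z\<bar> + K) powr (3/2))" using c(1) by (simp add: exp_add)
    also have "\<dots> \<le> exp (\<epsilon> * (Im z)\<^sup>2)" using Y[OF y(1)] by simp
    finally show ?thesis .
  qed
  then show "\<exists>Y. \<forall>z. a \<le> Re z \<and> Re z \<le> b \<and> \<bar>Im z\<bar> \<ge> Y \<longrightarrow> norm (f z) \<le> exp (\<epsilon> * (Im z)\<^sup>2)" by blast
qed

lemma norm_of_nat_powr: "n \<ge> 1 \<Longrightarrow> norm (of_nat n powr s :: complex) = real n powr Re s"
  using norm_powr_real_powr[of "of_nat n" s] by simp

section \<open>Continuation and functional equation of the twists\<close>

locale lfun =
  fixes F :: lform
  assumes framework: "L_framework F"
begin

abbreviation "d \<equiv> lf_degree F"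
abbreviation "lam \<equiv> lf_coeff F"

lemma mu_Re:
  assumes "q \<ge> 2" "primitive_char q ch" "j < d"
  shows "Re (lf_mu F (ch (-1)) j) > -1"
proof -
  obtain \<theta> where t: "1 / (2 * real d) < \<theta>" "Re (lf_mu F (ch (-1)) j) \<ge> - 1 + \<theta>"
    using framework assms unfolding L_framework_def by blast
  have "0 \<le> 1 / (2 * real d)" by simp
  then show ?thesis using t by linarith
qed

lemma cond_pos: "q \<ge> 2 \<Longrightarrow> lf_cond F q \<ge> 1"
  using framework unfolding L_framework_def by blast

text \<open>The framework bounds the conductor for large q only. As the conductor depends on q and
  not on the character, those of the finitely many smaller moduli can be added to the
  constant.\<close>

lemma cond_bound:
  "\<exists>C\<ge>1. \<forall>q ch. q \<ge> 2 \<longrightarrow> primitive_char q ch \<longrightarrow> real (lf_cond F q) \<le> C * real q ^ d"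
proof -
  obtain C q1 where C: "\<And>q ch. q \<ge> q1 \<Longrightarrow> q \<ge> 2 \<Longrightarrow> primitive_char q ch \<Longrightarrow> real (lf_cond F q) \<le> C * real q ^ d"
    using framework unfolding L_framework_def by blast
  define C' where "C' = 1 + \<bar>C\<bar> + (\<Sum>q<q1. real (lf_cond F q))"
  have s: "(\<Sum>q<q1. real (lf_cond F q)) \<ge> 0" by (intro sum_nonneg) auto
  have "real (lf_cond F q) \<le> C' * real q ^ d" if q: "q \<ge> 2" "primitive_char q ch" for q ch
  proof (cases "q < q1")
    case True
    then have "real (lf_cond F q) \<le> (\<Sum>q<q1. real (lf_cond F q))"
      by (intro member_le_sum) auto
    also have "\<dots> \<le> C' * 1" by (simp add: C'_def)
    also have "\<dots> \<le> C' * real q ^ d" using q s by (intro mult_left_mono) (auto simp: C'_def)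
    finally show ?thesis .
  next
    case False
    then have "real (lf_cond F q) \<le> C * real q ^ d" using C[of q ch] q by simp
    also have "\<dots> \<le> C' * real q ^ d" using s by (intro mult_right_mono) (auto simp: C'_def)
    finally show ?thesis .
  qed
  then show ?thesis using s by (intro exI[of _ C']) (auto simp: C'_def)
qed

lemma summable_lam:
  assumes "\<sigma> > 1"
  shows "(\<lambda>n. norm (lam n) * real n powr - \<sigma>) summable_on {1..}"
proof -
  have "(\<lambda>n. norm (L_term F (\<lambda>_. 1) (of_real \<sigma>) n)) summable_on {1..}"
    using framework assms unfolding L_framework_def euler_product_converges_def by simp
  also have "?this \<longleftrightarrow> ?thesis"
    by (intro summable_on_cong)
       (simp add: L_term_def norm_divide norm_of_nat_powr powr_minus field_simps)
  finally show ?thesis .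
qed

lemma norm_L_term_le:
  assumes "n \<ge> 1" "norm (ch (int n)) \<le> 1"
  shows "norm (L_term F ch s n) \<le> norm (lam n) * real n powr - Re s"
proof -
  have "norm (L_term F ch s n) = norm (lam n) * real n powr - Re s * norm (ch (int n))"
    using assms(1) by (simp add: L_term_def norm_divide norm_mult norm_of_nat_powr powr_minus field_simps)
  also have "\<dots> \<le> norm (lam n) * real n powr - Re s * 1"
    using assms(2) by (intro mult_left_mono) auto
  finally show ?thesis by simp
qed

definition rL_infinity :: "nat \<Rightarrow> (int \<Rightarrow> complex) \<Rightarrow> complex \<Rightarrow> complex" where
  "rL_infinity q ch s = of_nat (lf_cond F q) powr (- s / 2) * (\<Prod>j<d. rGamma_R (s + lf_mu F (ch (-1)) j))"

text \<open>Apart from the power of the conductor, this is the quotient of the gamma factors of the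
  dual form at 1/2 + s and those of F at 1/2 - s. In the powers of \<pi> the shifts survive as
  phases only.\<close>

definition gamma_factor :: "(int \<Rightarrow> complex) \<Rightarrow> complex \<Rightarrow> complex" where
  "gamma_factor ch s = (\<Prod>j<d. of_real pi powr (- s + \<i> * Im (lf_mu F (ch (-1)) j))
      * Gamma ((1/2 + s + cnj (lf_mu F (ch (-1)) j)) / 2) * rGamma ((1/2 - s + lf_mu F (ch (-1)) j) / 2))"

context
  fixes q ch
  assumes q: "q \<ge> 2" and prim: "primitive_char q ch"
begin

lemma twist_framework: "euler_product_converges F ch" "\<exists>g. is_entire_extension (completed_product F q ch) g"
  "entire_order (Lambda_twist F q ch) = 1"
  "\<exists>\<kappa>. norm \<kappa> = 1 \<and> (\<forall>s. Lambda_twist F q ch s = \<kappa> * Lambda_twist (dual_form F) q (conj_char ch) (1 - s))"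
  using framework q prim unfolding L_framework_def by blast+

lemma Lambda_twist_entire: "Lambda_twist F q ch holomorphic_on UNIV"
  and Lambda_twist_eq: "Re s > 1 \<Longrightarrow> Lambda_twist F q ch s = completed_product F q ch s"
proof -
  obtain g where g: "is_entire_extension (completed_product F q ch) g" using twist_framework(2) by blast
  then have "Lambda_twist F q ch = g" unfolding Lambda_twist_def by (rule entire_extension_eq)
  then show "Lambda_twist F q ch holomorphic_on UNIV"
    "Re s > 1 \<Longrightarrow> Lambda_twist F q ch s = completed_product F q ch s"
    using g by (auto simp: is_entire_extension_def)
qed

lemma rL_infinity_entire: "rL_infinity q ch holomorphic_on A"
  unfolding rL_infinity_def using cond_pos[OF q] by (auto intro!: holomorphic_intros)

lemma L_infinity_inverse:
  assumes "Re s \<ge> 1"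
  shows "L_infinity F q ch s * rL_infinity q ch s = 1"
proof -
  have "(\<Prod>j<d. Gamma_R (s + lf_mu F (ch (-1)) j)) * (\<Prod>j<d. rGamma_R (s + lf_mu F (ch (-1)) j)) = 1"
    unfolding prod.distrib[symmetric]
    by (intro prod.neutral ballI Gamma_R_mult_rGamma_R) (use mu_Re[OF q prim] assms in force)
  moreover have "of_nat (lf_cond F q) powr (s / 2) * of_nat (lf_cond F q) powr (- s / 2) = (1 :: complex)"
    using cond_pos[OF q] by (simp flip: powr_add)
  moreover have "(a * b) * (c * e) = (a * c) * (b * e)" for a b c e :: complex by simp
  ultimately show ?thesis unfolding L_infinity_def rL_infinity_def by (metis mult_1)
qed

text \<open>The framework continues the completed function; the L-function inherits this because the
  reciprocal \<open>rL_infinity\<close> of the gamma factors is entire.\<close>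

lemma L_twist_eq_Lambda: "L_twist F ch = (\<lambda>s. Lambda_twist F q ch s * rL_infinity q ch s)"
proof -
  have "is_entire_extension (L_series F ch) (\<lambda>s. Lambda_twist F q ch s * rL_infinity q ch s)"
    unfolding is_entire_extension_def
  proof (intro conjI allI impI)
    show "(\<lambda>s. Lambda_twist F q ch s * rL_infinity q ch s) holomorphic_on UNIV"
      by (intro holomorphic_intros Lambda_twist_entire rL_infinity_entire)
    fix s :: complex assume s: "Re s > 1"
    show "Lambda_twist F q ch s * rL_infinity q ch s = L_series F ch s"
      using Lambda_twist_eq[OF s] L_infinity_inverse[of s] s
      by (simp add: completed_product_def mult.assoc)
  qed
  then show ?thesis unfolding L_twist_def by (rule entire_extension_eq)
qed

lemma L_twist_entire: "L_twist F ch holomorphic_on A"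
proof -
  have "L_twist F ch holomorphic_on UNIV"
    unfolding L_twist_eq_Lambda by (intro holomorphic_intros Lambda_twist_entire rL_infinity_entire)
  then show ?thesis by (rule holomorphic_on_subset) simp
qed

lemma L_twist_eq_series:
  assumes "Re s > 1"
  shows "L_twist F ch s = L_series F ch s"
  using Lambda_twist_eq[OF assms] L_infinity_inverse[of s] assms
  by (simp add: L_twist_eq_Lambda completed_product_def mult.assoc)

lemma ch_props: "dirichlet_char q ch" using prim by (simp add: primitive_char_def)

lemma ch_sign: "ch (-1) = 1 \<or> ch (-1) = -1"
proof -
  have "ch (-1) * ch (-1) = 1"
    using dirichlet_char_mult[OF ch_props, of "-1" "-1"] dirichlet_char_1[OF ch_props] by simp
  then show ?thesis by (metis power2_eq_1_iff power2_eq_square)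
qed

text \<open>The reflection of \<open>Lambda_twist F q ch\<close> by complex conjugation in argument
  and value is entire and agrees with the completed product of the dual form for Re s > 1, so it is
  the continuation of that product. The gamma shifts match because \<open>ch (-1)\<close> is real
  and therefore the same for \<open>conj_char ch\<close>.\<close>

lemma Lambda_twist_dual:
  assumes "Re s > 1"
  shows "Lambda_twist (dual_form F) q (conj_char ch) s = cnj (completed_product F q ch (cnj s))"
proof -
  have eq: "completed_product (dual_form F) q (conj_char ch) s = cnj (completed_product F q ch (cnj s))"
    if "Re s > 1" for s
  proof -
    have "L_term (dual_form F) (conj_char ch) s n = cnj (L_term F ch (cnj s) n)" for n
      by (simp add: L_term_def dual_form_def conj_char_def cnj_powr)
    then have "L_series (dual_form F) (conj_char ch) s = cnj (L_series F ch (cnj s))"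
      by (simp add: L_series_def)
    moreover have "L_infinity (dual_form F) q (conj_char ch) s = cnj (L_infinity F q ch (cnj s))"
    proof -
      have "cnj (ch (-1)) = ch (-1)" using ch_sign by auto
      then show ?thesis
        by (simp add: L_infinity_def dual_form_def conj_char_def cnj_Gamma_R cnj_powr)
    qed
    ultimately show ?thesis by (simp add: completed_product_def)
  qed
  have "cnj \<circ> Lambda_twist F q ch \<circ> cnj holomorphic_on UNIV"
    by (rule holomorphic_on_compose_cnj_cnj) (auto intro: holomorphic_on_subset[OF Lambda_twist_entire])
  then have "is_entire_extension (completed_product (dual_form F) q (conj_char ch)) (cnj \<circ> Lambda_twist F q ch \<circ> cnj)"
    unfolding is_entire_extension_def using eq Lambda_twist_eq by simp
  then have "Lambda_twist (dual_form F) q (conj_char ch) = cnj \<circ> Lambda_twist F q ch \<circ> cnj"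
    unfolding Lambda_twist_def[of "dual_form F"] by (rule entire_extension_eq)
  then show ?thesis using Lambda_twist_eq[of "cnj s"] assms by simp
qed

text \<open>For Re s > 1/2 the point 1/2 + s lies in the half plane of absolute convergence, where
  the completed function is the literal product of the series and the gamma factors.\<close>

lemma L_twist_functional_equation:
  "\<exists>\<kappa>. norm \<kappa> = 1 \<and> (\<forall>s. Re s > 1/2 \<longrightarrow> L_twist F ch (1/2 - s) =
      \<kappa> * cnj (L_twist F ch (cnj (1/2 + s))) * of_nat (lf_cond F q) powr s * gamma_factor ch s)"
proof -
  obtain \<kappa> where k: "norm \<kappa> = 1"
    "\<And>s. Lambda_twist F q ch s = \<kappa> * Lambda_twist (dual_form F) q (conj_char ch) (1 - s)"
    using twist_framework(4) by blast
  define \<mu> where "\<mu> = lf_mu F (ch (-1))"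
  define N where "N = lf_cond F q"
  have N: "N \<ge> 1" using cond_pos[OF q] by (simp add: N_def)
  have "L_twist F ch (1/2 - s) =
      \<kappa> * cnj (L_twist F ch (cnj (1/2 + s))) * of_nat N powr s * gamma_factor ch s" if s: "Re s > 1/2" for s
  proof -
    define w where "w = 1/2 + s"
    have w: "Re w > 1" "Re (cnj w) > 1" "1/2 - s = 1 - w" using s by (auto simp: w_def)
    have "L_twist F ch (1/2 - s) = Lambda_twist F q ch (1 - w) * rL_infinity q ch (1 - w)"
      by (simp add: L_twist_eq_Lambda w(3))
    also have "Lambda_twist F q ch (1 - w) = \<kappa> * cnj (completed_product F q ch (cnj w))"
      using k(2)[of "1 - w"] Lambda_twist_dual[OF w(1)] by simp
    also have "\<dots> = \<kappa> * cnj (L_twist F ch (cnj w)) * cnj (L_infinity F q ch (cnj w))"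
      using L_twist_eq_series[OF w(2)] by (simp add: completed_product_def)
    also have "cnj (L_infinity F q ch (cnj w)) = of_nat N powr (w / 2) * (\<Prod>j<d. Gamma_R (w + cnj (\<mu> j)))"
      by (simp add: L_infinity_def cnj_Gamma_R cnj_powr N_def \<mu>_def)
    also have "rL_infinity q ch (1 - w) = of_nat N powr (- (1 - w) / 2) * (\<Prod>j<d. rGamma_R (1 - w + \<mu> j))"
      by (simp add: rL_infinity_def N_def \<mu>_def)
    also have "\<kappa> * cnj (L_twist F ch (cnj w)) * (of_nat N powr (w / 2) * (\<Prod>j<d. Gamma_R (w + cnj (\<mu> j)))) *
       (of_nat N powr (- (1 - w) / 2) * (\<Prod>j<d. rGamma_R (1 - w + \<mu> j))) =
       \<kappa> * cnj (L_twist F ch (cnj w)) * (of_nat N powr (w / 2) * of_nat N powr (- (1 - w) / 2)) *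
       (\<Prod>j<d. Gamma_R (w + cnj (\<mu> j)) * rGamma_R (1 - w + \<mu> j))"
      by (simp add: prod.distrib mult_ac)
    also have "of_nat N powr (w / 2) * of_nat N powr (- (1 - w) / 2) = (of_nat N powr s :: complex)"
    proof -
      have "w / 2 + - (1 - w) / 2 = s" by (simp add: w_def field_simps)
      then show ?thesis by (metis powr_add)
    qed
    also have "(\<Prod>j<d. Gamma_R (w + cnj (\<mu> j)) * rGamma_R (1 - w + \<mu> j)) = gamma_factor ch s"
      unfolding gamma_factor_def
    proof (intro prod.cong refl)
      fix j
      have i: "\<mu> j - cnj (\<mu> j) = 2 * \<i> * Im (\<mu> j)" by (simp add: complex_diff_cnj)
      have "- (w + cnj (\<mu> j)) / 2 + (1 - w + \<mu> j) / 2 = (1 - 2 * w + (\<mu> j - cnj (\<mu> j))) / 2"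
        by (simp add: field_simps)
      also have "\<dots> = - s + \<i> * Im (\<mu> j)" unfolding i by (simp add: w_def field_simps)
      finally have e: "- (w + cnj (\<mu> j)) / 2 + (1 - w + \<mu> j) / 2 = - s + \<i> * Im (\<mu> j)" .
      have "Gamma_R (w + cnj (\<mu> j)) * rGamma_R (1 - w + \<mu> j) =
        (of_real pi powr (- (w + cnj (\<mu> j)) / 2) * of_real pi powr ((1 - w + \<mu> j) / 2)) *
         Gamma ((w + cnj (\<mu> j)) / 2) * rGamma ((1 - w + \<mu> j) / 2)"
        by (simp add: Gamma_R_def rGamma_R_def)
      also have "of_real pi powr (- (w + cnj (\<mu> j)) / 2) * of_real pi powr ((1 - w + \<mu> j) / 2)
         = (of_real pi powr (- s + \<i> * Im (\<mu> j)) :: complex)"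
        by (simp only: e flip: powr_add)
      finally show "Gamma_R (w + cnj (\<mu> j)) * rGamma_R (1 - w + \<mu> j) =
         of_real pi powr (- s + \<i> * Im (lf_mu F (ch (-1)) j)) *
         Gamma ((1/2 + s + cnj (lf_mu F (ch (-1)) j)) / 2) * rGamma ((1/2 - s + lf_mu F (ch (-1)) j) / 2)"
        unfolding w(3) \<mu>_def w_def by simp
    qed
    finally show ?thesis by (simp only: w_def)
  qed
  then show ?thesis using k(1) by (auto simp: N_def)
qed

text \<open>A pole of a gamma factor at 1/2 forces a zero of the L-function there, because the
  completed function is finite.\<close>

lemma L_twist_half_eq_0:
  assumes "j < d" "1/2 + cnj (lf_mu F (ch (-1)) j) = 0"
  shows "L_twist F ch (1/2) = 0"
proof -
  have "cnj (1/2 + cnj (lf_mu F (ch (-1)) j)) = 0" using assms(2) by simp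
  then have "1/2 + lf_mu F (ch (-1)) j = 0" by simp
  then have "rGamma_R (1/2 + lf_mu F (ch (-1)) j) = 0" by (simp add: rGamma_R_def)
  then have "rL_infinity q ch (1/2) = 0" using assms(1) by (auto simp: rL_infinity_def)
  then show ?thesis by (simp add: L_twist_eq_Lambda)
qed

text \<open>The completed function has order 1, and each reciprocal gamma factor grows at most
  exponentially along a vertical strip.\<close>

lemma L_twist_subgaussian: "strip_subgaussian a b (L_twist F ch)"
proof -
  define N where "N = real (lf_cond F q)"
  have N: "N \<ge> 1" using cond_pos[OF q] by (simp add: N_def)
  have "strip_subgaussian a b (\<lambda>s. of_nat (lf_cond F q) powr (- s / 2))"
  proof (rule strip_subgaussian_exp_bound[where C = "N powr (\<bar>a\<bar>/2)" and c = 0])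
    fix z :: complex assume z: "a \<le> Re z" "Re z \<le> b"
    have "norm (of_nat (lf_cond F q) powr (- z / 2) :: complex) = N powr (- Re z / 2)"
      using norm_of_nat_powr[OF cond_pos[OF q], of "- z / 2"] by (simp add: N_def)
    also have "\<dots> \<le> N powr (\<bar>a\<bar>/2)" using N z by (intro powr_mono) auto
    finally show "norm (of_nat (lf_cond F q) powr (- z / 2) :: complex) \<le> N powr (\<bar>a\<bar>/2) * exp (0 * \<bar>Im z\<bar>)"
      by simp
  qed
  moreover have "strip_subgaussian a b (\<lambda>s. rGamma_R (s + m))" for m
  proof -
    define K where "K = (\<bar>a\<bar> + \<bar>b\<bar> + \<bar>Re m\<bar>) / 2"
    obtain C where C: "C > 0" "\<And>z::complex. \<bar>Re z\<bar> \<le> K \<Longrightarrow> norm (rGamma z) \<le> C * exp (pi * \<bar>Im z\<bar>)"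
      using rGamma_growth[of K] by blast
    show ?thesis
    proof (rule strip_subgaussian_exp_bound[where C = "pi powr K * (C * exp (pi * \<bar>Im m\<bar> / 2))" and c = "pi/2"])
      fix z :: complex assume z: "a \<le> Re z" "Re z \<le> b"
      have "\<bar>Re ((z + m)/2)\<bar> \<le> K" using z by (auto simp: K_def)
      then have "norm (rGamma ((z + m)/2)) \<le> C * exp (pi * \<bar>Im ((z + m)/2)\<bar>)" by (rule C(2))
      also have "\<dots> \<le> C * exp (pi * \<bar>Im m\<bar> / 2 + pi/2 * \<bar>Im z\<bar>)"
      proof -
        have "pi * \<bar>Im ((z + m)/2)\<bar> \<le> pi * ((\<bar>Im m\<bar> + \<bar>Im z\<bar>)/2)" by (intro mult_left_mono) auto
        then show ?thesis using C(1) by (simp add: field_simps)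
      qed
      finally have r: "norm (rGamma ((z + m)/2)) \<le> C * exp (pi * \<bar>Im m\<bar> / 2) * exp (pi/2 * \<bar>Im z\<bar>)"
        by (simp add: exp_add)
      have "norm (of_real pi powr ((z + m)/2) :: complex) = pi powr (Re (z + m) / 2)"
        using norm_powr_real_powr[of "of_real pi" "(z + m)/2"] by simp
      also have "\<dots> \<le> pi powr K" using z pi_gt3 by (intro powr_mono) (auto simp: K_def)
      finally have "norm (of_real pi powr ((z + m)/2) :: complex) * norm (rGamma ((z + m)/2))
        \<le> pi powr K * (C * exp (pi * \<bar>Im m\<bar> / 2) * exp (pi/2 * \<bar>Im z\<bar>))"
        using r by (intro mult_mono) auto
      then show "norm (rGamma_R (z + m)) \<le> pi powr K * (C * exp (pi * \<bar>Im m\<bar> / 2)) * exp (pi/2 * \<bar>Im z\<bar>)"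
        unfolding rGamma_R_def norm_mult by (simp only: mult.assoc)
    qed
  qed
  ultimately have "strip_subgaussian a b (rL_infinity q ch)"
    unfolding rL_infinity_def by (intro strip_subgaussian_mult strip_subgaussian_prod) auto
  then show ?thesis unfolding L_twist_eq_Lambda
    by (intro strip_subgaussian_mult[OF strip_subgaussian_order_1[OF twist_framework(3)]])
qed

end

end

lemma add_le_mult_exp: "a \<ge> 1 \<Longrightarrow> x \<ge> 0 \<Longrightarrow> a + x \<le> a * exp (x::real)"
  using mult_left_mono[OF exp_ge_add_one_self[of x], of a] mult_right_mono[of 1 a x]
  by (simp add: algebra_simps)

lemma exp_linear_minus_square_le:
  "exp (k * x) * exp (- x\<^sup>2) \<le> exp (k\<^sup>2 / 2) * exp (- x\<^sup>2 / 2 :: real)"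
proof -
  have "0 \<le> (k - x)\<^sup>2" by simp
  then have "k * x - x\<^sup>2 \<le> k\<^sup>2 / 2 - x\<^sup>2 / 2" by (simp add: power2_diff)
  then show ?thesis by (simp flip: exp_add)
qed

section \<open>Polynomial bounds in the critical strip\<close>

context lfun begin

lemma L_series_norm_le:
  assumes "\<And>n. norm (ch n) \<le> 1" "Re s \<ge> \<sigma>" "\<sigma> > 1"
  shows "norm (L_series F ch s) \<le> (\<Sum>\<^sub>\<infinity>n\<in>{1..}. norm (lam n) * real n powr - \<sigma>)"
proof -
  have le: "norm (L_term F ch s n) \<le> norm (lam n) * real n powr - \<sigma>" if "n \<in> {1..}" for n
  proof -
    have "norm (L_term F ch s n) \<le> norm (lam n) * real n powr - Re s"
      using norm_L_term_le[of n ch s] assms(1) that by simp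
    also have "\<dots> \<le> norm (lam n) * real n powr - \<sigma>"
      using that assms(2) by (intro mult_left_mono powr_mono) auto
    finally show ?thesis .
  qed
  have sum: "(\<lambda>n. norm (L_term F ch s n)) summable_on {1..}"
    by (rule summable_on_comparison_test[OF summable_lam[OF assms(3)]]) (use le in auto)
  then have "norm (L_series F ch s) \<le> (\<Sum>\<^sub>\<infinity>n\<in>{1..}. norm (L_term F ch s n))"
    unfolding L_series_def by (rule norm_infsum_bound)
  also have "\<dots> \<le> (\<Sum>\<^sub>\<infinity>n\<in>{1..}. norm (lam n) * real n powr - \<sigma>)"
    by (rule infsum_mono[OF sum summable_lam[OF assms(3)] le])
  finally show ?thesis .
qed

lemma norm_char_le:
  assumes "q \<ge> 2" "primitive_char q ch"
  shows "norm (ch n) \<le> 1"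
  by (rule norm_dirichlet_char_le[of q]) (use assms in \<open>auto simp: primitive_char_def\<close>)

definition lam_sum :: real where "lam_sum = 1 + (\<Sum>\<^sub>\<infinity>n\<in>{1..}. norm (lam n) * real n powr - (3/2))"

lemma lam_sum_ge_1: "lam_sum \<ge> 1"
  unfolding lam_sum_def by (simp add: infsum_nonneg)

lemma L_twist_right_bound:
  assumes "q \<ge> 2" "primitive_char q ch" "Re s \<ge> 3/2"
  shows "norm (L_twist F ch s) \<le> lam_sum"
  using L_series_norm_le[of ch, OF norm_char_le[OF assms(1,2)] assms(3)] assms(3)
    L_twist_eq_series[OF assms(1,2), of s]
  by (simp add: lam_sum_def)

text \<open>On Re s = 1 one has \<open>cnj s\<close> = 2 - s. Hence, if u is the argument of rGamma,
  the argument of Gamma is the conjugate of u + 1, and |Gamma (u + 1) rGamma u| = |u| is an exact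
  value. The factor with \<pi> has norm 1/\<pi>.\<close>

lemma norm_gamma_factor_1:
  assumes "q \<ge> 2" "primitive_char q ch" "Re s = 1"
  shows "norm (gamma_factor ch s) \<le> (\<Prod>j<d. norm (1/2 - s + lf_mu F (ch (-1)) j))"
  unfolding gamma_factor_def prod_norm[symmetric]
proof (intro prod_mono conjI norm_ge_zero)
  fix j assume j: "j \<in> {..<d}"
  define m where "m = lf_mu F (ch (-1)) j"
  have m: "Re m > -1" unfolding m_def using mu_Re[OF assms(1,2)] j by simp
  define u where "u = (1/2 - s + m) / 2"
  have cs: "cnj s = 2 - s" using assms(3) by (simp add: complex_eq_iff)
  have "cnj ((1/2 + s + cnj m) / 2) = u + 1" by (simp add: u_def cs field_simps)
  moreover have "norm (Gamma x) = norm (Gamma (cnj x))" for x :: complex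
    by (simp flip: cnj_Gamma)
  ultimately have G: "norm (Gamma ((1/2 + s + cnj m) / 2)) = norm (Gamma (u + 1))" by metis
  have "u + 1 \<notin> \<int>\<^sub>\<le>\<^sub>0"
  proof
    assume "u + 1 \<in> \<int>\<^sub>\<le>\<^sub>0"
    then obtain n where n: "u + 1 = of_int n" "n \<le> 0" by (auto elim!: nonpos_Ints_cases)
    have "Re (u + 1) \<le> 0" unfolding n(1) using n(2) by simp
    moreover have "Re (u + 1) = (Re m - 1/2) / 2 + 1" using assms(3) by (simp add: u_def)
    ultimately show False using m by (simp add: field_simps)
  qed
  then have "Gamma (u + 1) * rGamma (u + 1) = 1"
    by (simp add: rGamma_inverse_Gamma Gamma_eq_zero_iff)
  then have "Gamma (u + 1) * rGamma u = u"
    by (simp only: rGamma_plus1[of u, symmetric] mult.left_commute[of _ u] mult_1_right)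
  then have Gr: "norm (Gamma (u + 1)) * norm (rGamma u) = norm u" by (metis norm_mult)
  have "norm (of_real pi powr (- s + \<i> * Im m) :: complex) = pi powr (-1)"
    using norm_powr_real_powr[of "of_real pi" "- s + \<i> * Im m"] assms(3) by simp
  also have "\<dots> \<le> 1" using pi_gt3 by (simp add: powr_minus field_simps)
  finally have p: "norm (of_real pi powr (- s + \<i> * Im m) :: complex) \<le> 1" .
  have "norm (of_real pi powr (- s + \<i> * Im m) * Gamma ((1/2 + s + cnj m) / 2) * rGamma ((1/2 - s + m) / 2))
     = norm (of_real pi powr (- s + \<i> * Im m) :: complex) * norm u"
    unfolding norm_mult G by (simp only: mult.assoc Gr flip: u_def)
  also have "\<dots> \<le> 1 * norm u" using p by (intro mult_right_mono) auto
  also have "\<dots> \<le> norm (1/2 - s + m)" by (simp add: u_def norm_divide)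
  finally show "norm (of_real pi powr (- s + \<i> * Im (lf_mu F (ch (-1)) j)) * Gamma ((1/2 + s + cnj (lf_mu F (ch (-1)) j)) / 2)
      * rGamma ((1/2 - s + lf_mu F (ch (-1)) j) / 2)) \<le> norm (1/2 - s + lf_mu F (ch (-1)) j)"
    by (simp only: m_def)
qed

lemma L_twist_left_bound:
  assumes "q \<ge> 2" "primitive_char q ch" "Re z = -1/2"
  shows "norm (L_twist F ch z) \<le> lam_sum * real (lf_cond F q) * (\<Prod>j<d. norm (z + lf_mu F (ch (-1)) j))"
proof -
  define s where "s = 1/2 - z"
  have s: "Re s = 1" "1/2 - s = z" using assms(3) by (simp_all add: s_def)
  obtain \<kappa> where k: "norm \<kappa> = 1" "L_twist F ch (1/2 - s) =
      \<kappa> * cnj (L_twist F ch (cnj (1/2 + s))) * of_nat (lf_cond F q) powr s * gamma_factor ch s"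
    using L_twist_functional_equation[OF assms(1,2)] s(1) by fastforce
  have "norm (L_twist F ch z) = norm (L_twist F ch (cnj (1/2 + s))) * real (lf_cond F q) * norm (gamma_factor ch s)"
    using k s cond_pos[OF assms(1)] by (simp add: norm_mult norm_of_nat_powr)
  also have "\<dots> \<le> lam_sum * real (lf_cond F q) * (\<Prod>j<d. norm (1/2 - s + lf_mu F (ch (-1)) j))"
    using L_twist_right_bound[OF assms(1,2), of "cnj (1/2 + s)"] s(1) lam_sum_ge_1
    by (intro mult_mono norm_gamma_factor_1[OF assms(1,2)]) auto
  finally show ?thesis by (simp only: s(2))
qed

lemma L_twist_poly_bound:
  "\<exists>C\<ge>1. \<exists>A\<ge>1. \<forall>q ch z. q \<ge> 2 \<longrightarrow> primitive_char q ch \<longrightarrow> -1/2 \<le> Re z \<longrightarrow> Re z \<le> 3/2 \<longrightarrow>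
     norm (L_twist F ch z) \<le> C * real q ^ d * norm (z + of_real A) ^ d"
proof -
  obtain CN where CN: "CN \<ge> 1" "\<And>q ch. q \<ge> 2 \<Longrightarrow> primitive_char q ch \<Longrightarrow> real (lf_cond F q) \<le> CN * real q ^ d"
    using cond_bound by blast
  define A0 where "A0 = (\<Sum>j<d. norm (lf_mu F 1 j) + norm (lf_mu F (-1) j))"
  have A0: "A0 \<ge> 0" by (auto simp: A0_def intro!: sum_nonneg)
  define A where "A = A0 + 2"
  have "norm (L_twist F ch z0) \<le> (2 * lam_sum * 2 ^ d * CN) * real q ^ d * norm (z0 + of_real A) ^ d"
    if q: "q \<ge> 2" and prim: "primitive_char q ch" and z0: "-1/2 \<le> Re z0" "Re z0 \<le> 3/2" for q ch z0
  proof -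
    define \<mu> where "\<mu> = lf_mu F (ch (-1))"
    have mu: "norm (\<mu> j) \<le> A0" if "j < d" for j
    proof -
      have "norm (\<mu> j) \<le> norm (lf_mu F 1 j) + norm (lf_mu F (-1) j)"
        using ch_sign[OF q prim] by (auto simp: \<mu>_def)
      also have "\<dots> \<le> A0" unfolding A0_def using that
        by (intro member_le_sum[of j "{..<d}" "\<lambda>j. norm (lf_mu F 1 j) + norm (lf_mu F (-1) j)"]) auto
      finally show ?thesis .
    qed
    define f where "f z = L_twist F ch z * inverse ((z + of_real A) ^ d)" for z
    define N where "N = real (lf_cond F q)"
    have N: "N \<ge> 1" using cond_pos[OF q] by (simp add: N_def)
    define B where "B = 2 * N * lam_sum * 2 ^ d"
    have zA: "norm (z + of_real A) \<ge> 1" "z + of_real A \<noteq> 0" if "-1/2 \<le> Re z" for z :: complex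
    proof -
      have "Re (z + of_real A) \<ge> 1" using that A0 by (simp add: A_def)
      then show "norm (z + of_real A) \<ge> 1" using complex_Re_le_cmod[of "z + of_real A"] by linarith
      then show "z + of_real A \<noteq> 0" by auto
    qed
    have "norm (f z0) \<le> B"
    proof (rule phragmen_lindelof_strip[where f = f and a = "-1/2" and b = "3/2"])
      show "f holomorphic_on {z. - 1 / 2 \<le> Re z \<and> Re z \<le> 3 / 2}"
        unfolding f_def using zA by (intro holomorphic_intros L_twist_entire[OF q prim]) auto
      show "B > 0" using N lam_sum_ge_1 by (simp add: B_def)
      have "strip_subgaussian (-1/2) (3/2) f"
        unfolding f_def
      proof (intro strip_subgaussian_mult L_twist_subgaussian[OF q prim])
        show "strip_subgaussian (- 1 / 2) (3 / 2) (\<lambda>z. inverse ((z + complex_of_real A) ^ d))"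
        proof (rule strip_subgaussian_exp_bound[of _ _ _ 1 0])
          fix z :: complex assume "-1/2 \<le> Re z"
          then have "norm (z + of_real A) ^ d \<ge> 1" by (intro one_le_power zA)
          then show "norm (inverse ((z + of_real A) ^ d)) \<le> 1 * exp (0 * \<bar>Im z\<bar>)"
            by (simp add: norm_inverse norm_power inverse_le_1_iff)
        qed
      qed
      then show "\<exists>Y. \<forall>z. -1/2 \<le> Re z \<and> Re z \<le> 3/2 \<and> \<bar>Im z\<bar> \<ge> Y \<longrightarrow> norm (f z) \<le> exp (\<epsilon> * (Im z)\<^sup>2)"
        if "\<epsilon> > 0" for \<epsilon>
        using that unfolding strip_subgaussian_def by blast
      fix z assume z: "Re z = -1/2 \<or> Re z = 3/2"
      then have zA1: "norm (z + of_real A) \<ge> 1" using zA(1)[of z] by auto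
      then have zAd: "norm (z + of_real A) ^ d \<ge> 1" by (rule one_le_power)
      have "norm (L_twist F ch z) \<le> B * norm (z + of_real A) ^ d"
        using z
      proof
        assume "Re z = 3/2"
        then have "norm (L_twist F ch z) \<le> lam_sum" by (intro L_twist_right_bound[OF q prim]) simp
        also have "lam_sum = lam_sum * 1" by simp
        also have "\<dots> \<le> B * norm (z + of_real A) ^ d"
        proof (rule mult_mono)
          have "1 \<le> N * 2 ^ d" using N mult_mono[of 1 N 1 "2^d"] by simp
          then have "1 \<le> 2 * (N * 2 ^ d)" by linarith
          from mult_right_mono[OF this, of lam_sum] lam_sum_ge_1 show "lam_sum \<le> B"
            by (simp add: B_def mult_ac)
        qed (use zAd lam_sum_ge_1 N in \<open>auto simp: B_def\<close>)
        finally show ?thesis .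
      next
        assume re: "Re z = -1/2"
        have "norm (L_twist F ch z) \<le> lam_sum * N * (\<Prod>j<d. norm (z + \<mu> j))"
          unfolding N_def \<mu>_def by (rule L_twist_left_bound[OF q prim re])
        also have "(\<Prod>j<d. norm (z + \<mu> j)) \<le> (\<Prod>j<d. 2 * norm (z + of_real A))"
        proof (intro prod_mono conjI norm_ge_zero)
          fix j assume "j \<in> {..<d}"
          then have "norm (z + \<mu> j) \<le> norm z + A0" using norm_triangle_ineq[of z "\<mu> j"] mu[of j] by simp
          also have "norm z \<le> 1/2 + \<bar>Im z\<bar>" using cmod_le[of z] re by simp
          also have "\<bar>Im z\<bar> \<le> norm (z + of_real A)" using abs_Im_le_cmod[of "z + of_real A"] by simp
          also have "1/2 + norm (z + of_real A) + A0 \<le> 2 * norm (z + of_real A)"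
            using complex_Re_le_cmod[of "z + of_real A"] re by (simp add: A_def)
          finally show "norm (z + \<mu> j) \<le> 2 * norm (z + of_real A)" by simp
        qed
        also have "(\<Prod>j<d. 2 * norm (z + of_real A)) = 2 ^ d * norm (z + of_real A) ^ d"
          by (simp add: power_mult_distrib)
        finally have "norm (L_twist F ch z) \<le> lam_sum * N * (2 ^ d * norm (z + of_real A) ^ d)"
          using lam_sum_ge_1 N by simp
        also have "\<dots> \<le> 2 * (lam_sum * N * (2 ^ d * norm (z + of_real A) ^ d))"
          using lam_sum_ge_1 N by simp
        finally show ?thesis by (simp add: B_def mult_ac)
      qed
      moreover have "norm (f z) = norm (L_twist F ch z) / norm (z + of_real A) ^ d"
        unfolding f_def norm_mult norm_inverse norm_power divide_inverse ..
      ultimately show "norm (f z) \<le> B" using zAd by (simp add: pos_divide_le_eq)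
    qed (use z0 in auto)
    moreover have "norm (f z0) = norm (L_twist F ch z0) / norm (z0 + of_real A) ^ d"
      unfolding f_def norm_mult norm_inverse norm_power divide_inverse ..
    ultimately have "norm (L_twist F ch z0) \<le> B * norm (z0 + of_real A) ^ d"
      using one_le_power[OF zA(1)[OF z0(1)], of d] by (simp add: pos_divide_le_eq)
    also have "B \<le> 2 * (CN * real q ^ d) * lam_sum * 2 ^ d"
      unfolding B_def N_def using CN(2)[OF q prim] lam_sum_ge_1 by (intro mult_right_mono mult_left_mono) auto
    finally show ?thesis by (simp add: mult_ac mult_right_mono)
  qed
  moreover have "2 * lam_sum * 2 ^ d * CN \<ge> 1"
  proof -
    have "1 * 1 * 1 * 1 \<le> 2 * lam_sum * 2 ^ d * CN"
      using lam_sum_ge_1 CN(1) by (intro mult_mono) auto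
    then show ?thesis by simp
  qed
  moreover have "A \<ge> 1" using A0 by (simp add: A_def)
  ultimately show ?thesis
    by (intro exI[of _ "2 * lam_sum * 2 ^ d * CN"] conjI exI[of _ A]) auto
qed

text \<open>Here C * real q ^ d majorizes the conductor N, whose power N^(s/2) is contained in the
  weights; 1 / |s| is the pole at 0 whose residue is the central value, and the Gaussian is what
  exp(s^2) leaves after the gamma factors have taken their share.\<close>

definition afe_weight :: "real \<Rightarrow> nat \<Rightarrow> (complex \<Rightarrow> complex) \<Rightarrow> bool" where
  "afe_weight C q w \<longleftrightarrow> w holomorphic_on {s. Re s > 0} \<and>
         (\<forall>s. 0 < Re s \<longrightarrow> Re s \<le> 1 \<longrightarrow> norm (w s) \<le> C * (C * real q ^ d) powr (Re s / 2) * exp (- (Im s)\<^sup>2 / 2) / norm s)"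

text \<open>Both integrals contain the L-function of \<open>ch\<close> itself: the dual values that
  belong to the second one are complex conjugates of its values, and only norms matter. Hence a mean
  value over one family treats both.\<close>

definition approx_fun_eq :: "real \<Rightarrow> nat \<Rightarrow> (int \<Rightarrow> complex) \<Rightarrow> real \<Rightarrow> bool" where
  "approx_fun_eq C q ch H \<longleftrightarrow> (\<exists>w1 w2. afe_weight C q w1 \<and> afe_weight C q w2 \<and>
       norm (L_twist F ch (1/2)) \<le>
         norm (integral {-H..H} (\<lambda>t. w1 (Complex 1 t) * L_twist F ch (1/2 + Complex 1 t)))
         + norm (integral {-H..H} (\<lambda>t. w2 (Complex 1 t) * L_twist F ch (1/2 + Complex 1 t)))
         + C * real q ^ (2 * d) * exp (- H\<^sup>2 / 2))"

text \<open>In the proof, the polynomial \<open>P\<close> cancels the poles that the quotient of gamma factors in the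
  functional equation has for \<open>-1 \<le> Re s \<le> 1\<close>. If \<open>P 0 = 0\<close>, then \<open>1/2\<close> is a trivial zero.\<close>

lemma approx_functional_equation_parity:
  "\<exists>C\<ge>1. \<forall>q ch H. q \<ge> 2 \<longrightarrow> primitive_char q ch \<longrightarrow> ch (-1) = e \<longrightarrow> H \<ge> 1 \<longrightarrow> approx_fun_eq C q ch H"
proof (cases "\<exists>q ch. q \<ge> 2 \<and> primitive_char q ch \<and> ch (-1) = e")
  case False
  then show ?thesis by (intro exI[of _ 1]) auto
next
  case True
  define m where "m = lf_mu F e"
  have m: "Re (m j) > -1" if "j < d" for j
    using True mu_Re that by (auto simp: m_def)
  define P where "P s = (\<Prod>j<d. 1/2 + cnj (m j) - s)" for s
  show ?thesis
  proof (cases "P 0 = 0")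
    case True
    then obtain j where j: "j < d" "1/2 + cnj (m j) = 0" by (auto simp: P_def)
    show ?thesis
    proof (intro exI[of _ 1] conjI allI impI)
      fix q ch and H :: real assume "2 \<le> q" "primitive_char q ch" "ch (-1) = e" "1 \<le> H"
      then have "L_twist F ch (1/2) = 0" using L_twist_half_eq_0[of q ch j] j by (simp add: m_def)
      then show "approx_fun_eq 1 q ch H"
        unfolding approx_fun_eq_def afe_weight_def by (intro exI[of _ "\<lambda>_. 0"]) auto
    qed auto
  next
    case False
    define G where "G = P 0"
    have G: "norm G > 0" using False by (simp add: G_def)
    \<comment> \<open>This is exp(w^2) * P (- w) * \<open>gamma_factor ch w\<close>, where each
      factor 1/2 + cnj (m j) + w = 2 x of P has been absorbed by x Gamma x = Gamma (x + 1); hence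
      the shift from 1/2 to 5/2 and the factor 2.\<close>
    define V where "V w = exp (w\<^sup>2) * (\<Prod>j<d. of_real pi powr (- w + \<i> * Im (m j)) * (2 * Gamma ((5/2 + w + cnj (m j)) / 2))
      * rGamma ((1/2 - w + m j) / 2))" for w
    obtain CN where CN: "CN \<ge> 1" "\<And>q ch. q \<ge> 2 \<Longrightarrow> primitive_char q ch \<Longrightarrow> real (lf_cond F q) \<le> CN * real q ^ d"
      using cond_bound by blast
    obtain CL where CL0: "CL \<ge> 1 \<and> (\<exists>A\<ge>1. \<forall>q ch z. q \<ge> 2 \<longrightarrow> primitive_char q ch \<longrightarrow> -1/2 \<le> Re z \<longrightarrow> Re z \<le> 3/2 \<longrightarrow>
        norm (L_twist F ch z) \<le> CL * real q ^ d * norm (z + of_real A) ^ d)"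
      using L_twist_poly_bound ..
    from conjunct2[OF CL0] obtain A where CL1: "A \<ge> 1 \<and> (\<forall>q ch z. q \<ge> 2 \<longrightarrow> primitive_char q ch \<longrightarrow> -1/2 \<le> Re z \<longrightarrow> Re z \<le> 3/2 \<longrightarrow>
        norm (L_twist F ch z) \<le> CL * real q ^ d * norm (z + of_real A) ^ d)" ..
    have CL: "CL \<ge> 1" "A \<ge> 1" using CL0 CL1 by simp_all
    have CL3: "norm (L_twist F ch z) \<le> CL * real q ^ d * norm (z + of_real A) ^ d"
      if "q \<ge> 2" "primitive_char q ch" "-1/2 \<le> Re z" "Re z \<le> 3/2" for q ch z
      using CL1 that by simp
    define AP where "AP = (\<Prod>j<d. 2 + norm (m j))"
    have AP: "AP \<ge> 1" unfolding AP_def by (intro prod_ge_1) (use norm_ge_zero in \<open>auto intro: add_increasing2\<close>)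
    have Pb: "norm (P s) \<le> AP * exp (2 * real d * \<bar>Im s\<bar>)" if "\<bar>Re s\<bar> \<le> 1" for s
    proof -
      have "norm (P s) \<le> (\<Prod>j<d. (2 + norm (m j)) * exp (2 * \<bar>Im s\<bar>))"
        unfolding P_def prod_norm[symmetric]
      proof (intro prod_mono conjI norm_ge_zero)
        fix j
        have "norm (1/2 + cnj (m j) - s) \<le> norm (1/2 + cnj (m j)) + norm s" by (rule norm_triangle_ineq4)
        also have "norm (1/2 + cnj (m j)) \<le> 1/2 + norm (m j)" using norm_triangle_ineq[of "1/2" "cnj (m j)"] by simp
        also have "norm s \<le> 1 + \<bar>Im s\<bar>" using cmod_le[of s] that by linarith
        also have "1/2 + norm (m j) + (1 + \<bar>Im s\<bar>) \<le> (2 + norm (m j)) + \<bar>Im s\<bar>" by simp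
        also have "\<dots> \<le> (2 + norm (m j)) * exp \<bar>Im s\<bar>" by (intro add_le_mult_exp) auto
        also have "\<dots> \<le> (2 + norm (m j)) * exp (2 * \<bar>Im s\<bar>)" by (intro mult_left_mono) auto
        finally show "norm (1/2 + cnj (m j) - s) \<le> (2 + norm (m j)) * exp (2 * \<bar>Im s\<bar>)" by simp
      qed
      also have "\<dots> = AP * exp (2 * \<bar>Im s\<bar>) ^ d" by (simp add: prod.distrib AP_def)
      also have "exp (2 * \<bar>Im s\<bar>) ^ d = exp (2 * real d * \<bar>Im s\<bar>)" by (simp add: exp_of_nat_mult[symmetric] mult_ac)
      finally show ?thesis .
    qed
    have "\<exists>C\<ge>1. \<forall>w. 0 \<le> Re w \<longrightarrow> Re w \<le> 1 \<longrightarrow> norm (of_real pi powr (- w + \<i> * Im (m j)) * (2 * Gamma ((5/2 + w + cnj (m j)) / 2))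
      * rGamma ((1/2 - w + m j) / 2)) \<le> C * exp (2 * \<bar>Im w\<bar>)" if j: "j < d" for j
    proof -
      obtain C1 where C1: "\<And>z::complex. 3/4 \<le> Re z \<Longrightarrow> Re z \<le> 4 + \<bar>Re (m j)\<bar> \<Longrightarrow> norm (Gamma z) \<le> C1"
        using Gamma_bounded_strip[of "3/4" "4 + \<bar>Re (m j)\<bar>"] by auto
      obtain C2 where C2: "C2 > 0" "\<And>z::complex. \<bar>Re z\<bar> \<le> 2 + \<bar>Re (m j)\<bar> \<Longrightarrow> norm (rGamma z) \<le> C2 * exp (pi * \<bar>Im z\<bar>)"
        using rGamma_growth[of "2 + \<bar>Re (m j)\<bar>"] by auto
      define C where "C = max 1 (1 * (2 * C1) * (C2 * exp (2 * \<bar>Im (m j)\<bar>)))"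
      have "norm (of_real pi powr (- w + \<i> * Im (m j)) * (2 * Gamma ((5/2 + w + cnj (m j)) / 2))
        * rGamma ((1/2 - w + m j) / 2)) \<le> C * exp (2 * \<bar>Im w\<bar>)" if w: "0 \<le> Re w" "Re w \<le> 1" for w
      proof -
        have "norm (of_real pi powr (- w + \<i> * Im (m j)) :: complex) = pi powr (- Re w)"
          using norm_powr_real_powr[of "of_real pi" "- w + \<i> * Im (m j)"] by simp
        also have "\<dots> \<le> pi powr 0" using pi_gt3 w by (intro powr_mono) auto
        finally have 1: "norm (of_real pi powr (- w + \<i> * Im (m j)) :: complex) \<le> 1" using pi_gt3 by simp
        have "norm (Gamma ((5/2 + w + cnj (m j)) / 2)) \<le> C1" using w m[OF j] by (intro C1) auto
        then have 2: "norm (2 * Gamma ((5/2 + w + cnj (m j)) / 2)) \<le> 2 * C1" by (simp add: norm_mult)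
        have "norm (rGamma ((1/2 - w + m j) / 2)) \<le> C2 * exp (pi * \<bar>Im ((1/2 - w + m j) / 2)\<bar>)"
          using w by (intro C2) auto
        also have "\<dots> \<le> C2 * exp (2 * \<bar>Im (m j)\<bar> + 2 * \<bar>Im w\<bar>)"
        proof -
          have "pi * \<bar>Im ((1/2 - w + m j) / 2)\<bar> \<le> 4 * ((\<bar>Im (m j)\<bar> + \<bar>Im w\<bar>) / 2)"
            using pi_less_4 by (intro mult_mono) auto
          then show ?thesis using C2(1) by simp
        qed
        finally have 3: "norm (rGamma ((1/2 - w + m j) / 2)) \<le> C2 * exp (2 * \<bar>Im (m j)\<bar>) * exp (2 * \<bar>Im w\<bar>)"
          by (simp add: exp_add)
        have "norm (of_real pi powr (- w + \<i> * Im (m j)) :: complex) * norm (2 * Gamma ((5/2 + w + cnj (m j)) / 2))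
           * norm (rGamma ((1/2 - w + m j) / 2)) \<le> 1 * (2 * C1) * (C2 * exp (2 * \<bar>Im (m j)\<bar>) * exp (2 * \<bar>Im w\<bar>))"
          using 2 order_trans[OF norm_ge_zero 2] by (intro mult_mono 1 2 3) auto
        also have "\<dots> \<le> C * exp (2 * \<bar>Im w\<bar>)" unfolding C_def mult.assoc[symmetric]
          by (intro mult_right_mono) auto
        finally show ?thesis unfolding norm_mult .
      qed
      then show ?thesis by (intro exI[of _ C]) (auto simp: C_def)
    qed
    then obtain CV where CV: "\<And>j. j < d \<Longrightarrow> CV j \<ge> 1" "\<And>j w. j < d \<Longrightarrow> 0 \<le> Re w \<Longrightarrow> Re w \<le> 1 \<Longrightarrow>
       norm (of_real pi powr (- w + \<i> * Im (m j)) * (2 * Gamma ((5/2 + w + cnj (m j)) / 2)) * rGamma ((1/2 - w + m j) / 2))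
         \<le> CV j * exp (2 * \<bar>Im w\<bar>)" by metis
    define AV where "AV = (\<Prod>j<d. CV j)"
    have AV: "AV \<ge> 1" unfolding AV_def by (intro prod_ge_1) (use CV in auto)
    have nexp: "norm (exp (s\<^sup>2)) \<le> exp 1 * exp (- (Im s)\<^sup>2)" if "\<bar>Re s\<bar> \<le> 1" for s
    proof -
      have "(Re s)\<^sup>2 \<le> 1" using that by (simp add: abs_square_le_1)
      then show ?thesis by (simp add: Re_power2 flip: exp_add)
    qed
    have Vb: "norm (V w) \<le> exp 1 * exp (- (Im w)\<^sup>2) * (AV * exp (2 * real d * \<bar>Im w\<bar>))" if "0 \<le> Re w" "Re w \<le> 1" for w
    proof -
      have "(\<Prod>j<d. norm (of_real pi powr (- w + \<i> * Im (m j)) * (2 * Gamma ((5/2 + w + cnj (m j)) / 2)) * rGamma ((1/2 - w + m j) / 2)))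
        \<le> (\<Prod>j<d. CV j * exp (2 * \<bar>Im w\<bar>))"
        using that CV(2) by (intro prod_mono) auto
      also have "\<dots> = AV * exp (2 * \<bar>Im w\<bar>) ^ d" by (simp add: prod.distrib AV_def)
      also have "exp (2 * \<bar>Im w\<bar>) ^ d = exp (2 * real d * \<bar>Im w\<bar>)" by (simp add: exp_of_nat_mult[symmetric] mult_ac)
      finally show ?thesis unfolding V_def norm_mult[of "exp (w\<^sup>2)"] prod_norm[symmetric]
        using nexp[of w] that by (intro mult_mono prod_nonneg) auto
    qed
    \<comment> \<open>Half of the Gaussian decay is spent on the exponential growth of P and of the
      gamma factors, by completing the square.\<close>
    define E2 where "E2 = exp 1 * exp ((2 * real d)\<^sup>2 / 2)"
    have E2: "E2 \<ge> 1" unfolding E2_def by (simp flip: exp_add)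
    have gauss: "exp 1 * exp (- y\<^sup>2) * (K * exp (2 * real d * \<bar>y\<bar>)) \<le> K * E2 * exp (- y\<^sup>2 / 2)" if "K \<ge> 0" for y K :: real
    proof -
      have "exp 1 * K * (exp (2 * real d * \<bar>y\<bar>) * exp (- \<bar>y\<bar>\<^sup>2)) \<le> exp 1 * K * (exp ((2 * real d)\<^sup>2 / 2) * exp (- \<bar>y\<bar>\<^sup>2 / 2))"
        using that by (intro mult_left_mono exp_linear_minus_square_le) auto
      then show ?thesis by (simp add: E2_def mult_ac)
    qed
    define C where "C = max CN (max ((AP + AV) * E2 / norm G) (4 * CL * CN * (2 + A) ^ d * AP * exp 1 * exp ((3 * real d)\<^sup>2 / 2) / norm G))"
    have C: "C \<ge> CN" "C \<ge> 1" "C \<ge> (AP + AV) * E2 / norm G" "C \<ge> 4 * CL * CN * (2 + A) ^ d * AP * exp 1 * exp ((3 * real d)\<^sup>2 / 2) / norm G"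
      using CN(1) by (auto simp: C_def)
    show ?thesis
    proof (intro exI[of _ C] conjI allI impI C(2))
      fix q ch and H :: real assume q: "2 \<le> q" and prim: "primitive_char q ch" and e: "ch (-1) = e" and H: "1 \<le> H"
      define N where "N = lf_cond F q"
      have N: "N \<ge> 1" "real N \<le> CN * real q ^ d" using cond_pos[OF q] CN(2)[OF q prim] by (auto simp: N_def)
      obtain \<kappa> where k: "norm \<kappa> = 1" "\<And>s. Re s > 1/2 \<Longrightarrow> L_twist F ch (1/2 - s) =
        \<kappa> * cnj (L_twist F ch (cnj (1/2 + s))) * of_nat N powr s * gamma_factor ch s"
        using L_twist_functional_equation[OF q prim] unfolding N_def by blast
      \<comment> \<open>Crossing the pole produces 2 \<pi> f 0 = 2 \<pi> G L(1/2), and the weights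
        are normalized accordingly. The integral on Re s = -1 becomes, by the functional equation at
        w = -s, the conjugate of an integral on Re s = 1; therefore \<open>w2\<close> is conjugated
        and carries \<open>cnj \<kappa>\<close>.\<close>
      define w1 where "w1 s = of_nat N powr (s / 2) * (exp (s\<^sup>2) * P s) / s / (2 * pi * G)" for s
      define w2 where "w2 s = cnj \<kappa> * of_nat N powr (s / 2) * (cnj \<circ> V \<circ> cnj) s / s / cnj (2 * pi * G)" for s
      have V_hol: "V holomorphic_on {s. Re s > 0}"
      proof -
        have "(5/2 + w + cnj (m j)) / 2 \<notin> \<int>\<^sub>\<le>\<^sub>0" if "Re w > 0" "j < d" for w j
        proof
          assume "(5/2 + w + cnj (m j)) / 2 \<in> \<int>\<^sub>\<le>\<^sub>0"
          then obtain n where n: "(5/2 + w + cnj (m j)) / 2 = of_int n" "n \<le> 0" by (auto elim!: nonpos_Ints_cases)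
          have "Re ((5/2 + w + cnj (m j)) / 2) \<le> 0" unfolding n(1) using n(2) by simp
          then show False using m[OF that(2)] that(1) by simp
        qed
        then show ?thesis unfolding V_def by (auto intro!: holomorphic_intros)
      qed
      have Vc_hol: "(cnj \<circ> V \<circ> cnj) holomorphic_on {s. Re s > 0}"
      proof (rule holomorphic_on_compose_cnj_cnj)
        have "cnj ` {s. Re s > 0} \<subseteq> {s. Re s > 0}" by auto
        then show "V holomorphic_on cnj ` {s. Re s > 0}" by (rule holomorphic_on_subset[OF V_hol])
      qed (rule open_halfspace_Re_gt)
      have Npow: "norm (of_nat N powr (s / 2) :: complex) \<le> (C * real q ^ d) powr (Re s / 2)" if "0 \<le> Re s" for s
      proof -
        have "norm (of_nat N powr (s / 2) :: complex) = real N powr (Re s / 2)"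
          using norm_of_nat_powr[OF N(1), of "s/2"] by simp
        also have "\<dots> \<le> (C * real q ^ d) powr (Re s / 2)"
        proof (rule powr_mono2)
          have "CN * real q ^ d \<le> C * real q ^ d" using C by (intro mult_right_mono) auto
          then show "real N \<le> C * real q ^ d" using N by linarith
        qed (use that in auto)
        finally show ?thesis .
      qed
      have wb: "norm (x * y / s / z) \<le> C * (C * real q ^ d) powr (Re s / 2) * exp (- (Im s)\<^sup>2 / 2) / norm s"
        if "0 < Re s" "norm x \<le> (C * real q ^ d) powr (Re s / 2)" "norm y \<le> exp 1 * exp (- (Im s)\<^sup>2) * (K * exp (2 * real d * \<bar>Im s\<bar>))"
          "K \<ge> 0" "K \<le> AP + AV" "norm z = 2 * pi * norm G" for x y s z K
      proof -
        have "norm y \<le> K * E2 * exp (- (Im s)\<^sup>2 / 2)" using that(3) gauss[OF that(4)] by (rule order_trans)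
        also have "\<dots> \<le> (AP + AV) * E2 * exp (- (Im s)\<^sup>2 / 2)" using that E2 by (intro mult_right_mono) auto
        finally have y: "norm y \<le> (AP + AV) * E2 * exp (- (Im s)\<^sup>2 / 2)" .
        have z: "norm z \<ge> norm G" using that(6) pi_gt3 G mult_right_mono[of 1 "2 * pi" "norm G"] by simp
        have "norm (x * y / s / z) = norm x * (norm y / norm z) / norm s" by (simp add: norm_mult norm_divide)
        also have "\<dots> \<le> (C * real q ^ d) powr (Re s / 2) * ((AP + AV) * E2 * exp (- (Im s)\<^sup>2 / 2) / norm G) / norm s"
          using that y z G AP AV E2 by (intro divide_right_mono mult_mono frac_le) auto
        also have "\<dots> = (C * real q ^ d) powr (Re s / 2) * ((AP + AV) * E2 / norm G * exp (- (Im s)\<^sup>2 / 2)) / norm s" by simp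
        also have "\<dots> \<le> (C * real q ^ d) powr (Re s / 2) * (C * exp (- (Im s)\<^sup>2 / 2)) / norm s"
          using C by (intro divide_right_mono mult_left_mono mult_right_mono) auto
        finally show ?thesis by (simp add: mult_ac)
      qed
      have w1: "w1 holomorphic_on {s. Re s > 0}" "\<And>s. 0 < Re s \<Longrightarrow> Re s \<le> 1 \<Longrightarrow>
         norm (w1 s) \<le> C * (C * real q ^ d) powr (Re s / 2) * exp (- (Im s)\<^sup>2 / 2) / norm s"
      proof -
        show "w1 holomorphic_on {s. Re s > 0}" unfolding w1_def P_def
          using N(1) G by (auto intro!: holomorphic_intros)
        fix s assume s: "0 < Re s" "Re s \<le> 1"
        have "norm (exp (s\<^sup>2) * P s) \<le> exp 1 * exp (- (Im s)\<^sup>2) * (AP * exp (2 * real d * \<bar>Im s\<bar>))"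
          unfolding norm_mult using s by (intro mult_mono nexp Pb) auto
        then show "norm (w1 s) \<le> C * (C * real q ^ d) powr (Re s / 2) * exp (- (Im s)\<^sup>2 / 2) / norm s"
          unfolding w1_def using s AP AV by (intro wb[where K = AP] Npow) (auto simp: norm_mult)
      qed
      have w2: "w2 holomorphic_on {s. Re s > 0}" "\<And>s. 0 < Re s \<Longrightarrow> Re s \<le> 1 \<Longrightarrow>
         norm (w2 s) \<le> C * (C * real q ^ d) powr (Re s / 2) * exp (- (Im s)\<^sup>2 / 2) / norm s"
      proof -
        show "w2 holomorphic_on {s. Re s > 0}" unfolding w2_def
          using N(1) G by (intro holomorphic_intros Vc_hol) auto
        fix s assume s: "0 < Re s" "Re s \<le> 1"
        have "norm ((cnj \<circ> V \<circ> cnj) s) \<le> exp 1 * exp (- (Im s)\<^sup>2) * (AV * exp (2 * real d * \<bar>Im s\<bar>))"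
          using Vb[of "cnj s"] s by simp
        moreover have "norm (cnj \<kappa> * of_nat N powr (s / 2)) \<le> (C * real q ^ d) powr (Re s / 2)"
          using Npow[of s] s k(1) by (simp add: norm_mult)
        ultimately show "norm (w2 s) \<le> C * (C * real q ^ d) powr (Re s / 2) * exp (- (Im s)\<^sup>2 / 2) / norm s"
          unfolding w2_def using s AP AV by (intro wb[where K = AV]) (auto simp: norm_mult)
      qed
      define f where "f s = L_twist F ch (1/2 + s) * of_nat N powr (s / 2) * (exp (s\<^sup>2) * P s)" for s
      define I1 where "I1 = integral {-H..H} (\<lambda>t. w1 (Complex 1 t) * L_twist F ch (1/2 + Complex 1 t))"
      define I2 where "I2 = integral {-H..H} (\<lambda>t. w2 (Complex 1 t) * L_twist F ch (1/2 + Complex 1 t))"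
      have right: "integral {-H..H} (\<lambda>t. f (Complex 1 t) / Complex 1 t) = 2 * pi * G * I1"
      proof -
        have "f (Complex 1 t) / Complex 1 t = 2 * pi * G * (w1 (Complex 1 t) * L_twist F ch (1/2 + Complex 1 t))" for t
          using G by (simp add: f_def w1_def)
        then show ?thesis unfolding I1_def by simp
      qed
      have left: "integral {-H..H} (\<lambda>t. f (Complex (-1) t) / Complex (-1) t) = - (2 * pi * G * cnj I2)"
      proof -
        have "f (Complex (-1) t) / Complex (-1) t = - (2 * pi * G * cnj (w2 (Complex 1 t) * L_twist F ch (1/2 + Complex 1 t)))" for t
        proof -
          define w where "w = Complex 1 (-t)"
          have w: "Re w = 1" "Complex (-1) t = - w" "Complex 1 t = cnj w" by (auto simp: w_def complex_eq_iff)
          have w0: "w \<noteq> 0" using w(1) by auto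
          have VP: "gamma_factor ch w * (exp (w\<^sup>2) * P (- w)) = V w"
          proof -
            have "P (- w) * gamma_factor ch w = (\<Prod>j<d. of_real pi powr (- w + \<i> * Im (m j)) * (2 * Gamma ((5/2 + w + cnj (m j)) / 2))
              * rGamma ((1/2 - w + m j) / 2))"
              unfolding P_def gamma_factor_def prod.distrib[symmetric]
            proof (intro prod.cong refl)
              fix j assume j: "j \<in> {..<d}"
              define x where "x = (1/2 + w + cnj (m j)) / 2"
              have "Re x > 0" using m[of j] j w(1) by (simp add: x_def)
              then have "x \<noteq> 0" by auto
              have x2: "1/2 + cnj (m j) - - w = 2 * x" "(5/2 + w + cnj (m j)) / 2 = x + 1"
                by (simp_all add: x_def field_simps)
              have nx: "x \<notin> \<int>\<^sub>\<le>\<^sub>0"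
              proof
                assume "x \<in> \<int>\<^sub>\<le>\<^sub>0"
                then obtain n where n: "x = of_int n" "n \<le> 0" by (auto elim!: nonpos_Ints_cases)
                then have "Re x \<le> 0" by simp
                then show False using \<open>Re x > 0\<close> by simp
              qed
              have "2 * Gamma (x + 1) = 2 * x * Gamma x" using Gamma_plus1[OF nx] by simp
              then show "(1/2 + cnj (m j) - - w) * (of_real pi powr (- w + \<i> * Im (lf_mu F (ch (-1)) j))
                 * Gamma ((1/2 + w + cnj (lf_mu F (ch (-1)) j)) / 2) * rGamma ((1/2 - w + lf_mu F (ch (-1)) j) / 2)) =
                of_real pi powr (- w + \<i> * Im (m j)) * (2 * Gamma ((5/2 + w + cnj (m j)) / 2)) * rGamma ((1/2 - w + m j) / 2)"
                unfolding x2 e m_def[symmetric] x_def[symmetric] by (simp add: mult_ac)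
            qed
            then show ?thesis unfolding V_def by (simp add: mult_ac)
          qed
          have N2: "of_nat N powr w * of_nat N powr (- w / 2) = (of_nat N powr (w / 2) :: complex)"
          proof -
            have "w + - w / 2 = w / 2" by (simp add: field_simps)
            then show ?thesis by (metis powr_add)
          qed
          have "f (- w) = \<kappa> * cnj (L_twist F ch (cnj (1/2 + w))) * of_nat N powr w * gamma_factor ch w
              * of_nat N powr (- w / 2) * (exp (w\<^sup>2) * P (- w))"
            using k(2)[of w] w(1) by (simp add: f_def)
          also have "\<dots> = \<kappa> * cnj (L_twist F ch (cnj (1/2 + w))) * (of_nat N powr w * of_nat N powr (- w / 2))
              * (gamma_factor ch w * (exp (w\<^sup>2) * P (- w)))" by (simp add: mult_ac)
          also have "\<dots> = \<kappa> * cnj (L_twist F ch (cnj (1/2 + w))) * of_nat N powr (w / 2) * V w"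
            unfolding N2 VP ..
          finally have fw: "f (- w) = \<kappa> * cnj (L_twist F ch (cnj (1/2 + w))) * of_nat N powr (w / 2) * V w" .
          have X: "cnj (w2 (cnj w) * L_twist F ch (1/2 + cnj w)) = \<kappa> * of_nat N powr (w / 2) * V w / w / (2 * pi * G) * cnj (L_twist F ch (cnj (1/2 + w)))"
            by (simp add: w2_def cnj_powr)
          show ?thesis unfolding w(2,3) X fw using w0 G by (simp add: field_simps)
        qed
        then show ?thesis unfolding I2_def integral_cnj by simp
      qed
      \<comment> \<open>The integrand on the horizontal sides. The L-function, P and the height
        contribute at most exp(3 d H), which exp(-H^2) outweighs.\<close>
      define B where "B = CL * real q ^ d * ((2 + A) ^ d * exp (real d * H)) * (CN * real q ^ d) * (exp 1 * exp (- H\<^sup>2) * (AP * exp (2 * real d * H)))"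
      have Bpos: "B \<ge> 0" using CL AP CN by (auto simp: B_def intro!: mult_nonneg_nonneg)
      have hor: "norm (f s / s) \<le> B" if s: "\<bar>Re s\<bar> \<le> 1" "\<bar>Im s\<bar> = H" for s
      proof -
        have sH: "norm s \<ge> 1" using abs_Im_le_cmod[of s] s H by linarith
        have "norm (L_twist F ch (1/2 + s)) \<le> CL * real q ^ d * norm (1/2 + s + of_real A) ^ d"
          using s by (intro CL3[OF q prim]) auto
        also have "norm (1/2 + s + of_real A) \<le> (2 + A) * exp H"
        proof -
          have "norm (1/2 + s + of_real A) \<le> \<bar>Re (1/2 + s + of_real A)\<bar> + \<bar>Im (1/2 + s + of_real A)\<bar>" by (rule cmod_le)
          also have "\<dots> \<le> (2 + A) + H" using s CL(2) by simp
          also have "\<dots> \<le> (2 + A) * exp H" using CL(2) H by (intro add_le_mult_exp) auto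
          finally show ?thesis .
        qed
        then have "CL * real q ^ d * norm (1/2 + s + of_real A) ^ d \<le> CL * real q ^ d * ((2 + A) * exp H) ^ d"
          using CL by (intro mult_left_mono power_mono) auto
        also have "((2 + A) * exp H) ^ d = (2 + A) ^ d * exp (real d * H)"
          by (simp add: power_mult_distrib exp_of_nat_mult)
        finally have 1: "norm (L_twist F ch (1/2 + s)) \<le> CL * real q ^ d * ((2 + A) ^ d * exp (real d * H))" .
        have "norm (of_nat N powr (s / 2) :: complex) = real N powr (Re s / 2)"
          using norm_of_nat_powr[OF N(1), of "s/2"] by simp
        also have "\<dots> \<le> real N powr 1" using N s by (intro powr_mono) auto
        also have "\<dots> \<le> CN * real q ^ d" using N by simp
        finally have 2: "norm (of_nat N powr (s / 2) :: complex) \<le> CN * real q ^ d" .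
        have "norm (exp (s\<^sup>2) * P s) \<le> exp 1 * exp (- (Im s)\<^sup>2) * (AP * exp (2 * real d * \<bar>Im s\<bar>))"
          unfolding norm_mult using s by (intro mult_mono nexp Pb) auto
        also have "(Im s)\<^sup>2 = H\<^sup>2" by (simp flip: s(2))
        finally have 3: "norm (exp (s\<^sup>2) * P s) \<le> exp 1 * exp (- H\<^sup>2) * (AP * exp (2 * real d * H))" using s by simp
        have "norm (f s) \<le> B" unfolding f_def norm_mult[of "_ * _" "exp (s\<^sup>2) * P s"] norm_mult[of "L_twist F ch (1/2 + s)"] B_def
          using CL CN by (intro mult_mono 1 2 3 mult_nonneg_nonneg) auto
        moreover have "norm (f s / s) \<le> norm (f s) / 1" unfolding norm_divide using sH by (intro frac_le) auto
        ultimately show ?thesis by simp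
      qed
      have "norm (integral {-H..H} (\<lambda>t. f (Complex 1 t) / Complex 1 t) - integral {-H..H} (\<lambda>t. f (Complex (-1) t) / Complex (-1) t)
          - 2 * pi * f 0) \<le> 2 * B * (1 - (-1))"
      proof (rule vertical_integral_shift_pole)
        have "(\<lambda>s. L_twist F ch (1/2 + s)) holomorphic_on UNIV"
          by (rule holomorphic_on_compose_gen[of "\<lambda>s. 1/2 + s" UNIV "L_twist F ch" UNIV, unfolded o_def])
             (auto intro!: holomorphic_intros L_twist_entire[OF q prim])
        then show "f holomorphic_on {z. - 1 \<le> Re z \<and> Re z \<le> 1}"
          unfolding f_def P_def using N(1)
          by (intro holomorphic_intros) (auto elim: holomorphic_on_subset)
        show "norm (f (Complex x H) / Complex x H) \<le> B \<and> norm (f (Complex x (- H)) / Complex x (- H)) \<le> B"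
          if "-1 \<le> x" "x \<le> 1" for x
          using that H by (intro conjI hor) auto
      qed (use H Bpos in auto)
      then have main: "norm (2 * pi * G * I1 + 2 * pi * G * cnj I2 - 2 * pi * f 0) \<le> 4 * B"
        unfolding right left by simp
      have tri: "norm b \<le> norm (a - b) + norm a" for a b :: complex
        using norm_triangle_sub[of b a] by (simp add: norm_minus_commute)
      have f0: "f 0 = L_twist F ch (1/2) * G" using N(1) by (simp add: f_def G_def)
      have "2 * pi * norm G * norm (L_twist F ch (1/2)) = norm (2 * pi * f 0)" by (simp add: f0 norm_mult)
      also have "\<dots> \<le> norm (2 * pi * G * I1 + 2 * pi * G * cnj I2 - 2 * pi * f 0) + norm (2 * pi * G * I1 + 2 * pi * G * cnj I2)"
        by (rule tri)
      also have "\<dots> \<le> 4 * B + (2 * pi * norm G * norm I1 + 2 * pi * norm G * norm I2)"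
        using main norm_triangle_ineq[of "2 * pi * G * I1" "2 * pi * G * cnj I2"] by (simp add: norm_mult)
      finally have *: "2 * pi * norm G * norm (L_twist F ch (1/2)) \<le> 4 * B + (2 * pi * norm G * norm I1 + 2 * pi * norm G * norm I2)" .
      define c where "c = 2 * pi * norm G"
      have c: "c > 0" using G by (simp add: c_def)
      have "c * norm (L_twist F ch (1/2)) \<le> c * (norm I1 + norm I2 + 4 * B / c)"
        using * c by (simp add: distrib_left flip: c_def)
      then have "norm (L_twist F ch (1/2)) \<le> norm I1 + norm I2 + 4 * B / c"
        using c by (simp only: mult_le_cancel_left_pos)
      moreover have "4 * B / c \<le> C * real q ^ (2 * d) * exp (- H\<^sup>2 / 2)"
      proof -
        define K where "K = 4 * CL * CN * (2 + A) ^ d * AP * exp 1"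
        have K: "K \<ge> 0" using CL CN AP by (simp add: K_def)
        have "4 * B = K * real q ^ (2 * d) * (exp (3 * real d * H) * exp (- H\<^sup>2))"
        proof -
          have "exp (3 * real d * H) = exp (real d * H) * exp (2 * real d * H)" by (simp flip: exp_add)
          moreover have "real q ^ (2 * d) = real q ^ d * real q ^ d" by (simp add: power_add[symmetric] mult_2)
          ultimately show ?thesis by (simp only: B_def K_def mult_ac)
        qed
        also have "\<dots> \<le> K * real q ^ (2 * d) * (exp ((3 * real d)\<^sup>2 / 2) * exp (- H\<^sup>2 / 2))"
          using K by (intro mult_left_mono exp_linear_minus_square_le) auto
        finally have B4: "4 * B \<le> K * real q ^ (2 * d) * (exp ((3 * real d)\<^sup>2 / 2) * exp (- H\<^sup>2 / 2))" .
        have "4 * B / c \<le> 4 * B / norm G"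
          unfolding c_def using Bpos G pi_gt3 mult_right_mono[of 1 "2 * pi" "norm G"] by (intro divide_left_mono) auto
        also have "\<dots> \<le> K * real q ^ (2 * d) * (exp ((3 * real d)\<^sup>2 / 2) * exp (- H\<^sup>2 / 2)) / norm G"
          using B4 by (intro divide_right_mono) auto
        also have "\<dots> = (K * exp ((3 * real d)\<^sup>2 / 2) / norm G) * (real q ^ (2 * d) * exp (- H\<^sup>2 / 2))" by simp
        also have "\<dots> \<le> C * (real q ^ (2 * d) * exp (- H\<^sup>2 / 2))" using C(4) unfolding K_def by (intro mult_right_mono) auto
        finally show ?thesis by (simp add: mult_ac)
      qed
      ultimately have fin: "norm (L_twist F ch (1/2)) \<le> norm I1 + norm I2 + C * real q ^ (2 * d) * exp (- H\<^sup>2 / 2)" by linarith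
      show "approx_fun_eq C q ch H"
        using w1 w2 fin unfolding approx_fun_eq_def afe_weight_def I1_def I2_def by (intro exI[of _ w1] exI[of _ w2]) auto
    qed
  qed
qed

lemma approx_fun_eq_mono:
  assumes "approx_fun_eq C q ch H" "1 \<le> C" "C \<le> D"
  shows "approx_fun_eq D q ch H"
proof -
  have weight: "afe_weight D q w" if "afe_weight C q w" for w
    unfolding afe_weight_def
  proof (intro conjI allI impI)
    show "w holomorphic_on {s. Re s > 0}" using that by (simp add: afe_weight_def)
    fix s assume s: "0 < Re s" "Re s \<le> 1"
    then have "norm (w s) \<le> C * (C * real q ^ d) powr (Re s / 2) * exp (- (Im s)\<^sup>2 / 2) / norm s"
      using that by (simp add: afe_weight_def)
    also have "\<dots> \<le> D * (D * real q ^ d) powr (Re s / 2) * exp (- (Im s)\<^sup>2 / 2) / norm s"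
      using assms(2,3) s by (intro divide_right_mono mult_right_mono mult_mono powr_mono2) auto
    finally show "norm (w s) \<le> D * (D * real q ^ d) powr (Re s / 2) * exp (- (Im s)\<^sup>2 / 2) / norm s" .
  qed
  have "C * real q ^ (2 * d) * exp (- H\<^sup>2 / 2) \<le> D * real q ^ (2 * d) * exp (- H\<^sup>2 / 2)"
    using assms(3) by (intro mult_right_mono) auto
  then show ?thesis using assms(1) weight unfolding approx_fun_eq_def by (meson add_left_mono order_trans)
qed

lemma approx_functional_equation:
  obtains C where "C \<ge> 1" "\<And>q ch H. q \<ge> 2 \<Longrightarrow> primitive_char q ch \<Longrightarrow> H \<ge> 1 \<Longrightarrow> approx_fun_eq C q ch H"
proof -
  from approx_functional_equation_parity[of 1] obtain C1 where C1: "C1 \<ge> 1 \<and> (\<forall>q ch H. q \<ge> 2 \<longrightarrow> primitive_char q ch \<longrightarrow> ch (-1) = 1 \<longrightarrow> H \<ge> 1 \<longrightarrow> approx_fun_eq C1 q ch H)" ..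
  from approx_functional_equation_parity[of "-1"] obtain C2 where C2: "C2 \<ge> 1 \<and> (\<forall>q ch H. q \<ge> 2 \<longrightarrow> primitive_char q ch \<longrightarrow> ch (-1) = -1 \<longrightarrow> H \<ge> 1 \<longrightarrow> approx_fun_eq C2 q ch H)" ..
  have "approx_fun_eq (max C1 C2) q ch H" if q: "q \<ge> 2" "primitive_char q ch" and "H \<ge> 1" for q ch H
    using ch_sign[OF q] C1 C2 that approx_fun_eq_mono[of C1 q ch H "max C1 C2"] approx_fun_eq_mono[of C2 q ch H "max C1 C2"]
    by auto
  moreover have "max C1 C2 \<ge> 1" using C1 by (simp add: le_max_iff_disj)
  ultimately show ?thesis using that by blast
qed

end

section \<open>The Euler product and sums over primes\<close>

text \<open>The complete homogeneous symmetric polynomial of degree r in a 0, ..., a (m - 1): the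
  coefficients of an Euler factor with roots a j.\<close>

definition hsum :: "(nat \<Rightarrow> complex) \<Rightarrow> nat \<Rightarrow> nat \<Rightarrow> complex" where
  "hsum a m r = (\<Sum>rs | length rs = m \<and> sum_list rs = r. \<Prod>j<m. a j ^ (rs ! j))"

lemma finite_compositions: "finite {xs :: nat list. length xs = m \<and> sum_list xs = k}"
proof (rule finite_subset)
  show "{xs. length xs = m \<and> sum_list xs = k} \<subseteq> {xs. set xs \<subseteq> {..k} \<and> length xs = m}"
    by (auto intro: member_le_sum_list)
qed (rule finite_lists_length_eq, simp)

lemma hsum_0: "hsum a 0 r = (if r = 0 then 1 else 0)"
proof -
  have "{rs :: nat list. length rs = 0 \<and> sum_list rs = r} = (if r = 0 then {[]} else {})" by auto
  then show ?thesis by (simp add: hsum_def)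
qed

lemma hsum_Suc: "hsum a (Suc m) r = (\<Sum>k\<le>r. hsum a m k * a m ^ (r - k))"
proof -
  have "(\<Sum>k\<le>r. hsum a m k * a m ^ (r - k)) =
     (\<Sum>k\<le>r. \<Sum>xs | length xs = m \<and> sum_list xs = k. (\<Prod>j<m. a j ^ (xs ! j)) * a m ^ (r - k))"
    by (simp add: hsum_def sum_distrib_right)
  also have "\<dots> = (\<Sum>(k, xs)\<in>Sigma {..r} (\<lambda>k. {xs. length xs = m \<and> sum_list xs = k}). (\<Prod>j<m. a j ^ (xs ! j)) * a m ^ (r - k))"
    by (rule sum.Sigma) (auto simp: finite_compositions)
  also have "\<dots> = hsum a (Suc m) r"
    unfolding hsum_def
  proof (rule sum.reindex_bij_witness[of _ "\<lambda>rs. (sum_list (butlast rs), butlast rs)" "\<lambda>(k, xs). xs @ [r - k]"], goal_cases)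
    case (2 b)
    then show ?case by auto
  next
    case (3 b)
    then have "b \<noteq> []" by auto
    then have s: "r = sum_list (butlast b) + last b" using 3
      by (metis (mono_tags, lifting) append_butlast_last_id mem_Collect_eq sum_list.Nil sum_list.Cons sum_list.append add_0_right)
    then show ?case using \<open>b \<noteq> []\<close> by simp
  next
    case (4 b)
    then have "b \<noteq> []" by auto
    then have s: "r = sum_list (butlast b) + last b" using 4
      by (metis (mono_tags, lifting) append_butlast_last_id mem_Collect_eq sum_list.Nil sum_list.Cons sum_list.append add_0_right)
    then show ?case using 4 by auto
  next
    case (5 a)
    then show ?case by (auto simp: nth_append intro!: prod.cong)
  qed auto
  finally show ?thesis ..
qed

lemma hsum_at_0: "hsum a m 0 = 1"
  by (induction m) (simp_all add: hsum_0 hsum_Suc)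

lemma hsum_at_1: "hsum a m 1 = (\<Sum>j<m. a j)"
proof (induction m)
  case (Suc m)
  have "hsum a (Suc m) 1 = hsum a m 0 * a m + hsum a m 1"
    unfolding hsum_Suc by (simp add: atMost_Suc)
  then show ?case using Suc by (simp add: hsum_at_0)
qed (simp add: hsum_0)

lemma hsum_fps: "Abs_fps (hsum a m) * fps_of_poly (\<Prod>j<m. [:1, - a j:]) = 1"
proof (induction m)
  case 0
  show ?case by (rule fps_ext) (simp add: hsum_0)
next
  case (Suc m)
  have geo: "Abs_fps (\<lambda>r. c ^ r) * fps_of_poly [:1, - c:] = 1" for c :: complex
  proof -
    have "fps_of_poly [:1, - c:] = 1 - fps_const c * fps_X"
      by (rule fps_ext) (auto simp: coeff_pCons split: nat.splits)
    moreover have "Abs_fps (\<lambda>r. c ^ r) * (1 - fps_const c * fps_X) = 1"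
    proof (rule fps_ext)
      fix n show "(Abs_fps (\<lambda>r. c ^ r) * (1 - fps_const c * fps_X)) $ n = (1 :: complex fps) $ n"
        by (cases n) (simp_all add: right_diff_distrib fps_mult_right_const_nth mult.assoc[symmetric])
    qed
    ultimately show ?thesis by (simp only:)
  qed
  have "Abs_fps (hsum a (Suc m)) = Abs_fps (hsum a m) * Abs_fps (\<lambda>r. a m ^ r)"
    by (rule fps_ext) (simp add: fps_mult_nth hsum_Suc atMost_atLeast0)
  then have "Abs_fps (hsum a (Suc m)) * fps_of_poly (\<Prod>j<Suc m. [:1, - a j:]) =
     (Abs_fps (hsum a m) * fps_of_poly (\<Prod>j<m. [:1, - a j:])) * (Abs_fps (\<lambda>r. a m ^ r) * fps_of_poly [:1, - a m:])"
    by (simp add: fps_of_poly_mult mult_ac)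
  then show ?case unfolding Suc geo by simp
qed

text \<open>Polynomially bounded coefficients give the power series of \<open>hsum a m\<close> a
  radius of convergence of at least 1. If |a j| > 1, the point 1 / a j lies inside the disc, and
  there the identity of \<open>hsum_fps\<close> would read 1 = (finite value) * 0.\<close>

lemma hsum_roots_le_1:
  assumes bd: "\<And>r. norm (hsum a m r) \<le> (real r + 1) ^ k" and "j < m"
  shows "norm (a j) \<le> 1"
proof (rule ccontr)
  assume "\<not> norm (a j) \<le> 1"
  then have aj: "norm (a j) > 1" by simp
  define x where "x = inverse (a j)"
  have "a j \<noteq> 0" using aj by auto
  then have x: "norm x < 1" "a j * x = 1" using aj by (simp_all add: x_def norm_inverse inverse_less_1_iff)
  have "fps_conv_radius (Abs_fps (hsum a m)) \<ge> 1"
    unfolding fps_conv_radius_def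
  proof (rule conv_radius_geI_ex)
    fix r :: real assume r: "0 < r" "ereal r < 1"
    then have r1: "r < 1" by simp
    have "summable (\<lambda>n. (real n + 1) ^ k * r ^ n)"
    proof (rule summable_comparison_test_bigo)
      show "(\<lambda>n. (real n + 1) ^ k * r ^ n) \<in> O(\<lambda>n. 1 / real n ^ 2)" using r(1) r1 by real_asymp
      show "summable (\<lambda>n. norm (1 / real n ^ 2))"
        using inverse_power_summable[of 2, where 'a = real] by (simp add: field_simps)
    qed
    then have "summable (\<lambda>n. hsum a m n * of_real r ^ n)"
      by (rule summable_comparison_test[rotated])
         (use bd r in \<open>auto simp: norm_mult norm_power intro!: exI[of _ 0] mult_right_mono\<close>)
    then show "\<exists>z. norm z = r \<and> summable (\<lambda>n. fps_nth (Abs_fps (hsum a m)) n * z ^ n)"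
      using r by (intro exI[of _ "of_real r"]) auto
  qed
  then have 1: "ereal (norm x) < fps_conv_radius (Abs_fps (hsum a m))"
    by (rule less_le_trans[rotated]) (use x(1) in \<open>simp add: one_ereal_def\<close>)
  have 2: "ereal (norm x) < fps_conv_radius (fps_of_poly (\<Prod>j<m. [:1, - a j:]))" by simp
  have "1 = eval_fps (Abs_fps (hsum a m) * fps_of_poly (\<Prod>j<m. [:1, - a j:])) x"
    unfolding hsum_fps by simp
  also have "\<dots> = eval_fps (Abs_fps (hsum a m)) x * poly (\<Prod>j<m. [:1, - a j:]) x"
    by (simp only: eval_fps_mult[OF 1 2] eval_fps_of_poly)
  also have "poly (\<Prod>j<m. [:1, - a j:]) x = 0"
    using assms(2) x(2) by (auto simp: poly_prod mult.commute intro!: bexI[of _ j])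
  finally show False by simp
qed

text \<open>Each of the k entries is one of the r + 1 divisors of p^r; the condition on their
  product is dropped.\<close>

lemma divisor_fold_prime_power:
  assumes "prime p"
  shows "divisor_fold k (p ^ r) \<le> (r + 1) ^ k"
proof -
  have "{xs :: nat list. length xs = k \<and> prod_list xs = p ^ r} \<subseteq> {xs. set xs \<subseteq> (\<lambda>i. p ^ i) ` {..r} \<and> length xs = k}"
  proof (intro subsetI CollectI conjI)
    fix xs x :: "nat list" and y assume xs: "xs \<in> {xs. length xs = k \<and> prod_list xs = p ^ r}"
    then show "length xs = k" by simp
    assume "y \<in> set xs"
    then have "y dvd p ^ r" using prod_list_dvd[of y xs] xs by simp
    then show "y \<in> (\<lambda>i. p ^ i) ` {..r}" using divides_primepow_nat[OF assms] by auto
  qed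
  then have "divisor_fold k (p ^ r) \<le> card {xs. set xs \<subseteq> (\<lambda>i. p ^ i) ` {..r} \<and> length xs = k}"
    unfolding divisor_fold_def by (intro card_mono finite_lists_length_eq) auto
  also have "\<dots> = card ((\<lambda>i. p ^ i) ` {..r}) ^ k" by (rule card_lists_length_eq) simp
  also have "\<dots> \<le> (r + 1) ^ k" using card_image_le[of "{..r}" "\<lambda>i. p ^ i"] by (intro power_mono) auto
  finally show ?thesis .
qed

text \<open>By the mean value theorem, the term at n is at most 1/\<delta> times the decrease of
  x^(-\<delta>) from n - 1 to n, so the sum telescopes. Starting at n = 2 keeps the bound at
  1/\<delta>.\<close>

lemma powr_sum_bound:
  assumes "\<delta> > 0"
  shows "summable (\<lambda>n. if n \<ge> 2 then real n powr (-1 - \<delta>) else 0)"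
    and "(\<Sum>n. if n \<ge> 2 then real n powr (-1 - \<delta>) else 0) \<le> 1 / \<delta>"
proof -
  define f where "f n = (if n \<ge> 2 then real n powr (-1 - \<delta>) else 0)" for n :: nat
  have step: "real n powr (-1 - \<delta>) \<le> (real (n - 1) powr -\<delta> - real n powr -\<delta>) / \<delta>" if "n \<ge> 2" for n
  proof -
    have "\<exists>z. real n - 1 < z \<and> z < real n \<and> real n powr -\<delta> - (real n - 1) powr -\<delta> = (real n - (real n - 1)) * (-\<delta> * z powr (-\<delta> - 1))"
      by (rule MVT2) (use that in \<open>auto intro!: derivative_eq_intros simp: powr_diff\<close>)
    then obtain z where z: "real n - 1 < z" "z < real n" "real n powr -\<delta> - (real n - 1) powr -\<delta> = -\<delta> * z powr (-\<delta> - 1)"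
      by auto
    have "real n powr (-1 - \<delta>) \<le> z powr (-1 - \<delta>)"
      using z that assms by (intro powr_mono2') auto
    also have "\<dots> = (real (n - 1) powr -\<delta> - real n powr -\<delta>) / \<delta>"
    proof -
      have e: "- \<delta> - 1 = - 1 - \<delta>" by simp
      show ?thesis using z(3)[unfolded e] that assms by (simp add: of_nat_diff field_simps)
    qed
    finally show ?thesis .
  qed
  have part: "(\<Sum>n<Suc N. f n) \<le> (1 - real N powr -\<delta>) / \<delta>" if "N \<ge> 1" for N
    using that
  proof (induction N rule: dec_induct)
    case base
    then show ?case by (simp add: f_def)
  next
    case (step N)
    then show ?case using \<open>\<And>n. n \<ge> 2 \<Longrightarrow> real n powr (-1 - \<delta>) \<le> _\<close>[of "Suc N"] assms
      by (simp add: f_def field_simps)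
  qed
  have le: "(\<Sum>n<N. f n) \<le> 1 / \<delta>" for N
  proof -
    have "(\<Sum>n<N. f n) \<le> (\<Sum>n<Suc (Suc N). f n)" by (intro sum_mono2) (auto simp: f_def)
    also have "\<dots> \<le> (1 - real (Suc N) powr -\<delta>) / \<delta>" by (rule part) simp
    also have "\<dots> \<le> 1 / \<delta>" using assms by (intro divide_right_mono) auto
    finally show ?thesis .
  qed
  have s: "summable f" by (rule summableI_nonneg_bounded[OF _ le]) (simp add: f_def)
  then show "summable (\<lambda>n. if n \<ge> 2 then real n powr (-1 - \<delta>) else 0)" unfolding f_def .
  show "(\<Sum>n. if n \<ge> 2 then real n powr (-1 - \<delta>) else 0) \<le> 1 / \<delta>"
    using suminf_le_const[OF s le] unfolding f_def .
qed

lemma holomorphic_suminf_halfplane: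
  fixes f :: "nat \<Rightarrow> complex \<Rightarrow> complex"
  assumes hol: "\<And>n. f n holomorphic_on {z. Re z > a}"
    and M: "\<And>b. b > a \<Longrightarrow> \<exists>M. summable M \<and> (\<forall>n z. Re z \<ge> b \<longrightarrow> norm (f n z) \<le> M n)"
  shows "(\<lambda>z. \<Sum>n. f n z) holomorphic_on {z. Re z > a}"
proof (rule holomorphic_uniform_sequence)
  show "open {z. Re z > a}" by (rule open_halfspace_Re_gt)
  show "(\<lambda>z. \<Sum>n<N. f n z) holomorphic_on {z. Re z > a}" for N
    by (intro holomorphic_intros hol)
  fix x assume x: "x \<in> {z. Re z > a}"
  define e where "e = (Re x - a) / 2"
  have e: "e > 0" using x by (simp add: e_def)
  have sub: "Re z \<ge> a + e" if "z \<in> cball x e" for z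
  proof -
    have "Re x = a + 2 * e" by (simp add: e_def field_simps)
    moreover have "\<bar>Re x - Re z\<bar> \<le> e" using that abs_Re_le_cmod[of "x - z"] by (simp add: dist_norm)
    ultimately show ?thesis by linarith
  qed
  obtain M where M: "summable M" "\<And>n z. Re z \<ge> a + e \<Longrightarrow> norm (f n z) \<le> M n"
    using assms(2)[of "a + e"] e by auto
  have "uniform_limit (cball x e) (\<lambda>N z. \<Sum>n<N. f n z) (\<lambda>z. \<Sum>n. f n z) sequentially"
    by (rule Weierstrass_m_test[OF _ M(1)]) (use M(2) sub in auto)
  moreover have "cball x e \<subseteq> {z. Re z > a}" using sub e by force
  ultimately show "\<exists>d>0. cball x d \<subseteq> {z. Re z > a} \<and> uniform_limit (cball x d) (\<lambda>N z. \<Sum>n<N. f n z) (\<lambda>z. \<Sum>n. f n z) sequentially"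
    using e by blast
qed

locale lfun_tau = lfun +
  assumes tau_bound: "\<And>n. n \<ge> 1 \<Longrightarrow> norm (lf_coeff F n) \<le> real (divisor_fold (lf_degree F) n)"
begin

lemma norm_lam_prime_power:
  assumes "prime p"
  shows "norm (lam (p ^ r)) \<le> (real r + 1) ^ d"
proof -
  have "p ^ r \<ge> 1" using prime_gt_0_nat[OF assms] by simp
  then have "norm (lam (p ^ r)) \<le> real (divisor_fold d (p ^ r))" by (rule tau_bound)
  also have "\<dots> \<le> real ((r + 1) ^ d)" using divisor_fold_prime_power[OF assms] by (simp only: of_nat_le_iff)
  finally show ?thesis by (simp add: add.commute)
qed

lemma lam_prime_power:
  assumes "prime p"
  shows "lam (p ^ r) = hsum (\<lambda>j. lf_alpha F j p) d r"
  using framework assms unfolding L_framework_def multiplicative_coeffs_def hsum_def by blast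

text \<open>(A1) at the powers of p bounds the homogeneous polynomials in the local roots by a power
  of r + 1, and \<open>hsum_roots_le_1\<close> turns this into the Ramanujan bound for the
  roots.\<close>

lemma norm_alpha_le_1:
  assumes "prime p" "j < d"
  shows "norm (lf_alpha F j p) \<le> 1"
  using hsum_roots_le_1[of "\<lambda>j. lf_alpha F j p" d d j] norm_lam_prime_power[OF assms(1)] lam_prime_power[OF assms(1)] assms(2)
  by simp

lemma lam_prime: "prime p \<Longrightarrow> lam p = (\<Sum>j<d. lf_alpha F j p)"
  using lam_prime_power[of p 1] by (simp only: power_one_right hsum_at_1)

lemma norm_lam_prime_le: "prime p \<Longrightarrow> norm (lam p) \<le> real d"
proof -
  assume p: "prime p"
  have "norm (lam p) \<le> (\<Sum>j<d. norm (lf_alpha F j p))" unfolding lam_prime[OF p] by (rule norm_sum)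
  also have "\<dots> \<le> (\<Sum>j<d. 1)" by (intro sum_mono norm_alpha_le_1 p) auto
  finally show ?thesis by simp
qed

section \<open>The logarithm of the Euler product\<close>

definition prime_term :: "(int \<Rightarrow> complex) \<Rightarrow> complex \<Rightarrow> nat \<Rightarrow> complex" where
  "prime_term ch s n = (if prime n then lam n * ch (int n) / of_nat n powr s else 0)"

definition prime_series :: "(int \<Rightarrow> complex) \<Rightarrow> complex \<Rightarrow> complex" where
  "prime_series ch s = (\<Sum>n. prime_term ch s n)"

definition log_term :: "(int \<Rightarrow> complex) \<Rightarrow> complex \<Rightarrow> nat \<Rightarrow> complex" where
  "log_term ch s n = (if prime n then \<Sum>j<d. - Ln (1 - lf_alpha F j n * ch (int n) / of_nat n powr s)
     - lf_alpha F j n * ch (int n) / of_nat n powr s else 0)"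

definition log_series :: "(int \<Rightarrow> complex) \<Rightarrow> complex \<Rightarrow> complex" where
  "log_series ch s = (\<Sum>n. log_term ch s n)"

definition log_const :: real where
  "log_const = 2 * real d / (1 - 2 powr (-3/4))"

context
  fixes q ch
  assumes q: "q \<ge> 2" and prim: "primitive_char q ch"
begin

lemma norm_ch: "norm (ch n) \<le> 1" by (rule norm_char_le[OF q prim])

lemma norm_prime_term_le: "norm (prime_term ch s n) \<le> real d * (if n \<ge> 2 then real n powr - Re s else 0)"
proof (cases "prime n")
  case True
  then have n: "n \<ge> 2" by (rule prime_ge_2_nat)
  have "norm (prime_term ch s n) = norm (lam n) * norm (ch (int n)) * real n powr - Re s"
    using True n by (simp add: prime_term_def norm_divide norm_mult norm_of_nat_powr powr_minus field_simps)
  also have "\<dots> \<le> real d * 1 * real n powr - Re s"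
    by (intro mult_right_mono mult_mono norm_lam_prime_le True norm_ch) auto
  finally show ?thesis using n by simp
qed (simp add: prime_term_def)

lemma prime_term_bound:
  assumes "\<delta> > 0" "Re s \<ge> 1 + \<delta>"
  shows "norm (prime_term ch s n) \<le> real d * (if n \<ge> 2 then real n powr (-1 - \<delta>) else 0)"
proof -
  have "norm (prime_term ch s n) \<le> real d * (if n \<ge> 2 then real n powr - Re s else 0)" by (rule norm_prime_term_le)
  also have "\<dots> \<le> real d * (if n \<ge> 2 then real n powr (-1 - \<delta>) else 0)"
    using assms by (intro mult_left_mono) (auto intro!: powr_mono)
  finally show ?thesis .
qed

lemma summable_prime_term:
  assumes "Re s > 1"
  shows "summable (prime_term ch s)"
proof -
  have "summable (\<lambda>n. real d * (if n \<ge> 2 then real n powr (-1 - (Re s - 1)) else 0))"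
    using assms by (intro summable_mult powr_sum_bound) auto
  then show ?thesis
    by (rule summable_comparison_test[rotated])
       (use prime_term_bound[of "Re s - 1" s] assms in auto)
qed

lemma norm_prime_series_le:
  assumes "\<delta> > 0" "Re s \<ge> 1 + \<delta>"
  shows "norm (prime_series ch s) \<le> real d / \<delta>"
proof -
  have s: "summable (\<lambda>n. real d * (if n \<ge> 2 then real n powr (-1 - \<delta>) else 0))"
    using assms by (intro summable_mult powr_sum_bound) auto
  have "norm (prime_series ch s) \<le> (\<Sum>n. real d * (if n \<ge> 2 then real n powr (-1 - \<delta>) else 0))"
    unfolding prime_series_def by (rule norm_suminf_le[OF _ s]) (rule prime_term_bound[OF assms])
  also have "\<dots> = real d * (\<Sum>n. if n \<ge> 2 then real n powr (-1 - \<delta>) else 0)"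
    by (rule suminf_mult[OF powr_sum_bound(1)[OF assms(1)]])
  also have "\<dots> \<le> real d * (1 / \<delta>)" by (intro mult_left_mono powr_sum_bound assms) auto
  finally show ?thesis by simp
qed

lemma prime_series_holomorphic: "prime_series ch holomorphic_on {s. Re s > 1}"
proof -
  have "(\<lambda>s. \<Sum>n. prime_term ch s n) holomorphic_on {s. Re s > 1}"
  proof (rule holomorphic_suminf_halfplane)
    show "(\<lambda>s. prime_term ch s n) holomorphic_on {s. Re s > 1}" for n
      by (cases "prime n") (auto simp: prime_term_def prime_gt_0_nat intro!: holomorphic_intros)
    fix b :: real assume b: "b > 1"
    show "\<exists>M. summable M \<and> (\<forall>n z. b \<le> Re z \<longrightarrow> norm (prime_term ch z n) \<le> M n)"
      using b prime_term_bound[of "b - 1"]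
      by (intro exI[of _ "\<lambda>n. real d * (if n \<ge> 2 then real n powr (-1 - (b - 1)) else 0)"] conjI summable_mult powr_sum_bound) auto
  qed
  then show ?thesis unfolding prime_series_def .
qed

lemma euler_local_bound:
  assumes "prime n" "j < d" "Re s \<ge> 3/4"
  shows "norm (lf_alpha F j n * ch (int n) / of_nat n powr s) \<le> real n powr (-3/4)"
    and "norm (lf_alpha F j n * ch (int n) / of_nat n powr s) \<le> 2 powr (-3/4)"
proof -
  have n: "n \<ge> 2" using assms(1) by (rule prime_ge_2_nat)
  have "norm (lf_alpha F j n * ch (int n) / of_nat n powr s) = norm (lf_alpha F j n) * norm (ch (int n)) * real n powr - Re s"
    using n by (simp add: norm_divide norm_mult norm_of_nat_powr powr_minus field_simps)
  also have "\<dots> \<le> 1 * 1 * real n powr (-3/4)"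
    using assms n by (intro mult_mono norm_alpha_le_1 norm_ch powr_mono) auto
  finally show *: "norm (lf_alpha F j n * ch (int n) / of_nat n powr s) \<le> real n powr (-3/4)" by simp
  also have "\<dots> \<le> 2 powr (-3/4)" using n by (intro powr_mono2') auto
  finally show "norm (lf_alpha F j n * ch (int n) / of_nat n powr s) \<le> 2 powr (-3/4)" .
qed

lemma two_powr_lt: "2 powr (-3/4) < (1::real)"
  using powr_less_mono[of "-3/4" 0 "2::real"] by simp

lemma log_term_bound:
  assumes "Re s \<ge> 3/4"
  shows "norm (log_term ch s n) \<le> real d / (1 - 2 powr (-3/4)) * (if n \<ge> 2 then real n powr (-1 - 1/2) else 0)"
proof (cases "prime n")
  case True
  then have n: "n \<ge> 2" by (rule prime_ge_2_nat)
  have "norm (log_term ch s n) \<le> (\<Sum>j<d. real n powr (-1 - 1/2) / (1 - 2 powr (-3/4)))"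
    unfolding log_term_def if_P[OF True]
  proof (rule sum_norm_le)
    fix j assume j: "j \<in> {..<d}"
    define z where "z = lf_alpha F j n * ch (int n) / of_nat n powr s"
    have z: "norm z \<le> real n powr (-3/4)" "norm z \<le> 2 powr (-3/4)"
      unfolding z_def using euler_local_bound[OF True _ assms, of j] j by simp_all
    then have z1: "norm (- z) < 1" using two_powr_lt by simp
    have "norm (- Ln (1 - z) - z) = norm (Ln (1 + - z) - (- z))"
      using norm_minus_cancel[of "Ln (1 + - z) - (- z)"] by simp
    also have "\<dots> \<le> (norm z)\<^sup>2 / (1 - norm z)" using Ln_approx_linear[OF z1] by simp
    also have "\<dots> \<le> (real n powr (-3/4))\<^sup>2 / (1 - 2 powr (-3/4))"
      using z two_powr_lt by (intro frac_le power_mono) auto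
    also have "(real n powr (-3/4))\<^sup>2 = real n powr (-1 - 1/2)"
      using n by (simp add: power2_eq_square flip: powr_add)
    finally show "norm (- Ln (1 - lf_alpha F j n * ch (int n) / of_nat n powr s) - lf_alpha F j n * ch (int n) / of_nat n powr s)
      \<le> real n powr (-1 - 1/2) / (1 - 2 powr (-3/4))" unfolding z_def .
  qed
  then show ?thesis using n by simp
next
  case False
  then show ?thesis using two_powr_lt by (simp add: log_term_def)
qed

lemma summable_log_term: "Re s \<ge> 3/4 \<Longrightarrow> summable (log_term ch s)"
  by (rule summable_comparison_test[OF _ summable_mult[OF powr_sum_bound(1)[of "1/2"]], of _ "real d / (1 - 2 powr (-3/4))"])
     (use log_term_bound in auto)

lemma norm_log_series_le:
  assumes "Re s \<ge> 3/4"
  shows "norm (log_series ch s) \<le> log_const"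
proof -
  have s: "summable (\<lambda>n. real d / (1 - 2 powr (-3/4)) * (if n \<ge> 2 then real n powr (-1 - 1/2) else 0))"
    by (intro summable_mult powr_sum_bound) auto
  have "norm (log_series ch s) \<le> (\<Sum>n. real d / (1 - 2 powr (-3/4)) * (if n \<ge> 2 then real n powr (-1 - 1/2) else 0))"
    unfolding log_series_def by (rule norm_suminf_le[OF _ s]) (rule log_term_bound[OF assms])
  also have "\<dots> = real d / (1 - 2 powr (-3/4)) * (\<Sum>n. if n \<ge> 2 then real n powr (-1 - 1/2) else 0)"
    by (rule suminf_mult[OF powr_sum_bound(1)]) simp
  also have "\<dots> \<le> real d / (1 - 2 powr (-3/4)) * (1 / (1/2))"
    using two_powr_lt by (intro mult_left_mono powr_sum_bound) auto
  finally show ?thesis by (simp add: log_const_def mult.commute)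
qed

lemma log_series_holomorphic: "log_series ch holomorphic_on {s. Re s > 3/4}"
proof -
  have "(\<lambda>s. \<Sum>n. log_term ch s n) holomorphic_on {s. Re s > 3/4}"
  proof (rule holomorphic_suminf_halfplane)
    fix n
    show "(\<lambda>s. log_term ch s n) holomorphic_on {s. Re s > 3/4}"
    proof (cases "prime n")
      case True
      have "1 - lf_alpha F j n * ch (int n) / of_nat n powr s \<notin> \<real>\<^sub>\<le>\<^sub>0" if "j < d" "Re s > 3/4" for j s
      proof -
        have "norm (lf_alpha F j n * ch (int n) / of_nat n powr s) < 1"
          using euler_local_bound(2)[OF True that(1), of s] that two_powr_lt by simp
        then have "Re (1 - lf_alpha F j n * ch (int n) / of_nat n powr s) > 0"
          using complex_Re_le_cmod[of "lf_alpha F j n * ch (int n) / of_nat n powr s"] by simp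
        then show ?thesis by (auto simp: complex_nonpos_Reals_iff)
      qed
      then show ?thesis using prime_gt_0_nat[OF True] unfolding log_term_def if_P[OF True]
        by (intro holomorphic_intros) auto
    qed (simp add: log_term_def)
  next
    fix b :: real assume b: "b > 3/4"
    show "\<exists>M. summable M \<and> (\<forall>n z. b \<le> Re z \<longrightarrow> norm (log_term ch z n) \<le> M n)"
      using b log_term_bound
      by (intro exI[of _ "\<lambda>n. real d / (1 - 2 powr (-3/4)) * (if n \<ge> 2 then real n powr (-1 - 1/2) else 0)"] conjI summable_mult powr_sum_bound) auto
  qed
  then show ?thesis unfolding log_series_def .
qed

lemma L_twist_eq_exp:
  assumes s: "Re s > 1"
  shows "L_twist F ch s = exp (prime_series ch s + log_series ch s)"
proof -
  have "L_twist F ch s = prodinf (euler_factor F ch s)"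
    using twist_framework(1)[OF q prim] s L_twist_eq_series[OF q prim s] by (simp add: euler_product_converges_def)
  also have "euler_factor F ch s = (\<lambda>n. exp (prime_term ch s n + log_term ch s n))"
  proof
    fix n
    show "euler_factor F ch s n = exp (prime_term ch s n + log_term ch s n)"
    proof (cases "prime n")
      case True
      define z where "z j = lf_alpha F j n * ch (int n) / of_nat n powr s" for j
      have z: "1 - z j \<noteq> 0" if "j < d" for j
        using euler_local_bound(2)[OF True that, of s] s two_powr_lt by (auto simp: z_def)
      have "prime_term ch s n = (\<Sum>j<d. z j)"
        using True by (simp add: prime_term_def lam_prime z_def sum_distrib_right sum_divide_distrib)
      then have "prime_term ch s n + log_term ch s n = (\<Sum>j<d. - Ln (1 - z j))"
        using True by (simp add: log_term_def z_def flip: sum.distrib)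
      then have "exp (prime_term ch s n + log_term ch s n) = (\<Prod>j<d. exp (- Ln (1 - z j)))" by (simp add: exp_sum)
      also have "\<dots> = (\<Prod>j<d. inverse (1 - z j))"
        by (intro prod.cong refl) (use z in \<open>auto simp: exp_minus\<close>)
      finally show ?thesis using True by (simp add: euler_factor_def z_def)
    qed (simp add: euler_factor_def prime_term_def log_term_def)
  qed
  also have "prodinf \<dots> = exp (\<Sum>n. prime_term ch s n + log_term ch s n)"
    using s by (intro prodinf_exp summable_add summable_prime_term summable_log_term) auto
  also have "(\<Sum>n. prime_term ch s n + log_term ch s n) = prime_series ch s + log_series ch s"
    unfolding prime_series_def log_series_def using s
    by (intro suminf_add[symmetric] summable_prime_term summable_log_term) auto
  finally show ?thesis .
qed

text \<open>The convex zero-free region carries a holomorphic logarithm of the L-function. For Re s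
  > 1 it differs from the logarithm of the Euler product by a constant whose exponential is 1; after
  this correction, subtracting \<open>log_series\<close> extends \<open>prime_series\<close>. An
  upper bound for |L| controls only the real part of the logarithm, and Borel-Caratheodory turns
  this into a bound for its modulus.\<close>

lemma prime_series_extension:
  assumes \<rho>: "0 < \<rho>" "\<rho> \<le> 1/4" and "T > 1" "M > 0"
    and nz: "\<And>z. Re z > 1 - \<rho> \<Longrightarrow> \<bar>Im z\<bar> < T \<Longrightarrow> L_twist F ch z \<noteq> 0"
    and bd: "\<And>z. Re z > 1 - \<rho> \<Longrightarrow> Re z < 3/2 \<Longrightarrow> \<bar>Im z\<bar> < T \<Longrightarrow> norm (L_twist F ch z) < exp M"
  shows "\<exists>l. l holomorphic_on {z. Re z > 1 - \<rho> \<and> \<bar>Im z\<bar> < T} \<and>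
     (\<forall>z. Re z > 1 \<longrightarrow> \<bar>Im z\<bar> < T \<longrightarrow> l z = prime_series ch z) \<and>
     (\<forall>z. 1 - \<rho> / 4 \<le> Re z \<longrightarrow> Re z \<le> 1 + \<rho> / 4 \<longrightarrow> \<bar>Im z\<bar> \<le> T - 1 \<longrightarrow>
        norm (l z) \<le> 2 * M + 3 * (4 * real d / \<rho> + log_const) + log_const)"
proof -
  define R where "R = {z. Re z > 1 - \<rho> \<and> \<bar>Im z\<bar> < T}"
  have R_eq: "R = {z. Re z > 1 - \<rho>} \<inter> {z. Im z < T} \<inter> {z. Im z > - T}" by (auto simp: R_def)
  have R: "open R" "convex R"
    unfolding R_eq by (intro open_Int open_halfspace_Re_gt open_halfspace_Im_lt open_halfspace_Im_gt
        convex_Int convex_halfspace_Re_gt convex_halfspace_Im_lt convex_halfspace_Im_gt)+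
  define R1 where "R1 = R \<inter> {z. Re z > 1}"
  have R1: "open R1" "convex R1"
    unfolding R1_def by (intro open_Int R open_halfspace_Re_gt convex_Int convex_halfspace_Re_gt)+
  have in1: "(5/4 :: complex) \<in> R1" using \<rho> assms(3) by (simp add: R1_def R_def)
  then have inR: "(5/4 :: complex) \<in> R" by (simp add: R1_def)
  obtain g where g: "g holomorphic_on R" "\<And>z. z \<in> R \<Longrightarrow> exp (g z) = L_twist F ch z"
    using holomorphic_logarithm_exists[OF R(2,1) L_twist_entire[OF q prim] _ inR] nz by (auto simp: R_def)
  define k where "k z = prime_series ch z + log_series ch z" for z
  have k: "k holomorphic_on R1"
    unfolding k_def by (intro holomorphic_intros holomorphic_on_subset[OF prime_series_holomorphic]
      holomorphic_on_subset[OF log_series_holomorphic]) (auto simp: R1_def)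
  have gk: "exp (g z) = exp (k z)" if "z \<in> R1" for z
    using that g(2)[of z] L_twist_eq_exp[of z] by (simp add: R1_def k_def)
  \<comment> \<open>Functions with equal exponentials have equal derivatives, so their difference is
    constant on the convex set R1.\<close>
  have "\<exists>c. \<forall>z\<in>R1. g z - k z = c"
  proof (rule has_field_derivative_zero_constant[OF R1(2)])
    fix z assume z: "z \<in> R1"
    have zR: "z \<in> R" using z by (simp add: R1_def)
    have dg: "(g has_field_derivative deriv g z) (at z)" using g(1) R(1) zR by (rule holomorphic_derivI)
    have dk: "(k has_field_derivative deriv k z) (at z)" using k R1(1) z by (rule holomorphic_derivI)
    have e1: "((\<lambda>z. exp (g z)) has_field_derivative exp (g z) * deriv g z) (at z)"
      by (rule DERIV_chain2[OF DERIV_exp dg])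
    have "((\<lambda>z. exp (k z)) has_field_derivative exp (k z) * deriv k z) (at z)"
      by (rule DERIV_chain2[OF DERIV_exp dk])
    then have e2: "((\<lambda>z. exp (g z)) has_field_derivative exp (k z) * deriv k z) (at z)"
      by (rule has_field_derivative_transform_within_open[OF _ R1(1) z]) (use gk in simp)
    have "exp (g z) * deriv g z = exp (k z) * deriv k z" by (rule DERIV_unique[OF e1 e2])
    then have "deriv g z = deriv k z" using gk[OF z] by simp
    then have "((\<lambda>z. g z - k z) has_field_derivative 0) (at z)"
      using DERIV_diff[OF dg dk] by simp
    then show "((\<lambda>z. g z - k z) has_field_derivative 0) (at z within R1)"
      by (rule has_field_derivative_at_within)
  qed
  then obtain c where c: "\<And>z. z \<in> R1 \<Longrightarrow> g z - k z = c" by blast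
  have "exp c = exp (g (5/4) - k (5/4))" using c[OF in1] by simp
  also have "\<dots> = 1" by (simp add: exp_diff gk[OF in1])
  finally have ec: "exp c = 1" .
  define f where "f z = g z - c" for z
  have f: "f holomorphic_on R" unfolding f_def by (intro holomorphic_intros g(1))
  have ef: "exp (f z) = L_twist F ch z" if "z \<in> R" for z
    using g(2)[OF that] ec by (simp add: f_def exp_diff)
  have fk: "f z = k z" if "z \<in> R1" for z using c[OF that] by (simp add: f_def algebra_simps)
  define l where "l z = f z - log_series ch z" for z
  show ?thesis
  proof (intro exI[of _ l] conjI allI impI)
    have "l holomorphic_on R"
      unfolding l_def using \<rho> by (intro holomorphic_intros f holomorphic_on_subset[OF log_series_holomorphic]) (auto simp: R_def)
    then show "l holomorphic_on {z. Re z > 1 - \<rho> \<and> \<bar>Im z\<bar> < T}" by (simp add: R_def)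
    show "l z = prime_series ch z" if "Re z > 1" "\<bar>Im z\<bar> < T" for z
      using fk[of z] that \<rho> by (simp add: R1_def R_def l_def k_def)
    fix z assume z: "1 - \<rho> / 4 \<le> Re z" "Re z \<le> 1 + \<rho> / 4" "\<bar>Im z\<bar> \<le> T - 1"
    define a where "a = Complex (1 + \<rho> / 4) (Im z)"
    have sub: "w \<in> R \<and> Re w < 3/2" if "w \<in> ball a \<rho>" for w
    proof -
      have "\<bar>Re (a - w)\<bar> < \<rho>" "\<bar>Im (a - w)\<bar> < \<rho>"
        using that abs_Re_le_cmod[of "a - w"] abs_Im_le_cmod[of "a - w"] by (auto simp: dist_norm)
      then have "\<bar>1 + \<rho> / 4 - Re w\<bar> < \<rho>" "\<bar>Im z - Im w\<bar> < \<rho>" by (auto simp: a_def)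
      then show ?thesis using z(3) \<rho> by (auto simp: R_def)
    qed
    have "norm (f z) \<le> norm (f a) + 2 * (\<rho>/2) / (\<rho> - \<rho>/2) * (M + norm (f a))"
    proof (rule borel_caratheodory[where f = f and ?z0.0 = a and R = \<rho> and r = "\<rho>/2" and M = M])
      show "f holomorphic_on ball a \<rho>" by (rule holomorphic_on_subset[OF f]) (use sub in auto)
      show "Re (f w) < M" if "w \<in> ball a \<rho>" for w
      proof -
        have "exp (Re (f w)) = norm (L_twist F ch w)" using ef[of w] sub[OF that] by (metis norm_exp_eq_Re)
        also have "\<dots> < exp M" using sub[OF that] by (intro bd) (auto simp: R_def)
        finally show ?thesis by simp
      qed
      have "z - a = of_real (Re z - (1 + \<rho> / 4))" by (simp add: a_def complex_eq_iff)
      then have "norm (z - a) = \<bar>Re z - (1 + \<rho> / 4)\<bar>" by (metis norm_of_real)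
      then show "norm (z - a) \<le> \<rho> / 2" using z by linarith
    qed (use \<rho> assms in auto)
    also have "2 * (\<rho>/2) / (\<rho> - \<rho>/2) = 2" using \<rho> by (simp add: field_simps)
    finally have 1: "norm (f z) \<le> 2 * M + 3 * norm (f a)" by simp
    have a1: "a \<in> R1" using \<rho> z assms by (auto simp: a_def R1_def R_def)
    have "norm (f a) \<le> norm (prime_series ch a) + norm (log_series ch a)"
      unfolding fk[OF a1] k_def by (rule norm_triangle_ineq)
    also have "\<dots> \<le> real d / (\<rho> / 4) + log_const"
      using \<rho> by (intro add_mono norm_prime_series_le norm_log_series_le) (auto simp: a_def)
    finally have 2: "norm (f a) \<le> 4 * real d / \<rho> + log_const" by (simp add: mult.commute)
    have "norm (l z) \<le> norm (f z) + norm (log_series ch z)" unfolding l_def by (rule norm_triangle_ineq4)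
    also have "norm (log_series ch z) \<le> log_const" using z \<rho> by (intro norm_log_series_le) auto
    finally show "norm (l z) \<le> 2 * M + 3 * (4 * real d / \<rho> + log_const) + log_const" using 1 2 by simp
  qed
qed

end

end

text \<open>Partial summation against 1/k. The boundary terms give 2 K, and the harmonic sum costs
  the logarithm.\<close>

lemma sum_by_parts_div:
  fixes c :: "nat \<Rightarrow> complex"
  assumes "a \<ge> 1" "a \<le> b" and S: "\<And>n. a \<le> n \<Longrightarrow> n \<le> b \<Longrightarrow> norm (\<Sum>k\<le>n. c k) \<le> K * real n"
  shows "norm (\<Sum>k\<in>{a<..b}. c k / of_nat k) \<le> K * (2 + ln (real b))"
proof -
  define S where "S n = (\<Sum>k\<le>n. c k)" for n
  have K: "K \<ge> 0"
  proof -
    have "0 \<le> K * real a" using order_trans[OF norm_ge_zero assms(3)[of a]] assms(2) by simp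
    then show ?thesis using assms(1) by (simp add: zero_le_mult_iff)
  qed
  have id: "(\<Sum>k\<in>{a<..b}. c k / of_nat k) = S b / of_nat b - S a / of_nat a + (\<Sum>k\<in>{a..<b}. S k * (1 / of_nat k - 1 / of_nat (Suc k)))"
    using assms(2)
  proof (induction b rule: dec_induct)
    case (step n)
    have e: "{a<..Suc n} = insert (Suc n) {a<..n}" "{a..<Suc n} = insert n {a..<n}" using step by auto
    have c: "c (Suc n) = S (Suc n) - S n" by (simp add: S_def)
    show ?case unfolding e using step
      by (simp add: c diff_divide_distrib right_diff_distrib del: of_nat_Suc)
  qed simp
  have harm: "(\<Sum>k\<in>{a..<b}. 1 / real (Suc k)) \<le> ln (real b) - ln (real a)"
    using assms(2)
  proof (induction b rule: dec_induct)
    case (step n)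
    have n: "n \<ge> 1" using step assms(1) by simp
    have "ln (real n / real (Suc n)) \<le> real n / real (Suc n) - 1" using n by (intro ln_le_minus_one) auto
    then have "1 / real (Suc n) \<le> ln (real (Suc n)) - ln (real n)"
      using n by (simp add: ln_div field_simps)
    moreover have "{a..<Suc n} = insert n {a..<n}" using step by auto
    ultimately show ?case using step by simp
  qed simp
  have Sb: "norm (S n / of_nat n) \<le> K" if "a \<le> n" "n \<le> b" for n
    using assms(3)[OF that] that assms(1) by (simp add: S_def norm_divide divide_le_eq)
  have "norm (\<Sum>k\<in>{a..<b}. S k * (1 / of_nat k - 1 / of_nat (Suc k))) \<le> (\<Sum>k\<in>{a..<b}. K * (1 / real (Suc k)))"
  proof (rule sum_norm_le)
    fix k assume k: "k \<in> {a..<b}"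
    then have k1: "k \<ge> 1" using assms(1) by simp
    have f: "z * (1 / x - 1 / y) = z / x * (1 / y)" if "x \<noteq> 0" "y \<noteq> 0" "y = x + 1" for x y z :: complex
      using that by (simp add: field_simps)
    have "S k * (1 / of_nat k - 1 / of_nat (Suc k)) = S k / of_nat k * (1 / of_nat (Suc k))"
      by (rule f) (use k1 in \<open>auto simp del: of_nat_Suc simp: of_nat_Suc[symmetric] add.commute\<close>)
    also have "norm \<dots> \<le> K * (1 / real (Suc k))"
      unfolding norm_mult norm_divide[of 1] norm_of_nat norm_one using Sb[of k] k K by (intro mult_mono) auto
    finally show "norm (S k * (1 / of_nat k - 1 / of_nat (Suc k))) \<le> K * (1 / real (Suc k))" .
  qed
  also have "\<dots> \<le> K * (ln (real b) - ln (real a))"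
    unfolding sum_distrib_left[symmetric] by (intro mult_left_mono harm K)
  also have "\<dots> \<le> K * ln (real b)" using assms(1) K by (intro mult_left_mono) auto
  finally have 3: "norm (\<Sum>k\<in>{a..<b}. S k * (1 / of_nat k - 1 / of_nat (Suc k))) \<le> K * ln (real b)" .
  have "norm (\<Sum>k\<in>{a<..b}. c k / of_nat k) \<le> norm (S b / of_nat b) + norm (S a / of_nat a) + K * ln (real b)"
  proof -
    have "norm (x - y + z) \<le> norm x + norm y + norm z" for x y z :: complex
      using norm_triangle_ineq[of "x - y" z] norm_triangle_ineq4[of x y] by linarith
    then show ?thesis unfolding id using 3 by (meson add_left_mono order_trans)
  qed
  also have "\<dots> \<le> K + K + K * ln (real b)" using Sb[of a] Sb[of b] assms by simp
  finally show ?thesis by (simp add: algebra_simps)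
qed

section \<open>Sums over primes from Perron's formula\<close>

context lfun_tau begin

text \<open>The Riesz mean that belongs to the kernel x^s / s^2. Its terms are taken on the line Re
  s = 0, so they have size at most d apart from the logarithmic weight; the term n = 0 vanishes
  together with \<open>prime_term\<close>.\<close>

definition smooth_prime_sum :: "(int \<Rightarrow> complex) \<Rightarrow> real \<Rightarrow> real \<Rightarrow> complex" where
  "smooth_prime_sum ch t x = (\<Sum>n\<le>nat \<lfloor>x\<rfloor>. prime_term ch (Complex 0 t) n * ln (x / real n))"

context
  fixes q ch
  assumes q: "q \<ge> 2" and prim: "primitive_char q ch"
begin

text \<open>The abscissa 1 + 1 / ln x balances two costs: x to this power is only e * x, and the sum
  of n^(-1 - 1 / ln x) is at most ln x. The constant is 18 = 6 * 3, from \<open>perron_log\<close>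
  and e <= 3.\<close>

lemma perron_prime_series:
  assumes x: "x \<ge> 2" and T0: "T0 \<ge> 1 + 1 / ln x"
  shows "norm (integral {-T0..T0} (\<lambda>u. exp (Complex (1 + 1 / ln x) u * of_real (ln x)) / (Complex (1 + 1 / ln x) u)\<^sup>2
       * prime_series ch (Complex (1 + 1 / ln x) u + Complex 0 t)) - 2 * pi * smooth_prime_sum ch t x)
     \<le> 18 * real d * x * ln x / T0"
proof -
  define c where "c = 1 + 1 / ln x"
  have lnx: "ln x > 0" using x by simp
  have c: "c > 1" using lnx by (simp add: c_def)
  have T: "T0 > 0" "T0 \<ge> c" using T0 c unfolding c_def[symmetric] by linarith+
  have xc: "x powr c = exp 1 * x"
  proof -
    have "c * ln x = 1 + ln x" using lnx by (simp add: c_def field_simps)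
    then show ?thesis using x by (simp add: powr_def exp_add)
  qed
  define k where "k s = exp (s * of_real (ln x)) / s\<^sup>2" for s :: complex
  define D where "D N s = (\<Sum>n<N. prime_term ch (s + Complex 0 t) n)" for N s
  define S where "S = smooth_prime_sum ch t x"
  have nk: "norm (k (Complex c u)) \<le> x powr c" for u
  proof -
    have "norm (Complex c u) \<ge> 1" using complex_Re_le_cmod[of "Complex c u"] c by simp
    then have "(norm (Complex c u))\<^sup>2 \<ge> 1" by (simp add: one_le_power)
    then have "norm (k (Complex c u)) \<le> exp (c * ln x) / 1"
      unfolding k_def norm_divide norm_power by (intro frac_le) (auto simp: norm_exp_eq_Re)
    then show ?thesis using x by (simp add: powr_def)
  qed
  have kc: "continuous_on {-T0..T0} (\<lambda>u. k (Complex c u))"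
  proof -
    have "continuous_on {-T0..T0} (\<lambda>u. Complex c u)" unfolding Complex_eq by (intro continuous_intros)
    moreover have "Complex c u \<noteq> 0" for u using c by (simp add: complex_eq_iff)
    ultimately show ?thesis unfolding k_def by (intro continuous_intros) auto
  qed
  have ptc: "continuous_on {-T0..T0} (\<lambda>u. prime_term ch (Complex c u + Complex 0 t) n)" for n
    by (cases "prime n") (auto simp: prime_term_def Complex_eq prime_gt_0_nat intro!: continuous_intros)
  have PSc: "continuous_on {-T0..T0} (\<lambda>u. prime_series ch (Complex c u + Complex 0 t))"
    by (rule continuous_on_compose2[OF holomorphic_on_imp_continuous_on[OF prime_series_holomorphic[OF q prim]]])
       (use c in \<open>auto simp: Complex_eq intro!: continuous_intros\<close>)
  have pt: "prime_term ch (s + Complex 0 t) n * exp (s * of_real (ln x)) = prime_term ch (Complex 0 t) n * exp (s * of_real (ln (x / real n)))" for s n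
  proof (cases "prime n")
    case True
    then have n: "n > 0" by (rule prime_gt_0_nat)
    have "of_nat n powr (s + Complex 0 t) = of_nat n powr Complex 0 t * exp (s * of_real (ln (real n)))"
      using n by (simp add: powr_add) (simp add: powr_def Ln_of_nat mult.commute)
    moreover have "exp (s * of_real (ln (x / real n))) = exp (s * of_real (ln x)) / exp (s * of_real (ln (real n)))"
      using n x by (simp add: ln_div right_diff_distrib exp_diff)
    ultimately show ?thesis using True by (simp add: prime_term_def)
  qed (simp add: prime_term_def)
  \<comment> \<open>A finite sum first, so that the integral can be taken term by term. As N > x it
    contains all terms of the smoothed sum; those with n > x have main term max 0 (ln (x / n)) = 0
    and contribute only to the error.\<close>
  have fin: "norm (integral {-T0..T0} (\<lambda>u. k (Complex c u) * D N (Complex c u)) - 2 * pi * S) \<le> 6 * (exp 1 * x) * (real d * ln x) / T0"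
    if N: "real N > x" for N
  proof -
    have "integral {-T0..T0} (\<lambda>u. k (Complex c u) * D N (Complex c u))
       = (\<Sum>n<N. integral {-T0..T0} (\<lambda>u. k (Complex c u) * prime_term ch (Complex c u + Complex 0 t) n))"
      unfolding D_def sum_distrib_left
      by (intro integral_sum integrable_continuous_real continuous_on_mult kc ptc) auto
    also have "\<dots> = (\<Sum>n<N. prime_term ch (Complex 0 t) n * integral {-T0..T0} (\<lambda>u. exp (Complex c u * of_real (ln (x / real n))) / (Complex c u)\<^sup>2))"
    proof (intro sum.cong refl)
      fix n
      have "k (Complex c u) * prime_term ch (Complex c u + Complex 0 t) n =
         prime_term ch (Complex 0 t) n * (exp (Complex c u * of_real (ln (x / real n))) / (Complex c u)\<^sup>2)" for u
        using pt[of "Complex c u" n] by (simp add: k_def mult.commute)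
      then show "integral {-T0..T0} (\<lambda>u. k (Complex c u) * prime_term ch (Complex c u + Complex 0 t) n) =
         prime_term ch (Complex 0 t) n * integral {-T0..T0} (\<lambda>u. exp (Complex c u * of_real (ln (x / real n))) / (Complex c u)\<^sup>2)"
        by (simp only: integral_mult_right)
    qed
    finally have 1: "integral {-T0..T0} (\<lambda>u. k (Complex c u) * D N (Complex c u)) = \<dots>" .
    have 2: "2 * pi * S = (\<Sum>n<N. prime_term ch (Complex 0 t) n * of_real (2 * pi * max 0 (ln (x / real n))))"
    proof -
      have sub: "{..nat \<lfloor>x\<rfloor>} \<subseteq> {..<N}" using N x by (auto simp: le_nat_iff) linarith
      have "(\<Sum>n<N. prime_term ch (Complex 0 t) n * of_real (2 * pi * max 0 (ln (x / real n))))
         = (\<Sum>n\<le>nat \<lfloor>x\<rfloor>. prime_term ch (Complex 0 t) n * of_real (2 * pi * max 0 (ln (x / real n))))"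
      proof (rule sum.mono_neutral_right[OF _ sub])
        show "\<forall>n\<in>{..<N} - {..nat \<lfloor>x\<rfloor>}. prime_term ch (Complex 0 t) n * of_real (2 * pi * max 0 (ln (x / real n))) = 0"
        proof
          fix n assume "n \<in> {..<N} - {..nat \<lfloor>x\<rfloor>}"
          then have "real n > x" using x by (auto simp: not_le nat_less_iff) linarith
          then have "ln (x / real n) \<le> 0" using x by simp
          then show "prime_term ch (Complex 0 t) n * of_real (2 * pi * max 0 (ln (x / real n))) = 0" by simp
        qed
      qed simp
      also have "\<dots> = (\<Sum>n\<le>nat \<lfloor>x\<rfloor>. prime_term ch (Complex 0 t) n * of_real (2 * pi * ln (x / real n)))"
      proof (intro sum.cong refl)
        fix n assume n: "n \<in> {..nat \<lfloor>x\<rfloor>}"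
        show "prime_term ch (Complex 0 t) n * of_real (2 * pi * max 0 (ln (x / real n))) =
          prime_term ch (Complex 0 t) n * of_real (2 * pi * ln (x / real n))"
        proof (cases "n = 0")
          case True
          then show ?thesis by (simp add: prime_term_def)
        next
          case False
          then have "real n \<le> x" using n x by (simp add: le_nat_iff) linarith
          then have "ln (x / real n) \<ge> 0" using False x by simp
          then show ?thesis by simp
        qed
      qed
      finally show ?thesis by (simp add: S_def smooth_prime_sum_def sum_distrib_left mult_ac)
    qed
    have "norm (integral {-T0..T0} (\<lambda>u. k (Complex c u) * D N (Complex c u)) - 2 * pi * S) \<le>
       (\<Sum>n<N. 6 * (exp 1 * x) / T0 * (real d * (if n \<ge> 2 then real n powr (-1 - 1 / ln x) else 0)))"
      unfolding 1 2 sum_subtractf[symmetric]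
    proof (rule sum_norm_le)
      fix n assume "n \<in> {..<N}"
      show "norm (prime_term ch (Complex 0 t) n * integral {-T0..T0} (\<lambda>u. exp (Complex c u * of_real (ln (x / real n))) / (Complex c u)\<^sup>2)
         - prime_term ch (Complex 0 t) n * of_real (2 * pi * max 0 (ln (x / real n))))
         \<le> 6 * (exp 1 * x) / T0 * (real d * (if n \<ge> 2 then real n powr (-1 - 1 / ln x) else 0))"
      proof (cases "prime n")
        case True
        then have n: "n \<ge> 2" by (rule prime_ge_2_nat)
        have a: "norm (prime_term ch (Complex 0 t) n) \<le> real d"
          using norm_prime_term_le[OF q prim, of "Complex 0 t" n] n by simp
        have b: "norm (integral {-T0..T0} (\<lambda>u. exp (Complex c u * of_real (ln (x / real n))) / (Complex c u)\<^sup>2) - of_real (2 * pi * max 0 (ln (x / real n))))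
          \<le> 6 * (x / real n) powr c / T0"
          by (rule perron_log) (use x n c T in auto)
        have "norm (prime_term ch (Complex 0 t) n * (integral {-T0..T0} (\<lambda>u. exp (Complex c u * of_real (ln (x / real n))) / (Complex c u)\<^sup>2) - of_real (2 * pi * max 0 (ln (x / real n)))))
          \<le> real d * (6 * (x / real n) powr c / T0)"
          unfolding norm_mult using a b by (intro mult_mono) auto
        also have "(x / real n) powr c = exp 1 * x * real n powr (-1 - 1 / ln x)"
        proof -
          have e: "- 1 - 1 / ln x = - c" by (simp add: c_def)
          have "(x / real n) powr c = x powr c / real n powr c" using x by (simp add: powr_divide)
          then show ?thesis unfolding e powr_minus xc by (simp only: divide_inverse)
        qed
        finally show ?thesis using n by (simp add: right_diff_distrib mult_ac)
      qed (use x T in \<open>simp add: prime_term_def\<close>)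
    qed
    also have "\<dots> = 6 * (exp 1 * x) / T0 * (real d * (\<Sum>n<N. if n \<ge> 2 then real n powr (-1 - 1 / ln x) else 0))"
      by (simp only: sum_distrib_left)
    also have "\<dots> \<le> 6 * (exp 1 * x) / T0 * (real d * ln x)"
    proof -
      have "(\<Sum>n<N. if n \<ge> 2 then real n powr (-1 - 1 / ln x) else 0) \<le> (\<Sum>n. if n \<ge> 2 then real n powr (-1 - 1 / ln x) else 0)"
        by (rule sum_le_suminf[OF powr_sum_bound(1)]) (use lnx in auto)
      also have "\<dots> \<le> 1 / (1 / ln x)" by (rule powr_sum_bound(2)) (use lnx in simp)
      finally have "(\<Sum>n<N. if n \<ge> 2 then real n powr (-1 - 1 / ln x) else 0) \<le> ln x" by simp
      then show ?thesis using x T by (intro mult_left_mono) auto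
    qed
    finally show ?thesis by simp
  qed
  have lim: "norm (integral {-T0..T0} (\<lambda>u. k (Complex c u) * prime_series ch (Complex c u + Complex 0 t)) - 2 * pi * S)
     \<le> 6 * (exp 1 * x) * (real d * ln x) / T0 + \<epsilon>" if e: "\<epsilon> > 0" for \<epsilon>
  proof -
    define \<epsilon>' where "\<epsilon>' = \<epsilon> / (2 * x powr c * T0)"
    have xcp: "x powr c > 0" using x by simp
    have e': "\<epsilon>' > 0" using e T xcp by (simp add: \<epsilon>'_def)
    have "uniform_limit {s. Re s \<ge> c} (\<lambda>N s. \<Sum>n<N. prime_term ch s n) (\<lambda>s. \<Sum>n. prime_term ch s n) sequentially"
      by (rule Weierstrass_m_test[OF prime_term_bound[OF q prim, of "c - 1"] summable_mult[OF powr_sum_bound(1)]])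
         (use c in auto)
    then have "eventually (\<lambda>N. \<forall>s\<in>{s. Re s \<ge> c}. dist (\<Sum>n<N. prime_term ch s n) (\<Sum>n. prime_term ch s n) < \<epsilon>') sequentially"
      using e' by (simp add: uniform_limit_iff)
    then obtain N0 where N0: "\<And>N s. N \<ge> N0 \<Longrightarrow> Re s \<ge> c \<Longrightarrow> dist (\<Sum>n<N. prime_term ch s n) (prime_series ch s) < \<epsilon>'"
      by (auto simp: eventually_sequentially prime_series_def)
    define N where "N = max N0 (nat \<lceil>x\<rceil> + 1)"
    have N: "N \<ge> N0" "real N > x" using x by (auto simp: N_def) linarith
    have "integral {-T0..T0} (\<lambda>u. k (Complex c u) * prime_series ch (Complex c u + Complex 0 t))
       - integral {-T0..T0} (\<lambda>u. k (Complex c u) * D N (Complex c u)) =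
       integral {-T0..T0} (\<lambda>u. k (Complex c u) * (prime_series ch (Complex c u + Complex 0 t) - D N (Complex c u)))"
      unfolding right_diff_distrib D_def
      by (intro integral_diff[symmetric] integrable_continuous_real continuous_on_mult kc PSc continuous_on_sum ptc)
    also have "norm \<dots> \<le> 2 * (x powr c * \<epsilon>') * T0"
    proof (rule norm_integral_le_const)
      show "norm (k (Complex c u) * (prime_series ch (Complex c u + Complex 0 t) - D N (Complex c u))) \<le> x powr c * \<epsilon>'" for u
        unfolding norm_mult using nk N0[OF N(1), of "Complex c u + Complex 0 t"] e'
        by (intro mult_mono) (auto simp: D_def dist_norm norm_minus_commute)
    qed (use T in \<open>auto simp: D_def intro!: continuous_on_mult continuous_on_diff kc PSc continuous_on_sum ptc\<close>)
    also have "\<dots> = \<epsilon>" using T xcp by (simp add: \<epsilon>'_def)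
    finally show ?thesis using fin[OF N(2)]
      using norm_triangle_ineq[of "integral {-T0..T0} (\<lambda>u. k (Complex c u) * D N (Complex c u)) - 2 * pi * S"
        "integral {-T0..T0} (\<lambda>u. k (Complex c u) * prime_series ch (Complex c u + Complex 0 t)) - integral {-T0..T0} (\<lambda>u. k (Complex c u) * D N (Complex c u))"]
      by simp
  qed
  have "norm (integral {-T0..T0} (\<lambda>u. k (Complex c u) * prime_series ch (Complex c u + Complex 0 t)) - 2 * pi * S)
     \<le> 6 * (exp 1 * x) * (real d * ln x) / T0"
    by (rule field_le_epsilon) (rule lim)
  also have "\<dots> \<le> 6 * (3 * x) * (real d * ln x) / T0"
    using x lnx T exp_le by (intro divide_right_mono mult_right_mono mult_left_mono) auto
  finally show ?thesis by (simp add: c_def k_def S_def mult_ac)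
qed

text \<open>The line is moved from 1 + 1 / ln x to 1 - \<rho>/4, inside the zero-free region, where
  x^s saves x^(-\<rho>/4). The three terms are the truncation error of Perron's formula, the
  horizontal sides, and the new line.\<close>

lemma smooth_prime_sum_bound:
  assumes x: "x \<ge> 2" and \<rho>: "0 < \<rho>" "\<rho> \<le> 1/4" "1 / ln x \<le> \<rho> / 4" and T0: "T0 \<ge> 2" "\<bar>t\<bar> + T0 \<le> T - 1"
    and hol: "l holomorphic_on {z. Re z > 1 - \<rho> \<and> \<bar>Im z\<bar> < T}"
    and ext: "\<And>z. Re z > 1 \<Longrightarrow> \<bar>Im z\<bar> < T \<Longrightarrow> l z = prime_series ch z"
    and bd: "\<And>z. 1 - \<rho> / 4 \<le> Re z \<Longrightarrow> Re z \<le> 1 + \<rho> / 4 \<Longrightarrow> \<bar>Im z\<bar> \<le> T - 1 \<Longrightarrow> norm (l z) \<le> M"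
  shows "norm (smooth_prime_sum ch t x) \<le> (18 * real d * ln x / T0 + 6 * M / T0\<^sup>2 + 8 * T0 * M * x powr (- \<rho> / 4)) * x"
proof -
  define c where "c = 1 + 1 / ln x"
  define a where "a = 1 - \<rho> / 4"
  have lnx: "ln x > 0" using x by simp
  have c: "c > 1" "c \<le> 1 + \<rho> / 4" using lnx \<rho> by (auto simp: c_def)
  have a: "a < 1" "a \<ge> 1/2" using \<rho> by (auto simp: a_def)
  have M: "M \<ge> 0" using bd[of 1] \<rho> T0 by (smt (verit) norm_ge_zero one_complex.sel zero_le_divide_iff)
  have xc: "x powr c \<le> 3 * x"
  proof -
    have "c * ln x = 1 + ln x" using lnx by (simp add: c_def field_simps)
    then have "x powr c = exp 1 * x" using x by (simp add: powr_def exp_add)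
    then show ?thesis using exp_le x by simp
  qed
  define f where "f s = exp (s * of_real (ln x)) / s\<^sup>2 * l (s + Complex 0 t)" for s
  have nx: "norm (exp (s * of_real (ln x))) = x powr Re s" for s using x by (simp add: powr_def)
  have fh: "f holomorphic_on {z. a \<le> Re z \<and> Re z \<le> c \<and> - T0 \<le> Im z \<and> Im z \<le> T0}"
  proof -
    have "(\<lambda>s. l (s + Complex 0 t)) holomorphic_on {z. a \<le> Re z \<and> Re z \<le> c \<and> - T0 \<le> Im z \<and> Im z \<le> T0}"
      by (rule holomorphic_on_compose_gen[OF _ hol, unfolded o_def])
         (use T0 \<rho> in \<open>auto intro!: holomorphic_intros simp: a_def\<close>)
    then show ?thesis unfolding f_def using a by (intro holomorphic_intros) auto
  qed
  have shift: "norm (integral {-T0..T0} (\<lambda>u. f (Complex c u)) - integral {-T0..T0} (\<lambda>u. f (Complex a u))) \<le> 2 * (3 * x / T0\<^sup>2 * M) * (c - a)"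
  proof (rule vertical_integral_shift)
    have B: "norm (f s) \<le> 3 * x / T0\<^sup>2 * M" if "a \<le> Re s" "Re s \<le> c" "\<bar>Im s\<bar> = T0" for s
    proof -
      have "norm (l (s + Complex 0 t)) \<le> M" using that T0 c by (intro bd) (auto simp: a_def)
      moreover have "norm s \<ge> T0" using abs_Im_le_cmod[of s] that by simp
      moreover have "x powr Re s \<le> 3 * x" using order_trans[OF powr_mono[of "Re s" c x] xc] that x by simp
      ultimately show ?thesis unfolding f_def norm_mult norm_divide norm_power nx using T0 x
        by (intro mult_mono frac_le power_mono) auto
    qed
    show "norm (f (Complex r T0)) \<le> 3 * x / T0\<^sup>2 * M \<and> norm (f (Complex r (- T0))) \<le> 3 * x / T0\<^sup>2 * M" if "a \<le> r" "r \<le> c" for r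
      using that T0 by (intro conjI B) auto
  qed (use a c T0 x M fh in auto)
  also have "\<dots> \<le> 2 * (3 * x / T0\<^sup>2 * M) * 1"
    using x M \<rho> c by (intro mult_left_mono) (auto simp: a_def)
  finally have sh: "norm (integral {-T0..T0} (\<lambda>u. f (Complex c u)) - integral {-T0..T0} (\<lambda>u. f (Complex a u))) \<le> 6 * M / T0\<^sup>2 * x"
    by (simp add: mult_ac)
  have le: "norm (integral {-T0..T0} (\<lambda>u. f (Complex a u))) \<le> 2 * (x powr a / (1/2)\<^sup>2 * M) * T0"
  proof (rule norm_integral_le_const)
    show "norm (f (Complex a u)) \<le> x powr a / (1/2)\<^sup>2 * M" if "u \<in> {-T0..T0}" for u
    proof -
      have "norm (l (Complex a u + Complex 0 t)) \<le> M" using that T0 \<rho> by (intro bd) (auto simp: a_def)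
      moreover have "norm (Complex a u) \<ge> 1/2" using complex_Re_le_cmod[of "Complex a u"] a by simp
      ultimately show ?thesis unfolding f_def norm_mult norm_divide norm_power nx using x
        by (intro mult_mono frac_le power_mono) auto
    qed
    show "continuous_on {-T0..T0} (\<lambda>u. f (Complex a u))"
      by (rule continuous_on_compose2[OF holomorphic_on_imp_continuous_on[OF fh]])
         (use c a in \<open>auto simp: Complex_eq intro!: continuous_intros\<close>)
  qed (use T0 in auto)
  have xa: "x powr a = x powr (- \<rho> / 4) * x"
    using x powr_add[of x "- \<rho> / 4" 1] by (simp add: a_def)
  have per: "norm (integral {-T0..T0} (\<lambda>u. f (Complex c u)) - 2 * pi * smooth_prime_sum ch t x) \<le> 18 * real d * x * ln x / T0"
  proof -
    have "f (Complex c u) = exp (Complex c u * of_real (ln x)) / (Complex c u)\<^sup>2 * prime_series ch (Complex c u + Complex 0 t)" if "u \<in> {-T0..T0}" for u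
      unfolding f_def using that c T0 by (subst ext) auto
    then have "integral {-T0..T0} (\<lambda>u. f (Complex c u)) = integral {-T0..T0} (\<lambda>u. exp (Complex c u * of_real (ln x)) / (Complex c u)\<^sup>2 * prime_series ch (Complex c u + Complex 0 t))"
      by (intro integral_cong) auto
    then show ?thesis using perron_prime_series[OF x, of T0 t] T0 \<rho> by (simp add: c_def)
  qed
  have "norm (2 * pi * smooth_prime_sum ch t x) \<le> 18 * real d * x * ln x / T0 + 6 * M / T0\<^sup>2 * x + 2 * (x powr a / (1/2)\<^sup>2 * M) * T0"
  proof -
    have tri: "norm z \<le> norm (y - z) + norm (y - w) + norm w" for w y z :: complex
      using norm_triangle_ineq4[of y "y - z"] norm_triangle_sub[of y w] by simp
    show ?thesis using tri[of "2 * pi * smooth_prime_sum ch t x" "integral {-T0..T0} (\<lambda>u. f (Complex c u))" "integral {-T0..T0} (\<lambda>u. f (Complex a u))"]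
      per sh le by linarith
  qed
  also have "\<dots> = (18 * real d * ln x / T0 + 6 * M / T0\<^sup>2 + 8 * T0 * M * x powr (- \<rho> / 4)) * x"
    unfolding xa by (simp add: algebra_simps power2_eq_square)
  finally have "2 * pi * norm (smooth_prime_sum ch t x) \<le> (18 * real d * ln x / T0 + 6 * M / T0\<^sup>2 + 8 * T0 * M * x powr (- \<rho> / 4)) * x"
    by (simp add: norm_mult)
  moreover have "1 * norm (smooth_prime_sum ch t x) \<le> 2 * pi * norm (smooth_prime_sum ch t x)"
    using pi_gt3 by (intro mult_right_mono) auto
  ultimately show ?thesis by simp
qed

text \<open>Passing from x to x * exp \<delta> raises the weight of every n <= x by exactly
  \<delta>. So \<delta> times the plain sum is the difference of two smoothed sums, up to the terms
  between x and x * exp \<delta>, whose weights are at most \<delta>.\<close>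

lemma prime_sum_desmooth:
  assumes x: "x \<ge> 1" and \<delta>: "0 < \<delta>" "\<delta> \<le> 1" and "E \<ge> 0"
    and G: "norm (smooth_prime_sum ch t x) \<le> E * x" "norm (smooth_prime_sum ch t (x * exp \<delta>)) \<le> E * (x * exp \<delta>)"
  shows "norm (\<Sum>n\<le>nat \<lfloor>x\<rfloor>. prime_term ch (Complex 0 t) n) \<le> (4 * E / \<delta> + 2 * real d * \<delta>) * x + real d"
proof -
  define b where "b n = prime_term ch (Complex 0 t) n" for n
  define y where "y = x * exp \<delta>"
  define S where "S = (\<Sum>n\<le>nat \<lfloor>x\<rfloor>. b n)"
  have b: "norm (b n) \<le> real d" for n
    using norm_prime_term_le[OF q prim, of "Complex 0 t" n] by (auto simp: b_def split: if_splits)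
  have b0: "b 0 = 0" by (simp add: b_def prime_term_def)
  have xy: "x \<le> y" using x \<delta> by (simp add: y_def)
  have e3: "exp \<delta> \<le> 3" using \<delta> exp_le by (meson exp_le_cancel_iff order_trans)
  have ed: "exp \<delta> \<le> 1 + 2 * \<delta>" using exp_bound[of \<delta>] \<delta> by (auto simp: power2_eq_square intro: order_trans mult_left_le)
  have split: "{..nat \<lfloor>y\<rfloor>} = {..nat \<lfloor>x\<rfloor>} \<union> {nat \<lfloor>x\<rfloor><..nat \<lfloor>y\<rfloor>}"
    using xy x by (auto simp: nat_mono floor_mono intro: order_trans)
  have "smooth_prime_sum ch t y = (\<Sum>n\<le>nat \<lfloor>x\<rfloor>. b n * ln (y / real n)) + (\<Sum>n\<in>{nat \<lfloor>x\<rfloor><..nat \<lfloor>y\<rfloor>}. b n * ln (y / real n))"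
    unfolding smooth_prime_sum_def b_def[symmetric] split by (rule sum.union_disjoint) auto
  also have "(\<Sum>n\<le>nat \<lfloor>x\<rfloor>. b n * ln (y / real n)) = (\<Sum>n\<le>nat \<lfloor>x\<rfloor>. b n * ln (x / real n) + \<delta> * b n)"
  proof (intro sum.cong refl)
    fix n
    show "b n * of_real (ln (y / real n)) = b n * of_real (ln (x / real n)) + of_real \<delta> * b n"
    proof (cases "n = 0")
      case False
      then have "ln (y / real n) = ln (x / real n) + \<delta>" using x by (simp add: y_def ln_div ln_mult)
      then show ?thesis by (simp add: algebra_simps)
    qed (simp add: b0)
  qed
  also have "\<dots> = smooth_prime_sum ch t x + \<delta> * S"
    by (simp add: smooth_prime_sum_def b_def S_def sum.distrib sum_distrib_left)
  finally have eq: "\<delta> * S = smooth_prime_sum ch t y - smooth_prime_sum ch t x - (\<Sum>n\<in>{nat \<lfloor>x\<rfloor><..nat \<lfloor>y\<rfloor>}. b n * ln (y / real n))"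
    by simp
  have "norm (\<Sum>n\<in>{nat \<lfloor>x\<rfloor><..nat \<lfloor>y\<rfloor>}. b n * of_real (ln (y / real n))) \<le> (\<Sum>n\<in>{nat \<lfloor>x\<rfloor><..nat \<lfloor>y\<rfloor>}. real d * \<delta>)"
  proof (rule sum_norm_le)
    fix n assume n: "n \<in> {nat \<lfloor>x\<rfloor><..nat \<lfloor>y\<rfloor>}"
    have n1: "real n > x" "real n \<le> y" using n x xy by (auto simp: nat_less_iff le_nat_iff) linarith+
    have "ln (y / real n) \<le> ln (y / x)" using n1 x xy by (intro ln_mono divide_left_mono) auto
    then have "\<bar>ln (y / real n)\<bar> \<le> \<delta>" using n1 x by (simp add: y_def)
    then show "norm (b n * of_real (ln (y / real n))) \<le> real d * \<delta>"
      unfolding norm_mult using b[of n] by (intro mult_mono) auto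
  qed
  also have "\<dots> = real (nat \<lfloor>y\<rfloor> - nat \<lfloor>x\<rfloor>) * (real d * \<delta>)" by simp
  also have "\<dots> \<le> (2 * \<delta> * x + 1) * (real d * \<delta>)"
  proof (rule mult_right_mono)
    have "nat \<lfloor>x\<rfloor> \<le> nat \<lfloor>y\<rfloor>" using xy by (intro nat_mono floor_mono)
    then have "real (nat \<lfloor>y\<rfloor> - nat \<lfloor>x\<rfloor>) = real (nat \<lfloor>y\<rfloor>) - real (nat \<lfloor>x\<rfloor>)" by (rule of_nat_diff)
    also have "\<dots> \<le> y - x + 1" using x xy by linarith
    also have "y - x = (exp \<delta> - 1) * x" by (simp add: y_def algebra_simps)
    also have "\<dots> \<le> 2 * \<delta> * x" using ed x by (intro mult_right_mono) auto
    finally show "real (nat \<lfloor>y\<rfloor> - nat \<lfloor>x\<rfloor>) \<le> 2 * \<delta> * x + 1" by simp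
  qed (use \<delta> in auto)
  finally have tail: "norm (\<Sum>n\<in>{nat \<lfloor>x\<rfloor><..nat \<lfloor>y\<rfloor>}. b n * of_real (ln (y / real n))) \<le> (2 * \<delta> * x + 1) * (real d * \<delta>)" .
  have "E * (x * exp \<delta>) \<le> E * (x * 3)" using e3 x assms(4) by (intro mult_left_mono) auto
  then have Gy: "norm (smooth_prime_sum ch t y) \<le> 3 * E * x" using G(2) by (simp add: y_def mult_ac)
  have "\<delta> * norm S = norm (\<delta> * S)" using \<delta> by (simp add: norm_mult)
  also have "\<dots> \<le> 3 * E * x + E * x + (2 * \<delta> * x + 1) * (real d * \<delta>)"
  proof -
    have "norm (u - v - w) \<le> norm u + norm v + norm w" for u v w :: complex
      using norm_triangle_ineq4[of "u - v" w] norm_triangle_ineq4[of u v] by linarith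
    then show ?thesis unfolding eq using Gy G(1) tail by (meson add_mono order_trans)
  qed
  also have "\<dots> = \<delta> * ((4 * E / \<delta> + 2 * real d * \<delta>) * x + real d)"
    using \<delta> by (simp add: field_simps)
  finally show ?thesis using \<delta> by (simp add: S_def b_def)
qed

end

lemma log_const_nonneg: "log_const \<ge> 0"
  using powr_less_mono[of "-3/4" 0 "2::real"] by (simp add: log_const_def)

text \<open>The condition of (A4) for the admissible height \<open>ln q ^ 100\<close>.\<close>

definition nonvanishing :: "real \<Rightarrow> real \<Rightarrow> nat \<Rightarrow> (int \<Rightarrow> complex) \<Rightarrow> bool" where
  "nonvanishing c \<beta> q ch \<longleftrightarrow> (\<forall>\<sigma> t. \<sigma> > 1 - c / ln (real q * ln (real q) ^ 100) powr \<beta> \<longrightarrow> \<bar>t\<bar> \<le> ln (real q) ^ 100 \<longrightarrow> L_twist F ch (Complex \<sigma> t) \<noteq> 0)"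

definition prime_window :: "real \<Rightarrow> real \<Rightarrow> nat set" where
  "prime_window \<beta>' Q = {p. prime p \<and> exp (ln Q powr \<beta>') \<le> real p \<and> real p \<le> Q powr (1/10)}"

text \<open>Write L = ln Q. For x >= exp(L^\<beta>' / 2) and \<rho> = r L^(-\<beta>) the saving
  x^(-\<rho>/4) is at most exp(-(r/8) L^\<kappa>) with \<kappa> = \<beta>' - \<beta> > 0, smaller
  than any power of 1/L. With Perron's formula cut off at the height L^20 the smoothed sum is at
  most L^(-15) x; removing the smoothing with \<delta> = L^(-5) leaves L^(-4) x, and partial
  summation costs one factor L.\<close>

lemma prime_polynomial_small:
  assumes \<beta>: "0 \<le> \<beta>" "\<beta> < \<beta>'" "\<beta>' < 1" and "c > 0"
  shows "\<exists>L0\<ge>1. \<forall>Q q ch. Q > 0 \<longrightarrow> ln Q \<ge> L0 \<longrightarrow> Q \<le> real q \<longrightarrow> real q \<le> 2 * Q \<longrightarrow> primitive_char q ch \<longrightarrow>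
    nonvanishing c \<beta> q ch \<longrightarrow>
    (\<forall>t. \<bar>t\<bar> \<le> ln Q \<longrightarrow>
       norm (\<Sum>p\<in>prime_window \<beta>' Q. prime_term ch (Complex 1 t) p) \<le> 1 / (ln Q)\<^sup>2)"
proof -
  obtain CL where CL0: "CL \<ge> 1 \<and> (\<exists>A\<ge>1. \<forall>q ch z. q \<ge> 2 \<longrightarrow> primitive_char q ch \<longrightarrow> -1/2 \<le> Re z \<longrightarrow> Re z \<le> 3/2 \<longrightarrow>
      norm (L_twist F ch z) \<le> CL * real q ^ d * norm (z + of_real A) ^ d)"
    using L_twist_poly_bound ..
  from conjunct2[OF CL0] obtain A where CL1: "A \<ge> 1 \<and> (\<forall>q ch z. q \<ge> 2 \<longrightarrow> primitive_char q ch \<longrightarrow> -1/2 \<le> Re z \<longrightarrow> Re z \<le> 3/2 \<longrightarrow>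
      norm (L_twist F ch z) \<le> CL * real q ^ d * norm (z + of_real A) ^ d)" ..
  have CL: "CL \<ge> 1" "A \<ge> 1" using CL0 CL1 by simp_all
  have CL3: "norm (L_twist F ch z) \<le> CL * real q ^ d * norm (z + of_real A) ^ d"
    if "q \<ge> 2" "primitive_char q ch" "-1/2 \<le> Re z" "Re z \<le> 3/2" for q ch z
    using CL1 that by simp
  define \<kappa> where "\<kappa> = \<beta>' - \<beta>"
  \<comment> \<open>The width \<rho> = r L^(-\<beta>) fits into the region of (A4) because ln (q *
    ln q ^ 100) <= 4 L. The bound 1/4 keeps the region to the right of 3/4, where
    \<open>log_series\<close> is under control.\<close>
  define r where "r = min (1/4) (c / 4 powr \<beta>)"
  have k: "\<kappa> > 0" and r0: "r > 0" and b': "\<beta>' > 0"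
    using assms by (auto simp: \<kappa>_def r_def)
  have "r \<le> 1/4" "r \<le> c / 4 powr \<beta>"
    unfolding r_def by (rule min.cobounded1, rule min.cobounded2)
  note r = r0 this
  define K1 where "K1 = 4 * (real d + 1) + 12 * real d / r + 4 * log_const + 1 + CL + 8 * real d + 10"
  have K1: "K1 \<ge> 10" "K1 \<ge> CL" "K1 \<ge> 8 * real d" "K1 \<ge> 4 * (real d + 1) + 12 * real d / r + 4 * log_const"
    using log_const_nonneg r CL by (simp_all add: K1_def)
  \<comment> \<open>All size conditions on L used below; each holds for large L since \<kappa> and
    \<beta>' are positive.\<close>
  define Ev where "Ev = (\<lambda>L::real. K1 \<le> L \<and> 18 * L * L / L ^ 20 + 6 * L\<^sup>2 / (L ^ 20)\<^sup>2 + 8 * L ^ 20 * L\<^sup>2 * exp (- (r/8) * L powr \<kappa>) \<le> 1 / L ^ 15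
      \<and> 2 + A + L ^ 100 \<le> exp L / 2 \<and> L powr \<kappa> \<ge> 8 / r \<and> exp (L powr \<beta>') - 1 \<ge> exp (L powr \<beta>' / 2)
      \<and> exp (L powr \<beta>' / 2) \<ge> L ^ 5 \<and> 3 * exp (L / 10) \<le> exp L \<and> L ^ 20 + L \<le> L ^ 100 - 1
      \<and> (L + 1) + 100 * ln (2 * L) \<le> 4 * L \<and> (2 + L) / L ^ 4 \<le> 1 / L\<^sup>2 \<and> exp (L powr \<beta>') \<ge> 3)"
  have "eventually Ev at_top"
    unfolding Ev_def
    using k r(1) b' by (intro eventually_conj eventually_ge_at_top; real_asymp)
  then obtain L0 where L0: "\<And>L. L \<ge> L0 \<Longrightarrow> Ev L"
    unfolding eventually_at_top_linorder by blast
  show ?thesis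
  proof (intro exI[of _ "max 1 L0"] conjI allI impI)
    fix Q :: real and q ch t
    assume Q: "Q > 0" "max 1 L0 \<le> ln Q" "Q \<le> real q" "real q \<le> 2 * Q" and prim: "primitive_char q ch"
      and zf: "nonvanishing c \<beta> q ch"
      and t: "\<bar>t\<bar> \<le> ln Q"
    define L where "L = ln Q"
    have LL0: "L \<ge> L0" using Q by (simp add: L_def)
    have E: "K1 \<le> L" "18 * L * L / L ^ 20 + 6 * L\<^sup>2 / (L ^ 20)\<^sup>2 + 8 * L ^ 20 * L\<^sup>2 * exp (- (r/8) * L powr \<kappa>) \<le> 1 / L ^ 15"
      "2 + A + L ^ 100 \<le> exp L / 2" "L powr \<kappa> \<ge> 8 / r" "exp (L powr \<beta>') - 1 \<ge> exp (L powr \<beta>' / 2)"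
      "exp (L powr \<beta>' / 2) \<ge> L ^ 5" "3 * exp (L / 10) \<le> exp L" "L ^ 20 + L \<le> L ^ 100 - 1"
      "(L + 1) + 100 * ln (2 * L) \<le> 4 * L" "(2 + L) / L ^ 4 \<le> 1 / L\<^sup>2" "exp (L powr \<beta>') \<ge> 3"
      using L0[OF LL0] unfolding Ev_def by blast+
    have L: "L \<ge> 10" "L \<ge> CL" "L \<ge> 8 * real d" "L \<ge> 4 * (real d + 1) + 12 * real d / r + 4 * log_const"
      using E(1) K1 by linarith+
    have QL: "Q = exp L" using Q by (simp add: L_def)
    have "exp L \<ge> 1 + L" by (rule exp_ge_add_one_self)
    then have Q2: "Q \<ge> 2" using L unfolding QL by linarith
    have q2: "q \<ge> 2" using Q2 Q by linarith
    have lq: "L \<le> ln (real q)" using Q by (simp add: L_def)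
    have "ln (real q) \<le> ln (2 * Q)" using Q q2 by simp
    also have "\<dots> = ln 2 + L" using Q by (simp add: ln_mult L_def)
    finally have lq2: "ln (real q) \<le> L + 1" using ln_2_less_1 by linarith
    define \<rho> where "\<rho> = r * L powr - \<beta>"
    define T where "T = L ^ 100"
    have Lb: "L powr - \<beta> \<le> 1" "L powr - \<beta> > 0" using L \<beta> powr_mono[of "- \<beta>" 0 L] by auto
    have \<rho>: "\<rho> > 0" "\<rho> \<le> 1/4"
      using r Lb mult_mono[of r "1/4" "L powr - \<beta>" 1] by (auto simp: \<rho>_def)
    have reg: "\<rho> \<le> c / ln (real q * ln (real q) ^ 100) powr \<beta>"
    proof -
      have "ln (real q * ln (real q) ^ 100) = ln (real q) + 100 * ln (ln (real q))"
        using q2 lq L by (simp add: ln_mult ln_realpow)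
      also have "\<dots> \<le> (L + 1) + 100 * ln (2 * L)"
        using lq lq2 L by (intro add_mono mult_left_mono ln_mono) auto
      also have "\<dots> \<le> 4 * L" by (rule E(9))
      finally have up: "ln (real q * ln (real q) ^ 100) \<le> 4 * L" .
      have "ln (real q * ln (real q) ^ 100) = ln (real q) + 100 * ln (ln (real q))"
        using q2 lq L by (simp add: ln_mult ln_realpow)
      then have pos: "ln (real q * ln (real q) ^ 100) > 0" using lq L by (simp add: add_pos_nonneg)
      have "ln (real q * ln (real q) ^ 100) powr \<beta> \<le> (4 * L) powr \<beta>" using up pos \<beta> by (intro powr_mono2) auto
      also have "\<dots> = 4 powr \<beta> * L powr \<beta>" using L by (simp add: powr_mult)
      finally have "c / (4 powr \<beta> * L powr \<beta>) \<le> c / ln (real q * ln (real q) ^ 100) powr \<beta>"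
        using pos assms(4) L by (intro divide_left_mono) auto
      moreover have "\<rho> \<le> (c / 4 powr \<beta>) * L powr - \<beta>" unfolding \<rho>_def using r by (intro mult_right_mono) auto
      ultimately show ?thesis by (simp add: powr_minus field_simps)
    qed
    have nz: "L_twist F ch z \<noteq> 0" if "Re z > 1 - \<rho>" "\<bar>Im z\<bar> < T" for z
    proof -
      have "T \<le> ln (real q) ^ 100" unfolding T_def using lq L by (intro power_mono) auto
      then have "\<bar>Im z\<bar> \<le> ln (real q) ^ 100" using that by linarith
      moreover have "Re z > 1 - c / ln (real q * ln (real q) ^ 100) powr \<beta>" using that reg by linarith
      ultimately have "L_twist F ch (Complex (Re z) (Im z)) \<noteq> 0" using zf unfolding nonvanishing_def by blast
      then show ?thesis by simp
    qed
    \<comment> \<open>ln |L(z)| is O(L): the polynomial bound is at most CL * (2 Q)^d * (Q/2)^d, the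
      height log^100 q being far below Q.\<close>
    define M where "M = 2 * (real d + 1) * L"
    have bd: "norm (L_twist F ch z) < exp M" if "Re z > 1 - \<rho>" "Re z < 3/2" "\<bar>Im z\<bar> < T" for z
    proof -
      have "norm (L_twist F ch z) \<le> CL * real q ^ d * norm (z + of_real A) ^ d"
        using that \<rho> by (intro CL3[OF q2 prim]) auto
      also have "\<dots> \<le> CL * (2 * Q) ^ d * (exp L / 2) ^ d"
      proof (intro mult_mono power_mono)
        have "norm (z + of_real A) \<le> \<bar>Re z + A\<bar> + \<bar>Im z\<bar>" using cmod_le[of "z + of_real A"] by simp
        also have "\<dots> \<le> 2 + A + T" using that \<rho> CL by simp
        finally show "norm (z + of_real A) \<le> exp L / 2" using E(3) by (simp add: T_def)
      qed (use Q CL in auto)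
      also have "\<dots> = CL * (exp L * exp L) ^ d"
        unfolding mult.assoc[of CL] power_mult_distrib[symmetric] QL by simp
      also have "(exp L * exp L) ^ d = exp (real d * (2 * L))" by (simp only: exp_of_nat_mult flip: exp_add) simp
      also have "CL * exp (real d * (2 * L)) < exp L * exp (real d * (2 * L))"
      proof (rule mult_strict_right_mono)
        show "CL < exp L" using L \<open>exp L \<ge> 1 + L\<close> by linarith
      qed simp
      also have "\<dots> \<le> exp M" using L by (simp add: M_def algebra_simps flip: exp_add)
      finally show ?thesis .
    qed
    have T: "T > 1" "M > 0" using L one_less_power[of L 100] by (simp_all add: T_def M_def)
    from prime_series_extension[OF q2 prim \<rho> T nz bd] obtain l where
      l0: "l holomorphic_on {z. Re z > 1 - \<rho> \<and> \<bar>Im z\<bar> < T} \<and>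
        (\<forall>z. Re z > 1 \<longrightarrow> \<bar>Im z\<bar> < T \<longrightarrow> l z = prime_series ch z) \<and>
        (\<forall>z. 1 - \<rho> / 4 \<le> Re z \<longrightarrow> Re z \<le> 1 + \<rho> / 4 \<longrightarrow> \<bar>Im z\<bar> \<le> T - 1 \<longrightarrow>
          norm (l z) \<le> 2 * M + 3 * (4 * real d / \<rho> + log_const) + log_const)" ..
    have l: "l holomorphic_on {z. Re z > 1 - \<rho> \<and> \<bar>Im z\<bar> < T}"
      "\<And>z. Re z > 1 \<Longrightarrow> \<bar>Im z\<bar> < T \<Longrightarrow> l z = prime_series ch z"
      "\<And>z. 1 - \<rho> / 4 \<le> Re z \<Longrightarrow> Re z \<le> 1 + \<rho> / 4 \<Longrightarrow> \<bar>Im z\<bar> \<le> T - 1 \<Longrightarrow>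
        norm (l z) \<le> 2 * M + 3 * (4 * real d / \<rho> + log_const) + log_const"
      using l0 by simp_all
    have M1: "2 * M + 3 * (4 * real d / \<rho> + log_const) + log_const \<le> L\<^sup>2"
    proof -
      have "L powr \<beta> \<le> L powr 1" using L \<beta> by (intro powr_mono) auto
      then have "12 * real d / r * L powr \<beta> \<le> 12 * real d / r * L" using r L by (intro mult_left_mono) auto
      moreover have "4 * real d / \<rho> = 4 * real d / r * L powr \<beta>" by (simp add: \<rho>_def powr_minus field_simps)
      moreover have "4 * log_const \<le> 4 * log_const * L" using log_const_nonneg L mult_left_mono[of 1 L "4 * log_const"] by simp
      ultimately have "2 * M + 3 * (4 * real d / \<rho> + log_const) + log_const \<le> (4 * (real d + 1) + 12 * real d / r + 4 * log_const) * L"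
        by (simp add: M_def algebra_simps)
      also have "\<dots> \<le> L * L" using L by (intro mult_right_mono) auto
      finally show ?thesis by (simp add: power2_eq_square)
    qed
    \<comment> \<open>The range starts at the square root of P1 because the partial sums begin at a,
      which may lie slightly below P1. It ends at Q because x * exp \<delta> occurs besides
      x.\<close>
    have smooth: "norm (smooth_prime_sum ch t x) \<le> 1 / L ^ 15 * x" if x: "x \<ge> exp (L powr \<beta>' / 2)" "x \<le> exp L" for x
    proof -
      have "L ^ 1 \<le> L ^ 5" using L by (intro power_increasing) auto
      then have x2: "x \<ge> 2" using x E(6) L by simp
      have lnx: "ln x \<ge> L powr \<beta>' / 2" "ln x \<le> L" 
        using ln_mono[of "exp (L powr \<beta>' / 2)" x] ln_mono[of x "exp L"] x x2 by simp_all
      have lp: "L powr \<beta>' > 0" using L by simp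
      have lx: "ln x > 0" using lnx lp by linarith
      have kb: "L powr \<beta>' = L powr \<kappa> * L powr \<beta>" by (simp add: \<kappa>_def flip: powr_add)
      have inv: "1 / ln x \<le> \<rho> / 4"
      proof -
        have "8 / r * L powr \<beta> \<le> L powr \<kappa> * L powr \<beta>" using E(4) by (intro mult_right_mono) auto
        then have "4 / r * L powr \<beta> \<le> ln x" using lnx kb by simp
        then have "1 / ln x \<le> 1 / (4 / r * L powr \<beta>)" using lx r L by (intro divide_left_mono mult_pos_pos) auto
        then show ?thesis by (simp add: \<rho>_def powr_minus field_simps)
      qed
      have "norm (smooth_prime_sum ch t x) \<le> (18 * real d * ln x / L ^ 20 + 6 * L\<^sup>2 / (L ^ 20)\<^sup>2 + 8 * L ^ 20 * L\<^sup>2 * x powr (- \<rho> / 4)) * x"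
      proof (rule smooth_prime_sum_bound[OF q2 prim x2 \<rho> inv _ _ l(1,2)])
        show "2 \<le> L ^ 20" using power_mono[of 2 L 20] L by (simp add: order_trans)
        show "\<bar>t\<bar> + L ^ 20 \<le> T - 1" using t E(8) by (simp add: T_def L_def)
        show "norm (l z) \<le> L\<^sup>2" if "1 - \<rho> / 4 \<le> Re z" "Re z \<le> 1 + \<rho> / 4" "\<bar>Im z\<bar> \<le> T - 1" for z
          using l(3)[OF that] M1 by linarith
      qed auto
      also have "\<dots> \<le> (18 * L * L / L ^ 20 + 6 * L\<^sup>2 / (L ^ 20)\<^sup>2 + 8 * L ^ 20 * L\<^sup>2 * exp (- (r/8) * L powr \<kappa>)) * x"
      proof (intro mult_right_mono add_mono mult_left_mono divide_right_mono mult_mono)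
        have "(r/8) * L powr \<kappa> = \<rho> / 4 * (L powr \<beta>' / 2)" unfolding kb using L by (simp add: \<rho>_def powr_minus field_simps)
        also have "\<dots> \<le> \<rho> / 4 * ln x" using lnx \<rho> by (intro mult_left_mono) auto
        finally show "x powr (- \<rho> / 4) \<le> exp (- (r/8) * L powr \<kappa>)" using x2 by (simp add: powr_def)
      qed (use L lnx x2 in auto)
      also have "\<dots> \<le> 1 / L ^ 15 * x" using E(2) x2 by (intro mult_right_mono) auto
      finally show ?thesis .
    qed
    \<comment> \<open>The sum runs over a < p <= b, and subtracting 1 from the ceiling makes a < p
      equivalent to P1 <= p.\<close>
    define a where "a = nat \<lceil>exp (L powr \<beta>')\<rceil> - 1"
    define b where "b = nat \<lfloor>Q powr (1/10)\<rfloor>"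
    have a: "a \<ge> 1" "real a \<ge> exp (L powr \<beta>') - 1"
    proof -
      have "real (nat \<lceil>exp (L powr \<beta>')\<rceil>) \<ge> exp (L powr \<beta>')" by (rule real_nat_ceiling_ge)
      moreover from this have "nat \<lceil>exp (L powr \<beta>')\<rceil> \<ge> 2" using E(11) by linarith
      ultimately show "a \<ge> 1" "real a \<ge> exp (L powr \<beta>') - 1" by (auto simp: a_def of_nat_diff)
    qed
    have Q10: "Q powr (1/10) = exp (L / 10)" using Q by (simp add: powr_def L_def)
    have b: "real b \<le> exp (L / 10)" unfolding b_def Q10 by (rule of_nat_floor) simp
    have mem: "prime p \<and> exp (ln Q powr \<beta>') \<le> real p \<and> real p \<le> Q powr (1/10) \<longleftrightarrow> prime p \<and> p \<in> {a<..b}" for p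
    proof -
      have "nat \<lceil>exp (L powr \<beta>')\<rceil> \<le> p \<longleftrightarrow> exp (L powr \<beta>') \<le> real p" by (simp add: nat_le_iff ceiling_le_iff)
      moreover have "a < p \<longleftrightarrow> nat \<lceil>exp (L powr \<beta>')\<rceil> \<le> p" using a(1) unfolding a_def by linarith
      moreover have "p \<le> b \<longleftrightarrow> real p \<le> Q powr (1/10)" by (simp add: b_def le_nat_floor le_nat_iff le_floor_iff)
      ultimately show ?thesis by (auto simp: L_def)
    qed
    have "(\<Sum>p\<in>prime_window \<beta>' Q. prime_term ch (Complex 1 t) p)
       = (\<Sum>p\<in>{a<..b}. prime_term ch (Complex 1 t) p)"
      unfolding prime_window_def mem by (rule sum.mono_neutral_left) (auto simp: prime_term_def)
    also have "\<dots> = (\<Sum>p\<in>{a<..b}. prime_term ch (Complex 0 t) p / of_nat p)"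
    proof (intro sum.cong refl)
      fix p assume p: "p \<in> {a<..b}"
      have "Complex 1 t = Complex 0 t + 1" by (simp add: complex_eq_iff)
      then have "of_nat p powr Complex 1 t = of_nat p powr Complex 0 t * of_nat p" using p by (simp add: powr_add)
      then show "prime_term ch (Complex 1 t) p = prime_term ch (Complex 0 t) p / of_nat p" by (simp add: prime_term_def)
    qed
    finally have eq: "(\<Sum>p\<in>prime_window \<beta>' Q. prime_term ch (Complex 1 t) p)
       = (\<Sum>p\<in>{a<..b}. prime_term ch (Complex 0 t) p / of_nat p)" .
    show "norm (\<Sum>p\<in>prime_window \<beta>' Q. prime_term ch (Complex 1 t) p) \<le> 1 / (ln Q)\<^sup>2"
    proof (cases "a \<le> b")
      case False
      then show ?thesis unfolding eq by simp
    next
      case True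
      have S: "norm (\<Sum>k\<le>n. prime_term ch (Complex 0 t) k) \<le> 1 / L ^ 4 * real n" if n: "a \<le> n" "n \<le> b" for n
      proof -
        define \<delta> where "\<delta> = 1 / L ^ 5"
        have L5: "L ^ 5 \<ge> 1" using L by (intro one_le_power) auto
        have \<delta>: "0 < \<delta>" "\<delta> \<le> 1" using L5 L by (auto simp: \<delta>_def divide_le_eq)
        have n1: "real n \<ge> exp (L powr \<beta>' / 2)" using n a E(5) by linarith
        have n2: "real n \<le> exp (L / 10)" using n b by linarith
        have "exp \<delta> \<le> exp 1" using \<delta> by simp
        then have e3: "exp \<delta> \<le> 3" using exp_le by linarith
        have ne: "real n * exp \<delta> \<le> exp L"
        proof -
          have "real n * exp \<delta> \<le> exp (L/10) * 3" using n2 e3 by (intro mult_mono) auto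
          then show ?thesis using E(7) by simp
        qed
        have ne1: "real n \<le> real n * exp \<delta>" using \<delta> by (simp add: mult_le_cancel_left1)
        have "norm (\<Sum>k\<le>nat \<lfloor>real n\<rfloor>. prime_term ch (Complex 0 t) k) \<le> (4 * (1 / L ^ 15) / \<delta> + 2 * real d * \<delta>) * real n + real d"
        proof (rule prime_sum_desmooth[OF q2 prim _ \<delta>])
          show "norm (smooth_prime_sum ch t (real n)) \<le> 1 / L ^ 15 * real n" using n1 ne ne1 by (intro smooth) auto
          show "norm (smooth_prime_sum ch t (real n * exp \<delta>)) \<le> 1 / L ^ 15 * (real n * exp \<delta>)" using n1 ne ne1 by (intro smooth) auto
        qed (use n a L in auto)
        also have "\<dots> \<le> 1 / L ^ 4 * real n"
        proof -
          have p1: "4 * (1 / L ^ 15) / \<delta> \<le> 1 / 4 * (1 / L ^ 4)"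
          proof -
            have "(2::real) ^ 6 \<le> L ^ 6" using L by (intro power_mono) auto
            then have "4 / L ^ 6 \<le> 1 / 4" using L by (simp add: divide_le_eq)
            then have "4 / L ^ 6 * (1 / L ^ 4) \<le> 1 / 4 * (1 / L ^ 4)" using L by (intro mult_right_mono) auto
            moreover have "4 * (1 / L ^ 15) / \<delta> = 4 / L ^ 6 * (1 / L ^ 4)"
            proof -
              have "L ^ 15 = L ^ 5 * (L ^ 6 * L ^ 4)" by (simp flip: power_add)
              moreover have "L ^ 5 \<noteq> 0" using L by simp
              ultimately show ?thesis by (simp only: \<delta>_def) (simp add: divide_simps)
            qed
            ultimately show ?thesis by simp
          qed
          have p2: "2 * real d * \<delta> \<le> 1 / 4 * (1 / L ^ 4)"
          proof -
            have "2 * real d * \<delta> \<le> (L / 4) * (1 / L ^ 5)" unfolding \<delta>_def using L by (intro mult_right_mono) auto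
            also have "\<dots> = 1 / 4 * (1 / L ^ 4)" using L by (simp add: power_Suc[of L 4, simplified] field_simps eval_nat_numeral)
            finally show ?thesis .
          qed
          have p3: "real d \<le> 1 / 8 * (1 / L ^ 4) * real n"
          proof -
            have "L ^ 5 \<le> real n" using n1 E(6) by linarith
            then have "1 / 8 * (1 / L ^ 4) * L ^ 5 \<le> 1 / 8 * (1 / L ^ 4) * real n" using L by (intro mult_left_mono) auto
            moreover have "1 / 8 * (1 / L ^ 4) * L ^ 5 = L / 8" using L by (simp add: eval_nat_numeral)
            ultimately show ?thesis using L by linarith
          qed
          have "(4 * (1 / L ^ 15) / \<delta> + 2 * real d * \<delta>) * real n \<le> (1 / 4 * (1 / L ^ 4) + 1 / 4 * (1 / L ^ 4)) * real n"
            using p1 p2 by (intro mult_right_mono) auto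
          then have "(4 * (1 / L ^ 15) / \<delta> + 2 * real d * \<delta>) * real n + real d \<le> (5 / 8) * (1 / L ^ 4 * real n)"
            using p3 by (simp add: algebra_simps)
          also have "\<dots> \<le> 1 * (1 / L ^ 4 * real n)" using L by (intro mult_right_mono) auto
          finally show ?thesis by simp
        qed
        finally show ?thesis by simp
      qed
      have lb: "ln (real b) \<le> L"
      proof -
        have "real b > 0" using a True by simp
        then have "ln (real b) \<le> ln (exp (L / 10))" using b by (intro ln_mono) auto
        then show ?thesis using L by simp
      qed
      have "norm (\<Sum>p\<in>{a<..b}. prime_term ch (Complex 0 t) p / of_nat p) \<le> 1 / L ^ 4 * (2 + ln (real b))"
        by (rule sum_by_parts_div[OF a(1) True S])
      also have "\<dots> \<le> 1 / L ^ 4 * (2 + L)" using lb L by (intro mult_left_mono) auto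
      also have "\<dots> \<le> 1 / L\<^sup>2" using E(10) by simp
      finally show ?thesis unfolding eq by (simp add: L_def)
    qed
  qed auto
qed

end

section \<open>Ramare's identity\<close>

lemma sum_div_reindex:
  fixes f :: "nat \<Rightarrow> 'a::comm_monoid_add"
  assumes "p \<ge> 1"
  shows "(\<Sum>n | n \<in> {1..N} \<and> p dvd n \<and> R (n div p). f (n div p)) = (\<Sum>m | m \<in> {1..N} \<and> p * m \<le> N \<and> R m. f m)"
proof (rule sum.reindex_bij_witness[of _ "\<lambda>m. p * m" "\<lambda>n. n div p"], goal_cases)
  case (2 n)
  then obtain m where "n = p * m" by (auto elim: dvdE)
  then show ?case using 2 assms by (auto simp: Suc_le_eq intro: order_trans[of m "p * m"])
qed (use assms in auto)

lemma sum_divisor_swap: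
  fixes g :: "nat \<Rightarrow> nat \<Rightarrow> 'a::comm_monoid_add"
  assumes "finite P" "\<And>p. p \<in> P \<Longrightarrow> p \<ge> 1"
  shows "(\<Sum>n=1..N. \<Sum>p | p \<in> P \<and> p dvd n \<and> R (n div p). g p (n div p)) = (\<Sum>p\<in>P. \<Sum>m | m \<in> {1..N} \<and> p * m \<le> N \<and> R m. g p m)"
proof -
  have "(\<Sum>n=1..N. \<Sum>p | p \<in> P \<and> p dvd n \<and> R (n div p). g p (n div p)) =
     (\<Sum>n=1..N. \<Sum>p\<in>P. if p dvd n \<and> R (n div p) then g p (n div p) else 0)"
  proof (rule sum.cong[OF refl])
    fix n
    have "{p. p \<in> P \<and> p dvd n \<and> R (n div p)} = {p\<in>P. p dvd n \<and> R (n div p)}" by auto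
    then show "(\<Sum>p | p \<in> P \<and> p dvd n \<and> R (n div p). g p (n div p)) = (\<Sum>p\<in>P. if p dvd n \<and> R (n div p) then g p (n div p) else 0)"
      using sum.inter_filter[OF assms(1), of "\<lambda>p. g p (n div p)" "\<lambda>p. p dvd n \<and> R (n div p)"] by simp
  qed
  also have "\<dots> = (\<Sum>p\<in>P. \<Sum>n=1..N. if p dvd n \<and> R (n div p) then g p (n div p) else 0)" by (rule sum.swap)
  also have "\<dots> = (\<Sum>p\<in>P. \<Sum>m | m \<in> {1..N} \<and> p * m \<le> N \<and> R m. g p m)"
  proof (rule sum.cong[OF refl])
    fix p assume p: "p \<in> P"
    have "{n. n \<in> {1..N} \<and> p dvd n \<and> R (n div p)} = {n\<in>{1..N}. p dvd n \<and> R (n div p)}" by auto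
    then have "(\<Sum>n=1..N. if p dvd n \<and> R (n div p) then g p (n div p) else 0) = (\<Sum>n | n \<in> {1..N} \<and> p dvd n \<and> R (n div p). g p (n div p))"
      using sum.inter_filter[of "{1..N}" "\<lambda>n. g p (n div p)" "\<lambda>n. p dvd n \<and> R (n div p)"] by simp
    also have "\<dots> = (\<Sum>m | m \<in> {1..N} \<and> p * m \<le> N \<and> R m. g p m)"
      by (rule sum_div_reindex) (rule assms(2)[OF p])
    finally show "(\<Sum>n=1..N. if p dvd n \<and> R (n div p) then g p (n div p) else 0) = (\<Sum>m | m \<in> {1..N} \<and> p * m \<le> N \<and> R m. g p m)" .
  qed
  finally show ?thesis .
qed

lemma two_power_card_prime_divisors:
  assumes "finite P" "\<And>p. p \<in> P \<Longrightarrow> prime p \<and> p dvd n" "n \<ge> (1::nat)"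
  shows "2 ^ card P \<le> n"
  using assms
proof (induction P arbitrary: n rule: finite_induct)
  case (insert p P)
  have pn: "prime p" "p dvd n" using insert.prems(1)[of p] by auto
  from pn(2) obtain m where m: "n = p * m" by (rule dvdE)
  have "m \<ge> 1" using insert.prems(2) m by (cases m) simp_all
  moreover have "prime q \<and> q dvd m" if "q \<in> P" for q
  proof -
    have q: "prime q" "q dvd p * m" "q \<noteq> p" using insert.prems(1)[of q] insert.hyps(2) that m by auto
    then have "\<not> q dvd p" using primes_dvd_imp_eq[OF q(1) pn(1)] by blast
    then show ?thesis using q prime_dvd_mult_iff[OF q(1), of p m] by blast
  qed
  ultimately have "2 ^ card P \<le> m" by (intro insert.IH) simp_all
  moreover have "2 \<le> p" using pn(1) by (rule prime_ge_2_nat)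
  ultimately have "2 * 2 ^ card P \<le> p * m" by (intro mult_mono) auto
  then show ?case using insert m by simp
qed simp

lemma card_prime_divisors_le:
  assumes "finite P" "\<And>p. p \<in> P \<Longrightarrow> prime p \<and> p dvd n" "n \<ge> 1" "n \<le> N"
  shows "real (card P) \<le> 2 * (1 + ln (real N))"
proof -
  have "(2::real) ^ card P \<le> real n"
    using of_nat_mono[OF two_power_card_prime_divisors[OF assms(1-3)], where 'a = real] by simp
  then have "ln ((2::real) ^ card P) \<le> ln (real N)" using assms(3,4) by (intro ln_mono) auto
  then have "real (card P) * ln 2 \<le> ln (real N)" by (simp add: ln_realpow)
  moreover have "real (card P) * (1/2) \<le> real (card P) * ln 2"
    using ln2_ge_two_thirds by (intro mult_left_mono) auto
  ultimately show ?thesis by simp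
qed

lemma sum_inverse_le_ln: "finite P \<Longrightarrow> P \<subseteq> {1..N} \<Longrightarrow> (\<Sum>k\<in>P. 1 / real k) \<le> 1 + ln (real N)"
proof -
  assume P: "finite P" "P \<subseteq> {1..N}"
  have "(\<Sum>k=1..N. 1 / real k) \<le> 1 + ln (real N)" if "N \<ge> 1"
    using that
  proof (induction N rule: dec_induct)
    case (step n)
    have "ln (real n / real (Suc n)) \<le> real n / real (Suc n) - 1" using step by (intro ln_le_minus_one) auto
    then have "1 / real (Suc n) \<le> ln (real (Suc n)) - ln (real n)"
      using step by (simp add: ln_div field_simps)
    then show ?case using step by simp
  qed simp
  moreover have "(\<Sum>k\<in>P. 1 / real k) \<le> (\<Sum>k=1..N. 1 / real k)" using P by (intro sum_mono2) auto
  ultimately show ?thesis using P by (cases "N = 0") auto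
qed

lemma sum_inverse_squares_le:
  assumes "finite P" "\<And>k. k \<in> P \<Longrightarrow> real k \<ge> x" "x \<ge> 2"
  shows "(\<Sum>k\<in>P. 1 / (real k)\<^sup>2) \<le> 2 / x"
proof -
  define a where "a = nat \<lceil>x\<rceil>"
  have a: "a \<ge> 2" "real a \<ge> x" using assms(3) by (auto simp: a_def) linarith+
  define b where "b = Max (insert a P)"
  have sub: "P \<subseteq> {a..b}" using assms by (auto simp: a_def b_def nat_le_iff ceiling_le_iff)
  have "a \<le> b" using assms(1) by (simp add: b_def)
  then have "(\<Sum>k=a..b. 1 / (real k)\<^sup>2) \<le> 1 / real (a - 1) - 1 / real b"
  proof (induction b rule: dec_induct)
    case base
    have "1 / (real a)\<^sup>2 \<le> 1 / (real a * (real a - 1))"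
      using a by (intro divide_left_mono) (auto simp: power2_eq_square)
    also have "\<dots> = 1 / real (a - 1) - 1 / real a" using a by (simp add: of_nat_diff field_simps)
    finally show ?case by simp
  next
    case (step n)
    have n: "n \<ge> 2" using step a by simp
    have "1 / (real (Suc n))\<^sup>2 \<le> 1 / (real n * real (Suc n))"
      using n by (intro divide_left_mono) (auto simp: power2_eq_square)
    also have "\<dots> = 1 / real n - 1 / real (Suc n)" using n by (simp add: field_simps)
    finally show ?case using step by simp
  qed
  also have "\<dots> \<le> 1 / real (a - 1)" by simp
  also have "\<dots> \<le> 1 / (x / 2)"
    using a assms(3) by (intro divide_left_mono) (auto simp: of_nat_diff)
  finally have "(\<Sum>k=a..b. 1 / (real k)\<^sup>2) \<le> 2 / x" by simp
  moreover have "(\<Sum>k\<in>P. 1 / (real k)\<^sup>2) \<le> (\<Sum>k=a..b. 1 / (real k)\<^sup>2)" using sub by (intro sum_mono2) auto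
  ultimately show ?thesis by simp
qed

lemma sum_UN_le:
  fixes f :: "'a \<Rightarrow> real"
  assumes "finite I" "\<And>i. i \<in> I \<Longrightarrow> finite (A i)" "\<And>x. f x \<ge> 0"
  shows "(\<Sum>x\<in>(\<Union>i\<in>I. A i). f x) \<le> (\<Sum>i\<in>I. \<Sum>x\<in>A i. f x)"
  using assms(1,2)
proof (induction I rule: finite_induct)
  case (insert i I)
  have "(\<Sum>x\<in>A i \<union> (\<Union>i\<in>I. A i). f x) \<le> (\<Sum>x\<in>A i. f x) + (\<Sum>x\<in>(\<Union>i\<in>I. A i). f x)"
    using sum.union_inter[of "A i" "\<Union>i\<in>I. A i" f] insert sum_nonneg[of "A i \<inter> (\<Union>i\<in>I. A i)" f] assms(3) by simp
  also have "\<dots> \<le> (\<Sum>x\<in>A i. f x) + (\<Sum>i\<in>I. \<Sum>x\<in>A i. f x)" using insert by simp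
  finally show ?case using insert by simp
qed simp

lemma norm_sum_square_le:
  fixes z :: "'a \<Rightarrow> complex"
  assumes "finite A"
  shows "(norm (\<Sum>p\<in>A. z p))\<^sup>2 \<le> real (card A) * (\<Sum>p\<in>A. (norm (z p))\<^sup>2)"
proof -
  have "(norm (\<Sum>p\<in>A. z p))\<^sup>2 \<le> (\<Sum>p\<in>A. norm (z p))\<^sup>2" by (intro power_mono norm_sum) auto
  also have "\<dots> \<le> (\<Sum>p\<in>A. (norm (z p))\<^sup>2) * real (card A)"
    by (rule sum_squared_le_sum_of_squares)
  finally show ?thesis by (simp add: mult.commute)
qed

lemma norm_add_square_le: "(norm (x + y))\<^sup>2 \<le> 2 * (norm x)\<^sup>2 + 2 * (norm (y::complex))\<^sup>2"
proof -
  have "(norm (x + y))\<^sup>2 \<le> (norm x + norm y)\<^sup>2" by (intro power_mono norm_triangle_ineq) auto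
  also have "\<dots> \<le> 2 * (norm x)\<^sup>2 + 2 * (norm y)\<^sup>2"
    using sum_squares_bound[of "norm x" "norm y"] by (simp add: power2_sum)
  finally show ?thesis .
qed

section \<open>Mean squares of the coefficients in Ramare's identity\<close>

definition ram_count :: "nat set \<Rightarrow> nat \<Rightarrow> nat" where
  "ram_count P m = card {p \<in> P. p dvd m}"

locale lfun_mean = lfun_tau +
  fixes K :: real
  assumes K_ge_1: "K \<ge> 1"
    and mean_square: "\<And>N::nat. (\<Sum>n=1..N. (norm (lf_coeff F n))\<^sup>2) \<le> K * real N"
    and sieved_mean_square: "\<And>P1 P2 N. 2 \<le> P1 \<Longrightarrow> P1 \<le> P2 \<Longrightarrow> P2 \<le> real N \<Longrightarrow>
      (\<Sum>n | n \<in> {1..N} \<and> (\<forall>p. prime p \<and> P1 \<le> real p \<and> real p \<le> P2 \<longrightarrow> \<not> p dvd n). (norm (lf_coeff F n))\<^sup>2) \<le> K * (real N * ln P1 / ln P2)"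
begin

text \<open>\<open>ram_coeff P M0 n = lam n\<close> whenever \<open>n\<close> is large and has a prime factor in \<open>P\<close>, but is
  divisible by no square of one, so that \<open>rem_coeff\<close> is supported on a sparse set. Apart from the
  condition on the size of \<open>n\<close>, the Dirichlet polynomial of \<open>ram_coeff\<close> is a product of one
  over \<open>P\<close> and one over \<open>m \<ge> M0\<close>.\<close>

definition ram_coeff :: "nat set \<Rightarrow> real \<Rightarrow> nat \<Rightarrow> complex" where
  "ram_coeff P M0 n = (\<Sum>p | p \<in> P \<and> p dvd n \<and> M0 \<le> real (n div p).
     lam p * (lam (n div p) / of_nat (1 + ram_count P (n div p))))"

definition rem_coeff :: "nat set \<Rightarrow> real \<Rightarrow> nat \<Rightarrow> complex" where
  "rem_coeff P M0 n = lam n - ram_coeff P M0 n"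

text \<open>Write n = p^r * m with r >= k and p not dividing m. Multiplicativity, |lam (p^r)| <= (r
  + 1)^d and the mean square over m leave the sum over r >= k of (r + 1)^(2 d) / p^r. The factor 1 /
  p^k is the saving; majorizing the remaining powers of 1/p by those of 1/2 makes C independent of
  p.\<close>

lemma mean_square_prime_power_multiples:
  "\<exists>C\<ge>0. \<forall>p N. \<forall>k\<in>{1,2}. prime p \<longrightarrow> (\<Sum>n | n \<in> {1..N} \<and> p ^ k dvd n. (norm (lam n))\<^sup>2) \<le> C * real N / real p ^ k"
proof -
  have s: "summable (\<lambda>i. (real i + 3) ^ (2 * d) * (1/2) ^ i)"
  proof (rule summable_comparison_test_bigo)
    show "(\<lambda>i. (real i + 3) ^ (2 * d) * (1/2) ^ i) \<in> O(\<lambda>n. 1 / real n ^ 2)" by real_asymp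
    show "summable (\<lambda>n. norm (1 / real n ^ 2))"
      using inverse_power_summable[of 2, where 'a = real] by (simp add: field_simps)
  qed
  define C where "C = K * (\<Sum>i. (real i + 3) ^ (2 * d) * (1/2) ^ i)"
  have C: "C \<ge> 0" unfolding C_def using K_ge_1 by (intro mult_nonneg_nonneg suminf_nonneg s) auto
  have "(\<Sum>n | n \<in> {1..N} \<and> p ^ k dvd n. (norm (lam n))\<^sup>2) \<le> C * real N / real p ^ k"
    if k: "k \<in> {1,2}" and p: "prime p" for p N k
  proof -
    have p2: "p \<ge> 2" using p by (rule prime_ge_2_nat)
    \<comment> \<open>The upper end of r is generous: r < p^r <= n <= N.\<close>
    define B where "B = (SIGMA r:{k..k+N}. {m. m \<in> {1..N div p ^ r} \<and> \<not> p dvd m})"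
    have fB: "finite B" by (auto simp: B_def)
    have sub: "{n. n \<in> {1..N} \<and> p ^ k dvd n} \<subseteq> (\<lambda>(r, m). p ^ r * m) ` B"
    proof
      fix n assume n: "n \<in> {n. n \<in> {1..N} \<and> p ^ k dvd n}"
      then have n0: "n \<noteq> 0" "n \<le> N" "n \<ge> 1" by auto
      have np: "\<not> is_unit p" using p2 by auto
      obtain m where m: "n = p ^ multiplicity p n * m" "\<not> p dvd m"
        using multiplicity_decompose'[OF n0(1) np] by metis
      define r where "r = multiplicity p n"
      have kr: "k \<le> r" unfolding r_def using n n0 np by (intro multiplicity_geI) auto
      have "r < p ^ r" using p2 by (intro power_gt_expt) auto
      moreover have m0: "m \<noteq> 0" using m(1) n0(1) by (metis mult_0_right)
      ultimately have "r \<le> n" using m(1) mult_le_mono2[of 1 m "p ^ r"] unfolding r_def[symmetric] by linarith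
      moreover have "m \<le> N div p ^ r" using m(1) n0(2) p2 unfolding r_def[symmetric]
        by (simp add: less_eq_div_iff_mult_less_eq mult.commute)
      ultimately have "(r, m) \<in> B" using kr n0 m(2) \<open>m \<noteq> 0\<close> by (auto simp: B_def)
      then show "n \<in> (\<lambda>(r, m). p ^ r * m) ` B" using m(1) by (force simp: r_def)
    qed
    have "(\<Sum>n | n \<in> {1..N} \<and> p ^ k dvd n. (norm (lam n))\<^sup>2) \<le> (\<Sum>n\<in>(\<lambda>(r, m). p ^ r * m) ` B. (norm (lam n))\<^sup>2)"
      using fB by (intro sum_mono2[OF _ sub]) auto
    also have "\<dots> \<le> (\<Sum>(r, m)\<in>B. (norm (lam (p ^ r * m)))\<^sup>2)"
      using sum_image_le[OF fB, of "\<lambda>n. (norm (lam n))\<^sup>2" "\<lambda>(r, m). p ^ r * m"] by (simp add: o_def split_beta)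
    also have "\<dots> = (\<Sum>r\<in>{k..k+N}. \<Sum>m | m \<in> {1..N div p ^ r} \<and> \<not> p dvd m. (norm (lam (p ^ r * m)))\<^sup>2)"
      unfolding B_def by (rule sum.Sigma[symmetric]) auto
    also have "\<dots> \<le> (\<Sum>r\<in>{k..k+N}. (real r + 1) ^ (2 * d) * (K * (real N / real p ^ r)))"
    proof (rule sum_mono)
      fix r
      have "(\<Sum>m | m \<in> {1..N div p ^ r} \<and> \<not> p dvd m. (norm (lam (p ^ r * m)))\<^sup>2)
         \<le> (\<Sum>m | m \<in> {1..N div p ^ r} \<and> \<not> p dvd m. (real r + 1) ^ (2 * d) * (norm (lam m))\<^sup>2)"
      proof (rule sum_mono)
        fix m assume m: "m \<in> {m. m \<in> {1..N div p ^ r} \<and> \<not> p dvd m}"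
        then have "coprime (p ^ r) m" using p by (auto intro!: coprime_power_left_iff[THEN iffD2] prime_imp_coprime)
        moreover have "p ^ r \<ge> 1" using p2 by simp
        ultimately have "lam (p ^ r * m) = lam (p ^ r) * lam m"
          using framework m unfolding L_framework_def multiplicative_coeffs_def by auto
        then have "(norm (lam (p ^ r * m)))\<^sup>2 = (norm (lam (p ^ r)))\<^sup>2 * (norm (lam m))\<^sup>2"
          by (simp add: norm_mult power_mult_distrib)
        also have "\<dots> \<le> ((real r + 1) ^ d)\<^sup>2 * (norm (lam m))\<^sup>2"
          by (intro mult_right_mono power_mono norm_lam_prime_power p) auto
        finally show "(norm (lam (p ^ r * m)))\<^sup>2 \<le> (real r + 1) ^ (2 * d) * (norm (lam m))\<^sup>2"
          by (simp add: power_mult mult.commute flip: power_mult)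
      qed
      also have "\<dots> = (real r + 1) ^ (2 * d) * (\<Sum>m | m \<in> {1..N div p ^ r} \<and> \<not> p dvd m. (norm (lam m))\<^sup>2)"
        by (simp add: sum_distrib_left)
      also have "\<dots> \<le> (real r + 1) ^ (2 * d) * (K * (real N / real p ^ r))"
      proof (rule mult_left_mono)
        have "(\<Sum>m | m \<in> {1..N div p ^ r} \<and> \<not> p dvd m. (norm (lam m))\<^sup>2) \<le> (\<Sum>m=1..N div p ^ r. (norm (lam m))\<^sup>2)"
          by (intro sum_mono2) auto
        also have "\<dots> \<le> K * real (N div p ^ r)" by (rule mean_square)
        also have "\<dots> \<le> K * (real N / real p ^ r)"
          using K_ge_1 of_nat_div_le_of_nat[of N "p ^ r", where 'a = real] by (intro mult_left_mono) auto
        finally show "(\<Sum>m | m \<in> {1..N div p ^ r} \<and> \<not> p dvd m. (norm (lam m))\<^sup>2) \<le> K * (real N / real p ^ r)" .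
      qed simp
      finally show "(\<Sum>m | m \<in> {1..N div p ^ r} \<and> \<not> p dvd m. (norm (lam (p ^ r * m)))\<^sup>2) \<le> (real r + 1) ^ (2 * d) * (K * (real N / real p ^ r))" .
    qed
    also have "\<dots> = (\<Sum>i\<le>N. (real (k + i) + 1) ^ (2 * d) * (K * (real N / real p ^ (k + i))))"
      by (rule sum.reindex_bij_witness[of _ "\<lambda>i. k + i" "\<lambda>r. r - k"]) auto
    also have "\<dots> \<le> (\<Sum>i\<le>N. K * real N / real p ^ k * ((real i + 3) ^ (2 * d) * (1/2) ^ i))"
    proof (rule sum_mono)
      fix i
      have "(real (k + i) + 1) ^ (2 * d) \<le> (real i + 3) ^ (2 * d)" using k by (intro power_mono) auto
      moreover have "1 / real p ^ i \<le> 1 / 2 ^ i" using p2 by (intro divide_left_mono power_mono mult_pos_pos) auto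
      ultimately have "(real (k + i) + 1) ^ (2 * d) * (1 / real p ^ i) \<le> (real i + 3) ^ (2 * d) * (1 / 2 ^ i)"
        by (intro mult_mono) auto
      then have "K * real N / real p ^ k * ((real (k + i) + 1) ^ (2 * d) * (1 / real p ^ i)) \<le> K * real N / real p ^ k * ((real i + 3) ^ (2 * d) * (1 / 2 ^ i))"
        using K_ge_1 by (intro mult_left_mono) auto
      then show "(real (k + i) + 1) ^ (2 * d) * (K * (real N / real p ^ (k + i))) \<le> K * real N / real p ^ k * ((real i + 3) ^ (2 * d) * (1/2) ^ i)"
        by (simp add: power_add power_divide mult_ac)
    qed
    also have "\<dots> = K * real N / real p ^ k * (\<Sum>i\<le>N. (real i + 3) ^ (2 * d) * (1/2) ^ i)" by (simp add: sum_distrib_left)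
    also have "\<dots> \<le> K * real N / real p ^ k * (\<Sum>i. (real i + 3) ^ (2 * d) * (1/2) ^ i)"
      using K_ge_1 by (intro mult_left_mono sum_le_suminf s) auto
    also have "\<dots> = C * real N / real p ^ k" by (simp add: C_def)
    finally show ?thesis .
  qed
  then show ?thesis using C by blast
qed

text \<open>Cauchy-Schwarz over the primes of P that divide n, of which there are O(log N).\<close>

lemma ram_coeff_square_le:
  assumes P: "finite P" "\<And>p. p \<in> P \<Longrightarrow> prime p" and n: "1 \<le> n" "n \<le> N"
  shows "(norm (ram_coeff P M0 n))\<^sup>2 \<le> 2 * (1 + ln (real N)) * (real d)\<^sup>2 * (\<Sum>p | p \<in> P \<and> p dvd n. (norm (lam (n div p)))\<^sup>2)"
proof -
  let ?A = "{p. p \<in> P \<and> p dvd n \<and> M0 \<le> real (n div p)}"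
  let ?B = "{p. p \<in> P \<and> p dvd n}"
  have fin: "finite ?A" "finite ?B" using P(1) by auto
  have "(norm (ram_coeff P M0 n))\<^sup>2 \<le> real (card ?A) * (\<Sum>p\<in>?A. (norm (lam p * (lam (n div p) / of_nat (1 + ram_count P (n div p)))))\<^sup>2)"
    unfolding ram_coeff_def by (rule norm_sum_square_le[OF fin(1)])
  also have "\<dots> \<le> (2 * (1 + ln (real N))) * (\<Sum>p\<in>?B. (real d)\<^sup>2 * (norm (lam (n div p)))\<^sup>2)"
  proof (rule mult_mono)
    show "real (card ?A) \<le> 2 * (1 + ln (real N))"
      by (rule card_prime_divisors_le[OF fin(1) _ n]) (use P in auto)
    have "(\<Sum>p\<in>?A. (norm (lam p * (lam (n div p) / of_nat (1 + ram_count P (n div p)))))\<^sup>2) \<le> (\<Sum>p\<in>?A. (real d)\<^sup>2 * (norm (lam (n div p)))\<^sup>2)"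
    proof (rule sum_mono)
      fix p assume p: "p \<in> ?A"
      have "norm (lam (n div p) / of_nat (1 + ram_count P (n div p))) \<le> norm (lam (n div p)) / 1"
        unfolding norm_divide norm_of_nat by (intro divide_left_mono) auto
      then have "norm (lam p * (lam (n div p) / of_nat (1 + ram_count P (n div p)))) \<le> real d * norm (lam (n div p))"
        unfolding norm_mult using norm_lam_prime_le[of p] P p by (intro mult_mono) auto
      then have "(norm (lam p * (lam (n div p) / of_nat (1 + ram_count P (n div p)))))\<^sup>2 \<le> (real d * norm (lam (n div p)))\<^sup>2"
        by (intro power_mono) auto
      then show "(norm (lam p * (lam (n div p) / of_nat (1 + ram_count P (n div p)))))\<^sup>2 \<le> (real d)\<^sup>2 * (norm (lam (n div p)))\<^sup>2"
        by (simp add: power_mult_distrib)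
    qed
    also have "\<dots> \<le> (\<Sum>p\<in>?B. (real d)\<^sup>2 * (norm (lam (n div p)))\<^sup>2)" using fin by (intro sum_mono2) auto
    finally show "(\<Sum>p\<in>?A. (norm (lam p * (lam (n div p) / of_nat (1 + ram_count P (n div p)))))\<^sup>2) \<le> (\<Sum>p\<in>?B. (real d)\<^sup>2 * (norm (lam (n div p)))\<^sup>2)" .
  qed (use n in \<open>auto intro!: sum_nonneg\<close>)
  finally show ?thesis by (simp add: sum_distrib_left mult_ac)
qed

text \<open>A bound that loses log^2 N. It serves where such a loss is harmless: for the n below M0
  * P2, and for the dyadic blocks below Q^(9/4).\<close>

lemma rem_coeff_mean_square_trivial:
  assumes P: "finite P" "\<And>p. p \<in> P \<Longrightarrow> prime p" and "N \<ge> 1"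
  shows "(\<Sum>n=1..N. (norm (rem_coeff P M0 n))\<^sup>2) \<le> (2 * K + 4 * (real d)\<^sup>2 * K) * real N * (1 + ln (real N))\<^sup>2"
proof -
  define l where "l = 1 + ln (real N)"
  have l: "l \<ge> 1" using assms(3) by (simp add: l_def)
  have "(\<Sum>n=1..N. (norm (ram_coeff P M0 n))\<^sup>2) \<le> (\<Sum>n=1..N. 2 * l * (real d)\<^sup>2 * (\<Sum>p | p \<in> P \<and> p dvd n. (norm (lam (n div p)))\<^sup>2))"
    unfolding l_def by (intro sum_mono ram_coeff_square_le P) auto
  also have "\<dots> = 2 * l * (real d)\<^sup>2 * (\<Sum>n=1..N. \<Sum>p | p \<in> P \<and> p dvd n. (norm (lam (n div p)))\<^sup>2)"
    by (simp add: sum_distrib_left)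
  also have "(\<Sum>n=1..N. \<Sum>p | p \<in> P \<and> p dvd n. (norm (lam (n div p)))\<^sup>2) = (\<Sum>p\<in>P. \<Sum>m | m \<in> {1..N} \<and> p * m \<le> N. (norm (lam m))\<^sup>2)"
    using sum_divisor_swap[OF P(1) prime_ge_1_nat[OF P(2)], where N = N and R = "\<lambda>_. True" and g = "\<lambda>p m. (norm (lam m))\<^sup>2"] by simp
  also have "\<dots> \<le> K * real N * l"
  proof -
    have "(\<Sum>p\<in>P. \<Sum>m | m \<in> {1..N} \<and> p * m \<le> N. (norm (lam m))\<^sup>2) \<le> (\<Sum>p\<in>P. if p \<le> N then K * (real N / real p) else 0)"
    proof (rule sum_mono)
      fix p assume p: "p \<in> P"
      then have p1: "p \<ge> 1" by (intro prime_ge_1_nat P(2))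
      show "(\<Sum>m | m \<in> {1..N} \<and> p * m \<le> N. (norm (lam m))\<^sup>2) \<le> (if p \<le> N then K * (real N / real p) else 0)"
      proof (cases "p \<le> N")
        case True
        have "(\<Sum>m | m \<in> {1..N} \<and> p * m \<le> N. (norm (lam m))\<^sup>2) \<le> (\<Sum>m=1..N div p. (norm (lam m))\<^sup>2)"
          using p1 by (intro sum_mono2) (auto simp: less_eq_div_iff_mult_less_eq mult.commute)
        also have "\<dots> \<le> K * real (N div p)" by (rule mean_square)
        also have "\<dots> \<le> K * (real N / real p)" using K_ge_1 of_nat_div_le_of_nat[of N p, where 'a = real] by (intro mult_left_mono) auto
        finally show ?thesis using True by simp
      next
        case False
        have "{m. m \<in> {1..N} \<and> p * m \<le> N} = {}"
        proof -
          have "p * m > N" if "m \<ge> 1" for m using False that mult_le_mono2[of 1 m p] by linarith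
          then show ?thesis by (auto simp: not_le[symmetric])
        qed
        then show ?thesis using False by (simp only: sum.empty if_False order_refl)
      qed
    qed
    also have "\<dots> = (\<Sum>p\<in>{p\<in>P. p \<le> N}. K * (real N / real p))" by (simp only: sum.inter_filter[OF P(1)])
    also have "\<dots> = K * real N * (\<Sum>p\<in>{p\<in>P. p \<le> N}. 1 / real p)" by (simp add: sum_distrib_left)
    also have "\<dots> \<le> K * real N * l" unfolding l_def
      using K_ge_1 P(1) by (intro mult_left_mono sum_inverse_le_ln) (auto dest!: P(2) simp: Suc_le_eq prime_gt_0_nat)
    finally show ?thesis .
  qed
  finally have R: "(\<Sum>n=1..N. (norm (ram_coeff P M0 n))\<^sup>2) \<le> 2 * l * (real d)\<^sup>2 * (K * real N * l)" using l by (simp add: mult_left_mono)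
  have "(\<Sum>n=1..N. (norm (rem_coeff P M0 n))\<^sup>2) \<le> (\<Sum>n=1..N. 2 * (norm (lam n))\<^sup>2 + 2 * (norm (ram_coeff P M0 n))\<^sup>2)"
    unfolding rem_coeff_def using norm_add_square_le[of "lam _" "- ram_coeff P M0 _"] by (intro sum_mono) simp
  also have "\<dots> = 2 * (\<Sum>n=1..N. (norm (lam n))\<^sup>2) + 2 * (\<Sum>n=1..N. (norm (ram_coeff P M0 n))\<^sup>2)"
    by (simp add: sum.distrib sum_distrib_left)
  also have "\<dots> \<le> 2 * (K * real N * l\<^sup>2) + 2 * (2 * l * (real d)\<^sup>2 * (K * real N * l))"
  proof (intro add_mono mult_left_mono R)
    have "K * real N * 1 \<le> K * real N * l\<^sup>2" using K_ge_1 l by (intro mult_left_mono one_le_power) auto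
    then show "(\<Sum>n=1..N. (norm (lam n))\<^sup>2) \<le> K * real N * l\<^sup>2" using mean_square[of N] by simp
  qed auto
  also have "\<dots> = (2 * K + 4 * (real d)\<^sup>2 * K) * real N * l\<^sup>2" by (simp add: power2_eq_square algebra_simps)
  finally show ?thesis by (simp only: l_def)
qed

text \<open>Ramare's identity. If exactly k primes of P divide n, none of them twice, then each
  cofactor m = n / p is divisible by k - 1 of them, so 1 + \<open>ram_count P m\<close> = k, and the
  k terms, each equal to lam n / k, add up to lam n. The lower bound for n ensures n / p >= M0 for
  all p up to P2.\<close>

lemma rem_coeff_eq_0:
  assumes P: "finite P" "\<And>p. p \<in> P \<Longrightarrow> prime p \<and> real p \<le> P2" and n: "n \<ge> 1" "real n \<ge> M0 * P2" "M0 \<ge> 0"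
    and ex: "p0 \<in> P" "p0 dvd n" and sf: "\<And>p. p \<in> P \<Longrightarrow> \<not> p\<^sup>2 dvd n"
  shows "rem_coeff P M0 n = 0"
proof -
  define k where "k = card {p \<in> P. p dvd n}"
  have k: "k \<ge> 1" using ex P(1) by (auto simp: k_def Suc_le_eq card_gt_0_iff)
  have A: "{p. p \<in> P \<and> p dvd n \<and> M0 \<le> real (n div p)} = {p \<in> P. p dvd n}"
  proof -
    have "M0 \<le> real (n div p)" if p: "p \<in> P" "p dvd n" for p
    proof -
      have p0: "real p > 0" using P(2)[OF p(1)] prime_gt_0_nat by simp
      have "M0 * real p \<le> M0 * P2" using P(2)[OF p(1)] n(3) by (intro mult_left_mono) auto
      then have "M0 * real p \<le> real n" using n(2) by linarith
      then show ?thesis using p0 real_of_nat_div[OF p(2)] by (simp add: pos_le_divide_eq)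
    qed
    then show ?thesis by auto
  qed
  have "ram_coeff P M0 n = (\<Sum>p\<in>{p \<in> P. p dvd n}. lam n / of_nat k)"
    unfolding ram_coeff_def A
  proof (intro sum.cong refl)
    fix p assume p: "p \<in> {p \<in> P. p dvd n}"
    then have pp: "prime p" using P by auto
    obtain m where m: "n = p * m" using p by (auto elim: dvdE)
    have nm: "n div p = m" using m prime_gt_0_nat[OF pp] by simp
    have m1: "m \<ge> 1" using m n(1) by (cases m) auto
    have npm: "\<not> p dvd m"
    proof
      assume "p dvd m"
      then have "p\<^sup>2 dvd n" unfolding m power2_eq_square by (intro mult_dvd_mono) auto
      then show False using sf p by auto
    qed
    then have "coprime p m" using pp prime_imp_coprime by blast
    then have mult: "lam n = lam p * lam m"
      using framework m1 prime_ge_1_nat[OF pp] unfolding m L_framework_def multiplicative_coeffs_def by auto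
    have "{q \<in> P. q dvd n} = insert p {q \<in> P. q dvd m}"
      proof (intro equalityI subsetI)
      fix q assume q: "q \<in> {q \<in> P. q dvd n}"
      then have "q dvd p \<or> q dvd m" using P(2)[of q] m by (simp add: prime_dvd_mult_iff)
      moreover have "q = p" if "q dvd p" using primes_dvd_imp_eq[OF _ pp that] P(2)[of q] q by simp
      ultimately show "q \<in> insert p {q \<in> P. q dvd m}" using q by auto
    next
      fix q assume "q \<in> insert p {q \<in> P. q dvd m}"
      then show "q \<in> {q \<in> P. q dvd n}" using p m by auto
    qed
    then have "k = Suc (ram_count P m)" using npm P(1) by (simp add: k_def ram_count_def)
    then show "lam p * (lam (n div p) / of_nat (1 + ram_count P (n div p))) = lam n / of_nat k"
      by (simp add: nm mult)
  qed
  also have "\<dots> = of_nat k * (lam n / of_nat k)" by (simp add: k_def)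
  also have "\<dots> = lam n" using k by simp
  finally show ?thesis by (simp add: rem_coeff_def)
qed

text \<open>Outside three exceptional sets the coefficient is 0: \<open>A1\<close>, the n too small
  for the condition on n / p; \<open>A2\<close>, the n without a prime factor in the window, where
  \<open>ram_coeff\<close> is an empty sum and (A3) applies to lam; and \<open>Bad\<close>, the n
  divisible by p^2 for some p in the window, which carry a share of order 1/P1 up to logarithms.
  They account for the three terms of the bound.\<close>

lemma rem_coeff_mean_square:
  "\<exists>C\<ge>1. \<forall>P1 P2 M0 N. 2 \<le> P1 \<longrightarrow> P1 \<le> P2 \<longrightarrow> P2 \<le> real N \<longrightarrow> 1 \<le> M0 \<longrightarrow>
    (\<Sum>n=1..N. (norm (rem_coeff {p. prime p \<and> P1 \<le> real p \<and> real p \<le> P2} M0 n))\<^sup>2) \<le>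
     C * (M0 * P2 * (1 + ln (M0 * P2))\<^sup>2 + real N * ln P1 / ln P2 + real N * (1 + ln (real N))\<^sup>2 / P1)"
proof -
  from mean_square_prime_power_multiples obtain C2 where C2': "C2 \<ge> 0 \<and> (\<forall>p N. \<forall>k\<in>{1,2}. prime p \<longrightarrow> (\<Sum>n | n \<in> {1..N} \<and> p ^ k dvd n. (norm (lam n))\<^sup>2) \<le> C2 * real N / real p ^ k)" ..
  have C2: "C2 \<ge> 0" "\<And>p N k. k \<in> {1,2} \<Longrightarrow> prime p \<Longrightarrow> (\<Sum>n | n \<in> {1..N} \<and> p ^ k dvd n. (norm (lam n))\<^sup>2) \<le> C2 * real N / real p ^ k"
    using C2' by blast+
  define C0 where "C0 = 2 * K + 4 * (real d)\<^sup>2 * K"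
  have C0: "C0 \<ge> 2" using K_ge_1 by (simp add: C0_def add_increasing2)
  define C where "C = C0 + K + (4 * C2 + 4 * (real d)\<^sup>2 * (4 * C2))"
  have C: "C \<ge> C0" "C \<ge> K" "C \<ge> 4 * C2 + 4 * (real d)\<^sup>2 * (4 * C2)" "C \<ge> 1" using C0 K_ge_1 C2(1) mult_nonneg_nonneg[OF zero_le_power2[of "real d"] C2(1)] unfolding C_def by linarith+
  have "(\<Sum>n=1..N. (norm (rem_coeff {p. prime p \<and> P1 \<le> real p \<and> real p \<le> P2} M0 n))\<^sup>2) \<le>
     C * (M0 * P2 * (1 + ln (M0 * P2))\<^sup>2 + real N * ln P1 / ln P2 + real N * (1 + ln (real N))\<^sup>2 / P1)"
    if P12: "2 \<le> P1" "P1 \<le> P2" "P2 \<le> real N" "1 \<le> M0" for P1 P2 M0 N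
  proof -
    define P where "P = {p. prime p \<and> P1 \<le> real p \<and> real p \<le> P2}"
    have "P \<subseteq> {..nat \<lfloor>P2\<rfloor>}" by (auto simp: P_def le_nat_floor)
    then have Pf: "finite P" by (rule finite_subset) simp
    have Pp: "\<And>p. p \<in> P \<Longrightarrow> prime p" by (simp add: P_def)
    have PN: "P \<subseteq> {1..N}" using P12 by (auto simp: P_def prime_ge_1_nat)
    have N1: "N \<ge> 1" using P12 by linarith
    define l where "l = 1 + ln (real N)"
    have l: "l \<ge> 1" using N1 by (simp add: l_def)
    define f where "f n = (norm (rem_coeff P M0 n))\<^sup>2" for n
    have f0: "f n \<ge> 0" for n by (simp add: f_def)
    define A1 where "A1 = {1..nat \<lfloor>M0 * P2\<rfloor>}"
    define A2 where "A2 = {n. n \<in> {1..N} \<and> (\<forall>p. prime p \<and> P1 \<le> real p \<and> real p \<le> P2 \<longrightarrow> \<not> p dvd n)}"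
    define Bad where "Bad = {n. n \<in> {1..N} \<and> (\<exists>p\<in>P. p\<^sup>2 dvd n)}"
    have MP: "M0 * P2 \<ge> 1 * 2" using P12 by (intro mult_mono) auto
    have zero: "f n = 0" if "n \<in> {1..N}" "n \<notin> A1" "n \<notin> A2" "n \<notin> Bad" for n
    proof -
      have "\<exists>p0\<in>P. p0 dvd n" using that(1,3) unfolding A2_def P_def by blast
      then obtain p0 where p0: "p0 \<in> P" "p0 dvd n" ..
      have "real n \<ge> M0 * P2" using that by (auto simp: A1_def not_le nat_less_iff) linarith
      then have "rem_coeff P M0 n = 0"
        using that P12 p0 by (intro rem_coeff_eq_0[OF Pf, of P2 _ _ p0]) (auto simp: P_def Bad_def)
      then show ?thesis by (simp add: f_def)
    qed
    have "(\<Sum>n=1..N. f n) \<le> (\<Sum>n\<in>A1 \<union> (A2 \<union> Bad). f n)"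
    proof -
      have "(\<Sum>n=1..N. f n) = (\<Sum>n\<in>{1..N} \<inter> (A1 \<union> (A2 \<union> Bad)). f n)"
        by (rule sum.mono_neutral_right) (use zero in auto)
      also have "\<dots> \<le> (\<Sum>n\<in>A1 \<union> (A2 \<union> Bad). f n)"
        using f0 by (intro sum_mono2) (auto simp: A1_def A2_def Bad_def)
      finally show ?thesis .
    qed
    also have "\<dots> \<le> (\<Sum>n\<in>A1. f n) + ((\<Sum>n\<in>A2. f n) + (\<Sum>n\<in>Bad. f n))"
    proof -
      have un: "sum f (X \<union> Y) \<le> sum f X + sum f Y" if "finite X" "finite Y" for X Y
        using sum.union_inter[OF that, of f] sum_nonneg[of "X \<inter> Y" f] f0 by simp
      have fi: "finite A1" "finite A2" "finite Bad" by (auto simp: A1_def A2_def Bad_def)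
      show ?thesis using un[OF fi(1) finite_UnI[OF fi(2,3)]] un[OF fi(2,3)] by linarith
    qed
    also have "(\<Sum>n\<in>A1. f n) \<le> C * (M0 * P2 * (1 + ln (M0 * P2))\<^sup>2)"
    proof -
      define N' where "N' = nat \<lfloor>M0 * P2\<rfloor>"
      have N': "N' \<ge> 1" "real N' \<le> M0 * P2" using MP by (auto simp: N'_def le_nat_floor)
      have "(\<Sum>n\<in>A1. f n) \<le> C0 * real N' * (1 + ln (real N'))\<^sup>2"
        unfolding A1_def f_def C0_def N'_def[symmetric] by (rule rem_coeff_mean_square_trivial[OF Pf Pp N'(1)])
      also have "\<dots> \<le> C * (M0 * P2) * (1 + ln (M0 * P2))\<^sup>2"
        using N' C C0 by (intro mult_mono power_mono) auto
      finally show ?thesis by simp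
    qed
    also have "(\<Sum>n\<in>A2. f n) \<le> C * (real N * ln P1 / ln P2)"
    proof -
      have "(\<Sum>n\<in>A2. f n) = (\<Sum>n\<in>A2. (norm (lam n))\<^sup>2)"
      proof (intro sum.cong refl)
        fix n assume "n \<in> A2"
        then have e: "{p. p \<in> P \<and> p dvd n \<and> M0 \<le> real (n div p)} = {}" by (auto simp: A2_def P_def)
        then show "f n = (norm (lam n))\<^sup>2" by (simp only: f_def rem_coeff_def ram_coeff_def e sum.empty diff_zero)
      qed
      also have "\<dots> \<le> K * (real N * ln P1 / ln P2)" unfolding A2_def using P12 by (intro sieved_mean_square) auto
      also have "\<dots> \<le> C * (real N * ln P1 / ln P2)" using C P12 by (intro mult_right_mono) auto
      finally show ?thesis .
    qed
    also have "(\<Sum>n\<in>Bad. f n) \<le> C * (real N * l\<^sup>2 / P1)"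
    proof -
      have P1inv: "(\<Sum>p\<in>P. 1 / (real p)\<^sup>2) \<le> 2 / P1"
        using P12 by (intro sum_inverse_squares_le Pf) (auto simp: P_def)
      have B1: "(\<Sum>n\<in>Bad. (norm (lam n))\<^sup>2) \<le> C2 * real N * (2 / P1)"
      proof -
        have "Bad = (\<Union>p\<in>P. {n. n \<in> {1..N} \<and> p\<^sup>2 dvd n})" by (auto simp: Bad_def)
        then have "(\<Sum>n\<in>Bad. (norm (lam n))\<^sup>2) \<le> (\<Sum>p\<in>P. \<Sum>n | n \<in> {1..N} \<and> p\<^sup>2 dvd n. (norm (lam n))\<^sup>2)"
          using Pf by (simp only:) (intro sum_UN_le, auto)
        also have "\<dots> \<le> (\<Sum>p\<in>P. C2 * real N * (1 / (real p)\<^sup>2))"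
          by (intro sum_mono) (use C2(2)[of 2] Pp in auto)
        also have "\<dots> = C2 * real N * (\<Sum>p\<in>P. 1 / (real p)\<^sup>2)" by (simp add: sum_distrib_left)
        also have "\<dots> \<le> C2 * real N * (2 / P1)" using C2(1) P1inv by (intro mult_left_mono) auto
        finally show ?thesis .
      qed
      have B2: "(\<Sum>n\<in>Bad. \<Sum>p | p \<in> P \<and> p dvd n. (norm (lam (n div p)))\<^sup>2) \<le> 4 * C2 * real N * l / P1"
      proof -
        \<comment> \<open>The set \<open>Bad\<close> seen from the cofactor m = n / p: if p'^2
          divides n, then p divides m in case p' = p, and p'^2 divides m otherwise. Both are rare
          among the m, so the saving 1/P1 survives the division by p.\<close>
        define g where "g p m = (if p dvd m \<or> (\<exists>p'\<in>P. p'\<^sup>2 dvd m) then (norm (lam m))\<^sup>2 else 0)" for p m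
        have "(\<Sum>n\<in>Bad. \<Sum>p | p \<in> P \<and> p dvd n. (norm (lam (n div p)))\<^sup>2) \<le> (\<Sum>n\<in>Bad. \<Sum>p | p \<in> P \<and> p dvd n. g p (n div p))"
        proof (intro sum_mono)
          fix n p assume n: "n \<in> Bad" and p: "p \<in> {p. p \<in> P \<and> p dvd n}"
          obtain p' where p': "p' \<in> P" "p'\<^sup>2 dvd n" using n by (auto simp: Bad_def)
          obtain m where m: "n = p * m" using p by (auto elim: dvdE)
          have pp: "prime p" "prime p'" using p p' Pp by auto
          have nm: "n div p = m" using m prime_gt_0_nat[OF pp(1)] by simp
          have "p dvd m \<or> p'\<^sup>2 dvd m"
          proof (cases "p = p'")
            case True
            then have "p * p dvd p * m" using p'(2) m by (simp add: power2_eq_square)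
            then show ?thesis using prime_gt_0_nat[OF pp(1)] by simp
          next
            case False
            then have "coprime (p'\<^sup>2) p" using pp primes_coprime[of p' p] by simp
            then show ?thesis using p'(2) m by (simp add: coprime_dvd_mult_right_iff)
          qed
          then show "(norm (lam (n div p)))\<^sup>2 \<le> g p (n div p)" using p'(1) by (auto simp: g_def nm)
        qed
        also have "\<dots> \<le> (\<Sum>n=1..N. \<Sum>p | p \<in> P \<and> p dvd n. g p (n div p))"
          by (intro sum_mono2) (auto simp: Bad_def g_def intro!: sum_nonneg)
        also have "\<dots> = (\<Sum>p\<in>P. \<Sum>m | m \<in> {1..N} \<and> p * m \<le> N. g p m)"
          using sum_divisor_swap[OF Pf prime_ge_1_nat[OF Pp], where N = N and R = "\<lambda>_. True" and g = g] by simp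
        also have "\<dots> \<le> (\<Sum>p\<in>P. C2 * real N * (1 / (real p)\<^sup>2) + C2 * real N * (2 / P1) * (1 / real p))"
        proof (rule sum_mono)
          fix p assume p: "p \<in> P"
          then have p1: "p \<ge> 1" by (intro prime_ge_1_nat Pp)
          define N' where "N' = N div p"
          have N': "real N' \<le> real N / real p" unfolding N'_def by (rule of_nat_div_le_of_nat)
          have "(\<Sum>m | m \<in> {1..N} \<and> p * m \<le> N. g p m) \<le> (\<Sum>m=1..N'. g p m)"
            unfolding N'_def using p1 by (intro sum_mono2) (auto simp: g_def less_eq_div_iff_mult_less_eq mult.commute)
          also have "\<dots> \<le> (\<Sum>m=1..N'. (if p ^ 1 dvd m then (norm (lam m))\<^sup>2 else 0) + (\<Sum>p'\<in>P. if p'\<^sup>2 dvd m then (norm (lam m))\<^sup>2 else 0))"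
          proof (rule sum_mono)
            fix m
            have nn: "(\<Sum>p'\<in>P. if p'\<^sup>2 dvd m then (norm (lam m))\<^sup>2 else 0) \<ge> 0" by (intro sum_nonneg) auto
            have member: "(norm (lam m))\<^sup>2 \<le> (\<Sum>p'\<in>P. if p'\<^sup>2 dvd m then (norm (lam m))\<^sup>2 else 0)" if p': "p' \<in> P" "p'\<^sup>2 dvd m" for p'
            proof -
              have "(if p'\<^sup>2 dvd m then (norm (lam m))\<^sup>2 else 0) \<le> (\<Sum>p'\<in>P. if p'\<^sup>2 dvd m then (norm (lam m))\<^sup>2 else 0)"
                by (rule member_le_sum[OF p'(1)]) (use Pf in auto)
              then show ?thesis using p' by simp
            qed
            then show "g p m \<le> (if p ^ 1 dvd m then (norm (lam m))\<^sup>2 else 0) + (\<Sum>p'\<in>P. if p'\<^sup>2 dvd m then (norm (lam m))\<^sup>2 else 0)"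
            proof (cases "\<exists>p'\<in>P. p'\<^sup>2 dvd m")
              case True
              then obtain p' where p': "p' \<in> P" "p'\<^sup>2 dvd m" ..
              have "g p m \<le> (norm (lam m))\<^sup>2" by (simp add: g_def)
              then show ?thesis using member[OF p'] by (smt (verit) zero_le_power2)
            next
              case False
              then have "g p m = (if p ^ 1 dvd m then (norm (lam m))\<^sup>2 else 0)" by (simp add: g_def)
              then show ?thesis using nn by linarith
            qed
          qed
          also have "\<dots> = (\<Sum>m | m \<in> {1..N'} \<and> p ^ 1 dvd m. (norm (lam m))\<^sup>2) + (\<Sum>p'\<in>P. \<Sum>m | m \<in> {1..N'} \<and> p'\<^sup>2 dvd m. (norm (lam m))\<^sup>2)"
          proof -
            show ?thesis unfolding sum.distrib sum.inter_filter[OF finite_atLeastAtMost]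
              by (subst sum.swap[of _ P]) (rule refl)
          qed
          also have "\<dots> \<le> C2 * real N' / real p ^ 1 + (\<Sum>p'\<in>P. C2 * real N' / (real p')\<^sup>2)"
            by (intro add_mono sum_mono C2(2)) (use Pp p in auto)
          also have "\<dots> = C2 * real N' * (1 / real p) + C2 * real N' * (\<Sum>p'\<in>P. 1 / (real p')\<^sup>2)"
            by (simp add: sum_distrib_left)
          also have "\<dots> \<le> C2 * (real N / real p) * (1 / real p) + C2 * (real N / real p) * (2 / P1)"
            using N' C2(1) P1inv by (intro add_mono mult_mono mult_left_mono mult_right_mono) (auto intro!: sum_nonneg)
          finally show "(\<Sum>m | m \<in> {1..N} \<and> p * m \<le> N. g p m) \<le> C2 * real N * (1 / (real p)\<^sup>2) + C2 * real N * (2 / P1) * (1 / real p)"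
            by (simp add: power2_eq_square mult.commute[of P1])
        qed
        also have "\<dots> = C2 * real N * (\<Sum>p\<in>P. 1 / (real p)\<^sup>2) + C2 * real N * (2 / P1) * (\<Sum>p\<in>P. 1 / real p)"
          by (simp add: sum.distrib sum_distrib_left)
        also have "\<dots> \<le> C2 * real N * (2 / P1) + C2 * real N * (2 / P1) * l"
          unfolding l_def using C2(1) P1inv P12 by (intro add_mono mult_left_mono sum_inverse_le_ln Pf PN) auto
        also have "\<dots> \<le> C2 * real N * (2 / P1) * l + C2 * real N * (2 / P1) * l"
        proof -
          have "C2 * real N * (2 / P1) * 1 \<le> C2 * real N * (2 / P1) * l" using C2(1) P12 l by (intro mult_left_mono) auto
          then show ?thesis by (simp only: mult_1_right add_right_mono)
        qed
        also have "\<dots> = 4 * C2 * real N * l / P1" by simp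
        finally show ?thesis .
      qed
      have "(\<Sum>n\<in>Bad. f n) \<le> (\<Sum>n\<in>Bad. 2 * (norm (lam n))\<^sup>2 + 2 * (2 * l * (real d)\<^sup>2 * (\<Sum>p | p \<in> P \<and> p dvd n. (norm (lam (n div p)))\<^sup>2)))"
      proof (rule sum_mono)
        fix n assume "n \<in> Bad"
        then have n: "1 \<le> n" "n \<le> N" by (auto simp: Bad_def)
        have "f n \<le> 2 * (norm (lam n))\<^sup>2 + 2 * (norm (ram_coeff P M0 n))\<^sup>2"
          unfolding f_def rem_coeff_def using norm_add_square_le[of "lam n" "- ram_coeff P M0 n"] by simp
        then show "f n \<le> 2 * (norm (lam n))\<^sup>2 + 2 * (2 * l * (real d)\<^sup>2 * (\<Sum>p | p \<in> P \<and> p dvd n. (norm (lam (n div p)))\<^sup>2))"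
          using ram_coeff_square_le[OF Pf Pp n, of M0] unfolding l_def by linarith
      qed
      also have "\<dots> = 2 * (\<Sum>n\<in>Bad. (norm (lam n))\<^sup>2) + 4 * l * (real d)\<^sup>2 * (\<Sum>n\<in>Bad. \<Sum>p | p \<in> P \<and> p dvd n. (norm (lam (n div p)))\<^sup>2)"
        by (simp add: sum.distrib sum_distrib_left mult_ac)
      also have "\<dots> \<le> 2 * (C2 * real N * (2 / P1)) + 4 * l * (real d)\<^sup>2 * (4 * C2 * real N * l / P1)"
        using B1 B2 l by (intro add_mono mult_left_mono) auto
      also have "\<dots> \<le> (4 * C2) * (real N * l\<^sup>2 / P1) + 4 * l * (real d)\<^sup>2 * (4 * C2 * real N * l / P1)"
      proof -
        have "4 * C2 * (real N * 1 / P1) \<le> 4 * C2 * (real N * l\<^sup>2 / P1)"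
          using C2(1) P12 l by (intro mult_left_mono divide_right_mono one_le_power) auto
        then show ?thesis by simp
      qed
      also have "\<dots> = (4 * C2 + 4 * (real d)\<^sup>2 * (4 * C2)) * (real N * l\<^sup>2 / P1)"
        by (simp add: power2_eq_square algebra_simps)
      also have "\<dots> \<le> C * (real N * l\<^sup>2 / P1)" using C P12 by (intro mult_right_mono) auto
      finally show ?thesis .
    qed
    finally show ?thesis by (simp add: f_def P_def l_def algebra_simps)
  qed
  then show ?thesis using C(4) by (intro exI[of _ C]) blast
qed

end

section \<open>Mean values over families of characters\<close>

lemma integral_gaussian_le:
  assumes "H \<ge> 0"
  shows "integral {-H..H} (\<lambda>t::real. exp (- t\<^sup>2 / 2)) \<le> 2 * pi"
proof -
  have "((\<lambda>t. 2 * inverse (1 + t\<^sup>2)) has_integral (2 * arctan H - 2 * arctan (-H))) {-H..H}"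
    using assms
    by (intro fundamental_theorem_of_calculus)
       (auto intro!: derivative_eq_intros simp flip: has_real_derivative_iff_has_vector_derivative)
  then have i: "(\<lambda>t. 2 * inverse (1 + t\<^sup>2)) integrable_on {-H..H}"
      "integral {-H..H} (\<lambda>t. 2 * inverse (1 + t\<^sup>2)) = 2 * arctan H - 2 * arctan (-H)"
    by (rule has_integral_integrable, rule integral_unique)
  have "integral {-H..H} (\<lambda>t::real. exp (- t\<^sup>2 / 2)) \<le> integral {-H..H} (\<lambda>t. 2 * inverse (1 + t\<^sup>2))"
  proof (rule integral_le)
    show "(\<lambda>t::real. exp (- t\<^sup>2 / 2)) integrable_on {-H..H}"
      by (intro integrable_continuous_real continuous_intros) auto
    fix t :: real
    have "1 + t\<^sup>2 / 2 \<le> exp (t\<^sup>2 / 2)" by (rule exp_ge_add_one_self)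
    then have "(1 + t\<^sup>2) / 2 \<le> exp (t\<^sup>2 / 2)" by (simp add: field_simps)
    moreover have "0 < 1 + t\<^sup>2" by (simp add: add_pos_nonneg)
    ultimately have "inverse (exp (t\<^sup>2 / 2)) \<le> inverse ((1 + t\<^sup>2) / 2)" by (intro le_imp_inverse_le) auto
    then show "exp (- t\<^sup>2 / 2) \<le> 2 * inverse (1 + t\<^sup>2)" by (simp add: exp_minus divide_simps)
  qed (rule i(1))
  also have "\<dots> \<le> 2 * pi" using i(2) arctan_bounded[of H] by (simp add: arctan_minus)
  finally show ?thesis .
qed

text \<open>Proof by duality: the square of the left-hand side is the integral of \<open>w i t * D i t\<close> against its own conjugated values.\<close>

lemma integral_duality:
  fixes w D :: "'i \<Rightarrow> real \<Rightarrow> complex"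
  assumes I: "finite I" and "H \<ge> 0" "A \<ge> 0"
    and cont: "\<And>i. i \<in> I \<Longrightarrow> continuous_on {-H..H} (w i)" "\<And>i. i \<in> I \<Longrightarrow> continuous_on {-H..H} (D i)"
    and w: "\<And>i t. i \<in> I \<Longrightarrow> \<bar>t\<bar> \<le> H \<Longrightarrow> norm (w i t) \<le> A * exp (- t\<^sup>2 / 2)"
    and D: "\<And>t. \<bar>t\<bar> \<le> H \<Longrightarrow> L2_set (\<lambda>i. norm (D i t)) I \<le> S"
  shows "L2_set (\<lambda>i. norm (integral {-H..H} (\<lambda>t. w i t * D i t))) I \<le> 2 * pi * A * S"
proof -
  define J where "J i = integral {-H..H} (\<lambda>t. w i t * D i t)" for i
  define V where "V = L2_set (\<lambda>i. norm (J i)) I"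
  have V0: "V \<ge> 0" by (simp add: V_def)
  have S0: "S \<ge> 0" using D[of 0] assms(2) L2_set_nonneg[of "\<lambda>i. norm (D i 0)" I] by linarith
  have int: "(\<lambda>t. w i t * D i t) integrable_on {-H..H}" if "i \<in> I" for i
    using cont[OF that] by (intro integrable_continuous_real continuous_intros)
  have "complex_of_real (V\<^sup>2) = (\<Sum>i\<in>I. cnj (J i) * J i)"
    by (simp add: V_def L2_set_def sum_nonneg complex_norm_square[symmetric] mult.commute)
  also have "\<dots> = integral {-H..H} (\<lambda>t. \<Sum>i\<in>I. cnj (J i) * (w i t * D i t))"
    using I int by (subst integral_sum) (auto simp: J_def intro!: sum.cong integrable_on_mult_right)
  finally have eq: "complex_of_real (V\<^sup>2) = integral {-H..H} (\<lambda>t. \<Sum>i\<in>I. cnj (J i) * (w i t * D i t))" .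
  have "V\<^sup>2 = norm (complex_of_real (V\<^sup>2))" unfolding norm_of_real by simp
  also have "\<dots> \<le> integral {-H..H} (\<lambda>t. exp (- t\<^sup>2 / 2) * (A * (V * S)))"
    unfolding eq
  proof (rule integral_norm_bound_integral)
    show "(\<lambda>t. \<Sum>i\<in>I. cnj (J i) * (w i t * D i t)) integrable_on {-H..H}"
      using I int by (intro integrable_sum integrable_on_mult_right) auto
    show "(\<lambda>t. exp (- t\<^sup>2 / 2) * (A * (V * S))) integrable_on {-H..H}"
      by (intro integrable_continuous_real continuous_intros) auto
    fix t assume t: "t \<in> {-H..H}"
    have "norm (\<Sum>i\<in>I. cnj (J i) * (w i t * D i t)) \<le> (\<Sum>i\<in>I. norm (J i) * (A * exp (- t\<^sup>2 / 2) * norm (D i t)))"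
      using w t by (intro sum_norm_le) (auto simp: norm_mult intro!: mult_left_mono mult_right_mono)
    also have "\<dots> = A * exp (- t\<^sup>2 / 2) * (\<Sum>i\<in>I. \<bar>norm (J i)\<bar> * \<bar>norm (D i t)\<bar>)"
      unfolding sum_distrib_left by (intro sum.cong) (simp_all add: mult_ac)
    also have "\<dots> \<le> A * exp (- t\<^sup>2 / 2) * (V * S)"
    proof (rule mult_left_mono)
      have "(\<Sum>i\<in>I. \<bar>norm (J i)\<bar> * \<bar>norm (D i t)\<bar>) \<le> V * L2_set (\<lambda>i. norm (D i t)) I"
        unfolding V_def by (rule L2_set_mult_ineq)
      also have "\<dots> \<le> V * S" using D t V0 by (intro mult_left_mono) auto
      finally show "(\<Sum>i\<in>I. \<bar>norm (J i)\<bar> * \<bar>norm (D i t)\<bar>) \<le> V * S" .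
    qed (use assms(3) in auto)
    finally show "norm (\<Sum>i\<in>I. cnj (J i) * (w i t * D i t)) \<le> exp (- t\<^sup>2 / 2) * (A * (V * S))"
      by (simp add: mult_ac)
  qed
  also have "\<dots> = integral {-H..H} (\<lambda>t. exp (- t\<^sup>2 / 2)) * (A * (V * S))" by (rule integral_mult_left)
  also have "\<dots> \<le> 2 * pi * (A * (V * S))"
    using assms(2,3) V0 S0 by (intro mult_right_mono integral_gaussian_le) auto
  finally have "V * V \<le> V * (2 * pi * A * S)" by (simp add: power2_eq_square mult_ac)
  then have "V \<le> 2 * pi * A * S"
    using V0 S0 assms(3) by (cases "V = 0") (auto simp: mult_le_cancel_left)
  then show ?thesis by (simp add: V_def J_def)
qed

text \<open>The integral is moved from Re s = 1 to Re s = \<sigma>, where the weights have size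
  Y^\<sigma>; the horizontal sides carry the factor exp(-H^2/2). On the new line duality reduces the
  claim to a mean square of the D i for each fixed t.\<close>

lemma shifted_mean_value:
  fixes w D :: "'i \<Rightarrow> complex \<Rightarrow> complex"
  assumes I: "finite I" and H: "H > 0" and W: "W \<ge> 0" "Y \<ge> 1" and \<sigma>: "0 < \<sigma>" "\<sigma> \<le> 1" and B: "B \<ge> 0"
    and hw: "\<And>i. i \<in> I \<Longrightarrow> w i holomorphic_on {s. Re s > 0}" and hD: "\<And>i. i \<in> I \<Longrightarrow> D i holomorphic_on UNIV"
    and w: "\<And>i s. i \<in> I \<Longrightarrow> \<sigma> \<le> Re s \<Longrightarrow> Re s \<le> 1 \<Longrightarrow> norm (w i s) \<le> W * Y powr Re s * exp (- (Im s)\<^sup>2 / 2)"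
    and DB: "\<And>i s. i \<in> I \<Longrightarrow> Re s \<ge> 1/2 \<Longrightarrow> norm (D i s) \<le> B"
    and S: "\<And>t. \<bar>t\<bar> \<le> H \<Longrightarrow> L2_set (\<lambda>i. norm (D i (Complex (1/2 + \<sigma>) t))) I \<le> S"
  shows "L2_set (\<lambda>i. norm (integral {-H..H} (\<lambda>t. w i (Complex 1 t) * D i (1/2 + Complex 1 t)))) I
     \<le> 2 * pi * (W * Y powr \<sigma>) * S + sqrt (real (card I)) * (2 * W * Y * exp (- H\<^sup>2 / 2) * B)"
proof -
  define E where "E = W * Y * exp (- H\<^sup>2 / 2) * B"
  have E0: "E \<ge> 0" using W B by (simp add: E_def)
  define f where "f i s = w i s * D i (1/2 + s)" for i s
  have hf: "f i holomorphic_on {s. Re s > 0}" if "i \<in> I" for i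
  proof -
    have "(\<lambda>s. D i (1/2 + s)) holomorphic_on {s. Re s > 0}"
      by (rule holomorphic_on_compose_gen[of "\<lambda>s. 1/2 + s" "{s. Re s > 0}" "D i" UNIV, unfolded o_def])
         (auto intro!: holomorphic_intros hD[OF that])
    then show ?thesis unfolding f_def using hw[OF that] by (intro holomorphic_on_mult)
  qed
  have "norm (integral {-H..H} (\<lambda>t. f i (Complex 1 t))) \<le> norm (integral {-H..H} (\<lambda>t. f i (Complex \<sigma> t))) + 2 * E"
    if i: "i \<in> I" for i
  proof (cases "\<sigma> = 1")
    case False
    have hor: "norm (f i (Complex x y)) \<le> E" if "\<sigma> \<le> x" "x \<le> 1" "\<bar>y\<bar> = H" for x y
    proof -
      have y2: "y\<^sup>2 = H\<^sup>2" using that(3) power2_abs[of y] by simp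
      have "norm (w i (Complex x y)) \<le> W * Y powr x * exp (- H\<^sup>2 / 2)" using w[OF i, of "Complex x y"] that y2 by simp
      also have "\<dots> \<le> W * Y powr 1 * exp (- H\<^sup>2 / 2)" using W that by (intro mult_right_mono mult_left_mono powr_mono) auto
      finally have "norm (w i (Complex x y)) \<le> W * Y * exp (- H\<^sup>2 / 2)" using W by simp
      moreover have "norm (D i (1/2 + Complex x y)) \<le> B" using that \<sigma> by (intro DB[OF i]) auto
      ultimately show ?thesis unfolding f_def norm_mult E_def using W by (intro mult_mono) auto
    qed
    have "norm (integral {-H..H} (\<lambda>t. f i (Complex 1 t)) - integral {-H..H} (\<lambda>t. f i (Complex \<sigma> t))) \<le> 2 * E * (1 - \<sigma>)"
    proof (rule vertical_integral_shift)
      show "f i holomorphic_on {z. \<sigma> \<le> Re z \<and> Re z \<le> 1 \<and> - H \<le> Im z \<and> Im z \<le> H}"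
        by (rule holomorphic_on_subset[OF hf[OF i]]) (use \<sigma> in auto)
    qed (use False \<sigma> H E0 hor in auto)
    also have "\<dots> \<le> 2 * E * 1" using E0 \<sigma> by (intro mult_left_mono) auto
    finally show ?thesis
      using norm_triangle_ineq2[of "integral {-H..H} (\<lambda>t. f i (Complex 1 t))" "integral {-H..H} (\<lambda>t. f i (Complex \<sigma> t))"] by linarith
  qed (use E0 in simp)
  then have "L2_set (\<lambda>i. norm (integral {-H..H} (\<lambda>t. f i (Complex 1 t)))) I
     \<le> L2_set (\<lambda>i. norm (integral {-H..H} (\<lambda>t. f i (Complex \<sigma> t))) + 2 * E) I"
    by (intro L2_set_mono) auto
  also have "\<dots> \<le> L2_set (\<lambda>i. norm (integral {-H..H} (\<lambda>t. f i (Complex \<sigma> t)))) I + L2_set (\<lambda>i. 2 * E) I"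
    by (rule L2_set_triangle_ineq)
  also have "L2_set (\<lambda>i. 2 * E) I = sqrt (real (card I)) * (2 * E)" using E0 by (simp add: L2_set_constant)
  also have "L2_set (\<lambda>i. norm (integral {-H..H} (\<lambda>t. f i (Complex \<sigma> t)))) I \<le> 2 * pi * (W * Y powr \<sigma>) * S"
    unfolding f_def
  proof (rule integral_duality[OF I])
    have line: "continuous_on {-H..H} (\<lambda>t. Complex \<sigma> t)"
      by (simp add: Complex_eq) (intro continuous_intros)
    show "continuous_on {-H..H} (\<lambda>t. w i (Complex \<sigma> t))" if "i \<in> I" for i
      by (rule continuous_on_compose2[OF holomorphic_on_imp_continuous_on[OF hw[OF that]] line]) (use \<sigma> in auto)
    show "continuous_on {-H..H} (\<lambda>t. D i (1/2 + Complex \<sigma> t))" if "i \<in> I" for i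
      by (rule continuous_on_compose2[OF holomorphic_on_imp_continuous_on[OF hD[OF that]]])
         (auto intro!: continuous_intros line)
    show "L2_set (\<lambda>i. norm (D i (1/2 + Complex \<sigma> t))) I \<le> S" if "\<bar>t\<bar> \<le> H" for t
    proof -
      have "1/2 + Complex \<sigma> t = Complex (1/2 + \<sigma>) t" by (simp add: complex_eq_iff)
      then show ?thesis using S[OF that] by simp
    qed
    show "norm (w i (Complex \<sigma> t)) \<le> W * Y powr \<sigma> * exp (- t\<^sup>2 / 2)" if "i \<in> I" "\<bar>t\<bar> \<le> H" for i t
      using w[OF that(1), of "Complex \<sigma> t"] \<sigma> by simp
  qed (use H W in auto)
  finally show ?thesis by (simp add: f_def E_def mult_ac)
qed

lemma L2_set_norm_sum_le:
  fixes z :: "'k \<Rightarrow> 'i \<Rightarrow> complex"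
  shows "L2_set (\<lambda>i. norm (\<Sum>k\<in>S. z k i)) I \<le> (\<Sum>k\<in>S. L2_set (\<lambda>i. norm (z k i)) I)"
proof (induction S rule: infinite_finite_induct)
  case (insert k S)
  have "L2_set (\<lambda>i. norm (\<Sum>k\<in>insert k S. z k i)) I \<le> L2_set (\<lambda>i. norm (z k i) + norm (\<Sum>k\<in>S. z k i)) I"
    using insert by (intro L2_set_mono) (auto intro: norm_triangle_ineq)
  also have "\<dots> \<le> L2_set (\<lambda>i. norm (z k i)) I + L2_set (\<lambda>i. norm (\<Sum>k\<in>S. z k i)) I"
    by (rule L2_set_triangle_ineq)
  finally show ?case using insert by simp
qed (simp_all add: L2_set_def)

lemma geometric_sum_inj_le:
  fixes r :: real
  assumes "0 \<le> r" "r < 1" "finite S" "inj_on f S"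
  shows "(\<Sum>k\<in>S. r ^ f k) \<le> 1 / (1 - r)"
proof -
  have "(\<Sum>k\<in>S. r ^ f k) = (\<Sum>n\<in>f ` S. r ^ n)" using assms(4) by (simp add: sum.reindex)
  also have "\<dots> \<le> (\<Sum>n. r ^ n)" using assms by (intro sum_le_suminf) auto
  also have "\<dots> = 1 / (1 - r)" using assms by (intro suminf_geometric) auto
  finally show ?thesis .
qed

definition dyadic_const :: real where "dyadic_const = 2 / (1 - 2 powr (-1/4))"

lemma dyadic_const_pos: "dyadic_const > 0"
  using powr_less_mono[of "-1/4" 0 "2::real"] by (simp add: dyadic_const_def)

text \<open>The terms decay geometrically with ratio 2^(-1/4) on both sides of the k with 2^k
  closest to Y, so the bound does not depend on K.\<close>

lemma dyadic_two_sided_sum: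
  assumes "Y \<ge> 1"
  shows "(\<Sum>k<K. if 2 ^ k \<le> Y then (2 ^ k / Y) powr (1/4) else (Y / 2 ^ k) powr (1/4)) \<le> dyadic_const"
proof -
  define r :: real where "r = 2 powr (-1/4)"
  have r: "0 \<le> r" "r < 1" using powr_less_mono[of "-1/4" 0 "2::real"] by (auto simp: r_def)
  have rn: "(2 powr - real n) powr (1/4) = r ^ n" for n
    by (simp add: r_def powr_powr flip: powr_realpow)
  define k0 where "k0 = nat \<lfloor>log 2 Y\<rfloor>"
  have lY: "log 2 Y \<ge> 0" using assms by simp
  have k0: "real k0 \<le> log 2 Y" "log 2 Y \<le> real k0 + 1"
    using lY unfolding k0_def by linarith+
  have Y: "2 powr real k0 \<le> Y" "Y \<le> 2 powr (real k0 + 1)"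
    using k0 assms by (auto simp: le_log_iff log_le_iff)
  let ?g = "\<lambda>k. if 2 ^ k \<le> Y then (2 ^ k / Y) powr (1/4) else (Y / 2 ^ k) powr (1/4)"
  have "(\<Sum>k<K. ?g k) \<le> (\<Sum>k<K. if k \<le> k0 then r ^ (k0 - k) else r ^ (k - Suc k0))"
  proof (rule sum_mono)
    fix k
    show "?g k \<le> (if k \<le> k0 then r ^ (k0 - k) else r ^ (k - Suc k0))"
    proof (cases "k \<le> k0")
      case True
      then have "2 powr real k \<le> 2 powr real k0" by (intro powr_mono) auto
      then have "2 powr real k \<le> Y" using Y(1) by (rule order_trans)
      then have le: "2 ^ k \<le> Y" by (simp add: powr_realpow)
      have "2 ^ k / Y \<le> 2 powr real k / 2 powr real k0" using Y assms by (auto simp: powr_realpow intro!: divide_left_mono)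
      also have "\<dots> = 2 powr - real (k0 - k)" using True by (simp add: of_nat_diff flip: powr_diff)
      finally have "(2 ^ k / Y) powr (1/4) \<le> (2 powr - real (k0 - k)) powr (1/4)" using assms by (intro powr_mono2) auto
      then show ?thesis using True le unfolding rn by simp
    next
      case False
      then have "2 powr (real k0 + 1) \<le> 2 powr real k" by (intro powr_mono) auto
      then have ge: "Y \<le> 2 ^ k" using Y by (simp add: powr_realpow)
      have "Y / 2 ^ k \<le> 2 powr (real k0 + 1) / 2 powr real k" using Y by (auto simp: powr_realpow intro!: divide_right_mono)
      also have "\<dots> = 2 powr - real (k - Suc k0)" using False by (simp add: of_nat_diff algebra_simps flip: powr_diff)
      finally have "(Y / 2 ^ k) powr (1/4) \<le> (2 powr - real (k - Suc k0)) powr (1/4)" using assms by (intro powr_mono2) auto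
      then have "(Y / 2 ^ k) powr (1/4) \<le> r ^ (k - Suc k0)" unfolding rn .
      moreover have "(2 ^ k / Y) powr (1/4) = (Y / 2 ^ k) powr (1/4)" if "2 ^ k \<le> Y" using that ge by (simp add: order_antisym)
      ultimately show ?thesis using False by auto
    qed
  qed
  also have "\<dots> = (\<Sum>k | k < K \<and> k \<le> k0. r ^ (k0 - k)) + (\<Sum>k | k < K \<and> \<not> k \<le> k0. r ^ (k - Suc k0))"
    by (subst sum.If_cases) (auto intro!: arg_cong2[where f = "(+)"] sum.cong)
  also have "\<dots> \<le> 1 / (1 - r) + 1 / (1 - r)"
    using r by (intro add_mono geometric_sum_inj_le) (auto simp: inj_on_def)
  finally show ?thesis by (simp add: dyadic_const_def r_def)
qed

definition dpoly :: "(nat \<Rightarrow> complex) \<Rightarrow> (int \<Rightarrow> complex) \<Rightarrow> nat set \<Rightarrow> complex \<Rightarrow> complex" where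
  "dpoly a ch A s = (\<Sum>n\<in>A. a n * ch (int n) / of_nat n powr s)"

lemma dpoly_holomorphic [holomorphic_intros]: "0 \<notin> A \<Longrightarrow> dpoly a ch A holomorphic_on S"
  unfolding dpoly_def by (intro holomorphic_intros) (auto simp: powr_def)

lemma dpoly_dyadic: "dpoly a ch {1..<2 ^ K} s = (\<Sum>k<K. dpoly a ch {2 ^ k..<2 ^ Suc k} s)"
proof (induction K)
  case (Suc K)
  have "{1..<2 ^ Suc K} = {1..<2 ^ K} \<union> {2 ^ K..<2 ^ Suc K::nat}" by (rule ivl_disj_un_two(3)[symmetric]) auto
  then have "dpoly a ch {1..<2 ^ Suc K} s = dpoly a ch {1..<2 ^ K} s + dpoly a ch {2 ^ K..<2 ^ Suc K} s"
    unfolding dpoly_def by (simp only:) (rule sum.union_disjoint, auto)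
  then show ?case using Suc by simp
qed (simp add: dpoly_def)

lemma sum_dyadic_block_le:
  fixes f :: "nat \<Rightarrow> real"
  assumes "\<And>n. f n \<ge> 0"
  shows "(\<Sum>n\<in>{2 ^ k..<2 ^ Suc k}. f n) \<le> (\<Sum>n=1..2 ^ Suc k. f n)"
proof (rule sum_mono2)
  show "{2 ^ k..<2 ^ Suc k} \<subseteq> {1..2 ^ Suc k::nat}"
  proof
    fix n :: nat assume n: "n \<in> {2 ^ k..<2 ^ Suc k}"
    have "1 \<le> (2::nat) ^ k" by simp
    also have "2 ^ k \<le> n" using n by simp
    finally show "n \<in> {1..2 ^ Suc k}" using n by simp
  qed
qed (use assms in auto)

lemma ln_two_power_le: "ln (real (2 ^ k)) \<le> real k"
  using ln_2_less_1 mult_left_mono[of "ln 2" 1 "real k"] by (simp add: ln_realpow)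

text \<open>The exponent 3/2 is shared out: 5/4 keeps the Dirichlet series absolutely convergent,
  and 1/4 becomes a saving in the length N.\<close>

lemma powr_three_halves_le:
  assumes "real N \<le> x" "N \<ge> 1"
  shows "x powr - (3/2) \<le> real N powr - (1/4) * x powr - (5/4)"
proof -
  have "x powr - (3/2) = x powr - (1/4) * x powr - (5/4)" by (simp flip: powr_add)
  also have "\<dots> \<le> real N powr - (1/4) * x powr - (5/4)"
    using assms by (intro mult_right_mono powr_mono2') auto
  finally show ?thesis .
qed

lemma sum_norm_le_of_squares:
  assumes "finite A" "real (card A) \<le> M" "(\<Sum>n\<in>A. (norm (a n :: complex))\<^sup>2) \<le> E * M"
  shows "(\<Sum>n\<in>A. norm (a n)) \<le> (1 + E) * M"
proof -
  have "(\<Sum>n\<in>A. norm (a n)) \<le> (\<Sum>n\<in>A. 1 + (norm (a n))\<^sup>2)"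
  proof (rule sum_mono)
    fix n show "norm (a n) \<le> 1 + (norm (a n))\<^sup>2"
      using sum_squares_ge_zero[of "norm (a n) - 1/2" 0] by (simp add: power2_eq_square algebra_simps)
  qed
  also have "\<dots> = real (card A) + (\<Sum>n\<in>A. (norm (a n))\<^sup>2)" by (simp add: sum.distrib)
  finally show ?thesis using assms by (simp add: algebra_simps)
qed

lemma continuous_line: "continuous_on S (\<lambda>t. Complex 1 t)"
  by (simp add: Complex_eq) (intro continuous_intros)

section \<open>Families of characters and their weighted mean values\<close>

locale char_family =
  fixes Q :: real and X :: "nat \<Rightarrow> (int \<Rightarrow> complex) set"
  assumes Q_ge_2: "Q \<ge> 2"
    and primitive: "\<And>q ch. Q \<le> real q \<Longrightarrow> real q \<le> 2 * Q \<Longrightarrow> ch \<in> X q \<Longrightarrow> primitive_char q ch"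
begin

text \<open>The characters are paired with their moduli so that a mean square over all moduli is a
  single \<open>L2_set\<close>.\<close>

definition family :: "(nat \<times> (int \<Rightarrow> complex)) set" where
  "family = (SIGMA q:{q. Q \<le> real q \<and> real q \<le> 2 * Q}. X q)"

lemma finite_moduli: "finite {q. Q \<le> real q \<and> real q \<le> 2 * Q}"
  by (rule finite_subset[of _ "{..nat \<lfloor>2 * Q\<rfloor>}"]) (auto simp: le_nat_floor)

lemma finite_chars:
  assumes "Q \<le> real q" "real q \<le> 2 * Q"
  shows "finite (X q)"
proof (rule finite_subset[OF _ finite_dirichlet_chars[of q]])
  show "X q \<subseteq> {ch. dirichlet_char q ch}" using primitive[OF assms] by (auto simp: primitive_char_def)
  show "q > 0" using assms Q_ge_2 by linarith
qed

lemma finite_family: "finite family"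
  unfolding family_def using finite_moduli finite_chars by (intro finite_SigmaI) auto

lemma sum_family: "(\<Sum>i\<in>family. f i) = (\<Sum>q | Q \<le> real q \<and> real q \<le> 2 * Q. \<Sum>ch\<in>X q. f (q, ch))"
  unfolding family_def using finite_moduli finite_chars by (subst sum.Sigma) auto

lemma family_norm_le: "i \<in> family \<Longrightarrow> norm (snd i n) \<le> 1"
  using norm_dirichlet_char_le[of "fst i" "snd i" n] primitive Q_ge_2 unfolding family_def primitive_char_def by force

lemma large_sieve_family:
  "(\<Sum>i\<in>family. (norm (\<Sum>n=1..N. a n * snd i (int n)))\<^sup>2) \<le> (4 * Q\<^sup>2 + 65 * real N) * (\<Sum>n=1..N. (norm (a n))\<^sup>2)"
  unfolding sum_family snd_conv by (rule large_sieve[OF Q_ge_2 finite_chars primitive])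

text \<open>The large sieve for the single coefficient at n = 1, where every character takes the
  value 1.\<close>

lemma card_family_le: "real (card family) \<le> 4 * Q\<^sup>2 + 65"
proof -
  have "snd i 1 = 1" if "i \<in> family" for i
    using primitive that unfolding family_def primitive_char_def by (force intro: dirichlet_char_1)
  then show ?thesis using large_sieve_family[where N = 1 and a = "\<lambda>_. 1"] by simp
qed

lemma sqrt_card_family_le: "sqrt (real (card family)) \<le> 9 * Q"
proof -
  have "2 * 2 \<le> Q * Q" using Q_ge_2 by (intro mult_mono) auto
  then have "real (card family) \<le> (9 * Q)\<^sup>2" using card_family_le by (simp add: power2_eq_square)
  then have "sqrt (real (card family)) \<le> sqrt ((9 * Q)\<^sup>2)" by (rule real_sqrt_le_mono)
  also have "sqrt ((9 * Q)\<^sup>2) = 9 * Q" by (rule real_sqrt_unique) (use Q_ge_2 in auto)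
  finally show ?thesis .
qed

lemma family_member:
  assumes "i \<in> family"
  shows "fst i \<ge> 2" "primitive_char (fst i) (snd i)" "Q \<le> real (fst i)" "real (fst i) \<le> 2 * Q" "snd i \<in> X (fst i)"
proof -
  show *: "Q \<le> real (fst i)" "real (fst i) \<le> 2 * Q" "snd i \<in> X (fst i)" using assms by (auto simp: family_def)
  show "primitive_char (fst i) (snd i)" by (rule primitive[OF *])
  show "fst i \<ge> 2" using * Q_ge_2 by linarith
qed

lemma dpoly_norm_le:
  assumes "i \<in> family" "0 \<notin> A" "Re s \<ge> 0"
  shows "norm (dpoly a (snd i) A s) \<le> (\<Sum>n\<in>A. norm (a n))"
  unfolding dpoly_def
proof (rule sum_norm_le)
  fix n assume n: "n \<in> A"
  then have n1: "n \<ge> 1" using assms(2) by (cases n) auto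
  have "real n powr 0 \<le> real n powr Re s" using n1 assms by (intro powr_mono) auto
  then have "1 \<le> norm (of_nat n powr s :: complex)" using n1 norm_powr_real_powr[of "of_nat n" s] by simp
  moreover have "norm (a n) * norm (snd i (int n)) \<le> norm (a n) * 1" using family_norm_le[OF assms(1)] by (intro mult_left_mono) auto
  ultimately show "norm (a n * snd i (int n) / of_nat n powr s) \<le> norm (a n)"
    using frac_le[of "norm (a n)" "norm (a n) * norm (snd i (int n))" 1 "norm (of_nat n powr s :: complex)"]
    by (simp add: norm_divide norm_mult)
qed

text \<open>On a block the factor n^(-\<sigma>) is at most M^(-\<sigma>) and goes into the
  coefficients, together with the phase n^(-it). As the block ends at 2 M, the constant is 130 = 2 *
  65.\<close>

lemma dpoly_block_mean_square:
  assumes A: "\<And>n. n \<in> A \<Longrightarrow> M \<le> real n \<and> real n \<le> 2 * M" and "M \<ge> 1" "\<sigma> \<ge> 0"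
  shows "L2_set (\<lambda>i. norm (dpoly a (snd i) A (Complex \<sigma> t))) family
    \<le> sqrt ((4 * Q\<^sup>2 + 130 * M) * (M powr (- 2 * \<sigma>) * (\<Sum>n\<in>A. (norm (a n))\<^sup>2)))"
proof -
  define N where "N = nat \<lfloor>2 * M\<rfloor>"
  define b where "b n = (if n \<in> A then a n / of_nat n powr Complex \<sigma> t else 0)" for n
  have AN: "A \<subseteq> {1..N}"
  proof
    fix n assume "n \<in> A"
    then show "n \<in> {1..N}" using A[of n] assms(2) by (auto simp: N_def le_nat_floor)
  qed
  have dp: "dpoly a ch A (Complex \<sigma> t) = (\<Sum>n=1..N. b n * ch (int n))" for ch
    unfolding dpoly_def using AN by (intro sum.mono_neutral_cong_left) (auto simp: b_def)
  have "(\<Sum>i\<in>family. (norm (dpoly a (snd i) A (Complex \<sigma> t)))\<^sup>2) \<le> (4 * Q\<^sup>2 + 65 * real N) * (\<Sum>n=1..N. (norm (b n))\<^sup>2)"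
    unfolding dp by (rule large_sieve_family)
  also have "\<dots> \<le> (4 * Q\<^sup>2 + 130 * M) * (M powr (- 2 * \<sigma>) * (\<Sum>n\<in>A. (norm (a n))\<^sup>2))"
  proof (rule mult_mono)
    have "real N \<le> 2 * M" using assms(2) by (simp add: N_def)
    then show "4 * Q\<^sup>2 + 65 * real N \<le> 4 * Q\<^sup>2 + 130 * M" by simp
    have "(\<Sum>n=1..N. (norm (b n))\<^sup>2) = (\<Sum>n\<in>A. (norm (b n))\<^sup>2)"
      using AN by (intro sum.mono_neutral_right) (auto simp: b_def)
    also have "\<dots> \<le> (\<Sum>n\<in>A. M powr (- 2 * \<sigma>) * (norm (a n))\<^sup>2)"
    proof (rule sum_mono)
      fix n assume n: "n \<in> A"
      then have n1: "real n \<ge> M" "real n > 0" using A[of n] assms(2) by auto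
      have "(norm (b n))\<^sup>2 = (norm (a n))\<^sup>2 / (real n powr \<sigma>)\<^sup>2"
        using n n1 norm_powr_real_powr[of "of_nat n" "Complex \<sigma> t"] by (simp add: b_def norm_divide power_divide)
      also have "\<dots> = real n powr (- 2 * \<sigma>) * (norm (a n))\<^sup>2"
        using n1 by (simp add: powr_minus field_simps powr_power)
      also have "\<dots> \<le> M powr (- 2 * \<sigma>) * (norm (a n))\<^sup>2"
        using n1 assms by (intro mult_right_mono powr_mono2') auto
      finally show "(norm (b n))\<^sup>2 \<le> M powr (- 2 * \<sigma>) * (norm (a n))\<^sup>2" .
    qed
    finally show "(\<Sum>n=1..N. (norm (b n))\<^sup>2) \<le> M powr (- 2 * \<sigma>) * (\<Sum>n\<in>A. (norm (a n))\<^sup>2)"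
      by (simp add: sum_distrib_left)
  qed (use assms(2) in \<open>auto intro!: sum_nonneg\<close>)
  finally show ?thesis unfolding L2_set_def by simp
qed

end

text \<open>The weights \<open>w i\<close> come from the approximate functional equation; there \<open>Y\<close> is the square root of the conductor.\<close>

locale weighted_family = char_family +
  fixes w :: "nat \<times> (int \<Rightarrow> complex) \<Rightarrow> complex \<Rightarrow> complex" and W Y H \<delta> :: real
  assumes w_holo: "\<And>i. i \<in> family \<Longrightarrow> w i holomorphic_on {s. Re s > 0}"
    and w_le: "\<And>i s. i \<in> family \<Longrightarrow> \<delta> \<le> Re s \<Longrightarrow> Re s \<le> 1 \<Longrightarrow> norm (w i s) \<le> W * Y powr Re s * exp (- (Im s)\<^sup>2 / 2)"
    and pos: "W \<ge> 0" "Y \<ge> 1" "H > 0" "0 < \<delta>" "\<delta> \<le> 1/4"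
begin

definition wint :: "(nat \<times> (int \<Rightarrow> complex) \<Rightarrow> complex \<Rightarrow> complex) \<Rightarrow> nat \<times> (int \<Rightarrow> complex) \<Rightarrow> complex" where
  "wint D i = integral {-H..H} (\<lambda>t. w i (Complex 1 t) * D i (1/2 + Complex 1 t))"

text \<open>The cost of moving the line in \<open>shifted_mean_value\<close> for functions bounded
  by B. With H = ln Q it is smaller than any power of 1/Q as long as B is at most a power of
  Q.\<close>

definition shift_err :: "real \<Rightarrow> real" where
  "shift_err B = sqrt (real (card family)) * (2 * W * Y * exp (- H\<^sup>2 / 2) * B)"

lemma shift_err_mono: "B \<le> B' \<Longrightarrow> shift_err B \<le> shift_err B'"
  unfolding shift_err_def using pos by (intro mult_left_mono) auto

lemma wint_integrable:
  assumes "i \<in> family" "D i holomorphic_on {s. Re s > 1}"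
  shows "(\<lambda>t. w i (Complex 1 t) * D i (1/2 + Complex 1 t)) integrable_on {-H..H}"
proof (intro integrable_continuous_real continuous_intros)
  show "continuous_on {-H..H} (\<lambda>t. w i (Complex 1 t))"
    by (rule continuous_on_compose2[OF holomorphic_on_imp_continuous_on[OF w_holo[OF assms(1)]] continuous_line]) auto
  show "continuous_on {-H..H} (\<lambda>t. D i (1/2 + Complex 1 t))"
    by (rule continuous_on_compose2[OF holomorphic_on_imp_continuous_on[OF assms(2)]])
       (auto intro!: continuous_intros continuous_line)
qed

lemma wint_sum:
  assumes "i \<in> family" "finite S" "\<And>k. k \<in> S \<Longrightarrow> D k i holomorphic_on {s. Re s > 1}"
  shows "wint (\<lambda>i s. \<Sum>k\<in>S. D k i s) i = (\<Sum>k\<in>S. wint (D k) i)"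
  unfolding wint_def sum_distrib_left
  using assms by (intro integral_sum wint_integrable) auto

lemma wint_shifted:
  assumes "\<delta> \<le> \<sigma>" "\<sigma> \<le> 1" "B \<ge> 0" "\<And>i. i \<in> family \<Longrightarrow> D i holomorphic_on UNIV"
    and "\<And>i s. i \<in> family \<Longrightarrow> Re s \<ge> 1/2 \<Longrightarrow> norm (D i s) \<le> B"
    and "\<And>t. \<bar>t\<bar> \<le> H \<Longrightarrow> L2_set (\<lambda>i. norm (D i (Complex (1/2 + \<sigma>) t))) family \<le> S"
  shows "L2_set (\<lambda>i. norm (wint D i)) family \<le> 2 * pi * (W * Y powr \<sigma>) * S + shift_err B"
  unfolding wint_def shift_err_def
  proof (rule shifted_mean_value[OF finite_family])
  show "norm (w i s) \<le> W * Y powr Re s * exp (- (Im s)\<^sup>2 / 2)" if "i \<in> family" "\<sigma> \<le> Re s" "Re s \<le> 1" for i s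
    using that assms(1) by (intro w_le) auto
  show "\<sigma> > 0" using assms(1) pos by linarith
qed (fact pos w_holo assms)+

lemma wint_trivial:
  assumes "\<And>i. i \<in> family \<Longrightarrow> D i holomorphic_on {s. Re s > 1}" "\<tau> \<ge> 0"
    and "\<And>i t. i \<in> family \<Longrightarrow> norm (D i (Complex (3/2) t)) \<le> \<tau>"
  shows "L2_set (\<lambda>i. norm (wint D i)) family \<le> 2 * pi * (W * Y) * (sqrt (real (card family)) * \<tau>)"
  unfolding wint_def
proof (rule integral_duality[OF finite_family])
  have e: "1/2 + Complex 1 t = Complex (3/2) t" for t by (simp add: complex_eq_iff)
  show "continuous_on {-H..H} (\<lambda>t. w i (Complex 1 t))" if "i \<in> family" for i
    by (rule continuous_on_compose2[OF holomorphic_on_imp_continuous_on[OF w_holo[OF that]] continuous_line]) auto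
  show "continuous_on {-H..H} (\<lambda>t. D i (1/2 + Complex 1 t))" if "i \<in> family" for i
    by (rule continuous_on_compose2[OF holomorphic_on_imp_continuous_on[OF assms(1)[OF that]]])
       (auto intro!: continuous_intros continuous_line)
  show "norm (w i (Complex 1 t)) \<le> W * Y * exp (- t\<^sup>2 / 2)" if "i \<in> family" "\<bar>t\<bar> \<le> H" for i t
    using w_le[OF that(1), of "Complex 1 t"] pos by simp
  show "L2_set (\<lambda>i. norm (D i (1/2 + Complex 1 t))) family \<le> sqrt (real (card family)) * \<tau>" for t
  proof -
    have "L2_set (\<lambda>i. norm (D i (1/2 + Complex 1 t))) family \<le> L2_set (\<lambda>i. \<tau>) family"
      unfolding e using assms by (intro L2_set_mono) auto
    then show ?thesis using assms(2) by (simp add: L2_set_constant)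
  qed
qed (use pos in auto)

text \<open>For a block n ~ M with M >= Q^(9/4) the weight contributes Y^\<sigma> and the large
  sieve M^(1/2 - \<sigma>), together sqrt Y * (Y/M)^(\<sigma> - 1/2). With \<sigma> = \<delta> for M
  <= Y and \<sigma> = 1 for M > Y this decays on both sides of M = Y, so the sum over the blocks
  costs no logarithm. The shorter blocks are treated on the line \<sigma> = \<delta> with the cruder
  bound E1.\<close>

lemma dyadic_mean_value:
  assumes E1: "E1 \<ge> 0" "\<And>k. k < K \<Longrightarrow> (\<Sum>n\<in>{2 ^ k..<2 ^ Suc k}. (norm (a n))\<^sup>2) \<le> E1 * 2 ^ k"
    and E2: "E2 \<ge> 0" "\<And>k. k < K \<Longrightarrow> Q powr (9/4) \<le> 2 ^ k \<Longrightarrow> (\<Sum>n\<in>{2 ^ k..<2 ^ Suc k}. (norm (a n))\<^sup>2) \<le> E2 * 2 ^ k"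
  shows "L2_set (\<lambda>i. norm (wint (\<lambda>i. dpoly a (snd i) {1..<2 ^ K}) i)) family
    \<le> real K * (2 * pi * (W * Y powr \<delta>) * sqrt (134 * Q powr (9/4) * E1))
      + 2 * pi * W * sqrt (134 * E2) * sqrt Y * dyadic_const + real K * shift_err ((1 + E1) * 2 ^ K)"
proof -
  define g :: "nat \<Rightarrow> real" where "g k = (if 2 ^ k \<le> Y then (2 ^ k / Y) powr (1/4) else (Y / 2 ^ k) powr (1/4))" for k
  let ?A = "\<lambda>k. {2 ^ k..<2 ^ Suc k::nat}"
  let ?x = "2 * pi * (W * Y powr \<delta>) * sqrt (134 * Q powr (9/4) * E1)"
  let ?y = "2 * pi * W * sqrt (134 * E2) * sqrt Y"
  let ?z = "shift_err ((1 + E1) * 2 ^ K)"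
  have Q: "Q\<^sup>2 \<le> Q powr (9/4)" using Q_ge_2 powr_mono[of 2 "9/4" Q] by simp
  have x0: "?x \<ge> 0" "?y \<ge> 0" using pos E1 E2 by auto
  have blk: "L2_set (\<lambda>i. norm (wint (\<lambda>i. dpoly a (snd i) (?A k)) i)) family \<le> ?x + ?y * g k + ?z" if k: "k < K" for k
  proof -
    define M :: real where "M = 2 ^ k"
    have M: "M \<ge> 1" by (simp add: M_def)
    have mean: "L2_set (\<lambda>i. norm (dpoly a (snd i) (?A k) (Complex \<sigma> t))) family
      \<le> sqrt ((4 * Q\<^sup>2 + 130 * M) * (M powr (- 2 * \<sigma>) * (\<Sum>n\<in>?A k. (norm (a n))\<^sup>2)))" if "\<sigma> \<ge> 0" for \<sigma> t
    proof (rule dpoly_block_mean_square[OF _ M that])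
      fix n assume "n \<in> ?A k"
      then have "2 ^ k \<le> n" "n \<le> 2 * 2 ^ k" by auto
      then have "real (2 ^ k) \<le> real n" "real n \<le> real (2 * 2 ^ k)" by (simp_all only: of_nat_le_iff)
      then show "M \<le> real n \<and> real n \<le> 2 * M" by (simp add: M_def)
    qed
    have B: "norm (dpoly a (snd i) (?A k) s) \<le> (1 + E1) * 2 ^ K" if "i \<in> family" "Re s \<ge> 1/2" for i s
    proof -
      have "norm (dpoly a (snd i) (?A k) s) \<le> (\<Sum>n\<in>?A k. norm (a n))" using that by (intro dpoly_norm_le) auto
      also have "\<dots> \<le> (1 + E1) * 2 ^ k" using E1(2)[OF k] by (intro sum_norm_le_of_squares) auto
      also have "\<dots> \<le> (1 + E1) * 2 ^ K" using E1 k by (intro mult_left_mono power_increasing) auto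
      finally show ?thesis .
    qed
    have shifted: "L2_set (\<lambda>i. norm (wint (\<lambda>i. dpoly a (snd i) (?A k)) i)) family
        \<le> 2 * pi * (W * Y powr \<sigma>) * S + ?z"
      if "\<delta> \<le> \<sigma>" "\<sigma> \<le> 1" "sqrt ((4 * Q\<^sup>2 + 130 * M) * (M powr (- 2 * (1/2 + \<sigma>)) * (\<Sum>n\<in>?A k. (norm (a n))\<^sup>2))) \<le> S" for \<sigma> S
    proof (rule wint_shifted[OF that(1,2)])
      show "L2_set (\<lambda>i. norm (dpoly a (snd i) (?A k) (Complex (1/2 + \<sigma>) t))) family \<le> S" for t
        using mean[of "1/2 + \<sigma>" t] that pos by (meson add_nonneg_nonneg order_trans less_imp_le zero_le_divide_1_iff zero_le_numeral)
    qed (use E1 B in \<open>auto intro!: holomorphic_intros\<close>)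
    show ?thesis
    proof (cases "Q powr (9/4) \<le> M")
      \<comment> \<open>In a short block the term Q^2 of the large sieve may exceed M; both are
        bounded by Q^(9/4), with 134 = 4 + 130, and the weight costs only Y^\<delta>.\<close>
      case False
      have "(4 * Q\<^sup>2 + 130 * M) * (M powr (- 2 * (1/2 + \<delta>)) * (\<Sum>n\<in>?A k. (norm (a n))\<^sup>2))
          \<le> (4 * Q powr (9/4) + 130 * Q powr (9/4)) * (M powr - 1 * (E1 * M))"
        using Q False M pos E1(2)[OF k] E1(1) by (intro mult_mono add_mono powr_mono) (auto simp: M_def intro!: sum_nonneg mult_nonneg_nonneg)
      also have "\<dots> = 134 * Q powr (9/4) * E1" using M by (simp add: powr_minus_divide)
      finally have "L2_set (\<lambda>i. norm (wint (\<lambda>i. dpoly a (snd i) (?A k)) i)) family \<le> ?x + ?z"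
        using pos by (intro shifted real_sqrt_le_mono) auto
      moreover have "?y * g k \<ge> 0" by (intro mult_nonneg_nonneg x0) (simp add: g_def)
      ultimately show ?thesis by linarith
    next
      case True
      have S: "sqrt ((4 * Q\<^sup>2 + 130 * M) * (M powr (- 2 * (1/2 + \<sigma>)) * (\<Sum>n\<in>?A k. (norm (a n))\<^sup>2)))
          \<le> sqrt (134 * E2) * M powr (1/2 - \<sigma>)" for \<sigma>
      proof -
        have "(4 * Q\<^sup>2 + 130 * M) * (M powr (- 2 * (1/2 + \<sigma>)) * (\<Sum>n\<in>?A k. (norm (a n))\<^sup>2))
          \<le> (4 * M + 130 * M) * (M powr (- 2 * (1/2 + \<sigma>)) * (E2 * M))"
          using Q True M E2(2)[OF k] by (intro mult_mono add_mono) (auto simp: M_def intro!: sum_nonneg mult_nonneg_nonneg)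
        also have "\<dots> = 134 * E2 * (M powr 1 * M powr 1 * M powr (- 2 * (1/2 + \<sigma>)))" using M by simp
        also have "M powr 1 * M powr 1 * M powr (- 2 * (1/2 + \<sigma>)) = M powr (2 * (1/2 - \<sigma>))"
          unfolding powr_add[symmetric] by (simp add: algebra_simps)
        also have "\<dots> = (M powr (1/2 - \<sigma>))\<^sup>2" using M by (simp add: powr_power mult.commute)
        finally have "sqrt ((4 * Q\<^sup>2 + 130 * M) * (M powr (- 2 * (1/2 + \<sigma>)) * (\<Sum>n\<in>?A k. (norm (a n))\<^sup>2)))
          \<le> sqrt (134 * E2 * (M powr (1/2 - \<sigma>))\<^sup>2)" by (rule real_sqrt_le_mono)
        then show ?thesis by (simp add: real_sqrt_mult)
      qed
      \<comment> \<open>Since \<delta> <= 1/4, either choice has |\<sigma> - 1/2| >= 1/4, the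
        exponent in \<open>g\<close>.\<close>
      define \<sigma> where "\<sigma> = (if M \<le> Y then \<delta> else 1)"
      have \<sigma>: "\<delta> \<le> \<sigma>" "\<sigma> \<le> 1" using pos by (auto simp: \<sigma>_def)
      have key: "Y powr \<sigma> * M powr (1/2 - \<sigma>) \<le> sqrt Y * g k"
      proof -
        have "Y powr \<sigma> * M powr (1/2 - \<sigma>) = Y powr (1/2) * (Y powr (\<sigma> - 1/2) / M powr (\<sigma> - 1/2))"
          using M pos by (simp add: powr_diff field_simps flip: powr_add)
        also have "\<dots> = sqrt Y * (Y / M) powr (\<sigma> - 1/2)" using M pos by (simp add: powr_divide powr_half_sqrt)
        also have "(Y / M) powr (\<sigma> - 1/2) \<le> g k"
        proof (cases "M \<le> Y")
          case True
          have "(Y / M) powr (\<sigma> - 1/2) = (M / Y) powr (1/2 - \<delta>)"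
          proof -
            have "(Y / M) powr (\<delta> - 1/2) = inverse ((Y / M) powr (1/2 - \<delta>))" by (simp flip: powr_minus)
            also have "\<dots> = (M / Y) powr (1/2 - \<delta>)" using M pos by (simp add: powr_divide)
            finally show ?thesis using True by (simp add: \<sigma>_def)
          qed
          also have "\<dots> \<le> (M / Y) powr (1/4)" using True M pos by (intro powr_mono') auto
          finally show ?thesis using True by (simp add: g_def M_def)
        next
          case F: False
          have "(Y / M) powr (1/2) \<le> (Y / M) powr (1/4)" using F M pos by (intro powr_mono') auto
          then show ?thesis using F by (simp add: g_def M_def \<sigma>_def)
        qed
        finally show ?thesis using pos by simp
      qed
      have "L2_set (\<lambda>i. norm (wint (\<lambda>i. dpoly a (snd i) (?A k)) i)) family
        \<le> 2 * pi * (W * Y powr \<sigma>) * (sqrt (134 * E2) * M powr (1/2 - \<sigma>)) + ?z"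
        using \<sigma> S by (intro shifted) auto
      also have "2 * pi * (W * Y powr \<sigma>) * (sqrt (134 * E2) * M powr (1/2 - \<sigma>))
         = 2 * pi * W * sqrt (134 * E2) * (Y powr \<sigma> * M powr (1/2 - \<sigma>))" by simp
      also have "\<dots> \<le> 2 * pi * W * sqrt (134 * E2) * (sqrt Y * g k)"
        using key pos E2 by (intro mult_left_mono) auto
      finally have "L2_set (\<lambda>i. norm (wint (\<lambda>i. dpoly a (snd i) (?A k)) i)) family \<le> ?y * g k + ?z" by (simp only: mult.assoc)
      then show ?thesis using x0(1) by linarith
    qed
  qed
  have "L2_set (\<lambda>i. norm (wint (\<lambda>i. dpoly a (snd i) {1..<2 ^ K}) i)) family
     = L2_set (\<lambda>i. norm (\<Sum>k<K. wint (\<lambda>i. dpoly a (snd i) (?A k)) i)) family"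
  proof (intro L2_set_cong refl arg_cong[where f = norm])
    fix i assume i: "i \<in> family"
    have "dpoly a (snd i) {1..<2 ^ K} = (\<lambda>s. \<Sum>k<K. dpoly a (snd i) (?A k) s)" for i :: "nat \<times> (int \<Rightarrow> complex)"
      by (intro ext dpoly_dyadic)
    then have "wint (\<lambda>i. dpoly a (snd i) {1..<2 ^ K}) i = wint (\<lambda>i s. \<Sum>k<K. dpoly a (snd i) (?A k) s) i" by simp
    also have "\<dots> = (\<Sum>k<K. wint (\<lambda>i. dpoly a (snd i) (?A k)) i)"
      using i by (intro wint_sum) (auto intro!: holomorphic_intros)
    finally show "wint (\<lambda>i. dpoly a (snd i) {1..<2 ^ K}) i = (\<Sum>k<K. wint (\<lambda>i. dpoly a (snd i) (?A k)) i)" .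
  qed
  also have "\<dots> \<le> (\<Sum>k<K. L2_set (\<lambda>i. norm (wint (\<lambda>i. dpoly a (snd i) (?A k)) i)) family)"
    by (rule L2_set_norm_sum_le)
  also have "\<dots> \<le> (\<Sum>k<K. ?x + ?y * g k + ?z)" by (intro sum_mono blk) auto
  also have "\<dots> = real K * ?x + ?y * (\<Sum>k<K. g k) + real K * ?z" by (simp add: sum.distrib sum_distrib_left)
  also have "\<dots> \<le> real K * ?x + ?y * dyadic_const + real K * ?z"
    unfolding g_def using x0 pos by (intro add_mono mult_left_mono dyadic_two_sided_sum) auto
  finally show ?thesis .
qed

text \<open>With \<sigma> = 1/2 the products are evaluated on the line Re s = 1, where the sum over
  p is small for each character separately and is taken out with its maximum; the large sieve treats
  the other factor. All blocks count the same here, hence the factor K. As b vanishes below Q^2, the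
  blocks that matter satisfy Q^2 <= 2 M, and 138 = 8 + 130.\<close>

lemma dyadic_product_mean_value:
  assumes E: "E \<ge> 0" "\<And>k. k < K \<Longrightarrow> (\<Sum>n\<in>{2 ^ k..<2 ^ Suc k}. (norm (b n))\<^sup>2) \<le> E * 2 ^ k"
    and supp: "\<And>n. real n < Q\<^sup>2 \<Longrightarrow> b n = 0"
    and A: "0 \<notin> A" "(\<Sum>n\<in>A. norm (p n)) \<le> BP"
    and small: "\<And>i t. i \<in> family \<Longrightarrow> \<bar>t\<bar> \<le> H \<Longrightarrow> norm (dpoly p (snd i) A (Complex 1 t)) \<le> \<rho>" "\<rho> \<ge> 0"
  shows "L2_set (\<lambda>i. norm (wint (\<lambda>i s. dpoly p (snd i) A s * dpoly b (snd i) {1..<2 ^ K} s) i)) family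
    \<le> real K * (2 * pi * (W * Y powr (1/2)) * (\<rho> * sqrt (138 * E)) + shift_err (BP * ((1 + E) * 2 ^ K)))"
proof -
  let ?A = "\<lambda>k. {2 ^ k..<2 ^ Suc k::nat}"
  have BP: "BP \<ge> 0" using A(2) sum_nonneg[of A "\<lambda>n. norm (p n)"] by simp
  have mean: "L2_set (\<lambda>i. norm (dpoly b (snd i) (?A k) (Complex 1 t))) family \<le> sqrt (138 * E)" if k: "k < K" for k t
  proof (cases "Q\<^sup>2 \<le> 2 * 2 ^ k")
    case True
    define M :: real where "M = 2 ^ k"
    have M: "M \<ge> 1" "Q\<^sup>2 \<le> 2 * M" using True by (auto simp: M_def)
    have "L2_set (\<lambda>i. norm (dpoly b (snd i) (?A k) (Complex 1 t))) family
      \<le> sqrt ((4 * Q\<^sup>2 + 130 * M) * (M powr (- 2 * 1) * (\<Sum>n\<in>?A k. (norm (b n))\<^sup>2)))"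
    proof (rule dpoly_block_mean_square)
      fix n assume "n \<in> ?A k"
      then have "2 ^ k \<le> n" "n \<le> 2 * 2 ^ k" by auto
      then have "real (2 ^ k) \<le> real n" "real n \<le> real (2 * 2 ^ k)" by (simp_all only: of_nat_le_iff)
      then show "M \<le> real n \<and> real n \<le> 2 * M" by (simp add: M_def)
    qed (use M in auto)
    also have "\<dots> \<le> sqrt ((8 * M + 130 * M) * (M powr (- 2 * 1) * (E * M)))"
    proof (intro real_sqrt_le_mono mult_mono mult_left_mono)
      show "4 * Q\<^sup>2 + 130 * M \<le> 8 * M + 130 * M" using M by simp
      show "(\<Sum>n\<in>?A k. (norm (b n))\<^sup>2) \<le> E * M" using E(2)[OF k] by (simp add: M_def)
    qed (use M in \<open>auto intro!: mult_nonneg_nonneg sum_nonneg\<close>)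
    also have "(8 * M + 130 * M) * (M powr (- 2 * 1) * (E * M)) = 138 * E"
      using M by (simp add: powr_minus_divide power2_eq_square)
    finally show ?thesis .
  next
    case False
    have "dpoly b ch (?A k) s = 0" for ch s
      unfolding dpoly_def
    proof (intro sum.neutral ballI)
      fix n assume "n \<in> ?A k"
      then have "n \<le> 2 * 2 ^ k" by auto
      then have "real n \<le> real (2 * 2 ^ k)" by (simp only: of_nat_le_iff)
      then have "real n < Q\<^sup>2" using False by simp
      then show "b n * ch (int n) / of_nat n powr s = 0" using supp by simp
    qed
    then show ?thesis using E by (simp add: L2_set_def)
  qed
  have blk: "L2_set (\<lambda>i. norm (wint (\<lambda>i s. dpoly p (snd i) A s * dpoly b (snd i) (?A k) s) i)) family
     \<le> 2 * pi * (W * Y powr (1/2)) * (\<rho> * sqrt (138 * E)) + shift_err (BP * ((1 + E) * 2 ^ K))" if k: "k < K" for k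
  proof (rule wint_shifted)
    show "BP * ((1 + E) * 2 ^ K) \<ge> 0" using BP E by simp
    show "(\<lambda>s. dpoly p (snd i) A s * dpoly b (snd i) (?A k) s) holomorphic_on UNIV" for i :: "nat \<times> (int \<Rightarrow> complex)"
      using A by (intro holomorphic_intros) auto
    show "norm (dpoly p (snd i) A s * dpoly b (snd i) (?A k) s) \<le> BP * ((1 + E) * 2 ^ K)"
      if "i \<in> family" "Re s \<ge> 1/2" for i s
      unfolding norm_mult
    proof (rule mult_mono)
      have "norm (dpoly p (snd i) A s) \<le> (\<Sum>n\<in>A. norm (p n))" using that A by (intro dpoly_norm_le) auto
      then show "norm (dpoly p (snd i) A s) \<le> BP" using A by simp
      have "norm (dpoly b (snd i) (?A k) s) \<le> (\<Sum>n\<in>?A k. norm (b n))" using that by (intro dpoly_norm_le) auto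
      also have "\<dots> \<le> (1 + E) * 2 ^ k" using E(2)[OF k] by (intro sum_norm_le_of_squares) auto
      also have "\<dots> \<le> (1 + E) * 2 ^ K" using E k by (intro mult_left_mono power_increasing) auto
      finally show "norm (dpoly b (snd i) (?A k) s) \<le> (1 + E) * 2 ^ K" .
    qed (use BP in auto)
    show "L2_set (\<lambda>i. norm (dpoly p (snd i) A (Complex (1/2 + 1/2) t) * dpoly b (snd i) (?A k) (Complex (1/2 + 1/2) t))) family
        \<le> \<rho> * sqrt (138 * E)" if t: "\<bar>t\<bar> \<le> H" for t
    proof -
      have "L2_set (\<lambda>i. norm (dpoly p (snd i) A (Complex 1 t) * dpoly b (snd i) (?A k) (Complex 1 t))) family
        \<le> L2_set (\<lambda>i. \<rho> * norm (dpoly b (snd i) (?A k) (Complex 1 t))) family"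
        using small t by (intro L2_set_mono) (auto simp: norm_mult intro!: mult_right_mono)
      also have "\<dots> = \<rho> * L2_set (\<lambda>i. norm (dpoly b (snd i) (?A k) (Complex 1 t))) family"
        using small(2) by (rule L2_set_right_distrib[symmetric])
      also have "\<dots> \<le> \<rho> * sqrt (138 * E)" using mean[OF k] small(2) by (intro mult_left_mono)
      finally show ?thesis by simp
    qed
  qed (use pos in auto)
  have "L2_set (\<lambda>i. norm (wint (\<lambda>i s. dpoly p (snd i) A s * dpoly b (snd i) {1..<2 ^ K} s) i)) family
     = L2_set (\<lambda>i. norm (\<Sum>k<K. wint (\<lambda>i s. dpoly p (snd i) A s * dpoly b (snd i) (?A k) s) i)) family"
  proof (intro L2_set_cong refl arg_cong[where f = norm])
    fix i assume i: "i \<in> family"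
    have "wint (\<lambda>i s. dpoly p (snd i) A s * dpoly b (snd i) {1..<2 ^ K} s) i
      = wint (\<lambda>i s. \<Sum>k<K. dpoly p (snd i) A s * dpoly b (snd i) (?A k) s) i" by (simp only: dpoly_dyadic sum_distrib_left)
    also have "\<dots> = (\<Sum>k<K. wint (\<lambda>i s. dpoly p (snd i) A s * dpoly b (snd i) (?A k) s) i)"
      using i A by (intro wint_sum) (auto intro!: holomorphic_intros)
    finally show "wint (\<lambda>i s. dpoly p (snd i) A s * dpoly b (snd i) {1..<2 ^ K} s) i
      = (\<Sum>k<K. wint (\<lambda>i s. dpoly p (snd i) A s * dpoly b (snd i) (?A k) s) i)" .
  qed
  also have "\<dots> \<le> (\<Sum>k<K. L2_set (\<lambda>i. norm (wint (\<lambda>i s. dpoly p (snd i) A s * dpoly b (snd i) (?A k) s) i)) family)"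
    by (rule L2_set_norm_sum_le)
  also have "\<dots> \<le> (\<Sum>k<K. 2 * pi * (W * Y powr (1/2)) * (\<rho> * sqrt (138 * E)) + shift_err (BP * ((1 + E) * 2 ^ K)))"
    by (intro sum_mono blk) auto
  finally show ?thesis by simp
qed

end

section \<open>Splitting the twisted L-functions by Ramare's identity\<close>

context lfun_mean begin

definition lam_sum54 :: real where "lam_sum54 = (\<Sum>\<^sub>\<infinity>n\<in>{1..}. norm (lam n) * real n powr - (5/4))"

lemma lam_sum54_nonneg: "lam_sum54 \<ge> 0"
  unfolding lam_sum54_def by (rule infsum_nonneg) simp

text \<open>The coefficients of the cofactor m in Ramare's identity. The cut at M0 = Q^2 removes the
  m for which the large sieve would not be sharp.\<close>

definition quot_coeff :: "nat set \<Rightarrow> real \<Rightarrow> nat \<Rightarrow> complex" where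
  "quot_coeff P M0 m = (if M0 \<le> real m then lam m / of_nat (1 + ram_count P m) else 0)"

lemma norm_quot_coeff_le: "norm (quot_coeff P M0 m) \<le> norm (lam m)"
proof -
  have "norm (lam m) / real (1 + ram_count P m) \<le> norm (lam m) / 1" by (intro divide_left_mono) auto
  then show ?thesis unfolding quot_coeff_def by (simp add: norm_divide del: of_nat_Suc of_nat_add)
qed

lemma lam_sum54_finite_le: "finite A \<Longrightarrow> A \<subseteq> {1..} \<Longrightarrow> (\<Sum>n\<in>A. norm (lam n) * real n powr - (5/4)) \<le> lam_sum54"
  unfolding lam_sum54_def using summable_lam[of "5/4"]
  by (intro finite_sum_le_infsum) auto

lemma twist_tail:
  assumes q: "q \<ge> 2" "primitive_char q ch" and s: "Re s = 3/2" and N: "N \<ge> 1"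
  shows "norm (L_twist F ch s - dpoly lam ch {1..<N} s) \<le> lam_sum54 * real N powr - (1/4)"
proof -
  have ch: "norm (ch n) \<le> 1" for n by (rule norm_char_le[OF q])
  have sm: "(\<lambda>n. norm (lam n) * real n powr - (3/2)) summable_on {1..}" by (rule summable_lam) simp
  have le: "norm (L_term F ch s n) \<le> norm (lam n) * real n powr - (3/2)" if "n \<ge> 1" for n
    using norm_L_term_le[OF that, of ch s] ch s by simp
  have abs: "(\<lambda>n. norm (L_term F ch s n)) summable_on {1..}"
    by (rule summable_on_comparison_test[OF sm]) (use le in auto)
  then have sl: "L_term F ch s summable_on {1..}" by (rule abs_summable_summable)
  have un: "{1..} = {1..<N} \<union> {N..}" using N by auto
  have s1: "L_term F ch s summable_on {N..}" by (rule summable_on_subset_banach[OF sl]) (use N in auto)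
  have "L_twist F ch s = (\<Sum>\<^sub>\<infinity>n\<in>{1..<N} \<union> {N..}. L_term F ch s n)"
    using L_twist_eq_series[OF q, of s] s unfolding un[symmetric] by (simp add: L_series_def)
  also have "\<dots> = (\<Sum>\<^sub>\<infinity>n\<in>{1..<N}. L_term F ch s n) + (\<Sum>\<^sub>\<infinity>n\<in>{N..}. L_term F ch s n)"
    by (rule infsum_Un_disjoint) (use s1 in auto)
  also have "(\<Sum>\<^sub>\<infinity>n\<in>{1..<N}. L_term F ch s n) = dpoly lam ch {1..<N} s"
    by (simp add: dpoly_def L_term_def)
  finally have "norm (L_twist F ch s - dpoly lam ch {1..<N} s) = norm (\<Sum>\<^sub>\<infinity>n\<in>{N..}. L_term F ch s n)" by simp
  also have "\<dots> \<le> (\<Sum>\<^sub>\<infinity>n\<in>{N..}. real N powr - (1/4) * (norm (lam n) * real n powr - (5/4)))"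
  proof (rule norm_infsum_le)
    show "((\<lambda>n. L_term F ch s n) has_sum (\<Sum>\<^sub>\<infinity>n\<in>{N..}. L_term F ch s n)) {N..}"
      using s1 by (rule has_sum_infsum)
    have "(\<lambda>n. norm (lam n) * real n powr - (5/4)) summable_on {N..}"
      by (rule summable_on_subset_banach[OF summable_lam[of "5/4"]]) (use N in auto)
    then have "(\<lambda>n. real N powr - (1/4) * (norm (lam n) * real n powr - (5/4))) summable_on {N..}"
      by (rule summable_on_cmult_right)
    then show "((\<lambda>n. real N powr - (1/4) * (norm (lam n) * real n powr - (5/4))) has_sum
        (\<Sum>\<^sub>\<infinity>n\<in>{N..}. real N powr - (1/4) * (norm (lam n) * real n powr - (5/4)))) {N..}"
      by (rule has_sum_infsum)
    fix n assume n: "n \<in> {N..}"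
    then have "norm (L_term F ch s n) \<le> norm (lam n) * real n powr - (3/2)" using N by (intro le) auto
    also have "\<dots> \<le> norm (lam n) * (real N powr - (1/4) * real n powr - (5/4))"
      using n N by (intro mult_left_mono powr_three_halves_le) auto
    finally show "norm (L_term F ch s n) \<le> real N powr - (1/4) * (norm (lam n) * real n powr - (5/4))"
      by (simp only: mult_ac)
  qed
  also have "\<dots> = real N powr - (1/4) * (\<Sum>\<^sub>\<infinity>n\<in>{N..}. norm (lam n) * real n powr - (5/4))"
    by (rule infsum_cmult_right')
  also have "\<dots> \<le> real N powr - (1/4) * lam_sum54"
    unfolding lam_sum54_def
  proof (intro mult_left_mono infsum_mono_neutral)
    show "(\<lambda>n. norm (lam n) * real n powr - (5/4)) summable_on {N..}"
      by (rule summable_on_subset_banach[OF summable_lam[of "5/4"]]) (use N in auto)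
    show "(\<lambda>n. norm (lam n) * real n powr - (5/4)) summable_on {1..}" by (rule summable_lam) simp
  qed (use N in auto)
  finally show ?thesis by (simp only: mult.commute)
qed

text \<open>Only the condition p * m <= N separates this double sum from a product of two Dirichlet
  polynomials; \<open>twist_decomposition\<close> removes it.\<close>

lemma dpoly_ram_coeff:
  assumes P: "finite P" "\<And>p. p \<in> P \<Longrightarrow> prime p" and "dirichlet_char q ch"
  shows "dpoly (ram_coeff P M0) ch {1..<Suc N} s =
    (\<Sum>p\<in>P. \<Sum>m | m \<in> {1..N} \<and> p * m \<le> N \<and> M0 \<le> real m.
       (lam p * ch (int p) / of_nat p powr s) * (quot_coeff P M0 m * ch (int m) / of_nat m powr s))"
proof -
  define g where "g p m = (lam p * ch (int p) / of_nat p powr s) * (quot_coeff P M0 m * ch (int m) / of_nat m powr s)" for p m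
  have mult: "ram_coeff P M0 n * ch (int n) / of_nat n powr s = (\<Sum>p | p \<in> P \<and> p dvd n \<and> M0 \<le> real (n div p). g p (n div p))"
    if n: "n \<in> {1..N}" for n
    unfolding ram_coeff_def sum_distrib_right sum_divide_distrib
  proof (rule sum.cong[OF refl])
    fix p assume p: "p \<in> {p. p \<in> P \<and> p dvd n \<and> M0 \<le> real (n div p)}"
    define m where "m = n div p"
    have nm: "n = p * m" using p by (simp add: m_def)
    have "of_nat n powr s = (of_nat p powr s * of_nat m powr s :: complex)"
      unfolding nm of_nat_mult by (rule powr_times_real) auto
    moreover have "ch (int n) = ch (int p) * ch (int m)"
      unfolding nm of_nat_mult by (rule dirichlet_char_mult[OF assms(3)])
    moreover have "quot_coeff P M0 m = lam m / of_nat (1 + ram_count P m)" using p by (simp add: quot_coeff_def m_def)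
    ultimately show "lam p * (lam (n div p) / of_nat (1 + ram_count P (n div p))) * ch (int n) / of_nat n powr s = g p (n div p)"
      unfolding g_def m_def[symmetric] by (simp only: times_divide_eq_left times_divide_eq_right divide_divide_eq_left mult_ac)
  qed
  have "dpoly (ram_coeff P M0) ch {1..<Suc N} s = (\<Sum>n=1..N. \<Sum>p | p \<in> P \<and> p dvd n \<and> M0 \<le> real (n div p). g p (n div p))"
    unfolding dpoly_def by (intro sum.cong mult) auto
  also have "\<dots> = (\<Sum>p\<in>P. \<Sum>m | m \<in> {1..N} \<and> p * m \<le> N \<and> M0 \<le> real m. g p m)"
    by (rule sum_divisor_swap[OF P(1) prime_ge_1_nat[OF P(2)]])
  finally show ?thesis by (simp only: g_def)
qed

text \<open>The product of the two polynomials has additional terms with p * m >= N. On Re s = 3/2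
  they are as small as the tail of the L-series: (p m)^(-3/2) <= N^(-1/4) * m^(-5/4), summed over m
  for each p in P.\<close>

lemma twist_decomposition:
  assumes q: "q \<ge> 2" "primitive_char q ch" and s: "Re s = 3/2" and N: "N \<ge> 2"
    and P: "finite P" "\<And>p. p \<in> P \<Longrightarrow> prime p"
  shows "norm (L_twist F ch s - dpoly (rem_coeff P M0) ch {1..<N} s - dpoly lam ch P s * dpoly (quot_coeff P M0) ch {1..<N} s)
    \<le> (1 + real (card P) * real d) * lam_sum54 * real N powr - (1/4)"
proof -
  have ch: "norm (ch n) \<le> 1" for n by (rule norm_char_le[OF q])
  have dc: "dirichlet_char q ch" using q by (simp add: primitive_char_def)
  obtain N' where N': "N = Suc N'" using N by (cases N) auto
  define u where "u p = lam p * ch (int p) / of_nat p powr s" for p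
  define v where "v m = quot_coeff P M0 m * ch (int m) / of_nat m powr s" for m
  have split: "(\<Sum>m=1..N'. u p * v m) =
      (\<Sum>m | m \<in> {1..N'} \<and> p * m \<le> N' \<and> M0 \<le> real m. u p * v m) + (\<Sum>m | m \<in> {1..N'} \<and> N \<le> p * m. u p * v m)" for p
  proof -
    have "(\<Sum>m=1..N'. u p * v m) = (\<Sum>m\<in>{m\<in>{1..N'}. p * m \<le> N'}. u p * v m) + (\<Sum>m\<in>{m\<in>{1..N'}. \<not> p * m \<le> N'}. u p * v m)"
      by (subst sum.union_disjoint[symmetric]) (auto intro!: sum.cong)
    also have "(\<Sum>m\<in>{m\<in>{1..N'}. p * m \<le> N'}. u p * v m) = (\<Sum>m | m \<in> {1..N'} \<and> p * m \<le> N' \<and> M0 \<le> real m. u p * v m)"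
      by (intro sum.mono_neutral_right) (auto simp: v_def quot_coeff_def)
    also have "{m\<in>{1..N'}. \<not> p * m \<le> N'} = {m. m \<in> {1..N'} \<and> N \<le> p * m}" by (auto simp: N')
    finally show ?thesis .
  qed
  have prod: "dpoly lam ch P s * dpoly (quot_coeff P M0) ch {1..<N} s = (\<Sum>p\<in>P. \<Sum>m=1..N'. u p * v m)"
    unfolding dpoly_def u_def v_def N' atLeastLessThanSuc_atLeastAtMost by (rule sum_product)
  have "dpoly lam ch {1..<N} s - dpoly (rem_coeff P M0) ch {1..<N} s = dpoly (ram_coeff P M0) ch {1..<N} s"
    unfolding dpoly_def rem_coeff_def sum_subtractf[symmetric]
    by (intro sum.cong refl) (simp add: algebra_simps diff_divide_distrib)
  then have "L_twist F ch s - dpoly (rem_coeff P M0) ch {1..<N} s - dpoly lam ch P s * dpoly (quot_coeff P M0) ch {1..<N} s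
     = (L_twist F ch s - dpoly lam ch {1..<N} s) - (\<Sum>p\<in>P. \<Sum>m | m \<in> {1..N'} \<and> N \<le> p * m. u p * v m)"
    using dpoly_ram_coeff[OF P dc, of M0 N' s, folded u_def v_def N'] unfolding prod split sum.distrib
    by (simp only: algebra_simps)
  also have "norm \<dots> \<le> lam_sum54 * real N powr - (1/4) + (\<Sum>p\<in>P. real d * lam_sum54 * real N powr - (1/4))"
  proof (rule order_trans[OF norm_triangle_ineq4], rule add_mono)
    show "norm (L_twist F ch s - dpoly lam ch {1..<N} s) \<le> lam_sum54 * real N powr - (1/4)"
      using N by (intro twist_tail[OF q s]) auto
    show "norm (\<Sum>p\<in>P. \<Sum>m | m \<in> {1..N'} \<and> N \<le> p * m. u p * v m) \<le> (\<Sum>p\<in>P. real d * lam_sum54 * real N powr - (1/4))"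
    proof (rule sum_norm_le)
      fix p assume p: "p \<in> P"
      then have pp: "prime p" by (rule P)
      have p1: "p \<ge> 1" by (rule prime_ge_1_nat[OF pp])
      have "norm (\<Sum>m | m \<in> {1..N'} \<and> N \<le> p * m. u p * v m)
        \<le> (\<Sum>m | m \<in> {1..N'} \<and> N \<le> p * m. real d * real N powr - (1/4) * (norm (lam m) * real m powr - (5/4)))"
      proof (rule sum_norm_le)
        fix m assume m: "m \<in> {m. m \<in> {1..N'} \<and> N \<le> p * m}"
        then have m1: "m \<ge> 1" by auto
        have Npm: "real N \<le> real p * real m"
        proof -
          have "real N \<le> real (p * m)" using m by (simp only: of_nat_le_iff) simp
          then show ?thesis by simp
        qed
        have "norm (u p) \<le> real d * real p powr - (3/2)"
        proof -
          have "norm (lam p) * norm (ch (int p)) \<le> real d * 1" by (intro mult_mono norm_lam_prime_le pp ch) auto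
          then have "norm (lam p) * norm (ch (int p)) / real p powr (3/2) \<le> real d / real p powr (3/2)" by (intro divide_right_mono) auto
          then show ?thesis using p1 by (simp add: u_def norm_divide norm_mult norm_of_nat_powr powr_minus_divide s)
        qed
        moreover have "norm (v m) \<le> norm (lam m) * real m powr - (3/2)"
        proof -
          have "norm (quot_coeff P M0 m) * norm (ch (int m)) \<le> norm (lam m) * 1" by (intro mult_mono norm_quot_coeff_le ch) auto
          then have "norm (quot_coeff P M0 m) * norm (ch (int m)) / real m powr (3/2) \<le> norm (lam m) / real m powr (3/2)" by (intro divide_right_mono) auto
          then show ?thesis using m1 by (simp add: v_def norm_divide norm_mult norm_of_nat_powr powr_minus_divide s)
        qed
        ultimately have "norm (u p * v m) \<le> (real d * real p powr - (3/2)) * (norm (lam m) * real m powr - (3/2))"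
          unfolding norm_mult by (intro mult_mono) auto
        also have "\<dots> = real d * norm (lam m) * (real p * real m) powr - (3/2)" using p1 m1 by (simp add: powr_mult)
        also have "\<dots> \<le> real d * norm (lam m) * (real N powr - (1/4) * (real p * real m) powr - (5/4))"
          using Npm N by (intro mult_left_mono powr_three_halves_le) auto
        also have "\<dots> \<le> real d * norm (lam m) * (real N powr - (1/4) * real m powr - (5/4))"
          using p1 m1 by (intro mult_left_mono powr_mono2') (auto simp: mult_le_cancel_right1)
        finally show "norm (u p * v m) \<le> real d * real N powr - (1/4) * (norm (lam m) * real m powr - (5/4))"
          by (simp only: mult_ac)
      qed
      also have "\<dots> = real d * real N powr - (1/4) * (\<Sum>m | m \<in> {1..N'} \<and> N \<le> p * m. norm (lam m) * real m powr - (5/4))"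
        by (simp only: sum_distrib_left)
      also have "\<dots> \<le> real d * real N powr - (1/4) * lam_sum54"
        by (intro mult_left_mono lam_sum54_finite_le) auto
      finally show "norm (\<Sum>m | m \<in> {1..N'} \<and> N \<le> p * m. u p * v m) \<le> real d * lam_sum54 * real N powr - (1/4)"
        by (simp only: mult_ac)
    qed
  qed
  also have "\<dots> = (1 + real (card P) * real d) * lam_sum54 * real N powr - (1/4)" by (simp add: algebra_simps)
  finally show ?thesis .
qed

lemma block_mean_square_le:
  assumes "\<And>n. norm (b n) \<le> norm (lam n)"
  shows "(\<Sum>n\<in>{2 ^ k..<2 ^ Suc k}. (norm (b n :: complex))\<^sup>2) \<le> 2 * K * 2 ^ k"
proof -
  have "(\<Sum>n\<in>{2 ^ k..<2 ^ Suc k}. (norm (b n))\<^sup>2) \<le> (\<Sum>n\<in>{2 ^ k..<2 ^ Suc k}. (norm (lam n))\<^sup>2)"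
    using assms by (intro sum_mono power_mono) auto
  also have "\<dots> \<le> (\<Sum>n=1..2 ^ Suc k. (norm (lam n))\<^sup>2)" by (rule sum_dyadic_block_le) simp
  also have "\<dots> \<le> K * real (2 ^ Suc k)" by (rule mean_square)
  finally show ?thesis by simp
qed

lemma weighted_twist_mean:
  assumes wf: "weighted_family Q X w W Y H \<delta>"
    and P: "finite P" "\<And>p. p \<in> P \<Longrightarrow> prime p" and R: "R \<ge> 1"
    and E1: "E1 \<ge> 0" "\<And>k. k < R \<Longrightarrow> (\<Sum>n\<in>{2 ^ k..<2 ^ Suc k}. (norm (rem_coeff P (Q\<^sup>2) n))\<^sup>2) \<le> E1 * 2 ^ k"
    and E2: "E2 \<ge> 0" "\<And>k. k < R \<Longrightarrow> Q powr (9/4) \<le> 2 ^ k \<Longrightarrow> (\<Sum>n\<in>{2 ^ k..<2 ^ Suc k}. (norm (rem_coeff P (Q\<^sup>2) n))\<^sup>2) \<le> E2 * 2 ^ k"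
    and small: "\<And>i t. i \<in> char_family.family Q X \<Longrightarrow> \<bar>t\<bar> \<le> H \<Longrightarrow> norm (dpoly lam (snd i) P (Complex 1 t)) \<le> \<rho>" "\<rho> \<ge> 0"
  shows "L2_set (\<lambda>i. norm (weighted_family.wint w H (\<lambda>i. L_twist F (snd i)) i)) (char_family.family Q X)
    \<le> (real R * (2 * pi * (W * Y powr \<delta>) * sqrt (134 * Q powr (9/4) * E1))
        + 2 * pi * W * sqrt (134 * E2) * sqrt Y * dyadic_const + real R * weighted_family.shift_err Q X W Y H ((1 + E1) * 2 ^ R))
      + real R * (2 * pi * (W * Y powr (1/2)) * (\<rho> * sqrt (138 * (2 * K)))
        + weighted_family.shift_err Q X W Y H ((real (card P) * real d) * ((1 + 2 * K) * 2 ^ R)))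
      + 2 * pi * (W * Y) * (sqrt (real (card (char_family.family Q X)))
          * ((1 + real (card P) * real d) * lam_sum54 * (2 ^ R) powr - (1/4)))"
proof -
  interpret weighted_family Q X w W Y H \<delta> by (rule wf)
  define N :: nat where "N = 2 ^ R"
  have N2: "N \<ge> 2" using R power_increasing[of 1 R "2::nat"] by (simp add: N_def)
  have P0: "0 \<notin> P" using P(2)[of 0] by auto
  define A where "A i = dpoly (rem_coeff P (Q\<^sup>2)) (snd i) {1..<N}" for i :: "nat \<times> (int \<Rightarrow> complex)"
  define B where "B i s = dpoly lam (snd i) P s * dpoly (quot_coeff P (Q\<^sup>2)) (snd i) {1..<N} s" for i :: "nat \<times> (int \<Rightarrow> complex)" and s
  define U where "U i s = L_twist F (snd i) s - A i s - B i s" for i :: "nat \<times> (int \<Rightarrow> complex)" and s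
  have hol: "A i holomorphic_on S" "B i holomorphic_on S" "L_twist F (snd i) holomorphic_on S" if "i \<in> family" for i S
    unfolding A_def B_def using P0 family_member[OF that] by (auto intro!: holomorphic_intros L_twist_entire[of "fst i"])
  have holU: "U i holomorphic_on S" if "i \<in> family" for i S
    unfolding U_def using hol[OF that] by (intro holomorphic_on_diff)
  have eq: "wint (\<lambda>i. L_twist F (snd i)) i = wint A i + wint B i + wint U i" if i: "i \<in> family" for i
  proof -
    have "(\<lambda>t. w i (Complex 1 t) * L_twist F (snd i) (1/2 + Complex 1 t)) =
      (\<lambda>t. w i (Complex 1 t) * A i (1/2 + Complex 1 t) + w i (Complex 1 t) * B i (1/2 + Complex 1 t) + w i (Complex 1 t) * U i (1/2 + Complex 1 t))"
      by (simp add: U_def algebra_simps)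
    then show ?thesis unfolding wint_def
      using wint_integrable[of i A] wint_integrable[of i B] wint_integrable[of i U] hol[OF i] holU[OF i] i
      by (simp add: integral_add integrable_add)
  qed
  have "L2_set (\<lambda>i. norm (wint (\<lambda>i. L_twist F (snd i)) i)) family
    \<le> L2_set (\<lambda>i. (norm (wint A i) + norm (wint B i)) + norm (wint U i)) family"
  proof (rule L2_set_mono)
    fix i assume i: "i \<in> family"
    show "norm (wint (\<lambda>i. L_twist F (snd i)) i) \<le> norm (wint A i) + norm (wint B i) + norm (wint U i)"
      unfolding eq[OF i] by (intro norm_triangle_le add_mono order_refl norm_triangle_ineq)
  qed auto
  also have "\<dots> \<le> L2_set (\<lambda>i. norm (wint A i) + norm (wint B i)) family + L2_set (\<lambda>i. norm (wint U i)) family"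
    by (rule L2_set_triangle_ineq)
  also have "\<dots> \<le> (L2_set (\<lambda>i. norm (wint A i)) family + L2_set (\<lambda>i. norm (wint B i)) family) + L2_set (\<lambda>i. norm (wint U i)) family"
    by (intro add_right_mono L2_set_triangle_ineq)
  also have "L2_set (\<lambda>i. norm (wint A i)) family \<le> real R * (2 * pi * (W * Y powr \<delta>) * sqrt (134 * Q powr (9/4) * E1))
      + 2 * pi * W * sqrt (134 * E2) * sqrt Y * dyadic_const + real R * shift_err ((1 + E1) * 2 ^ R)"
    unfolding A_def N_def by (rule dyadic_mean_value[OF E1 E2])
  also have "L2_set (\<lambda>i. norm (wint B i)) family \<le> real R * (2 * pi * (W * Y powr (1/2)) * (\<rho> * sqrt (138 * (2 * K)))
        + shift_err ((real (card P) * real d) * ((1 + 2 * K) * 2 ^ R)))"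
    unfolding B_def N_def
  proof (rule dyadic_product_mean_value[OF _ _ _ P0 _ small])
    show "(\<Sum>n\<in>{2 ^ k..<2 ^ Suc k}. (norm (quot_coeff P (Q\<^sup>2) n))\<^sup>2) \<le> 2 * K * 2 ^ k" for k
      by (rule block_mean_square_le) (rule norm_quot_coeff_le)
    have "(\<Sum>n\<in>P. norm (lam n)) \<le> (\<Sum>n\<in>P. real d)" using P(2) by (intro sum_mono norm_lam_prime_le)
    then show "(\<Sum>n\<in>P. norm (lam n)) \<le> real (card P) * real d" by simp
  qed (use K_ge_1 in \<open>auto simp: quot_coeff_def\<close>)
  also have "L2_set (\<lambda>i. norm (wint U i)) family \<le> 2 * pi * (W * Y) * (sqrt (real (card family))
          * ((1 + real (card P) * real d) * lam_sum54 * (2 ^ R) powr - (1/4)))"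
  proof (rule wint_trivial)
    show "norm (U i (Complex (3/2) t)) \<le> (1 + real (card P) * real d) * lam_sum54 * (2 ^ R) powr - (1/4)" if "i \<in> family" for i t
    proof -
      have "norm (U i (Complex (3/2) t)) \<le> (1 + real (card P) * real d) * lam_sum54 * real N powr - (1/4)"
        unfolding U_def A_def B_def using family_member[OF that] N2 P by (intro twist_decomposition[of "fst i"]) auto
      then show ?thesis by (simp add: N_def)
    qed
  qed (use holU lam_sum54_nonneg in auto)
  finally show ?thesis by simp
qed

text \<open>The target is the square root of Q^(d/2) * (ln Q)^(\<beta>' - 1), up to a constant,
  since this is a bound for a norm and not for its square. The blocks of the remainder beyond
  Q^(9/4) attain it; each of the other terms stays below a constant times it.\<close>

lemma weighted_twist_mean_large:
  assumes \<beta>': "0 < \<beta>'" "\<beta>' < 1" and CA: "CA \<ge> 1" and d5: "d \<ge> 5"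
  shows "\<exists>A\<ge>1. \<exists>L0\<ge>1. \<forall>Q X w. Q > 0 \<longrightarrow> ln Q \<ge> L0 \<longrightarrow>
     weighted_family Q X w (8 * real d * CA) ((CA * (2 * Q) ^ d) powr (1/2)) (ln Q) (1 / (8 * real d)) \<longrightarrow>
     (\<forall>i\<in>char_family.family Q X. \<forall>t. \<bar>t\<bar> \<le> ln Q \<longrightarrow>
        norm (dpoly lam (snd i) (prime_window \<beta>' Q) (Complex 1 t)) \<le> 1 / (ln Q)\<^sup>2) \<longrightarrow>
     L2_set (\<lambda>i. norm (weighted_family.wint w (ln Q) (\<lambda>i. L_twist F (snd i)) i)) (char_family.family Q X)
       \<le> A * (sqrt ((CA * (2 * Q) ^ d) powr (1/2)) * ln Q powr ((\<beta>' - 1) / 2))"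
proof -
  obtain CR where CR0: "CR \<ge> 1 \<and> (\<forall>P1 P2 M0 N. 2 \<le> P1 \<longrightarrow> P1 \<le> P2 \<longrightarrow> P2 \<le> real N \<longrightarrow> 1 \<le> M0 \<longrightarrow>
    (\<Sum>n=1..N. (norm (rem_coeff {p. prime p \<and> P1 \<le> real p \<and> real p \<le> P2} M0 n))\<^sup>2) \<le>
     CR * (M0 * P2 * (1 + ln (M0 * P2))\<^sup>2 + real N * ln P1 / ln P2 + real N * (1 + ln (real N))\<^sup>2 / P1))"
    using rem_coeff_mean_square ..
  define C0 where "C0 = 2 * K + 4 * (real d)\<^sup>2 * K"
  define W where "W = 8 * real d * CA"
  \<comment> \<open>The Dirichlet polynomials have length 2^R with R about \<kappa> L. As ln 2 >=
    1/2, the choice makes (2^R)^(-1/4) at most exp(-(2 d + 15) L), which outweighs the factors Y,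
    the root of the size of the family and the size of P in the truncation error.\<close>
  define \<kappa> where "\<kappa> = 16 * real d + 120"
  define \<gamma> where "\<gamma> = (\<beta>' - 1) / 2"
  have CR: "CR \<ge> 1" using CR0 by simp
  have C0: "C0 \<ge> 0" using K_ge_1 by (simp add: C0_def)
  have W: "W \<ge> 0" using CA by (simp add: W_def)
  have \<kappa>: "\<kappa> > 0" by (simp add: \<kappa>_def)
  have \<gamma>: "- 1/2 \<le> \<gamma>" "\<gamma> < 0" "2 * \<gamma> = \<beta>' - 1" using \<beta>' by (auto simp: \<gamma>_def)
  define c2 where "c2 = 2 * pi * W * sqrt (134 * (22 * CR)) * dyadic_const"
  define c4 where "c4 = 2 * pi * W * (\<kappa> + 1) * sqrt (138 * (2 * K))"
  define c5 where "c5 = 2 * pi * W * (1 + real d) * lam_sum54"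
  have c: "c2 \<ge> 0" "c4 \<ge> 0" "c5 \<ge> 0"
    using W \<kappa> CR K_ge_1 dyadic_const_pos lam_sum54_nonneg by (auto simp: c2_def c4_def c5_def)
  define Ev where "Ev = (\<lambda>L::real. 1 \<le> L \<and> exp (L powr \<beta>') \<ge> 2 \<and> exp (L powr \<beta>') \<le> exp (L / 10)
      \<and> exp (21/10 * L) * (1 + 21/10 * L)\<^sup>2 \<le> exp (9/4 * L) * L powr (\<beta>' - 1)
      \<and> 2 * (\<kappa> * L + 2)\<^sup>2 / exp (L powr \<beta>') \<le> L powr (\<beta>' - 1)
      \<and> (\<kappa> * L + 1) * (2 * pi * W * exp (3/40 * L) * (exp (9/8 * L) * (\<kappa> * L + 2) * sqrt (268 * C0))) \<le> exp (5/4 * L) * L powr \<gamma>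
      \<and> (\<kappa> * L + 1) * (exp (2 * L) * (2 * W * exp (real d * L) * exp (- L\<^sup>2 / 2) * ((1 + 2 * C0 * (\<kappa> * L + 2)\<^sup>2) * exp (\<kappa> * L + 1)))) \<le> 1
      \<and> (\<kappa> * L + 1) * (exp (2 * L) * (2 * W * exp (real d * L) * exp (- L\<^sup>2 / 2) * ((exp L * real d) * ((1 + 2 * K) * exp (\<kappa> * L + 1))))) \<le> 1
      \<and> c5 * exp (- L) \<le> 1 \<and> 1 \<le> exp (5/4 * L) * L powr \<gamma> \<and> CA * 2 ^ d \<le> exp L \<and> 69 \<le> exp L)"
  have "eventually Ev at_top"
    unfolding Ev_def
    using \<beta>' \<gamma> \<kappa> by (intro eventually_conj eventually_ge_at_top; real_asymp)
  then obtain L0 where L0: "\<And>L. L \<ge> L0 \<Longrightarrow> Ev L"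
    unfolding eventually_at_top_linorder by blast
  show ?thesis
  proof (rule exI[of _ "4 + c2 + c4"], rule conjI[rotated], rule exI[of _ "max 1 L0"], intro conjI allI impI)
    fix Q :: real and X w
    assume Q: "Q > 0" "max 1 L0 \<le> ln Q"
      and wf: "weighted_family Q X w (8 * real d * CA) ((CA * (2 * Q) ^ d) powr (1/2)) (ln Q) (1 / (8 * real d))"
      and small: "\<forall>i\<in>char_family.family Q X. \<forall>t. \<bar>t\<bar> \<le> ln Q \<longrightarrow>
        norm (dpoly lam (snd i) (prime_window \<beta>' Q) (Complex 1 t)) \<le> 1 / (ln Q)\<^sup>2"
    define L where "L = ln Q"
    define Y where "Y = (CA * (2 * Q) ^ d) powr (1/2)"
    define \<delta> where "\<delta> = 1 / (8 * real d)"
    define P where "P = {p. prime p \<and> exp (L powr \<beta>') \<le> real p \<and> real p \<le> Q powr (1/10)}"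
    define R where "R = nat \<lceil>\<kappa> * L\<rceil>"
    interpret weighted_family Q X w W Y L \<delta>
      using wf unfolding W_def Y_def L_def \<delta>_def .
    have LL0: "L \<ge> L0" using Q by (simp add: L_def)
    note E = L0[OF LL0, unfolded Ev_def]
    have E1: "1 \<le> L" "exp (L powr \<beta>') \<ge> 2" "exp (L powr \<beta>') \<le> exp (L / 10)"
      "exp (21/10 * L) * (1 + 21/10 * L)\<^sup>2 \<le> exp (9/4 * L) * L powr (\<beta>' - 1)"
      "2 * (\<kappa> * L + 2)\<^sup>2 / exp (L powr \<beta>') \<le> L powr (\<beta>' - 1)"
      using E by blast+
    have E2: "(\<kappa> * L + 1) * (2 * pi * W * exp (3/40 * L) * (exp (9/8 * L) * (\<kappa> * L + 2) * sqrt (268 * C0))) \<le> exp (5/4 * L) * L powr \<gamma>"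
      "(\<kappa> * L + 1) * (exp (2 * L) * (2 * W * exp (real d * L) * exp (- L\<^sup>2 / 2) * ((1 + 2 * C0 * (\<kappa> * L + 2)\<^sup>2) * exp (\<kappa> * L + 1)))) \<le> 1"
      "(\<kappa> * L + 1) * (exp (2 * L) * (2 * W * exp (real d * L) * exp (- L\<^sup>2 / 2) * ((exp L * real d) * ((1 + 2 * K) * exp (\<kappa> * L + 1))))) \<le> 1"
      "c5 * exp (- L) \<le> 1" "1 \<le> exp (5/4 * L) * L powr \<gamma>" "CA * 2 ^ d \<le> exp L" "69 \<le> exp L"
      using E by blast+
    have QL: "Q = exp L" using Q by (simp add: L_def)
    have Qpow: "Q powr x = exp (x * L)" for x using Q by (simp add: powr_def L_def)
    have Q2: "Q\<^sup>2 = exp (2 * L)" unfolding QL by (simp flip: exp_double)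
    have Qd: "Q ^ d = exp (real d * L)" unfolding QL by (simp flip: exp_of_nat_mult)
    have R: "\<kappa> * L \<le> real R" "real R \<le> \<kappa> * L + 1" "R \<ge> 1"
    proof -
      have "\<kappa> * L > 0" using \<kappa> E1 by simp
      then show "\<kappa> * L \<le> real R" "real R \<le> \<kappa> * L + 1" "R \<ge> 1" unfolding R_def by linarith+
    qed
    have R2: "2 ^ R \<le> exp (\<kappa> * L + 1)"
    proof -
      have "(2::real) ^ R \<le> exp 1 ^ R" using exp_ge_add_one_self[of 1] by (intro power_mono) auto
      also have "\<dots> = exp (real R)" by (simp flip: exp_of_nat_mult)
      also have "\<dots> \<le> exp (\<kappa> * L + 1)" using R by simp
      finally show ?thesis .
    qed
    have R3: "(2 ^ R) powr - (1/4) \<le> exp (- (2 * real d + 15) * L)"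
    proof -
      have "1 / 2 \<le> ln (2::real)" using ln2_ge_two_thirds by simp
      then have "real R * ln 2 \<ge> real R * (1/2)" by (intro mult_left_mono) auto
      then have "- (1/4) * (real R * ln 2) \<le> - (2 * real d + 15) * L"
        using R(1) by (simp add: \<kappa>_def algebra_simps)
      then show ?thesis by (simp add: powr_def ln_realpow)
    qed
    \<comment> \<open>The constant CA * 2^d is absorbed into one additional factor Q under the
      root.\<close>
    have Y1: "Y \<le> exp ((real d + 1) / 2 * L)"
    proof -
      have "CA * (2 * Q) ^ d = (CA * 2 ^ d) * Q ^ d" by (simp add: power_mult_distrib)
      also have "\<dots> \<le> exp L * exp (real d * L)" unfolding Qd using E2(6) by (intro mult_right_mono) auto
      also have "\<dots> = exp ((real d + 1) * L)" by (simp add: algebra_simps flip: exp_add)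
      finally have "(CA * (2 * Q) ^ d) powr (1/2) \<le> exp ((real d + 1) * L) powr (1/2)"
        using CA Q by (intro powr_mono2) auto
      then show ?thesis by (simp add: Y_def powr_def)
    qed
    \<comment> \<open>The lower bound for the main term that makes the short blocks negligible: sqrt
      Y >= Q^(d/4) has to exceed the root Q^(9/8) of Q^(9/4), which fails for d = 4.\<close>
    have Y2: "sqrt Y \<ge> exp (5/4 * L)"
    proof -
      have "1 \<le> CA * 2 ^ d" using CA mult_mono[of 1 CA 1 "2 ^ d"] by simp
      then have "1 * Q ^ d \<le> (CA * 2 ^ d) * Q ^ d" using Q by (intro mult_right_mono) auto
      moreover have "exp (5 * L) \<le> Q ^ d" using d5 E1(1) mult_right_mono[of 5 "real d" L] unfolding Qd by simp
      ultimately have "exp (5 * L) \<le> CA * (2 * Q) ^ d" by (simp only: power_mult_distrib mult.assoc mult_1_left)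
      then have "exp (5 * L) powr (1/2) \<le> Y" unfolding Y_def by (intro powr_mono2) auto
      then have "exp (5/2 * L) \<le> Y" by (simp add: powr_def)
      then have "sqrt (exp (5/2 * L)) \<le> sqrt Y" by (rule real_sqrt_le_mono)
      moreover have "sqrt (exp (5/2 * L)) = exp (5/4 * L)"
        by (rule real_sqrt_unique) (simp_all flip: exp_double)
      ultimately show ?thesis by linarith
    qed
    have Yd: "Y \<le> exp (real d * L)"
    proof -
      have "(real d + 1) / 2 * L \<le> real d * L" using d5 E1(1) by (intro mult_right_mono) auto
      then show ?thesis using Y1 by (smt (verit) exp_le_cancel_iff)
    qed
    \<comment> \<open>The exponent (d + 1) / (16 d) decreases in d and equals 3/40 at d = 5.\<close>
    have Y\<delta>: "Y powr \<delta> \<le> exp (3/40 * L)"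
    proof -
      have "Y powr \<delta> \<le> exp ((real d + 1) / 2 * L) powr \<delta>" using Y1 pos by (intro powr_mono2) auto
      also have "\<dots> = exp ((real d + 1) / (16 * real d) * L)" by (simp add: powr_def \<delta>_def)
      also have "\<dots> \<le> exp (3/40 * L)"
      proof -
        have "(real d + 1) / (16 * real d) \<le> 3/40" using d5 by (simp add: field_simps)
        then have "(real d + 1) / (16 * real d) * L \<le> 3/40 * L" using E1(1) by (intro mult_right_mono) auto
        then show ?thesis by (simp only: exp_le_cancel_iff)
      qed
      finally show ?thesis .
    qed
    have cardF: "sqrt (real (card family)) \<le> exp (2 * L)"
    proof -
      have "1 \<le> exp (2 * L)" using E1(1) by simp
      then have "real (card family) \<le> 69 * exp (2 * L)" using card_family_le unfolding Q2 by linarith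
      also have "\<dots> \<le> exp L * exp (2 * L)" using E2(7) by (intro mult_right_mono) auto
      also have "\<dots> \<le> exp (4 * L)" using E1(1) by (simp flip: exp_add)
      finally have "sqrt (real (card family)) \<le> sqrt (exp (4 * L))" by (rule real_sqrt_le_mono)
      also have "sqrt (exp (4 * L)) = exp (2 * L)" by (rule real_sqrt_unique) (simp_all flip: exp_double)
      finally show ?thesis .
    qed
    have "P \<subseteq> {1..nat \<lfloor>Q powr (1/10)\<rfloor>}" by (auto simp: P_def le_nat_floor Suc_le_eq prime_gt_0_nat)
    then have Pf: "finite P" "card P \<le> nat \<lfloor>Q powr (1/10)\<rfloor>"
      using card_mono[of "{1..nat \<lfloor>Q powr (1/10)\<rfloor>}" P] by (auto intro: finite_subset)
    have Pp: "prime p" if "p \<in> P" for p using that by (simp add: P_def)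
    have cardP: "real (card P) \<le> exp L"
    proof -
      have "real (card P) \<le> real (nat \<lfloor>Q powr (1/10)\<rfloor>)" using Pf(2) by (rule of_nat_mono)
      also have "\<dots> \<le> Q powr (1/10)" by (rule of_nat_floor) simp
      also have "\<dots> \<le> exp L" unfolding Qpow using E1(1) by simp
      finally show ?thesis .
    qed
    define G where "G = sqrt Y * L powr \<gamma>"
    have G1: "G \<ge> exp (5/4 * L) * L powr \<gamma>" unfolding G_def using Y2 by (intro mult_right_mono) auto
    have G2: "G \<ge> 1" using G1 E2(5) by linarith
    have shift: "shift_err B \<le> exp (2 * L) * (2 * W * exp (real d * L) * exp (- L\<^sup>2 / 2) * B')" if "B \<le> B'" "0 \<le> B'" for B B'
    proof -
      have "shift_err B \<le> shift_err B'" by (rule shift_err_mono[OF that(1)])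
      also have "\<dots> \<le> exp (2 * L) * (2 * W * exp (real d * L) * exp (- L\<^sup>2 / 2) * B')"
        unfolding shift_err_def using cardF Yd that(2) pos by (intro mult_mono mult_left_mono) auto
      finally show ?thesis .
    qed
    define E1' where "E1' = 2 * C0 * (1 + real R)\<^sup>2"
    have E1'0: "E1' \<ge> 0" using C0 by (simp add: E1'_def)
    have E1'le: "E1' \<le> 2 * C0 * (\<kappa> * L + 2)\<^sup>2" unfolding E1'_def using C0 R by (intro mult_left_mono power_mono) auto
    \<comment> \<open>22 = 1 + 20 + 1, with one summand for each term of
      \<open>rem_coeff_mean_square\<close>; 20 is 2 * 10, from N = 2 * 2^k and ln P2 = L /
      10.\<close>
    define E2' where "E2' = 22 * CR * L powr (\<beta>' - 1)"
    have E2'0: "E2' \<ge> 0" using CR by (simp add: E2'_def)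
    have main: "L2_set (\<lambda>i. norm (wint (\<lambda>i. L_twist F (snd i)) i)) family
    \<le> (real R * (2 * pi * (W * Y powr \<delta>) * sqrt (134 * Q powr (9/4) * E1'))
        + 2 * pi * W * sqrt (134 * E2') * sqrt Y * dyadic_const + real R * shift_err ((1 + E1') * 2 ^ R))
      + real R * (2 * pi * (W * Y powr (1/2)) * (1 / L\<^sup>2 * sqrt (138 * (2 * K)))
        + shift_err ((real (card P) * real d) * ((1 + 2 * K) * 2 ^ R)))
      + 2 * pi * (W * Y) * (sqrt (real (card family))
          * ((1 + real (card P) * real d) * lam_sum54 * (2 ^ R) powr - (1/4)))"
    proof (rule weighted_twist_mean[OF weighted_family_axioms Pf(1) Pp R(3) E1'0 _ E2'0])
      show "(\<Sum>n\<in>{2 ^ k..<2 ^ Suc k}. (norm (rem_coeff P (Q\<^sup>2) n))\<^sup>2) \<le> E1' * 2 ^ k" if k: "k < R" for k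
      proof -
        have "(\<Sum>n\<in>{2 ^ k..<2 ^ Suc k}. (norm (rem_coeff P (Q\<^sup>2) n))\<^sup>2) \<le> (\<Sum>n=1..2 ^ Suc k. (norm (rem_coeff P (Q\<^sup>2) n))\<^sup>2)"
          by (rule sum_dyadic_block_le) simp
        also have "\<dots> \<le> C0 * real (2 ^ Suc k) * (1 + ln (real (2 ^ Suc k)))\<^sup>2"
          unfolding C0_def by (rule rem_coeff_mean_square_trivial[OF Pf(1) Pp]) auto
        also have "\<dots> \<le> C0 * real (2 ^ Suc k) * (1 + real R)\<^sup>2"
        proof -
          have "ln (real (2 ^ Suc k)) \<le> real R" using ln_two_power_le[of "Suc k"] k by linarith
          moreover have "0 \<le> ln (real (2 ^ Suc k))" by (rule ln_ge_zero) (simp only: of_nat_power of_nat_numeral one_le_power)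
          ultimately show ?thesis using C0 by (intro mult_left_mono power_mono) auto
        qed
        finally show ?thesis by (simp add: E1'_def algebra_simps)
      qed
      show "(\<Sum>n\<in>{2 ^ k..<2 ^ Suc k}. (norm (rem_coeff P (Q\<^sup>2) n))\<^sup>2) \<le> E2' * 2 ^ k" if k: "k < R" "Q powr (9/4) \<le> 2 ^ k" for k
      proof -
        define N :: nat where "N = 2 ^ Suc k"
        have N: "real N = 2 * 2 ^ k" by (simp add: N_def)
        define P1 where "P1 = exp (L powr \<beta>')"
        define P2 where "P2 = Q powr (1/10)"
        have P12: "2 \<le> P1" "P1 \<le> P2" "P2 \<le> real N" "1 \<le> Q\<^sup>2"
        proof -
          show "2 \<le> P1" "P1 \<le> P2" using E1(2,3) by (simp_all add: P1_def P2_def Qpow)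
          have "P2 \<le> Q powr (9/4)" unfolding P2_def Qpow using E1(1) by simp
          also have "\<dots> \<le> 2 * 2 ^ k" by (rule order_trans[OF k(2)]) simp
          finally show "P2 \<le> real N" unfolding N .
          show "1 \<le> Q\<^sup>2" unfolding Q2 using E1(1) by simp
        qed
        have MP: "Q\<^sup>2 * P2 = exp (21/10 * L)" unfolding P2_def Qpow Q2 by (simp flip: exp_add)
        have "(\<Sum>n\<in>{2 ^ k..<2 ^ Suc k}. (norm (rem_coeff P (Q\<^sup>2) n))\<^sup>2) \<le> (\<Sum>n=1..N. (norm (rem_coeff P (Q\<^sup>2) n))\<^sup>2)"
          unfolding N_def by (rule sum_dyadic_block_le) simp
        also have "\<dots> \<le> CR * (Q\<^sup>2 * P2 * (1 + ln (Q\<^sup>2 * P2))\<^sup>2 + real N * ln P1 / ln P2 + real N * (1 + ln (real N))\<^sup>2 / P1)"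
          unfolding P_def P1_def[symmetric] P2_def[symmetric] using conjunct2[OF CR0] P12 by (simp only: simp_thms)
        also have "\<dots> \<le> CR * (2 ^ k * L powr (\<beta>' - 1) + 2 ^ k * (20 * L powr (\<beta>' - 1)) + 2 ^ k * L powr (\<beta>' - 1))"
        proof (intro mult_left_mono add_mono)
          have "Q\<^sup>2 * P2 * (1 + ln (Q\<^sup>2 * P2))\<^sup>2 \<le> exp (9/4 * L) * L powr (\<beta>' - 1)" unfolding MP using E1(4) by simp
          also have "\<dots> \<le> 2 ^ k * L powr (\<beta>' - 1)" using k(2) unfolding Qpow by (intro mult_right_mono) auto
          finally show "Q\<^sup>2 * P2 * (1 + ln (Q\<^sup>2 * P2))\<^sup>2 \<le> 2 ^ k * L powr (\<beta>' - 1)" .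
          have "real N * ln P1 / ln P2 = 2 ^ k * (20 * (L powr \<beta>' / L))" by (simp add: N P1_def P2_def Qpow)
          then show "real N * ln P1 / ln P2 \<le> 2 ^ k * (20 * L powr (\<beta>' - 1))" using E1(1) by (simp add: powr_diff)
          have "ln (real N) \<le> real R" unfolding N_def using ln_two_power_le[of "Suc k"] k by linarith
          then have "1 + ln (real N) \<le> \<kappa> * L + 2" using R by linarith
          moreover have "0 \<le> ln (real N)" unfolding N by (rule ln_ge_zero) (simp add: mult_ge1_I one_le_power)
          ultimately have "(1 + ln (real N))\<^sup>2 \<le> (\<kappa> * L + 2)\<^sup>2" by (intro power_mono) auto
          then have "real N * (1 + ln (real N))\<^sup>2 / P1 \<le> real N * (\<kappa> * L + 2)\<^sup>2 / P1"
            using P12 by (intro divide_right_mono mult_left_mono) auto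
          also have "\<dots> = 2 ^ k * (2 * (\<kappa> * L + 2)\<^sup>2 / exp (L powr \<beta>'))" by (simp add: N P1_def)
          also have "\<dots> \<le> 2 ^ k * L powr (\<beta>' - 1)" using E1(5) by (intro mult_left_mono) auto
          finally show "real N * (1 + ln (real N))\<^sup>2 / P1 \<le> 2 ^ k * L powr (\<beta>' - 1)" .
        qed (use CR in auto)
        also have "\<dots> = E2' * 2 ^ k" by (simp add: E2'_def algebra_simps)
        finally show ?thesis .
      qed
      show "norm (dpoly lam (snd i) P (Complex 1 t)) \<le> 1 / L\<^sup>2" if "i \<in> family" "\<bar>t\<bar> \<le> L" for i t
        using small that unfolding P_def L_def prime_window_def by simp
    qed (assumption | rule divide_nonneg_nonneg[OF zero_le_one zero_le_power2])+
    have T1: "real R * (2 * pi * (W * Y powr \<delta>) * sqrt (134 * Q powr (9/4) * E1')) \<le> G"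
    proof -
      have "sqrt (134 * Q powr (9/4) * E1') \<le> sqrt ((exp (9/8 * L) * (\<kappa> * L + 2))\<^sup>2 * (268 * C0))"
      proof (rule real_sqrt_le_mono)
        have "134 * Q powr (9/4) * E1' \<le> 134 * Q powr (9/4) * (2 * C0 * (\<kappa> * L + 2)\<^sup>2)"
          using E1'le by (intro mult_left_mono) auto
        moreover have "Q powr (9/4) = (exp (9/8 * L))\<^sup>2" unfolding Qpow by (simp flip: exp_double)
        ultimately show "134 * Q powr (9/4) * E1' \<le> (exp (9/8 * L) * (\<kappa> * L + 2))\<^sup>2 * (268 * C0)"
          by (simp only: power_mult_distrib) (simp add: mult_ac)
      qed
      also have "\<dots> = exp (9/8 * L) * (\<kappa> * L + 2) * sqrt (268 * C0)"
        using \<kappa> E1(1) by (simp add: real_sqrt_mult abs_mult)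
      finally have "real R * (2 * pi * (W * Y powr \<delta>) * sqrt (134 * Q powr (9/4) * E1'))
        \<le> (\<kappa> * L + 1) * (2 * pi * (W * exp (3/40 * L)) * (exp (9/8 * L) * (\<kappa> * L + 2) * sqrt (268 * C0)))"
        using R(2) Y\<delta> W \<kappa> E1(1) E1'0 by (intro mult_mono mult_left_mono) auto
      also have "\<dots> = (\<kappa> * L + 1) * (2 * pi * W * exp (3/40 * L) * (exp (9/8 * L) * (\<kappa> * L + 2) * sqrt (268 * C0)))"
        by (simp only: mult.assoc)
      finally show ?thesis using E2(1) G1 by linarith
    qed
    have T2: "2 * pi * W * sqrt (134 * E2') * sqrt Y * dyadic_const = c2 * G"
    proof -
      have "L powr (\<beta>' - 1) = (L powr \<gamma>)\<^sup>2" using E1(1) \<gamma>(3) by (simp add: powr_power mult.commute)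
      then have "sqrt (134 * E2') = sqrt (134 * (22 * CR)) * L powr \<gamma>"
        unfolding E2'_def by (simp add: real_sqrt_mult)
      then show ?thesis unfolding c2_def G_def by (simp only: mult_ac)
    qed
    have T3: "real R * shift_err ((1 + E1') * 2 ^ R) \<le> 1"
    proof -
      have "real R * shift_err ((1 + E1') * 2 ^ R) \<le> (\<kappa> * L + 1) * (exp (2 * L) * (2 * W * exp (real d * L) * exp (- L\<^sup>2 / 2) * ((1 + 2 * C0 * (\<kappa> * L + 2)\<^sup>2) * exp (\<kappa> * L + 1))))"
      proof (rule mult_mono[OF R(2) shift])
        show "(1 + E1') * 2 ^ R \<le> (1 + 2 * C0 * (\<kappa> * L + 2)\<^sup>2) * exp (\<kappa> * L + 1)"
          using E1'le R2 C0 by (intro mult_mono) auto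
        show "0 \<le> shift_err ((1 + E1') * 2 ^ R)" unfolding shift_err_def using pos E1'0 by auto
      qed (use C0 \<kappa> E1(1) in auto)
      then show ?thesis using E2(2) by linarith
    qed
    have T4: "real R * (2 * pi * (W * Y powr (1/2)) * (1 / L\<^sup>2 * sqrt (138 * (2 * K)))) \<le> c4 * G"
    proof -
      \<comment> \<open>There are about \<kappa> L blocks, and the sum over primes saves L^(-2) in
        each. This leaves L^(-1), which is below L^\<gamma> because \<gamma> >= -1/2.\<close>
      have "real R * (1 / L\<^sup>2) \<le> (\<kappa> + 1) * L powr \<gamma>"
      proof -
        have "real R * (1 / L\<^sup>2) \<le> ((\<kappa> + 1) * L) * (1 / L\<^sup>2)" using R(2) E1(1) by (intro mult_right_mono) (auto simp: algebra_simps)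
        also have "\<dots> = (\<kappa> + 1) * L powr - 1" using E1(1) by (simp add: powr_minus_divide power2_eq_square)
        also have "\<dots> \<le> (\<kappa> + 1) * L powr \<gamma>" using E1(1) \<gamma> \<kappa> by (intro mult_left_mono powr_mono) auto
        finally show ?thesis .
      qed
      then have "(real R * (1 / L\<^sup>2)) * (2 * pi * W * sqrt Y * sqrt (138 * (2 * K))) \<le> ((\<kappa> + 1) * L powr \<gamma>) * (2 * pi * W * sqrt Y * sqrt (138 * (2 * K)))"
        using W K_ge_1 pos by (intro mult_right_mono) auto
      moreover have "Y powr (1/2) = sqrt Y" using pos by (simp add: powr_half_sqrt)
      ultimately show ?thesis unfolding c4_def G_def by (simp only: mult_ac)
    qed
    have T4b: "real R * shift_err ((real (card P) * real d) * ((1 + 2 * K) * 2 ^ R)) \<le> 1"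
    proof -
      have "real R * shift_err ((real (card P) * real d) * ((1 + 2 * K) * 2 ^ R)) \<le> (\<kappa> * L + 1) * (exp (2 * L) * (2 * W * exp (real d * L) * exp (- L\<^sup>2 / 2) * ((exp L * real d) * ((1 + 2 * K) * exp (\<kappa> * L + 1)))))"
      proof (rule mult_mono[OF R(2) shift])
        show "(real (card P) * real d) * ((1 + 2 * K) * 2 ^ R) \<le> (exp L * real d) * ((1 + 2 * K) * exp (\<kappa> * L + 1))"
          using cardP R2 K_ge_1 by (intro mult_mono) auto
        show "0 \<le> shift_err ((real (card P) * real d) * ((1 + 2 * K) * 2 ^ R))" unfolding shift_err_def using pos K_ge_1 by auto
      qed (use K_ge_1 \<kappa> E1(1) in auto)
      then show ?thesis using E2(3) by linarith
    qed
    have T5: "2 * pi * (W * Y) * (sqrt (real (card family)) * ((1 + real (card P) * real d) * lam_sum54 * (2 ^ R) powr - (1/4))) \<le> 1"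
    proof -
      have "1 + real (card P) * real d \<le> exp L + exp L * real d"
        using cardP E1(1) one_le_exp_iff[of L] by (intro add_mono mult_right_mono) auto
      then have cP: "1 + real (card P) * real d \<le> (1 + real d) * exp L" by (simp add: algebra_simps)
      have "2 * pi * (W * Y) * (sqrt (real (card family)) * ((1 + real (card P) * real d) * lam_sum54 * (2 ^ R) powr - (1/4)))
        \<le> 2 * pi * (W * exp (real d * L)) * (exp (2 * L) * ((1 + real d) * exp L * lam_sum54 * exp (- (2 * real d + 15) * L)))"
        using Yd cardF cP R3 W lam_sum54_nonneg pos by (intro mult_mono mult_left_mono) auto
      also have "\<dots> = c5 * (exp (real d * L) * (exp (2 * L) * (exp L * exp (- (2 * real d + 15) * L))))"
        unfolding c5_def by (simp only: mult_ac)
      also have "exp (real d * L) * (exp (2 * L) * (exp L * exp (- (2 * real d + 15) * L))) = exp (- (real d + 12) * L)"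
        by (simp add: algebra_simps flip: exp_add)
      also have "c5 * \<dots> \<le> c5 * exp (- L)"
      proof -
        have "1 * L \<le> (real d + 12) * L" using E1(1) by (intro mult_right_mono) auto
        then have "- (real d + 12) * L \<le> - L" by (simp only: mult_minus_left neg_le_iff_le mult_1_left)
        then show ?thesis using c by (intro mult_left_mono) (simp_all only: exp_le_cancel_iff)
      qed
      finally show ?thesis using E2(4) by linarith
    qed
    have "L2_set (\<lambda>i. norm (wint (\<lambda>i. L_twist F (snd i)) i)) family \<le> (4 + c2 + c4) * G"
      using main T1 T2 T3 T4 T4b T5 G2 by (simp add: algebra_simps)
    then show "L2_set (\<lambda>i. norm (weighted_family.wint w (ln Q) (\<lambda>i. L_twist F (snd i)) i)) (char_family.family Q X)
       \<le> (4 + c2 + c4) * (sqrt ((CA * (2 * Q) ^ d) powr (1/2)) * ln Q powr ((\<beta>' - 1) / 2))"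
      unfolding G_def Y_def \<gamma>_def L_def .
  qed (use c in auto)
qed

text \<open>The integrals of the approximate functional equation are cut at the height H = ln Q:
  there exp(-H^2/2) is already smaller than any power of 1/Q, and the range |t| <= ln Q is the one
  in which the sum over primes is known to be small.\<close>

lemma second_moment_large:
  assumes \<beta>: "0 \<le> \<beta>" "\<beta> < \<beta>'" "\<beta>' < 1" and c: "c > 0" and d5: "d \<ge> 5"
  shows "\<exists>A\<ge>0. \<exists>L0\<ge>1. \<forall>Q X. Q > 0 \<longrightarrow> ln Q \<ge> L0 \<longrightarrow> char_family Q X \<longrightarrow>
     (\<forall>q. \<forall>ch\<in>X q. Q \<le> real q \<longrightarrow> real q \<le> 2 * Q \<longrightarrow>
        nonvanishing c \<beta> q ch) \<longrightarrow>
     (\<Sum>q | Q \<le> real q \<and> real q \<le> 2 * Q. \<Sum>ch\<in>X q. (norm (L_twist F ch (1/2)))\<^sup>2) \<le> A * (Q powr (real d / 2) * ln Q powr (\<beta>' - 1))"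
proof -
  obtain CA where CA: "CA \<ge> 1" and afe: "\<And>q ch H. q \<ge> 2 \<Longrightarrow> primitive_char q ch \<Longrightarrow> H \<ge> 1 \<Longrightarrow> approx_fun_eq CA q ch H"
    using approx_functional_equation by blast
  have b': "0 < \<beta>'" using \<beta> by simp
  obtain A where A0: "A \<ge> 1 \<and> (\<exists>L0\<ge>1. \<forall>Q X w. Q > 0 \<longrightarrow> ln Q \<ge> L0 \<longrightarrow>
     weighted_family Q X w (8 * real d * CA) ((CA * (2 * Q) ^ d) powr (1/2)) (ln Q) (1 / (8 * real d)) \<longrightarrow>
     (\<forall>i\<in>char_family.family Q X. \<forall>t. \<bar>t\<bar> \<le> ln Q \<longrightarrow>
        norm (dpoly lam (snd i) (prime_window \<beta>' Q) (Complex 1 t)) \<le> 1 / (ln Q)\<^sup>2) \<longrightarrow>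
     L2_set (\<lambda>i. norm (weighted_family.wint w (ln Q) (\<lambda>i. L_twist F (snd i)) i)) (char_family.family Q X)
       \<le> A * (sqrt ((CA * (2 * Q) ^ d) powr (1/2)) * ln Q powr ((\<beta>' - 1) / 2)))"
    using weighted_twist_mean_large[OF b' \<beta>(3) CA d5] ..
  have A: "A \<ge> 1" using A0 by simp
  from conjunct2[OF A0] obtain L1 where L1: "L1 \<ge> 1 \<and> (\<forall>Q X w. Q > 0 \<longrightarrow> ln Q \<ge> L1 \<longrightarrow>
     weighted_family Q X w (8 * real d * CA) ((CA * (2 * Q) ^ d) powr (1/2)) (ln Q) (1 / (8 * real d)) \<longrightarrow>
     (\<forall>i\<in>char_family.family Q X. \<forall>t. \<bar>t\<bar> \<le> ln Q \<longrightarrow>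
        norm (dpoly lam (snd i) (prime_window \<beta>' Q) (Complex 1 t)) \<le> 1 / (ln Q)\<^sup>2) \<longrightarrow>
     L2_set (\<lambda>i. norm (weighted_family.wint w (ln Q) (\<lambda>i. L_twist F (snd i)) i)) (char_family.family Q X)
       \<le> A * (sqrt ((CA * (2 * Q) ^ d) powr (1/2)) * ln Q powr ((\<beta>' - 1) / 2)))" ..
  obtain L2 where L2: "L2 \<ge> 1 \<and> (\<forall>Q q ch. Q > 0 \<longrightarrow> ln Q \<ge> L2 \<longrightarrow> Q \<le> real q \<longrightarrow> real q \<le> 2 * Q \<longrightarrow> primitive_char q ch \<longrightarrow>
    nonvanishing c \<beta> q ch \<longrightarrow>
    (\<forall>t. \<bar>t\<bar> \<le> ln Q \<longrightarrow>
       norm (\<Sum>p\<in>prime_window \<beta>' Q. prime_term ch (Complex 1 t) p) \<le> 1 / (ln Q)\<^sup>2))"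
    using prime_polynomial_small[OF \<beta> c] ..
  define \<gamma> where "\<gamma> = (\<beta>' - 1) / 2"
  have \<gamma>: "- 1/2 \<le> \<gamma>" "2 * \<gamma> = \<beta>' - 1" using \<beta> by (auto simp: \<gamma>_def)
  define Ev where "Ev = (\<lambda>L::real. 1 \<le> L \<and> 9 * exp L * (CA * (4 ^ d * exp (2 * real d * L)) * exp (- L\<^sup>2 / 2)) \<le> L powr \<gamma>)"
  have "eventually Ev at_top"
    unfolding Ev_def
    by (intro eventually_conj eventually_ge_at_top; real_asymp)
  then obtain L3 where L3: "\<And>L. L \<ge> L3 \<Longrightarrow> Ev L"
    unfolding eventually_at_top_linorder by blast
  define B where "B = (2 * A + 1)\<^sup>2 * (CA * 2 ^ d) powr (1/2)"
  show ?thesis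
  proof (rule exI[of _ B], rule conjI[rotated], rule exI[of _ "max 1 (max L1 (max L2 L3))"], intro conjI allI impI)
    fix Q :: real and X
    assume Q: "Q > 0" "max 1 (max L1 (max L2 L3)) \<le> ln Q" and cf: "char_family Q X"
      and zf: "\<forall>q. \<forall>ch\<in>X q. Q \<le> real q \<longrightarrow> real q \<le> 2 * Q \<longrightarrow>
        nonvanishing c \<beta> q ch"
    interpret char_family Q X by (rule cf)
    define L where "L = ln Q"
    have L: "L \<ge> 1" "L \<ge> L1" "L \<ge> L2" "L \<ge> L3" using Q by (simp_all add: L_def)
    have QL: "Q = exp L" using Q by (simp add: L_def)
    define W where "W = 8 * real d * CA"
    define Y where "Y = (CA * (2 * Q) ^ d) powr (1/2)"
    define \<delta> where "\<delta> = 1 / (8 * real d)"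
    have Y1: "Y \<ge> 1"
    proof -
      have "1 \<le> (2 * Q) ^ d" using Q_ge_2 by (intro one_le_power) auto
      then have "1 * 1 \<le> CA * (2 * Q) ^ d" using CA by (intro mult_mono) auto
      then show ?thesis unfolding Y_def by (intro ge_one_powr_ge_zero) auto
    qed
    \<comment> \<open>One bound for the whole family: on Re s >= \<delta> the factor 1 / |s| is at
      most 1/\<delta> = 8 d and goes into W, and (2 Q)^d replaces q^d in Y.\<close>
    define weight where "weight w \<longleftrightarrow> w holomorphic_on {s. Re s > 0} \<and>
        (\<forall>s. \<delta> \<le> Re s \<longrightarrow> Re s \<le> 1 \<longrightarrow> norm (w s) \<le> W * Y powr Re s * exp (- (Im s)\<^sup>2 / 2))" for w
    define J where "J w i = integral {-L..L} (\<lambda>t. w (Complex 1 t) * L_twist F (snd i) (1/2 + Complex 1 t))"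
      for w and i :: "nat \<times> (int \<Rightarrow> complex)"
    define err where "err = CA * (4 ^ d * exp (2 * real d * L)) * exp (- L\<^sup>2 / 2)"
    define good where "good i w1 w2 \<longleftrightarrow> weight w1 \<and> weight w2 \<and> norm (L_twist F (snd i) (1/2)) \<le> norm (J w1 i) + norm (J w2 i) + err" for i w1 w2
    have "\<exists>w1 w2. good i w1 w2"
      if i: "i \<in> family" for i
    proof -
      note iq = family_member[OF i]
      from afe[OF iq(1,2) L(1)] obtain w1 w2 where w: "afe_weight CA (fst i) w1" "afe_weight CA (fst i) w2"
        and le: "norm (L_twist F (snd i) (1/2)) \<le> norm (J w1 i) + norm (J w2 i) + CA * real (fst i) ^ (2 * d) * exp (- L\<^sup>2 / 2)"
        unfolding approx_fun_eq_def J_def by blast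
      have wt: "weight w" if "afe_weight CA (fst i) w" for w
        unfolding weight_def
      proof (intro conjI allI impI)
        show "w holomorphic_on {s. Re s > 0}" using that by (simp add: afe_weight_def)
        fix s assume s: "\<delta> \<le> Re s" "Re s \<le> 1"
        have \<delta>0: "\<delta> > 0" using d5 by (simp add: \<delta>_def)
        have "norm (w s) \<le> CA * (CA * real (fst i) ^ d) powr (Re s / 2) * exp (- (Im s)\<^sup>2 / 2) / norm s"
          using that s \<delta>0 by (auto simp: afe_weight_def)
        also have "\<dots> \<le> CA * (CA * (2 * Q) ^ d) powr (Re s / 2) * exp (- (Im s)\<^sup>2 / 2) / \<delta>"
        proof (intro frac_le mult_right_mono mult_left_mono powr_mono2 power_mono)
          show "\<delta> \<le> norm s" using s(1) complex_Re_le_cmod[of s] by linarith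
        qed (use CA iq s \<delta>0 Q in auto)
        also have "(CA * (2 * Q) ^ d) powr (Re s / 2) = Y powr Re s" by (simp add: Y_def powr_powr)
        finally show "norm (w s) \<le> W * Y powr Re s * exp (- (Im s)\<^sup>2 / 2)" by (simp add: W_def \<delta>_def mult_ac)
      qed
      have "CA * real (fst i) ^ (2 * d) * exp (- L\<^sup>2 / 2) \<le> CA * (2 * Q) ^ (2 * d) * exp (- L\<^sup>2 / 2)"
        using iq CA by (intro mult_right_mono mult_left_mono power_mono) auto
      also have "(2 * Q) ^ (2 * d) = 4 ^ d * exp (2 * real d * L)"
        unfolding QL by (simp add: power_mult_distrib power_mult flip: exp_of_nat_mult)
      finally show ?thesis using wt[OF w(1)] wt[OF w(2)] le unfolding err_def good_def by (intro exI[of _ w1] exI[of _ w2]) auto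
    qed
    then have "\<forall>i\<in>family. \<exists>w1 w2. good i w1 w2" by blast
    from bchoice[OF this] obtain w1 where "\<forall>i\<in>family. \<exists>w2. good i (w1 i) w2" ..
    from bchoice[OF this] obtain w2 where good: "\<forall>i\<in>family. good i (w1 i) (w2 i)" ..
    then have w: "\<And>i. i \<in> family \<Longrightarrow> weight (w1 i)" "\<And>i. i \<in> family \<Longrightarrow> weight (w2 i)"
      "\<And>i. i \<in> family \<Longrightarrow> norm (L_twist F (snd i) (1/2)) \<le> norm (J (w1 i) i) + norm (J (w2 i) i) + err"
      by (simp_all add: good_def)
    have small: "\<forall>i\<in>family. \<forall>t. \<bar>t\<bar> \<le> ln Q \<longrightarrow>
        norm (dpoly lam (snd i) (prime_window \<beta>' Q) (Complex 1 t)) \<le> 1 / (ln Q)\<^sup>2"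
    proof (intro ballI allI impI)
      fix i t assume i: "i \<in> family" and t: "\<bar>t\<bar> \<le> ln Q"
      note iq = family_member[OF i]
      have "dpoly lam (snd i) (prime_window \<beta>' Q) (Complex 1 t)
        = (\<Sum>p\<in>prime_window \<beta>' Q. prime_term (snd i) (Complex 1 t) p)"
        unfolding dpoly_def by (intro sum.cong) (auto simp: prime_term_def prime_window_def)
      moreover have "ln Q \<ge> L2" using L by (simp add: L_def)
      ultimately show "norm (dpoly lam (snd i) (prime_window \<beta>' Q) (Complex 1 t)) \<le> 1 / (ln Q)\<^sup>2"
        using conjunct2[OF L2, rule_format, OF Q(1) _ iq(3,4,2) _ t] zf[rule_format, OF iq(5,3,4)] by simp
    qed
    define G where "G = sqrt Y * L powr \<gamma>"
    have mean: "L2_set (\<lambda>i. norm (J (w i) i)) family \<le> A * G" if "\<And>i. i \<in> family \<Longrightarrow> weight (w i)" for w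
    proof -
      have wf: "weighted_family Q X w W Y L \<delta>"
      proof
        show "w i holomorphic_on {s. Re s > 0}" if "i \<in> family" for i
          using \<open>\<And>i. i \<in> family \<Longrightarrow> weight (w i)\<close>[OF that] by (simp add: weight_def)
        show "norm (w i s) \<le> W * Y powr Re s * exp (- (Im s)\<^sup>2 / 2)" if "i \<in> family" "\<delta> \<le> Re s" "Re s \<le> 1" for i s
          using \<open>\<And>i. i \<in> family \<Longrightarrow> weight (w i)\<close>[OF that(1)] that by (simp add: weight_def)
        show "0 \<le> W" "1 \<le> Y" "0 < L" "0 < \<delta>" "\<delta> \<le> 1/4"
          using CA Y1 L d5 by (simp_all add: W_def \<delta>_def field_simps)
      qed
      have "ln Q \<ge> L1" using L by (simp add: L_def)
      from conjunct2[OF L1, rule_format, OF Q(1) this wf[unfolded W_def Y_def L_def \<delta>_def]] small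
      show ?thesis unfolding weighted_family.wint_def[OF wf[unfolded L_def]] J_def G_def Y_def L_def \<gamma>_def by simp
    qed
    have errG: "sqrt (real (card family)) * err \<le> G"
    proof -
      have "sqrt (real (card family)) * err \<le> 9 * exp L * err"
        using sqrt_card_family_le CA unfolding QL err_def by (intro mult_right_mono) auto
      also have "\<dots> \<le> L powr \<gamma>" using L3[OF L(4)] by (simp add: err_def Ev_def)
      also have "\<dots> \<le> G" unfolding G_def using Y1 by (simp add: mult_le_cancel_right1)
      finally show ?thesis .
    qed
    have "L2_set (\<lambda>i. norm (L_twist F (snd i) (1/2))) family
      \<le> L2_set (\<lambda>i. (norm (J (w1 i) i) + norm (J (w2 i) i)) + err) family"
      using w(3) by (intro L2_set_mono) auto
    also have "\<dots> \<le> L2_set (\<lambda>i. norm (J (w1 i) i) + norm (J (w2 i) i)) family + L2_set (\<lambda>i. err) family"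
      by (rule L2_set_triangle_ineq)
    also have "\<dots> \<le> (L2_set (\<lambda>i. norm (J (w1 i) i)) family + L2_set (\<lambda>i. norm (J (w2 i) i)) family) + L2_set (\<lambda>i. err) family"
      by (intro add_right_mono L2_set_triangle_ineq)
    also have "\<dots> \<le> (A * G + A * G) + G"
    proof (intro add_mono mean w)
      have "err \<ge> 0" using CA by (simp add: err_def)
      then show "L2_set (\<lambda>i. err) family \<le> G" using errG by (simp add: L2_set_constant)
    qed
    finally have "L2_set (\<lambda>i. norm (L_twist F (snd i) (1/2))) family \<le> (2 * A + 1) * G" by (simp add: algebra_simps)
    then have "(L2_set (\<lambda>i. norm (L_twist F (snd i) (1/2))) family)\<^sup>2 \<le> ((2 * A + 1) * G)\<^sup>2" by (intro power_mono) auto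
    also have "(L2_set (\<lambda>i. norm (L_twist F (snd i) (1/2))) family)\<^sup>2 = (\<Sum>q | Q \<le> real q \<and> real q \<le> 2 * Q. \<Sum>ch\<in>X q. (norm (L_twist F ch (1/2)))\<^sup>2)"
      by (simp add: L2_set_def sum_nonneg sum_family)
    also have "((2 * A + 1) * G)\<^sup>2 = (2 * A + 1)\<^sup>2 * (Y * L powr (\<beta>' - 1))"
    proof -
      have "(L powr \<gamma>)\<^sup>2 = L powr (\<beta>' - 1)" using L(1) \<gamma>(2) by (simp add: powr_power mult.commute)
      then show ?thesis using Y1 by (simp add: G_def power_mult_distrib)
    qed
    also have "Y = (CA * 2 ^ d) powr (1/2) * Q powr (real d / 2)"
      using CA Q by (simp add: Y_def power_mult_distrib powr_mult powr_powr mult.assoc flip: powr_realpow)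
    also have "(2 * A + 1)\<^sup>2 * ((CA * 2 ^ d) powr (1/2) * Q powr (real d / 2) * L powr (\<beta>' - 1)) = B * (Q powr (real d / 2) * ln Q powr (\<beta>' - 1))"
      by (simp add: B_def L_def mult_ac)
    finally show "(\<Sum>q | Q \<le> real q \<and> real q \<le> 2 * Q. \<Sum>ch\<in>X q. (norm (L_twist F ch (1/2)))\<^sup>2) \<le> B * (Q powr (real d / 2) * ln Q powr (\<beta>' - 1))" .
  qed (auto simp: B_def)
qed

end

section \<open>The second moment\<close>

text \<open>The mean square over all n <= N is (A3) for the window P1 = P2 = 5/2. It contains no
  prime, so the coprimality condition is empty, and the quotient of logarithms is 1. This instance
  requires N >= 5/2; for N = 1 and N = 2 the values f 1 and f 2 are added to the constant.\<close>

lemma lfun_mean_exists: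
  assumes fw: "L_framework F"
    and A1: "\<forall>n\<ge>1. norm (lf_coeff F n) \<le> real (divisor_fold (lf_degree F) n)"
    and A3: "\<forall>P\<^sub>1 P\<^sub>2 X :: real. 2 \<le> P\<^sub>1 \<longrightarrow> P\<^sub>1 \<le> P\<^sub>2 \<longrightarrow> P\<^sub>2 \<le> X \<longrightarrow>
        (\<Sum>n | 1 \<le> n \<and> real n \<le> X \<and>
              coprime n (\<Prod>p | prime p \<and> P\<^sub>1 \<le> real p \<and> real p \<le> P\<^sub>2. p).
           (norm (lf_coeff F n))\<^sup>2) \<le> K * (X * ln P\<^sub>1 / ln P\<^sub>2)"
  shows "\<exists>K'. lfun_mean F K'"
proof -
  define f where "f n = (norm (lf_coeff F n))\<^sup>2" for n
  define K' where "K' = 1 + \<bar>K\<bar> + f 1 + f 2"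
  have f0: "f n \<ge> 0" for n by (simp add: f_def)
  have KK: "K \<le> K'" "K' \<ge> 1" "f 1 + f 2 \<le> K'" using f0[of 1] f0[of 2] by (auto simp: K'_def)
  have fin: "finite {n. 1 \<le> n \<and> real n \<le> X \<and> R n}" for X :: real and R
    by (rule finite_subset[of _ "{..nat \<lfloor>X\<rfloor>}"]) (auto simp: le_nat_floor)
  have "lfun_mean F K'"
  proof
    show "L_framework F" by (rule fw)
    show "norm (lf_coeff F n) \<le> real (divisor_fold (lf_degree F) n)" if "n \<ge> 1" for n using A1 that by blast
    show "1 \<le> K'" by (rule KK)
    show "(\<Sum>n=1..N. (norm (lf_coeff F n))\<^sup>2) \<le> K' * real N" for N
    proof (cases "N \<ge> 3")
      case True
      have "{p. prime p \<and> (5/2::real) \<le> real p \<and> real p \<le> 5/2} = {}"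
      proof -
        have "False" if "(5/2::real) \<le> real p" "real p \<le> 5/2" for p
        proof -
          have "real (2 * p) = real 5" using that by simp
          then have "2 * p = 5" by (simp only: of_nat_eq_iff)
          then show False by presburger
        qed
        then show ?thesis by blast
      qed
      then have "(\<Sum>n | 1 \<le> n \<and> real n \<le> real N \<and> coprime n (\<Prod>p | prime p \<and> (5/2::real) \<le> real p \<and> real p \<le> 5/2. p). f n) \<le> K * (real N * ln (5/2) / ln (5/2))"
        using A3[rule_format, of "5/2" "5/2" "real N"] True unfolding f_def by simp
      moreover have "{n. 1 \<le> n \<and> real n \<le> real N \<and> coprime n (\<Prod>p | prime p \<and> (5/2::real) \<le> real p \<and> real p \<le> 5/2. p)} = {1..N}"
        unfolding \<open>{p. prime p \<and> (5/2::real) \<le> real p \<and> real p \<le> 5/2} = {}\<close> by auto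
      ultimately have "(\<Sum>n=1..N. f n) \<le> K * real N" by simp
      also have "\<dots> \<le> K' * real N" using KK by (intro mult_right_mono) auto
      finally show ?thesis by (simp add: f_def)
    next
      case False
      then consider "N = 0" | "N = 1" | "N = 2" by linarith
      then show ?thesis
      proof cases
        case 1
        then show ?thesis by simp
      next
        case 2
        then have "(\<Sum>n=1..N. (norm (lf_coeff F n))\<^sup>2) = f 1" by (simp add: f_def)
        then show ?thesis using 2 KK f0[of 2] by simp
      next
        case 3
        have "{1..2::nat} = {1, 2}" by auto
        then have "(\<Sum>n=1..N. (norm (lf_coeff F n))\<^sup>2) = f 1 + f 2" using 3 by (simp add: f_def)
        then show ?thesis using 3 KK by simp
      qed
    qed
    show "(\<Sum>n | n \<in> {1..N} \<and> (\<forall>p. prime p \<and> P1 \<le> real p \<and> real p \<le> P2 \<longrightarrow> \<not> p dvd n). (norm (lf_coeff F n))\<^sup>2)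
       \<le> K' * (real N * ln P1 / ln P2)" if P: "2 \<le> P1" "P1 \<le> P2" "P2 \<le> real N" for P1 P2 N
    proof -
      have "(\<Sum>n | n \<in> {1..N} \<and> (\<forall>p. prime p \<and> P1 \<le> real p \<and> real p \<le> P2 \<longrightarrow> \<not> p dvd n). f n)
        \<le> (\<Sum>n | 1 \<le> n \<and> real n \<le> real N \<and> coprime n (\<Prod>p | prime p \<and> P1 \<le> real p \<and> real p \<le> P2. p). f n)"
      proof (rule sum_mono2[OF fin])
        show "{n. n \<in> {1..N} \<and> (\<forall>p. prime p \<and> P1 \<le> real p \<and> real p \<le> P2 \<longrightarrow> \<not> p dvd n)}
          \<subseteq> {n. 1 \<le> n \<and> real n \<le> real N \<and> coprime n (\<Prod>p | prime p \<and> P1 \<le> real p \<and> real p \<le> P2. p)}"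
        proof
          fix n assume n: "n \<in> {n. n \<in> {1..N} \<and> (\<forall>p. prime p \<and> P1 \<le> real p \<and> real p \<le> P2 \<longrightarrow> \<not> p dvd n)}"
          have "coprime n (\<Prod>p | prime p \<and> P1 \<le> real p \<and> real p \<le> P2. p)"
          proof (rule prod_coprime_right)
            fix p assume p: "p \<in> {p. prime p \<and> P1 \<le> real p \<and> real p \<le> P2}"
            then have "coprime p n" using n by (intro prime_imp_coprime) auto
            then show "coprime n p" by (simp only: coprime_commute)
          qed
          then show "n \<in> {n. 1 \<le> n \<and> real n \<le> real N \<and> coprime n (\<Prod>p | prime p \<and> P1 \<le> real p \<and> real p \<le> P2. p)}"
            using n by simp
        qed
      qed (rule f0)
      also have "\<dots> \<le> K * (real N * ln P1 / ln P2)" using A3 P unfolding f_def by blast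
      also have "\<dots> \<le> K' * (real N * ln P1 / ln P2)" using KK P by (intro mult_right_mono) auto
      finally show ?thesis by (simp add: f_def)
    qed
  qed
  then show ?thesis ..
qed

lemma admissible_height_log_power: "admissible_height (\<lambda>q. ln (real q) ^ 100)"
  unfolding admissible_height_def
proof
  show "\<exists>a>0. \<forall>\<^sub>F q in sequentially. ln (real q) ^ 100 \<ge> a * ln (real q) ^ 100"
    by (intro exI[of _ 1]) simp
  show "(\<lambda>q::nat. ln (ln (real q) ^ 100)) \<in> o(\<lambda>q. ln (real q))" by real_asymp
qed

lemma finite_primitive_chars: "q > 0 \<Longrightarrow> finite {ch. primitive_char q ch}"
  by (rule finite_subset[OF _ finite_dirichlet_chars[of q]]) (auto simp: primitive_char_def)

theorem theorem1p2:
  fixes F :: lform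
    and \<beta> \<eta> \<epsilon> c :: real
    and q\<^sub>0 :: "(nat \<Rightarrow> real) \<Rightarrow> nat"
  assumes "L_framework F" and "lf_degree F \<ge> 5"
    and "0 \<le> \<beta>" and "\<beta> < 1" and "\<eta> < 1 - \<beta>"
    and A1: "\<forall>n\<ge>1. norm (lf_coeff F n) \<le> real (divisor_fold (lf_degree F) n)"
    and "\<epsilon> > 0"
    and A2: "\<exists>K X\<^sub>0. \<forall>X Y :: real. X \<ge> 2 \<longrightarrow> X \<ge> X\<^sub>0 \<longrightarrow> X powr (1 - \<epsilon>) \<le> Y \<longrightarrow> Y \<le> X \<longrightarrow>
        (\<Sum>n | X \<le> real n \<and> real n \<le> X + Y. (norm (lf_coeff F n))\<^sup>2) \<le> K * Y"
    and A3: "\<exists>K. \<forall>P\<^sub>1 P\<^sub>2 X :: real. 2 \<le> P\<^sub>1 \<longrightarrow> P\<^sub>1 \<le> P\<^sub>2 \<longrightarrow> P\<^sub>2 \<le> X \<longrightarrow>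
        (\<Sum>n | 1 \<le> n \<and> real n \<le> X \<and>
              coprime n (\<Prod>p | prime p \<and> P\<^sub>1 \<le> real p \<and> real p \<le> P\<^sub>2. p).
           (norm (lf_coeff F n))\<^sup>2) \<le> K * (X * ln P\<^sub>1 / ln P\<^sub>2)"
    and "c > 0"
  shows "\<exists>K. \<forall>Q::real. \<forall>\<F> :: nat \<Rightarrow> (int \<Rightarrow> complex) set.
      Q \<ge> 2 \<longrightarrow>
      (\<forall>q. Q \<le> real q \<longrightarrow> real q \<le> 2 * Q \<longrightarrow> \<F> q \<subseteq> {chi. primitive_char q chi}) \<longrightarrow>
      zero_free F \<beta> c q\<^sub>0 Q \<F> \<longrightarrow>
      (\<Sum>q | Q \<le> real q \<and> real q \<le> 2 * Q. \<Sum>chi\<in>\<F> q. (norm (L_twist F chi (1 / 2)))\<^sup>2)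
        \<le> K * Q powr (real (lf_degree F) / 2) / ln Q powr \<eta>"
proof -
  obtain K3 where "\<forall>P\<^sub>1 P\<^sub>2 X :: real. 2 \<le> P\<^sub>1 \<longrightarrow> P\<^sub>1 \<le> P\<^sub>2 \<longrightarrow> P\<^sub>2 \<le> X \<longrightarrow>
        (\<Sum>n | 1 \<le> n \<and> real n \<le> X \<and>
              coprime n (\<Prod>p | prime p \<and> P\<^sub>1 \<le> real p \<and> real p \<le> P\<^sub>2. p).
           (norm (lf_coeff F n))\<^sup>2) \<le> K3 * (X * ln P\<^sub>1 / ln P\<^sub>2)"
    using A3 ..
  from lfun_mean_exists[OF assms(1) A1 this] obtain K' where "lfun_mean F K'" ..
  then interpret lfun_mean F K' .
  \<comment> \<open>\<eta> may be 0 or negative. Raising it to at least (1 - \<beta>)/2 > 0 keeps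
    \<beta>' < 1, while \<eta>' < 1 - \<beta> gives \<beta> < \<beta>'.\<close>
  define \<eta>' where "\<eta>' = max \<eta> ((1 - \<beta>) / 2)"
  define \<beta>' where "\<beta>' = 1 - \<eta>'"
  have "0 < (1 - \<beta>) / 2" "(1 - \<beta>) / 2 < 1 - \<beta>" using assms(4) by (simp_all add: field_simps)
  moreover have "(1 - \<beta>) / 2 \<le> \<eta>'" "\<eta> \<le> \<eta>'" unfolding \<eta>'_def by (rule max.cobounded2, rule max.cobounded1)
  moreover from calculation have "\<eta>' < 1 - \<beta>" unfolding \<eta>'_def using assms(5) by (simp only: max_less_iff_conj)
  ultimately have \<eta>: "\<eta> \<le> \<eta>'" "\<beta> < \<beta>'" "\<beta>' < 1" "\<beta>' - 1 = - \<eta>'" unfolding \<beta>'_def by linarith+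
  \<comment> \<open>The height at which (A4) is applied; its threshold \<open>q\<^sub>0 T\<close>
    becomes a lower bound for Q. It exceeds by far the height L^20 at which Perron's formula is cut
    off.\<close>
  define T where "T = (\<lambda>q::nat. ln (real q) ^ 100)"
  obtain A where A: "A \<ge> 0 \<and> (\<exists>L0\<ge>1. \<forall>Q X. Q > 0 \<longrightarrow> ln Q \<ge> L0 \<longrightarrow> char_family Q X \<longrightarrow>
     (\<forall>q. \<forall>ch\<in>X q. Q \<le> real q \<longrightarrow> real q \<le> 2 * Q \<longrightarrow>
        nonvanishing c \<beta> q ch) \<longrightarrow>
     (\<Sum>q | Q \<le> real q \<and> real q \<le> 2 * Q. \<Sum>ch\<in>X q. (norm (L_twist F ch (1/2)))\<^sup>2) \<le> A * (Q powr (real d / 2) * ln Q powr (\<beta>' - 1)))"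
    using second_moment_large[OF assms(3) \<eta>(2,3) \<open>c > 0\<close> assms(2)] ..
  from conjunct2[OF A] obtain L0 where L0: "L0 \<ge> 1 \<and> (\<forall>Q X. Q > 0 \<longrightarrow> ln Q \<ge> L0 \<longrightarrow> char_family Q X \<longrightarrow>
     (\<forall>q. \<forall>ch\<in>X q. Q \<le> real q \<longrightarrow> real q \<le> 2 * Q \<longrightarrow>
        nonvanishing c \<beta> q ch) \<longrightarrow>
     (\<Sum>q | Q \<le> real q \<and> real q \<le> 2 * Q. \<Sum>ch\<in>X q. (norm (L_twist F ch (1/2)))\<^sup>2) \<le> A * (Q powr (real d / 2) * ln Q powr (\<beta>' - 1)))" ..
  \<comment> \<open>From \<open>Q0\<close> on, both the asymptotic bound and the nonvanishing hold.
    Below it only finitely many moduli occur, and \<open>S\<close>, which runs over all primitive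
    characters, bounds the moment for every family.\<close>
  define Q0 where "Q0 = max (exp L0) (real (q\<^sub>0 T))"
  define S where "S = (\<Sum>q\<in>{2..nat \<lfloor>2 * Q0\<rfloor>}. \<Sum>ch | primitive_char q ch. (norm (L_twist F ch (1/2)))\<^sup>2)"
  have S0: "S \<ge> 0" unfolding S_def by (intro sum_nonneg) auto
  \<comment> \<open>As a function of Q, (ln Q)^\<eta> increases or decreases according to the sign
    of \<eta>; on 2 <= Q < Q0 it is at most the sum of its values at the two ends.\<close>
  define B where "B = max A (S * (ln 2 powr \<eta> + ln Q0 powr \<eta>))"
  show ?thesis
  proof (intro exI[of _ B] allI impI)
    fix Q :: real and \<F> :: "nat \<Rightarrow> (int \<Rightarrow> complex) set"
    assume Q: "Q \<ge> 2" and \<F>: "\<forall>q. Q \<le> real q \<longrightarrow> real q \<le> 2 * Q \<longrightarrow> \<F> q \<subseteq> {chi. primitive_char q chi}"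
      and zf: "zero_free F \<beta> c q\<^sub>0 Q \<F>"
    have cf: "char_family Q \<F>" by unfold_locales (use Q \<F> in auto)
    then interpret char_family Q \<F> .
    have lnQ: "ln Q > 0" using Q by simp
    show "(\<Sum>q | Q \<le> real q \<and> real q \<le> 2 * Q. \<Sum>chi\<in>\<F> q. (norm (L_twist F chi (1 / 2)))\<^sup>2)
        \<le> B * Q powr (real (lf_degree F) / 2) / ln Q powr \<eta>"
    proof (cases "Q \<ge> Q0")
      case True
      then have Q0: "exp L0 \<le> Q" "real (q\<^sub>0 T) \<le> Q" by (auto simp: Q0_def)
      have QL: "ln Q \<ge> L0" using Q0(1) Q by (simp add: ln_ge_iff)
      have nz: "\<forall>q. \<forall>ch\<in>\<F> q. Q \<le> real q \<longrightarrow> real q \<le> 2 * Q \<longrightarrow>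
        nonvanishing c \<beta> q ch"
        unfolding nonvanishing_def
      proof (intro allI ballI impI)
        fix q ch \<sigma> t
        assume ch: "ch \<in> \<F> q" and q: "Q \<le> real q" "real q \<le> 2 * Q"
          and st: "\<sigma> > 1 - c / ln (real q * ln (real q) ^ 100) powr \<beta>" "\<bar>t\<bar> \<le> ln (real q) ^ 100"
        have "admissible_height T" unfolding T_def by (rule admissible_height_log_power)
        moreover have "q\<^sub>0 T \<le> q" using Q0(2) q(1) by linarith
        ultimately have "(\<Prod>chi\<in>\<F> q. L_twist F chi (Complex \<sigma> t)) \<noteq> 0"
          using zf q st unfolding zero_free_def T_def by blast
        then show "L_twist F ch (Complex \<sigma> t) \<noteq> 0" using ch finite_chars[OF q] by (simp add: prod_zero_iff)
      qed
      have "(\<Sum>q | Q \<le> real q \<and> real q \<le> 2 * Q. \<Sum>ch\<in>\<F> q. (norm (L_twist F ch (1/2)))\<^sup>2) \<le> A * (Q powr (real d / 2) * ln Q powr (\<beta>' - 1))"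
        using conjunct2[OF L0, rule_format, OF _ QL cf] nz Q by simp
      also have "\<dots> \<le> B * (Q powr (real d / 2) * ln Q powr (- \<eta>))"
      proof (intro mult_mono mult_left_mono)
        have "ln Q \<ge> 1" using QL L0 by linarith
        then show "ln Q powr (\<beta>' - 1) \<le> ln Q powr (- \<eta>)" unfolding \<eta>(4) using \<eta>(1) by (intro powr_mono) auto
        show "0 \<le> B" using A by (simp add: B_def le_max_iff_disj)
      qed (auto simp: B_def)
      finally show ?thesis by (simp add: powr_minus_divide)
    next
      case False
      have sub: "{q. Q \<le> real q \<and> real q \<le> 2 * Q} \<subseteq> {2..nat \<lfloor>2 * Q0\<rfloor>}"
        using False Q by (auto simp: le_nat_floor)
      have "(\<Sum>q | Q \<le> real q \<and> real q \<le> 2 * Q. \<Sum>ch\<in>\<F> q. (norm (L_twist F ch (1/2)))\<^sup>2)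
        \<le> (\<Sum>q | Q \<le> real q \<and> real q \<le> 2 * Q. \<Sum>ch | primitive_char q ch. (norm (L_twist F ch (1/2)))\<^sup>2)"
        using \<F> Q by (intro sum_mono sum_mono2 finite_primitive_chars) auto
      also have "\<dots> \<le> S" unfolding S_def by (rule sum_mono2[OF _ sub]) (auto intro: sum_nonneg)
      also have "S * 1 \<le> S * ((ln 2 powr \<eta> + ln Q0 powr \<eta>) / ln Q powr \<eta> * Q powr (real d / 2))"
      proof (rule mult_left_mono[OF _ S0])
        have "ln Q powr \<eta> \<le> ln 2 powr \<eta> + ln Q0 powr \<eta>"
        proof (cases "\<eta> \<ge> 0")
          case True
          have "ln Q powr \<eta> \<le> ln Q0 powr \<eta>" using False Q lnQ True by (intro powr_mono2 ln_mono) auto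
          then show ?thesis by (simp add: add_increasing)
        next
          case neg: False
          have "ln Q powr \<eta> \<le> ln 2 powr \<eta>" using Q neg by (intro powr_mono2' ln_mono) auto
          then show ?thesis by (simp add: add_increasing2)
        qed
        then have "1 \<le> (ln 2 powr \<eta> + ln Q0 powr \<eta>) / ln Q powr \<eta>" using lnQ by (simp add: le_divide_eq)
        moreover have "1 \<le> Q powr (real d / 2)" using Q by (intro ge_one_powr_ge_zero) auto
        ultimately show "1 \<le> (ln 2 powr \<eta> + ln Q0 powr \<eta>) / ln Q powr \<eta> * Q powr (real d / 2)"
          using mult_mono[of 1 _ 1] by fastforce
      qed
      also have "\<dots> = (S * (ln 2 powr \<eta> + ln Q0 powr \<eta>)) * Q powr (real d / 2) / ln Q powr \<eta>" by simp
      also have "\<dots> \<le> B * Q powr (real d / 2) / ln Q powr \<eta>"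
        unfolding B_def by (intro divide_right_mono mult_right_mono) auto
      finally show ?thesis by simp
    qed
  qed
qed

end
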